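(* Let $A=(a_{ij})_{1\le i,j\le n}$ satisfy $a_{ij}=a_{ji}\ge0$ for $1\le i,j\le n$. Suppose that $U$ is nondegenerate in $H$, that the kernel $K$ of $A$ is $k$-dimensional with $k\in\{1,\dots,n-1\}$, and that there exists a positive vector solution $\vec cU=(c_1,\dots,c_n)U\in\mathbb{R}^nU$ of the system $-\Delta u_i+\lambda u_i=\sum_{j=1}^na_{ij}u_iu_j^2$ in $\Omega$, $u_i\in H$, $1\le i\le n$. Let $$L=\big\{\big((c_1^2+\gamma_1)^{1/2},\dots,(c_n^2+\gamma_n)^{1/2}\big)\ \big|\ \vec\gamma\in K,\ c_i^2+\gamma_i>0,\ i=1,\dots,n\big\}\subset S_r^+,\qquad r=c_1^2+\cdots+c_n^2,$$ which is a connected smooth $k$-dimensional manifold. Let $E=(e_{ij})_{1\le i,j\le n}$ be a symmetric matrix complementary to $A$ at $\vec c\in L$ and define $A^E_\varepsilon=A+\varepsilon E$. Then, for any small $\varepsilon>0$, there exists a unique positive vector solution $\vec u_\varepsilon$, near $\vec cU$ in $\mathbf{H}$, of the system with $A$ replaced by $A^E_\varepsilon$; moreover $\vec u_\varepsilon\in\mathbb{R}^nU$, and $\vec u_\varepsilon$ converges to $\vec cU$ as $\varepsilon\to0$.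
   Context: $\Omega\subset\mathbb{R}^N$ is a domain, $N\le 3$, $\lambda>0$. $H=H^1_0(\Omega)$, except that if $\Omega=\mathbb{R}^N$ then $H$ is the subspace of radially symmetric functions in $H^1(\mathbb{R}^N)$; $\mathbf{H}=H^n$. $U\in H$ is a least energy positive solution of the scalar equation $\Delta u-\lambda u+u^3=0$ in $\Omega$, $u=0$ on $\partial\Omega$. $U$ is nondegenerate in $H$ if $\psi=0$ is the only $\psi\in H$ with $\Delta\psi-\lambda\psi+3U^2\psi=0$. $\mathbb{R}^nU=\{\vec cU\mid \vec c\in\mathbb{R}^n\}$. A positive vector solution is a solution with $u_i>0$ in $\Omega$ for every $i$. For $r>0$, $S_r^+=\{(c_1,\dots,c_n)\in\mathbb{R}^n\mid c_1^2+\cdots+c_n^2=r,\ c_i>0,\ i=1,\dots,n\}$. A symmetric matrix $E$ is complementary to $A$ at $\vec d=(d_1,\dots,d_n)\in L$ if for any $\vec\gamma\in K\setminus\{0\}$ one has $E\vec\gamma\perp(d_1^2,\dots,d_n^2)$, but there exists $\vec\eta\in K$ such that $E\vec\gamma\cdot\vec\eta\ne0$. "Unique near $\vec cU$ for any small $\varepsilon>0$" means: there are $\varepsilon_0>0$ and a neighborhood of $\vec cU$ in $\mathbf{H}$ such that for each $\varepsilon\in(0,\varepsilon_0)$ there is exactly one positive vector solution in that neighborhood. *)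

theory Defs
  imports "HOL-Analysis.Analysis"
begin

text \<open>
  Smooth maps between Euclidean spaces. The definition is meant for open sets: on an open
  set, differentiability together with \<open>Ck\<close> partial derivatives for all \<open>k\<close> is the usual
  notion of a smooth map.
\<close>

primrec Ck_on ::
  "nat \<Rightarrow> 'a::euclidean_space set \<Rightarrow> ('a \<Rightarrow> 'b::real_normed_vector) \<Rightarrow> bool" where
  "Ck_on 0 S f \<longleftrightarrow> continuous_on S f"
| "Ck_on (Suc k) S f \<longleftrightarrow>
     (\<forall>x\<in>S. f differentiable (at x)) \<and>
     (\<forall>b\<in>Basis. Ck_on k S (\<lambda>x. frechet_derivative f (at x) b))"

definition smooth_map_on ::
  "'a::euclidean_space set \<Rightarrow> ('a \<Rightarrow> 'b::real_normed_vector) \<Rightarrow> bool" where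
  "smooth_map_on S f \<longleftrightarrow> (\<forall>k. Ck_on k S f)"

text \<open>Embedded submanifolds, by charts of the ambient space that straighten \<open>M\<close>.\<close>

definition smooth_submanifold :: "nat \<Rightarrow> 'a::euclidean_space set \<Rightarrow> bool" where
  "smooth_submanifold k M \<longleftrightarrow>
     (\<forall>p\<in>M. \<exists>W W' (\<Phi> :: 'a \<Rightarrow> 'a) \<Psi> S.
        open W \<and> p \<in> W \<and> open W' \<and> homeomorphism W W' \<Phi> \<Psi> \<and>
        smooth_map_on W \<Phi> \<and> smooth_map_on W' \<Psi> \<and>
        subspace S \<and> dim S = k \<and> \<Phi> ` (M \<inter> W) = S \<inter> W')"


text \<open>
  Sobolev spaces. Elements are represented by functions on the whole Euclidean space, of
  which only the restriction to \<open>\<Omega>\<close> up to null sets matters; thus equality in these spaces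
  is equality almost everywhere with respect to \<open>lebesgue_on \<Omega>\<close>.
\<close>

definition test_functions :: "'a::euclidean_space set \<Rightarrow> ('a \<Rightarrow> real) set" where
  "test_functions \<Omega> =
     {\<phi>. smooth_map_on UNIV \<phi> \<and> compact (closure {x. \<phi> x \<noteq> 0}) \<and> closure {x. \<phi> x \<noteq> 0} \<subseteq> \<Omega>}"

definition grad :: "('a::euclidean_space \<Rightarrow> real) \<Rightarrow> 'a \<Rightarrow> 'a" where
  "grad \<phi> x = (\<Sum>b\<in>Basis. frechet_derivative \<phi> (at x) b *\<^sub>R b)"

definition L2 :: "'a::euclidean_space set \<Rightarrow> ('a \<Rightarrow> 'b::euclidean_space) set" where
  "L2 \<Omega> = {f. f \<in> borel_measurable (lebesgue_on \<Omega>) \<and>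
               integrable (lebesgue_on \<Omega>) (\<lambda>x. (norm (f x))\<^sup>2)}"

definition is_weak_grad ::
  "'a::euclidean_space set \<Rightarrow> ('a \<Rightarrow> real) \<Rightarrow> ('a \<Rightarrow> 'a) \<Rightarrow> bool" where
  "is_weak_grad \<Omega> u g \<longleftrightarrow>
     (\<forall>\<phi>\<in>test_functions \<Omega>.
        (LINT x|lebesgue_on \<Omega>. u x *\<^sub>R grad \<phi> x) = - (LINT x|lebesgue_on \<Omega>. \<phi> x *\<^sub>R g x))"

definition H1 :: "'a::euclidean_space set \<Rightarrow> ('a \<Rightarrow> real) set" where
  "H1 \<Omega> = {u \<in> L2 \<Omega>. \<exists>g\<in>L2 \<Omega>. is_weak_grad \<Omega> u g}"

text \<open>
  The weak gradient is determined up to null sets for \<open>u \<in> H1 \<Omega>\<close>, the only functions to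
  which \<open>wgrad\<close> is meant to be applied.
\<close>

definition wgrad :: "'a::euclidean_space set \<Rightarrow> ('a \<Rightarrow> real) \<Rightarrow> 'a \<Rightarrow> 'a" where
  "wgrad \<Omega> u = (SOME g. g \<in> L2 \<Omega> \<and> is_weak_grad \<Omega> u g)"

definition H1_norm :: "'a::euclidean_space set \<Rightarrow> ('a \<Rightarrow> real) \<Rightarrow> real" where
  "H1_norm \<Omega> u = sqrt (LINT x|lebesgue_on \<Omega>. (norm (wgrad \<Omega> u x))\<^sup>2 + (u x)\<^sup>2)"

text \<open>The closure of the test functions in \<open>H1 \<Omega>\<close>.\<close>

definition H10 :: "'a::euclidean_space set \<Rightarrow> ('a \<Rightarrow> real) set" where
  "H10 \<Omega> = {u \<in> H1 \<Omega>. \<forall>e>0. \<exists>\<phi>\<in>test_functions \<Omega>. H1_norm \<Omega> (\<lambda>x. u x - \<phi> x) < e}"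

text \<open>Pointwise symmetry is too strict for functions that are only defined up to null sets.\<close>

definition radially_symmetric :: "('a::euclidean_space \<Rightarrow> real) \<Rightarrow> bool" where
  "radially_symmetric u \<longleftrightarrow>
     (\<forall>T. orthogonal_transformation T \<longrightarrow> (AE x in lebesgue. u (T x) = u x))"

definition Hsp :: "'a::euclidean_space set \<Rightarrow> ('a \<Rightarrow> real) set" where
  "Hsp \<Omega> = (if \<Omega> = UNIV then {u \<in> H1 UNIV. radially_symmetric u} else H10 \<Omega>)"


text \<open>The product space \<open>H\<^sup>n\<close>, with \<open>n\<close> the cardinality of the index type.\<close>

definition Hvec :: "'a::euclidean_space set \<Rightarrow> ('n::finite \<Rightarrow> 'a \<Rightarrow> real) set" where
  "Hvec \<Omega> = {u. \<forall>i. u i \<in> Hsp \<Omega>}"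

definition Hvec_dist ::
  "'a::euclidean_space set \<Rightarrow> ('n::finite \<Rightarrow> 'a \<Rightarrow> real) \<Rightarrow> ('n \<Rightarrow> 'a \<Rightarrow> real) \<Rightarrow> real" where
  "Hvec_dist \<Omega> u v = sqrt (\<Sum>i\<in>UNIV. (H1_norm \<Omega> (\<lambda>x. u i x - v i x))\<^sup>2)"

definition Hvec_eq ::
  "'a::euclidean_space set \<Rightarrow> ('n::finite \<Rightarrow> 'a \<Rightarrow> real) \<Rightarrow> ('n \<Rightarrow> 'a \<Rightarrow> real) \<Rightarrow> bool" where
  "Hvec_eq \<Omega> u v \<longleftrightarrow> (\<forall>i. AE x in lebesgue_on \<Omega>. u i x = v i x)"

definition Hvec_neighborhood ::
  "'a::euclidean_space set \<Rightarrow> ('n::finite \<Rightarrow> 'a \<Rightarrow> real) \<Rightarrow> ('n \<Rightarrow> 'a \<Rightarrow> real) set \<Rightarrow> bool" where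
  "Hvec_neighborhood \<Omega> u V \<longleftrightarrow>
     V \<subseteq> Hvec \<Omega> \<and> (\<exists>\<rho>>0. \<forall>v\<in>Hvec \<Omega>. Hvec_dist \<Omega> v u < \<rho> \<longrightarrow> v \<in> V)"

definition vec_mult :: "real^'n \<Rightarrow> ('a \<Rightarrow> real) \<Rightarrow> 'n \<Rightarrow> 'a \<Rightarrow> real" where
  "vec_mult c U = (\<lambda>i x. c $ i * U x)"

text \<open>
  \<open>u\<close> is a weak (distributional) solution of \<open>- \<Delta> u + lam u = f\<close> in \<open>\<Omega>\<close>. The boundary condition
  is expressed by membership in \<open>Hsp \<Omega>\<close>.
\<close>

definition weak_solution ::
  "'a::euclidean_space set \<Rightarrow> real \<Rightarrow> ('a \<Rightarrow> real) \<Rightarrow> ('a \<Rightarrow> real) \<Rightarrow> bool" where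
  "weak_solution \<Omega> lam u f \<longleftrightarrow>
     (\<forall>\<phi>\<in>test_functions \<Omega>.
        (LINT x|lebesgue_on \<Omega>. wgrad \<Omega> u x \<bullet> grad \<phi> x + lam * u x * \<phi> x)
        = (LINT x|lebesgue_on \<Omega>. f x * \<phi> x))"

definition scalar_positive_solution ::
  "'a::euclidean_space set \<Rightarrow> real \<Rightarrow> ('a \<Rightarrow> real) \<Rightarrow> bool" where
  "scalar_positive_solution \<Omega> lam U \<longleftrightarrow>
     U \<in> Hsp \<Omega> \<and> weak_solution \<Omega> lam U (\<lambda>x. U x ^ 3) \<and> (AE x in lebesgue_on \<Omega>. U x > 0)"

definition energy :: "'a::euclidean_space set \<Rightarrow> real \<Rightarrow> ('a \<Rightarrow> real) \<Rightarrow> real" where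
  "energy \<Omega> lam u =
     (1/2) * (LINT x|lebesgue_on \<Omega>. (norm (wgrad \<Omega> u x))\<^sup>2 + lam * (u x)\<^sup>2)
     - (1/4) * (LINT x|lebesgue_on \<Omega>. u x ^ 4)"

definition nehari :: "'a::euclidean_space set \<Rightarrow> real \<Rightarrow> ('a \<Rightarrow> real) set" where
  "nehari \<Omega> lam =
     {w \<in> Hsp \<Omega>. \<not> (AE x in lebesgue_on \<Omega>. w x = 0) \<and>
        (LINT x|lebesgue_on \<Omega>. (norm (wgrad \<Omega> w x))\<^sup>2 + lam * (w x)\<^sup>2)
        = (LINT x|lebesgue_on \<Omega>. w x ^ 4)}"

text \<open>
  Least energy in the variational sense: \<open>U\<close> attains the ground state level, the infimum of the
  energy on the Nehari manifold. All nontrivial solutions lie on that manifold, so \<open>U\<close> also has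
  least energy among them. Conversely, whenever the level is attained (e.g. for bounded \<open>\<Omega>\<close> or
  for the whole space), minimality among the nontrivial solutions implies the condition below.
\<close>

definition least_energy_positive_solution ::
  "'a::euclidean_space set \<Rightarrow> real \<Rightarrow> ('a \<Rightarrow> real) \<Rightarrow> bool" where
  "least_energy_positive_solution \<Omega> lam U \<longleftrightarrow>
     scalar_positive_solution \<Omega> lam U \<and> (\<forall>w\<in>nehari \<Omega> lam. energy \<Omega> lam U \<le> energy \<Omega> lam w)"

definition nondegenerate ::
  "'a::euclidean_space set \<Rightarrow> real \<Rightarrow> ('a \<Rightarrow> real) \<Rightarrow> bool" where
  "nondegenerate \<Omega> lam U \<longleftrightarrow>
     (\<forall>\<psi>\<in>Hsp \<Omega>. weak_solution \<Omega> lam \<psi> (\<lambda>x. 3 * (U x)\<^sup>2 * \<psi> x) \<longrightarrow>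
        (AE x in lebesgue_on \<Omega>. \<psi> x = 0))"

definition positive_vector_solution ::
  "'a::euclidean_space set \<Rightarrow> real \<Rightarrow> real^'n^'n \<Rightarrow> ('n::finite \<Rightarrow> 'a \<Rightarrow> real) \<Rightarrow> bool" where
  "positive_vector_solution \<Omega> lam A u \<longleftrightarrow>
     u \<in> Hvec \<Omega> \<and>
     (\<forall>i. weak_solution \<Omega> lam (u i) (\<lambda>x. \<Sum>j\<in>UNIV. A $ i $ j * u i x * (u j x)\<^sup>2)) \<and>
     (\<forall>i. AE x in lebesgue_on \<Omega>. u i x > 0)"


definition mat_kernel :: "real^'n^'n \<Rightarrow> (real^'n) set" where
  "mat_kernel A = {x. A *v x = 0}"

definition S_plus :: "real \<Rightarrow> (real^'n) set" where
  "S_plus r = {c. (\<Sum>i\<in>UNIV. (c $ i)\<^sup>2) = r \<and> (\<forall>i. c $ i > 0)}"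

definition L_set :: "real^'n^'n \<Rightarrow> real^'n \<Rightarrow> (real^'n) set" where
  "L_set A c =
     {\<chi> i. sqrt ((c $ i)\<^sup>2 + \<gamma> $ i) | \<gamma>. \<gamma> \<in> mat_kernel A \<and> (\<forall>i. (c $ i)\<^sup>2 + \<gamma> $ i > 0)}"

definition complementary :: "real^'n^'n \<Rightarrow> real^'n^'n \<Rightarrow> real^'n \<Rightarrow> bool" where
  "complementary E A d \<longleftrightarrow>
     transpose E = E \<and>
     (\<forall>\<gamma>\<in>mat_kernel A - {0}.
        orthogonal (E *v \<gamma>) (\<chi> i. (d $ i)\<^sup>2) \<and> (\<exists>\<eta>\<in>mat_kernel A. (E *v \<gamma>) \<bullet> \<eta> \<noteq> 0))"

end

theory Submission
  imports Defs "HOL-Computational_Algebra.Polynomial"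
begin

text \<open>
  For \<open>u = d U\<close> the system with matrix \<open>B\<close> reduces to \<open>B d\<^sup>2 = 1\<close>. Let \<open>P\<close> be the orthogonal
  projection onto the kernel \<open>K\<close> of \<open>A\<close>. Complementarity makes \<open>w \<mapsto> A w + P E w\<close> invertible, so
  \<open>(A + \<epsilon> E) x = 1\<close> has a solution \<open>x = c\<^sup>2 + O(\<epsilon>)\<close>, and \<open>\<surd>x U\<close> is the desired solution.

  For the uniqueness, linearize at \<open>c U\<close>. Since \<open>A\<close> is nonnegative and \<open>A c\<^sup>2 = 1\<close>, the matrix
  \<open>(c\<^sub>i a\<^sub>i\<^sub>j c\<^sub>j)\<close> is at most the identity as a quadratic form. Together with the second variation
  inequality for the least energy solution \<open>U\<close> and its nondegeneracy, this shows that the kernel of the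
  linearized operator consists of the \<open>\<theta>\<close> with \<open>\<theta>\<^sub>i = \<gamma>\<^sub>i U / c\<^sub>i\<close> and \<open>\<gamma> \<in> K\<close>; by compactness of the
  multiplication by \<open>U\<^sup>2\<close> the operator is bounded below transversally to this kernel. A solution near \<open>c U\<close> is
  written as \<open>d U + \<theta>\<close> with \<open>\<beta> = d\<^sup>2 - x \<in> K\<close> and \<open>\<theta>\<close> transversal. Then \<open>\<theta> = O(\<epsilon> \<bar>\<beta>\<bar>)\<close>, and testing
  the equation with \<open>U\<close> yields \<open>P E \<beta> = O(\<epsilon> \<bar>\<beta>\<bar>)\<close>, so that \<open>\<beta> = 0\<close> and \<open>\<theta> = 0\<close>.
\<close>

subsection \<open>Calculus of smooth maps\<close>

lemma Ck_on_cong: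
  assumes "open S" "\<And>x. x \<in> S \<Longrightarrow> f x = g x" "Ck_on k S f"
  shows "Ck_on k S g"
  using assms(2,3)
proof (induction k arbitrary: f g)
  case 0
  then show ?case by (auto cong: continuous_on_cong)
next
  case (Suc k)
  have d: "(g has_derivative frechet_derivative f (at x)) (at x)" if "x \<in> S" for x
    using Suc.prems that assms(1)
    by (intro has_derivative_transform_within_open[of f "frechet_derivative f (at x)" x UNIV S g])
       (auto simp: frechet_derivative_works[symmetric])
  have e: "frechet_derivative g (at x) = frechet_derivative f (at x)" if "x \<in> S" for x
    using frechet_derivative_at[OF d[OF that]] by simp
  show ?case
    unfolding Ck_on.simps
  proof (intro conjI ballI)
    show "g differentiable at x" if "x \<in> S" for x
      using d[OF that] by (auto simp: differentiable_def)
    show "Ck_on k S (\<lambda>x. frechet_derivative g (at x) b)" if "b \<in> Basis" for b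
      using Suc.prems that by (auto simp: e intro: Suc.IH[of "\<lambda>x. frechet_derivative f (at x) b"])
  qed
qed

lemma Ck_on_SucI:
  assumes "open S" "\<And>x. x \<in> S \<Longrightarrow> (f has_derivative f' x) (at x)"
    "\<And>b. b \<in> Basis \<Longrightarrow> Ck_on k S (\<lambda>x. f' x b)"
  shows "Ck_on (Suc k) S f"
  unfolding Ck_on.simps
proof (intro conjI ballI)
  show "f differentiable at x" if "x \<in> S" for x
    using assms(2)[OF that] by (auto simp: differentiable_def)
  show "Ck_on k S (\<lambda>x. frechet_derivative f (at x) b)" if "b \<in> Basis" for b
    by (rule Ck_on_cong[OF assms(1) _ assms(3)[OF that]])
       (auto simp: frechet_derivative_at[OF assms(2), symmetric])
qed

lemma Ck_on_has_derivative:
  assumes "Ck_on (Suc k) S f" "x \<in> S"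
  shows "(f has_derivative frechet_derivative f (at x)) (at x)"
  using assms by (auto simp: frechet_derivative_works)

lemma Ck_on_SucD: "Ck_on (Suc k) S f \<Longrightarrow> Ck_on k S f"
proof (induction k arbitrary: f)
  case 0
  then show ?case
    by (auto intro!: continuous_at_imp_continuous_on differentiable_imp_continuous_within)
qed auto

lemma Ck_on_const: "Ck_on k S (\<lambda>x. c)"
  by (induction k arbitrary: c) auto

lemma Ck_on_bounded_linear:
  assumes "open S" "bounded_linear L"
  shows "Ck_on k S f \<Longrightarrow> Ck_on k S (\<lambda>x. L (f x))"
proof (induction k arbitrary: f)
  case 0
  then show ?case using assms by (auto intro: bounded_linear.continuous_on)
next
  case (Suc k)
  show ?case
  proof (rule Ck_on_SucI[OF assms(1)])
    show "((\<lambda>x. L (f x)) has_derivative (\<lambda>h. L (frechet_derivative f (at x) h))) (at x)"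
      if "x \<in> S" for x
      by (rule bounded_linear.has_derivative[OF assms(2) Ck_on_has_derivative[OF Suc.prems that]])
  qed (use Suc in auto)
qed

lemma Ck_on_id: "open S \<Longrightarrow> Ck_on k S (\<lambda>x. x)"
  by (cases k) (simp_all add: Ck_on_const)

lemma Ck_on_add:
  assumes "open S"
  shows "Ck_on k S f \<Longrightarrow> Ck_on k S g \<Longrightarrow> Ck_on k S (\<lambda>x. f x + g x)"
proof (induction k arbitrary: f g)
  case 0
  then show ?case by (auto intro: continuous_intros)
next
  case (Suc k)
  show ?case
    by (rule Ck_on_SucI[OF assms has_derivative_add[OF Ck_on_has_derivative[OF Suc.prems(1)]
          Ck_on_has_derivative[OF Suc.prems(2)]]]) (use Suc in auto)
qed

lemma Ck_on_sum:
  assumes "open S" "\<And>i. i \<in> I \<Longrightarrow> Ck_on k S (f i)"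
  shows "Ck_on k S (\<lambda>x. \<Sum>i\<in>I. f i x)"
  using assms(2) by (induction I rule: infinite_finite_induct) (auto intro: Ck_on_add[OF assms(1)] Ck_on_const)

lemma Ck_on_bilinear:
  assumes "open S" "bounded_bilinear B"
  shows "Ck_on k S f \<Longrightarrow> Ck_on k S g \<Longrightarrow> Ck_on k S (\<lambda>x. B (f x) (g x))"
proof (induction k arbitrary: f g)
  case 0
  then show ?case using assms by (auto intro: bounded_bilinear.continuous_on)
next
  case (Suc k)
  show ?case
  proof (rule Ck_on_SucI[OF assms(1) bounded_bilinear.FDERIV[OF assms(2)
        Ck_on_has_derivative[OF Suc.prems(1)] Ck_on_has_derivative[OF Suc.prems(2)]]])
    show "Ck_on k S (\<lambda>x. B (f x) (frechet_derivative g (at x) b) + B (frechet_derivative f (at x) b) (g x))"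
      if "b \<in> Basis" for b
      using Suc.prems that Ck_on_SucD[OF Suc.prems(1)] Ck_on_SucD[OF Suc.prems(2)]
      by (intro Ck_on_add[OF assms(1)] Suc.IH) simp_all
  qed
qed

lemma Ck_on_compose_real:
  fixes H :: "nat \<Rightarrow> real \<Rightarrow> real"
  assumes "open S" "\<And>x. x \<in> S \<Longrightarrow> f x \<in> I"
    and H: "\<And>j t. t \<in> I \<Longrightarrow> (H j has_real_derivative H (Suc j) t) (at t)"
  shows "Ck_on k S f \<Longrightarrow> Ck_on k S (\<lambda>x. H j (f x))"
proof (induction k arbitrary: j)
  case 0
  have "continuous_on I (H j)"
    by (meson DERIV_isCont H continuous_at_imp_continuous_on)
  with 0 show ?case using assms(2) by (auto intro: continuous_on_compose2)
next
  case (Suc k)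
  show ?case
  proof (rule Ck_on_SucI[OF assms(1)])
    show "((\<lambda>x. H j (f x)) has_derivative (\<lambda>h. frechet_derivative f (at x) h * H (Suc j) (f x))) (at x)"
      if "x \<in> S" for x
      using DERIV_compose_FDERIV[OF H[OF assms(2)[OF that]] Ck_on_has_derivative[OF Suc.prems that]]
      by simp
    show "Ck_on k S (\<lambda>x. frechet_derivative f (at x) b * H (Suc j) (f x))" if "b \<in> Basis" for b
      using Suc that Ck_on_SucD[OF Suc.prems]
      by (intro Ck_on_bilinear[OF assms(1) bounded_bilinear_mult]) auto
  qed
qed

lemma smooth_map_on_partial:
  assumes "smooth_map_on S f" "b \<in> Basis"
  shows "smooth_map_on S (\<lambda>x. frechet_derivative f (at x) b)"
  using assms unfolding smooth_map_on_def by (metis Ck_on.simps(2))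

lemma smooth_map_on_has_derivative:
  assumes "smooth_map_on S f" "x \<in> S"
  shows "(f has_derivative frechet_derivative f (at x)) (at x)"
  using assms Ck_on_has_derivative unfolding smooth_map_on_def by blast

lemma smooth_map_on_continuous: "smooth_map_on S f \<Longrightarrow> continuous_on S f"
  unfolding smooth_map_on_def by (metis Ck_on.simps(1))

subsection \<open>The smooth function \<open>exp (-1/t)\<close>\<close>

text \<open>For \<open>t > 0\<close> the derivatives of \<open>exp (-1/t)\<close> are \<open>p (1/t) exp (-1/t)\<close> with
  \<open>p\<close> running through the polynomials below.\<close>

primrec flat_poly :: "nat \<Rightarrow> real poly" where
  "flat_poly 0 = 1"
| "flat_poly (Suc j) = [:0, 0, 1:] * (flat_poly j - pderiv (flat_poly j))"

definition flat :: "nat \<Rightarrow> real \<Rightarrow> real" where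
  "flat j t = (if t > 0 then poly (flat_poly j) (1/t) * exp (- (1/t)) else 0)"

lemma poly_times_exp_tendsto_0:
  fixes p :: "real poly"
  shows "((\<lambda>s. poly p s * exp (- s)) \<longlongrightarrow> 0) at_top"
proof -
  have "((\<lambda>s. \<Sum>i\<le>degree p. coeff p i * (s ^ i / exp s)) \<longlongrightarrow> (\<Sum>i\<le>degree p. coeff p i * 0)) at_top"
    by (intro tendsto_intros tendsto_power_div_exp_0)
  then show ?thesis
    by (simp add: poly_altdef sum_distrib_right exp_minus divide_inverse mult.assoc)
qed

lemma flat_has_derivative: "(flat j has_real_derivative flat (Suc j) t) (at t)"
proof -
  consider "t > 0" | "t < 0" | "t = 0" by linarith
  then show ?thesis
  proof cases
    case 1
    have "((\<lambda>t. poly (flat_poly j) (1/t) * exp (- (1/t))) has_real_derivative flat (Suc j) t) (at t)"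
      using 1 by (auto intro!: derivative_eq_intros DERIV_chain'[OF _ poly_DERIV]
          simp: flat_def power2_eq_square field_simps)
    then show ?thesis
      by (rule has_field_derivative_transform_within_open[where S = "{0<..}"])
         (use 1 in \<open>auto simp: flat_def\<close>)
  next
    case 2
    have "((\<lambda>t. 0) has_real_derivative flat (Suc j) t) (at t)"
      using 2 by (simp add: flat_def)
    then show ?thesis
      by (rule has_field_derivative_transform_within_open[where S = "{..<0}"])
         (use 2 in \<open>auto simp: flat_def\<close>)
  next
    case 3
    have "((\<lambda>s. poly ([:0, 1:] * flat_poly j) s * exp (- s)) \<longlongrightarrow> 0) at_top"
      by (rule poly_times_exp_tendsto_0)
    then have "((\<lambda>h. poly ([:0, 1:] * flat_poly j) (inverse h) * exp (- inverse h)) \<longlongrightarrow> 0) (at_right 0)"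
      by (rule filterlim_compose[OF _ filterlim_inverse_at_top_right])
    then have "((\<lambda>h. flat j h / h) \<longlongrightarrow> 0) (at_right 0)"
      by (rule Lim_transform_eventually)
         (auto simp: flat_def field_simps intro!: eventually_at_rightI[of 0 1])
    moreover have "((\<lambda>h. flat j h / h) \<longlongrightarrow> 0) (at_left 0)"
      by (rule Lim_transform_eventually[OF tendsto_const])
         (auto simp: flat_def intro!: eventually_at_leftI[of "-1" 0])
    ultimately have "((\<lambda>h. flat j h / h) \<longlongrightarrow> 0) (at 0)"
      by (simp add: filterlim_split_at)
    then show ?thesis
      using 3 by (simp add: DERIV_def flat_def)
  qed
qed

lemma flat_0_nonneg: "flat 0 t \<ge> 0"
  and flat_0_pos_iff: "flat 0 t > 0 \<longleftrightarrow> t > 0"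
  and flat_0_le: "t \<le> 1 \<Longrightarrow> flat 0 t \<le> exp (- 1)"
  by (auto simp: flat_def divide_simps)

lemma smooth_map_on_flat:
  assumes "open S" "smooth_map_on S f"
  shows "smooth_map_on S (\<lambda>x. flat 0 (f x))"
  using assms unfolding smooth_map_on_def
  by (metis Ck_on_compose_real[where I = UNIV and H = flat, OF assms(1) UNIV_I flat_has_derivative])

subsection \<open>Square integrable functions\<close>

definition sq_int :: "'x measure \<Rightarrow> ('x \<Rightarrow> 'b::euclidean_space) \<Rightarrow> bool" where
  "sq_int M f \<longleftrightarrow> f \<in> borel_measurable M \<and> integrable M (\<lambda>x. (norm (f x))\<^sup>2)"

definition l2norm :: "'x measure \<Rightarrow> ('x \<Rightarrow> 'b::euclidean_space) \<Rightarrow> real" where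
  "l2norm M f = sqrt (LINT x|M. (norm (f x))\<^sup>2)"

lemma L2_eq_sq_int: "f \<in> L2 \<Omega> \<longleftrightarrow> sq_int (lebesgue_on \<Omega>) f"
  by (simp add: L2_def sq_int_def)

lemma sq_int_measurable: "sq_int M f \<Longrightarrow> f \<in> borel_measurable M"
  and sq_int_integrable: "sq_int M f \<Longrightarrow> integrable M (\<lambda>x. (norm (f x))\<^sup>2)"
  by (simp_all add: sq_int_def)

lemma l2norm_nonneg: "l2norm M f \<ge> 0"
  by (simp add: l2norm_def)

lemma l2norm_sq: "(l2norm M f)\<^sup>2 = (LINT x|M. (norm (f x))\<^sup>2)"
  by (simp add: l2norm_def)

lemma sq_int_bound:
  assumes "sq_int M f" "g \<in> borel_measurable M" "AE x in M. norm (g x) \<le> norm (f x)"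
  shows "sq_int M g"
  unfolding sq_int_def
proof
  have [measurable]: "g \<in> borel_measurable M" by fact
  show "integrable M (\<lambda>x. (norm (g x))\<^sup>2)"
    by (rule Bochner_Integration.integrable_bound[OF sq_int_integrable[OF assms(1)]])
       (use assms(3) in \<open>auto elim!: eventually_mono intro: power_mono\<close>)
qed fact

lemma sq_int_norm_mult:
  assumes "sq_int M f" "sq_int M g"
  shows "integrable M (\<lambda>x. norm (f x) * norm (g x))"
proof (rule Bochner_Integration.integrable_bound)
  show "integrable M (\<lambda>x. (norm (f x))\<^sup>2 + (norm (g x))\<^sup>2)"
    using assms by (intro Bochner_Integration.integrable_add sq_int_integrable)
  show "(\<lambda>x. norm (f x) * norm (g x)) \<in> borel_measurable M"
    using assms by (auto dest!: sq_int_measurable)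
  have "a * b \<le> a\<^sup>2 + b\<^sup>2" if "a \<ge> 0" "b \<ge> 0" for a b :: real
    using sum_squares_bound[of a b] mult_nonneg_nonneg[OF that] by linarith
  then show "AE x in M. norm (norm (f x) * norm (g x)) \<le> norm ((norm (f x))\<^sup>2 + (norm (g x))\<^sup>2)"
    by simp
qed

lemma sq_int_inner:
  assumes "sq_int M f" "sq_int M g"
  shows "integrable M (\<lambda>x. f x \<bullet> g x)"
  by (rule Bochner_Integration.integrable_bound[OF sq_int_norm_mult[OF assms]])
     (use assms in \<open>auto dest!: sq_int_measurable simp: abs_mult intro: Cauchy_Schwarz_ineq2\<close>)

lemma sq_int_scaleR:
  assumes "sq_int M f" "sq_int M g"
  shows "integrable M (\<lambda>x. f x *\<^sub>R g x)"
  by (rule Bochner_Integration.integrable_bound[OF sq_int_norm_mult[OF assms]])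
     (use assms in \<open>auto dest!: sq_int_measurable\<close>)

lemma sq_int_mult:
  fixes f g :: "_ \<Rightarrow> real"
  assumes "sq_int M f" "sq_int M g"
  shows "integrable M (\<lambda>x. f x * g x)"
  using sq_int_scaleR[OF assms] by simp

lemma sq_int_add:
  assumes "sq_int M f" "sq_int M g"
  shows "sq_int M (\<lambda>x. f x + g x)"
  unfolding sq_int_def
proof
  show m: "(\<lambda>x. f x + g x) \<in> borel_measurable M"
    using assms by (auto dest!: sq_int_measurable)
  have "integrable M (\<lambda>x. (norm (f x))\<^sup>2 + 2 * (f x \<bullet> g x) + (norm (g x))\<^sup>2)"
    using assms by (intro Bochner_Integration.integrable_add integrable_mult_right sq_int_integrable sq_int_inner)
  then show "integrable M (\<lambda>x. (norm (f x + g x))\<^sup>2)"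
    by (rule Bochner_Integration.integrable_cong[THEN iffD1, rotated 2])
       (auto simp: power2_norm_eq_inner inner_add inner_commute)
qed

lemma sq_int_linear:
  assumes "sq_int M f" "bounded_linear L"
  shows "sq_int M (\<lambda>x. L (f x))"
  unfolding sq_int_def
proof
  obtain K where K: "\<And>x. norm (L x) \<le> norm x * K"
    using bounded_linear.bounded[OF assms(2)] by blast
  have [measurable]: "L \<in> borel_measurable borel"
    using assms(2) by (intro borel_measurable_continuous_onI linear_continuous_on)
  show m: "(\<lambda>x. L (f x)) \<in> borel_measurable M"
    using sq_int_measurable[OF assms(1)] by measurable
  show "integrable M (\<lambda>x. (norm (L (f x)))\<^sup>2)"
  proof (rule Bochner_Integration.integrable_bound)
    show "integrable M (\<lambda>x. (norm (f x))\<^sup>2 * K\<^sup>2)"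
      using assms(1) by (intro integrable_mult_left sq_int_integrable)
    have "(norm (L (f x)))\<^sup>2 \<le> (norm (f x))\<^sup>2 * K\<^sup>2" for x
      using power_mono[OF K[of "f x"], of 2] by (simp add: power_mult_distrib)
    then show "AE x in M. norm ((norm (L (f x)))\<^sup>2) \<le> norm ((norm (f x))\<^sup>2 * K\<^sup>2)"
      by simp
  qed (use m in measurable)
qed

lemma sq_int_scale: "sq_int M f \<Longrightarrow> sq_int M (\<lambda>x. c *\<^sub>R f x)"
  by (rule sq_int_linear[OF _ bounded_linear_scaleR_right])

lemma sq_int_cmult: "sq_int M f \<Longrightarrow> sq_int M (\<lambda>x. c * f x :: real)"
  using sq_int_scale[of M f c] by simp

lemma sq_int_diff:
  assumes "sq_int M f" "sq_int M g"
  shows "sq_int M (\<lambda>x. f x - g x)"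
  using sq_int_add[OF assms(1) sq_int_scale[OF assms(2), of "-1"]] by simp

lemma sq_int_Pair:
  assumes "sq_int M f" "sq_int M g"
  shows "sq_int M (\<lambda>x. (f x, g x))"
  using sq_int_add[OF sq_int_linear[OF assms(1), of "\<lambda>y. (y, 0)"] sq_int_linear[OF assms(2), of "\<lambda>y. (0, y)"]]
  by (auto simp: bounded_linear_Pair bounded_linear_ident bounded_linear_zero)

lemma l2norm_cong_AE:
  assumes "f \<in> borel_measurable M" "g \<in> borel_measurable M" "AE x in M. f x = g x"
  shows "l2norm M f = l2norm M g"
proof -
  have "(LINT x|M. (norm (f x))\<^sup>2) = (LINT x|M. (norm (g x))\<^sup>2)"
    by (rule integral_cong_AE) (use assms in \<open>auto elim!: eventually_mono\<close>)
  then show ?thesis by (simp add: l2norm_def)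
qed

lemma discriminant_nonpos:
  fixes a b c :: real
  assumes "\<And>t. a + 2 * b * t + c * t\<^sup>2 \<ge> 0" "a \<ge> 0" "c \<ge> 0"
  shows "b\<^sup>2 \<le> a * c"
proof (cases "c = 0")
  case True
  have "b = 0"
  proof (rule ccontr)
    assume b: "b \<noteq> 0"
    have "a + 2 * b * (- (a + 1) / (2 * b)) + c * (- (a + 1) / (2 * b))\<^sup>2 \<ge> 0"
      by (rule assms(1))
    then show False using b True by simp
  qed
  with True show ?thesis by simp
next
  case False
  have "0 \<le> c * (a + 2 * b * (- b / c) + c * (- b / c)\<^sup>2)"
    using assms(1)[of "- b / c"] assms(3) by (intro mult_nonneg_nonneg) auto
  also have "\<dots> = a * c - b\<^sup>2"
    using False by (simp add: field_simps power2_eq_square)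
  finally show ?thesis by simp
qed

lemma l2_Cauchy_Schwarz_norm:
  assumes "sq_int M f" "sq_int M g"
  shows "(LINT x|M. norm (f x) * norm (g x)) \<le> l2norm M f * l2norm M g"
proof -
  let ?a = "LINT x|M. (norm (f x))\<^sup>2" and ?b = "LINT x|M. norm (f x) * norm (g x)"
    and ?c = "LINT x|M. (norm (g x))\<^sup>2"
  note i = sq_int_integrable[OF assms(1)] sq_int_integrable[OF assms(2)] sq_int_norm_mult[OF assms]
  have "?a + 2 * ?b * t + ?c * t\<^sup>2 \<ge> 0" for t
  proof -
    have "?a + 2 * ?b * t + ?c * t\<^sup>2
        = (LINT x|M. (norm (f x))\<^sup>2 + 2 * t * (norm (f x) * norm (g x)) + t\<^sup>2 * (norm (g x))\<^sup>2)"
      using i by (simp add: mult.commute)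
    also have "\<dots> = (LINT x|M. (norm (f x) + t * norm (g x))\<^sup>2)"
      by (intro Bochner_Integration.integral_cong) (auto simp: power2_eq_square algebra_simps)
    also have "\<dots> \<ge> 0" by simp
    finally show ?thesis .
  qed
  then have "?b\<^sup>2 \<le> ?a * ?c"
    by (intro discriminant_nonpos) auto
  also have "\<dots> = (l2norm M f * l2norm M g)\<^sup>2"
    by (simp add: power_mult_distrib l2norm_sq)
  finally show ?thesis
    by (rule power2_le_imp_le) (simp add: l2norm_nonneg)
qed

lemma l2_Cauchy_Schwarz_scaleR:
  assumes "sq_int M f" "sq_int M g"
  shows "norm (LINT x|M. f x *\<^sub>R g x) \<le> l2norm M f * l2norm M g"
proof -
  have "norm (LINT x|M. f x *\<^sub>R g x) \<le> (LINT x|M. norm (f x *\<^sub>R g x))"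
    by (rule integral_norm_bound)
  then show ?thesis
    using l2_Cauchy_Schwarz_norm[OF assms] by simp
qed

lemma l2_Cauchy_Schwarz:
  assumes "sq_int M f" "sq_int M g"
  shows "\<bar>LINT x|M. f x \<bullet> g x\<bar> \<le> l2norm M f * l2norm M g"
proof -
  have "\<bar>LINT x|M. f x \<bullet> g x\<bar> \<le> (LINT x|M. \<bar>f x \<bullet> g x\<bar>)"
    using integral_norm_bound[of M "\<lambda>x. f x \<bullet> g x"] by simp
  also have "\<dots> \<le> (LINT x|M. norm (f x) * norm (g x))"
    using sq_int_inner[OF assms] sq_int_norm_mult[OF assms]
    by (intro integral_mono) (auto intro: Cauchy_Schwarz_ineq2)
  finally show ?thesis
    using l2_Cauchy_Schwarz_norm[OF assms] by simp
qed

lemma l2norm_add_sq: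
  assumes "sq_int M f" "sq_int M g"
  shows "(l2norm M (\<lambda>x. f x + g x))\<^sup>2 = (l2norm M f)\<^sup>2 + 2 * (LINT x|M. f x \<bullet> g x) + (l2norm M g)\<^sup>2"
proof -
  have "(l2norm M (\<lambda>x. f x + g x))\<^sup>2 = (LINT x|M. (norm (f x))\<^sup>2 + 2 * (f x \<bullet> g x) + (norm (g x))\<^sup>2)"
    unfolding l2norm_sq
    by (intro Bochner_Integration.integral_cong)
       (auto simp: power2_norm_eq_inner inner_add inner_commute)
  then show ?thesis
    using assms by (simp add: l2norm_sq sq_int_integrable sq_int_inner)
qed

lemma l2norm_triangle:
  assumes "sq_int M f" "sq_int M g"
  shows "l2norm M (\<lambda>x. f x + g x) \<le> l2norm M f + l2norm M g"
proof (rule power2_le_imp_le)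
  show "(l2norm M (\<lambda>x. f x + g x))\<^sup>2 \<le> (l2norm M f + l2norm M g)\<^sup>2"
    unfolding l2norm_add_sq[OF assms] using l2_Cauchy_Schwarz[OF assms]
    by (simp add: power2_sum)
qed (simp add: l2norm_nonneg)

lemma l2norm_scale: "l2norm M (\<lambda>x. c *\<^sub>R f x) = \<bar>c\<bar> * l2norm M f"
  by (simp add: l2norm_def power_mult_distrib real_sqrt_mult)

lemma l2norm_minus: "l2norm M (\<lambda>x. f x - g x) = l2norm M (\<lambda>x. g x - f x)"
  by (simp add: l2norm_def norm_minus_commute)

lemma l2norm_triangle_diff:
  assumes "sq_int M f" "sq_int M g" "sq_int M h"
  shows "l2norm M (\<lambda>x. f x - h x) \<le> l2norm M (\<lambda>x. f x - g x) + l2norm M (\<lambda>x. g x - h x)"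
  using l2norm_triangle[OF sq_int_diff[OF assms(1,2)] sq_int_diff[OF assms(2,3)]] by simp

lemma l2norm_eq_0_iff:
  assumes "sq_int M f"
  shows "l2norm M f = 0 \<longleftrightarrow> (AE x in M. f x = 0)"
  using integral_nonneg_eq_0_iff_AE[OF sq_int_integrable[OF assms]] by (simp add: l2norm_def)

lemma l2norm_mono:
  assumes "sq_int M f" "g \<in> borel_measurable M" "AE x in M. norm (g x) \<le> norm (f x)"
  shows "l2norm M g \<le> l2norm M f"
  unfolding l2norm_def
  by (intro real_sqrt_le_mono integral_mono_AE sq_int_integrable assms sq_int_bound[OF assms])
     (use assms(3) in \<open>auto elim!: eventually_mono intro: power_mono\<close>)

lemma l2norm_Pair_sq:
  assumes "sq_int M f" "sq_int M g"
  shows "(l2norm M (\<lambda>x. (f x, g x)))\<^sup>2 = (l2norm M f)\<^sup>2 + (l2norm M g)\<^sup>2"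
  using assms by (simp add: l2norm_sq norm_Pair sq_int_integrable)

lemma l2_tendsto_AE_subseq:
  assumes "sq_int M f" "\<And>n. sq_int M (fs n)"
    and "(\<lambda>n. l2norm M (\<lambda>x. fs n x - f x)) \<longlonglongrightarrow> 0"
  shows "\<exists>r. strict_mono r \<and> (AE x in M. (\<lambda>n. fs (r n) x) \<longlonglongrightarrow> f x)"
proof -
  have "\<exists>r. strict_mono r \<and> (AE x in M. (\<lambda>n. (norm (fs (r n) x - f x))\<^sup>2) \<longlonglongrightarrow> 0)"
  proof (rule tendsto_L1_AE_subseq)
    show "integrable M (\<lambda>x. (norm (fs n x - f x))\<^sup>2)" for n
      by (intro sq_int_integrable sq_int_diff assms)
    show "(\<lambda>n. LINT x|M. norm ((norm (fs n x - f x))\<^sup>2)) \<longlonglongrightarrow> 0"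
      using tendsto_power[OF assms(3), of 2] by (simp add: l2norm_sq)
  qed
  then obtain r where r: "strict_mono r" "AE x in M. (\<lambda>n. (norm (fs (r n) x - f x))\<^sup>2) \<longlonglongrightarrow> 0"
    by blast
  have "AE x in M. (\<lambda>n. fs (r n) x) \<longlonglongrightarrow> f x"
    using r(2)
  proof eventually_elim
    case (elim x)
    then have "(\<lambda>n. fs (r n) x - f x) \<longlonglongrightarrow> 0"
      using tendsto_real_sqrt[OF elim] by (simp add: tendsto_norm_zero_iff)
    then show ?case by (rule LIM_zero_cancel)
  qed
  with r(1) show ?thesis by blast
qed

text \<open>Multiplication by a positive weight in \<open>L\<^sup>2\<close> turns an \<open>L\<^sup>2\<close> Cauchy sequence into an
  \<open>L\<^sup>1\<close> Cauchy sequence, which has an almost everywhere convergent subsequence.\<close>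

lemma l2_complete:
  fixes fs :: "nat \<Rightarrow> 'x \<Rightarrow> 'b::euclidean_space" and w :: "'x \<Rightarrow> real"
  assumes w: "sq_int M w" "\<And>x. w x > 0"
    and fs: "\<And>n. sq_int M (fs n)"
    and C: "\<And>e. e > 0 \<Longrightarrow> \<exists>N. \<forall>m\<ge>N. \<forall>n\<ge>N. l2norm M (\<lambda>x. fs m x - fs n x) < e"
  shows "\<exists>f. sq_int M f \<and> (\<lambda>n. l2norm M (\<lambda>x. fs n x - f x)) \<longlonglongrightarrow> 0"
proof -
  have [measurable]: "fs n \<in> borel_measurable M" for n
    using fs by (rule sq_int_measurable)
  have 1: "integrable M (\<lambda>x. w x *\<^sub>R fs n x)" for n
    by (rule sq_int_scaleR[OF w(1) fs])
  have 2: "\<exists>N. \<forall>i\<ge>N. \<forall>j\<ge>N. (LINT x|M. norm (w x *\<^sub>R fs i x - w x *\<^sub>R fs j x)) < e" if "e > 0" for e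
  proof -
    have "e / (l2norm M w + 1) > 0" using that l2norm_nonneg[of M w] by simp
    from C[OF this] obtain N where
      N: "\<And>m n. m \<ge> N \<Longrightarrow> n \<ge> N \<Longrightarrow> l2norm M (\<lambda>x. fs m x - fs n x) < e / (l2norm M w + 1)" by blast
    have "(LINT x|M. norm (w x *\<^sub>R fs i x - w x *\<^sub>R fs j x)) < e" if "i \<ge> N" "j \<ge> N" for i j
    proof -
      have "(LINT x|M. norm (w x *\<^sub>R fs i x - w x *\<^sub>R fs j x)) = (LINT x|M. norm (w x) * norm (fs i x - fs j x))"
        by (simp flip: scaleR_diff_right)
      also have "\<dots> \<le> l2norm M w * l2norm M (\<lambda>x. fs i x - fs j x)"
        by (rule l2_Cauchy_Schwarz_norm[OF w(1) sq_int_diff[OF fs fs]])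
      also have "\<dots> \<le> l2norm M w * (e / (l2norm M w + 1))"
        using N[OF that] by (intro mult_left_mono) (auto simp: l2norm_nonneg)
      also have "\<dots> < e" using l2norm_nonneg[of M w] \<open>e > 0\<close> by (simp add: field_simps)
      finally show ?thesis .
    qed
    then show ?thesis by blast
  qed
  obtain r where r: "strict_mono r" "AE x in M. Cauchy (\<lambda>i. w x *\<^sub>R fs (r i) x)"
    by (rule cauchy_L1_AE_cauchy_subseq[OF 1 2])
  define f where "f x = lim (\<lambda>i. fs (r i) x)" for x
  have f[measurable]: "f \<in> borel_measurable M"
    unfolding f_def by measurable
  have lim: "AE x in M. (\<lambda>i. fs (r i) x) \<longlonglongrightarrow> f x"
    using r(2)
  proof eventually_elim
    case (elim x)
    then have "convergent (\<lambda>i. w x *\<^sub>R fs (r i) x)" by (simp add: Cauchy_convergent_iff)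
    then obtain l where "(\<lambda>i. w x *\<^sub>R fs (r i) x) \<longlonglongrightarrow> l" by (auto simp: convergent_def)
    then have "(\<lambda>i. inverse (w x) *\<^sub>R (w x *\<^sub>R fs (r i) x)) \<longlonglongrightarrow> inverse (w x) *\<^sub>R l"
      by (intro tendsto_intros)
    then have "convergent (\<lambda>i. fs (r i) x)"
      using w(2)[of x] by (auto simp: convergent_def)
    then show ?case by (simp add: f_def convergent_LIMSEQ_iff)
  qed
  have key: "sq_int M (\<lambda>x. fs m x - f x) \<and> l2norm M (\<lambda>x. fs m x - f x) \<le> e"
    if N: "\<And>n. n \<ge> N \<Longrightarrow> l2norm M (\<lambda>x. fs m x - fs n x) < e" and "e > 0" for m N e
  proof -
    have "(\<integral>\<^sup>+x. ennreal ((norm (fs m x - f x))\<^sup>2) \<partial>M)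
        = (\<integral>\<^sup>+x. liminf (\<lambda>i. ennreal ((norm (fs m x - fs (r i) x))\<^sup>2)) \<partial>M)"
    proof (rule nn_integral_cong_AE)
      show "AE x in M. ennreal ((norm (fs m x - f x))\<^sup>2) = liminf (\<lambda>i. ennreal ((norm (fs m x - fs (r i) x))\<^sup>2))"
        using lim
      proof eventually_elim
        case (elim x)
        have "(\<lambda>i. ennreal ((norm (fs m x - fs (r i) x))\<^sup>2)) \<longlonglongrightarrow> ennreal ((norm (fs m x - f x))\<^sup>2)"
          by (intro tendsto_ennrealI tendsto_intros elim)
        from lim_imp_Liminf[OF _ this] show ?case by simp
      qed
    qed
    also have "\<dots> \<le> liminf (\<lambda>i. \<integral>\<^sup>+x. ennreal ((norm (fs m x - fs (r i) x))\<^sup>2) \<partial>M)"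
      by (rule nn_integral_liminf) measurable
    also have "\<dots> \<le> ennreal (e\<^sup>2)"
    proof -
      have "(\<integral>\<^sup>+x. ennreal ((norm (fs m x - fs (r i) x))\<^sup>2) \<partial>M) \<le> ennreal (e\<^sup>2)" if "i \<ge> N" for i
      proof -
        have "r i \<ge> N" using seq_suble[OF r(1), of i] that by linarith
        have "(\<integral>\<^sup>+x. ennreal ((norm (fs m x - fs (r i) x))\<^sup>2) \<partial>M) = ennreal ((l2norm M (\<lambda>x. fs m x - fs (r i) x))\<^sup>2)"
          unfolding l2norm_sq
          by (intro nn_integral_eq_integral sq_int_integrable sq_int_diff fs) auto
        also have "\<dots> \<le> ennreal (e\<^sup>2)"
          using N[OF \<open>r i \<ge> N\<close>] by (intro ennreal_leI power_mono) (auto simp: l2norm_nonneg)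
        finally show ?thesis .
      qed
      then have "\<forall>\<^sub>F i in sequentially. (\<integral>\<^sup>+x. ennreal ((norm (fs m x - fs (r i) x))\<^sup>2) \<partial>M) \<le> ennreal (e\<^sup>2)"
        by (auto simp: eventually_sequentially)
      then show ?thesis
        by (rule Liminf_le[OF _ , rotated]) simp
    qed
    finally have le: "(\<integral>\<^sup>+x. ennreal ((norm (fs m x - f x))\<^sup>2) \<partial>M) \<le> ennreal (e\<^sup>2)" .
    have i: "integrable M (\<lambda>x. (norm (fs m x - f x))\<^sup>2)"
      using le by (intro integrableI_bounded) (auto intro: le_less_trans)
    have "ennreal (LINT x|M. (norm (fs m x - f x))\<^sup>2) \<le> ennreal (e\<^sup>2)"
      using le by (subst (asm) nn_integral_eq_integral[OF i]) auto
    then have "(LINT x|M. (norm (fs m x - f x))\<^sup>2) \<le> e\<^sup>2"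
      by simp
    then have "l2norm M (\<lambda>x. fs m x - f x) \<le> e"
      unfolding l2norm_def using \<open>e > 0\<close> by (metis real_sqrt_le_mono real_sqrt_unique less_imp_le)
    with i show ?thesis by (simp add: sq_int_def)
  qed
  obtain N1 where "\<And>m n. m \<ge> N1 \<Longrightarrow> n \<ge> N1 \<Longrightarrow> l2norm M (\<lambda>x. fs m x - fs n x) < 1"
    using C[of 1] by auto
  then have "sq_int M (\<lambda>x. fs N1 x - f x)"
    using key[of N1 N1 1] by auto
  from sq_int_diff[OF fs[of N1] this] have "sq_int M f" by simp
  moreover have "(\<lambda>n. l2norm M (\<lambda>x. fs n x - f x)) \<longlonglongrightarrow> 0"
  proof (rule LIMSEQ_I)
    fix e :: real assume "e > 0"
    then obtain N where N: "\<And>m n. m \<ge> N \<Longrightarrow> n \<ge> N \<Longrightarrow> l2norm M (\<lambda>x. fs m x - fs n x) < e/2"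
      using C[of "e/2"] by auto
    have "norm (l2norm M (\<lambda>x. fs n x - f x) - 0) < e" if "n \<ge> N" for n
      using key[of N n "e/2"] N[OF that] \<open>e > 0\<close> by (auto simp: l2norm_nonneg abs_of_nonneg)
    then show "\<exists>no. \<forall>n\<ge>no. norm (l2norm M (\<lambda>x. fs n x - f x) - 0) < e" by blast
  qed
  ultimately show ?thesis by blast
qed

subsection \<open>Continuous functions with compact support\<close>

definition cont_cs :: "('a::euclidean_space \<Rightarrow> 'b::euclidean_space) \<Rightarrow> bool" where
  "cont_cs f \<longleftrightarrow> continuous_on UNIV f \<and> (\<exists>K. compact K \<and> (\<forall>x. x \<notin> K \<longrightarrow> f x = 0))"

lemma cont_cs_bounded:
  assumes "cont_cs f"
  obtains B where "B > 0" "\<And>x. norm (f x) \<le> B"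
proof -
  obtain K where K: "compact K" "\<And>x. x \<notin> K \<Longrightarrow> f x = 0" and c: "continuous_on UNIV f"
    using assms by (auto simp: cont_cs_def)
  have "compact (f ` K)" 
    by (rule compact_continuous_image[OF continuous_on_subset[OF c subset_UNIV] K(1)])
  then have "bounded (f ` K)" by (rule compact_imp_bounded)
  then obtain B where B: "B > 0" "\<And>x. x \<in> K \<Longrightarrow> norm (f x) \<le> B"
    unfolding bounded_pos by blast
  have "norm (f x) \<le> B" for x
    using B K(2)[of x] by (cases "x \<in> K") auto
  with B(1) show ?thesis using that by blast
qed

lemma cont_cs_integrable:
  assumes "cont_cs f"
  shows "integrable lborel f"
proof -
  obtain K where K: "compact K" "\<And>x. x \<notin> K \<Longrightarrow> f x = 0" and c: "continuous_on UNIV f"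
    using assms by (auto simp: cont_cs_def)
  have "integrable lborel (\<lambda>x. indicator K x *\<^sub>R f x)"
    by (rule borel_integrable_compact[OF K(1) continuous_on_subset[OF c]]) simp
  moreover have "(\<lambda>x. indicator K x *\<^sub>R f x) = f"
    using K(2) by (auto simp: indicator_def)
  ultimately show ?thesis by simp
qed

lemma cont_cs_measurable: "cont_cs f \<Longrightarrow> f \<in> borel_measurable borel"
  by (auto simp: cont_cs_def intro: borel_measurable_continuous_onI)

lemma cont_cs_continuous: "cont_cs f \<Longrightarrow> continuous_on UNIV f"
  by (simp add: cont_cs_def)

lemma cont_cs_scaleR:
  "cont_cs f \<Longrightarrow> continuous_on UNIV g \<Longrightarrow> cont_cs (\<lambda>x. g x *\<^sub>R f x)"
  "continuous_on UNIV f \<Longrightarrow> cont_cs g \<Longrightarrow> cont_cs (\<lambda>x. g x *\<^sub>R f x)"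
  by (auto simp: cont_cs_def intro!: continuous_intros)

lemma cont_cs_norm: "cont_cs f \<Longrightarrow> cont_cs (\<lambda>x. norm (f x))"
  by (auto simp: cont_cs_def intro!: continuous_intros)

lemma cont_cs_power: "cont_cs f \<Longrightarrow> cont_cs (\<lambda>x. f x ^ Suc n :: real)"
  by (auto simp: cont_cs_def intro!: continuous_intros)

lemma cont_cs_norm_sq: "cont_cs f \<Longrightarrow> cont_cs (\<lambda>x. (norm (f x))\<^sup>2)"
  using cont_cs_power[OF cont_cs_norm, of f 1] by (simp add: numeral_2_eq_2)

lemma cont_cs_shift:
  assumes "cont_cs f"
  shows "cont_cs (\<lambda>x. f (a + x))"
proof -
  obtain K where K: "compact K" "\<And>x. x \<notin> K \<Longrightarrow> f x = 0" and c: "continuous_on UNIV f"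
    using assms by (auto simp: cont_cs_def)
  have "compact ((\<lambda>x. -a + x) ` K)" using K(1) by (rule compact_translation)
  moreover have "f (a + x) = 0" if "x \<notin> (\<lambda>x. -a + x) ` K" for x
    using that by (intro K(2)) (auto simp: image_iff)
  moreover have "continuous_on UNIV (\<lambda>x. f (a + x))"
    by (intro continuous_on_compose2[OF c] continuous_intros) auto
  ultimately show ?thesis unfolding cont_cs_def by blast
qed

lemma integrable_lebesgue_on:
  assumes "integrable lborel f" "open \<Omega>"
  shows "integrable (lebesgue_on \<Omega>) (f :: 'a::euclidean_space \<Rightarrow> 'b::euclidean_space)"
proof -
  have "integrable lebesgue f"
    using assms(1) borel_measurable_integrable[OF assms(1)] by (subst integrable_completion) auto
  then have "integrable lebesgue (\<lambda>x. indicator \<Omega> x *\<^sub>R f x)"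
    using assms(2) by (intro integrable_mult_indicator) auto
  then show ?thesis using assms(2) by (simp add: integrable_restrict_space)
qed

lemma integral_lebesgue_on_eq_lborel:
  assumes "f \<in> borel_measurable borel" "open \<Omega>" "\<And>x. x \<notin> \<Omega> \<Longrightarrow> f x = 0"
  shows "integral\<^sup>L (lebesgue_on \<Omega>) f = (LINT x|lborel. f x :: 'b::euclidean_space)"
proof -
  have "(\<lambda>x. indicator \<Omega> x *\<^sub>R f x) = f" using assms(3) by (auto simp: indicator_def)
  then have "integral\<^sup>L (lebesgue_on \<Omega>) f = integral\<^sup>L lebesgue f"
    using assms(2) by (simp add: integral_restrict_space)
  also have "\<dots> = (LINT x|lborel. f x)" using assms(1) by (intro integral_completion) simp
  finally show ?thesis .
qed

lemma borel_measurable_lebesgue_on_borel: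
  "f \<in> borel_measurable borel \<Longrightarrow> f \<in> borel_measurable (lebesgue_on \<Omega>)"
  by (intro measurable_restrict_space1 measurable_completion) simp

lemma cont_cs_sq_int:
  assumes "cont_cs f" "open \<Omega>"
  shows "sq_int (lebesgue_on \<Omega>) f"
  unfolding sq_int_def
  by (intro conjI borel_measurable_lebesgue_on_borel cont_cs_measurable integrable_lebesgue_on
      cont_cs_integrable cont_cs_norm_sq assms)

lemma ex_positive_sq_int_weight:
  assumes "open (\<Omega> :: 'a::euclidean_space set)"
  shows "\<exists>w::'a \<Rightarrow> real. sq_int (lebesgue_on \<Omega>) w \<and> (\<forall>x. w x > 0)"
proof -
  obtain f :: "'a \<Rightarrow> real" where f: "\<And>x. f x > 0" "integrable lborel f"
    using sigma_finite_measure.obtain_positive_integrable_function[OF sigma_finite_lborel] by metis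
  have "integrable (lebesgue_on \<Omega>) (\<lambda>x. (norm (sqrt (f x)))\<^sup>2)"
    using integrable_lebesgue_on[OF f(2) assms] f(1) by (simp add: less_imp_le)
  moreover have "(\<lambda>x. sqrt (f x)) \<in> borel_measurable (lebesgue_on \<Omega>)"
    using borel_measurable_integrable[OF integrable_lebesgue_on[OF f(2) assms]] by measurable
  ultimately show ?thesis using f(1) by (intro exI[of _ "\<lambda>x. sqrt (f x)"]) (auto simp: sq_int_def)
qed

subsection \<open>Test functions\<close>

lemma test_functionsI:
  assumes "smooth_map_on UNIV \<phi>" "compact K" "K \<subseteq> \<Omega>" "\<And>x. x \<notin> K \<Longrightarrow> \<phi> x = 0"
  shows "\<phi> \<in> test_functions \<Omega>"
proof -
  have "closure {x. \<phi> x \<noteq> 0} \<subseteq> K"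
    using assms(2,4) by (intro closure_minimal) (auto intro: compact_imp_closed)
  moreover have "bounded {x. \<phi> x \<noteq> 0}"
    using assms(4) by (intro bounded_subset[OF compact_imp_bounded[OF assms(2)]]) auto
  ultimately show ?thesis
    using assms unfolding test_functions_def by auto
qed

lemma test_functions_smooth: "\<phi> \<in> test_functions \<Omega> \<Longrightarrow> smooth_map_on UNIV \<phi>"
  by (simp add: test_functions_def)

lemma test_functionsE:
  assumes "\<phi> \<in> test_functions \<Omega>"
  obtains K where "smooth_map_on UNIV \<phi>" "compact K" "K \<subseteq> \<Omega>" "\<And>x. x \<notin> K \<Longrightarrow> \<phi> x = 0"
    "\<And>x. x \<notin> K \<Longrightarrow> grad \<phi> x = 0"
proof
  let ?K = "closure {x. \<phi> x \<noteq> 0}"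
  show s: "smooth_map_on UNIV \<phi>" and K: "compact ?K" "?K \<subseteq> \<Omega>"
    using assms by (auto simp: test_functions_def)
  show *: "\<phi> x = 0" if "x \<notin> ?K" for x
    using that closure_subset[of "{x. \<phi> x \<noteq> 0}"] by auto
  show "grad \<phi> x = 0" if "x \<notin> ?K" for x
  proof -
    have "((\<lambda>x. 0) has_derivative (\<lambda>h. 0)) (at x)" by simp
    then have "(\<phi> has_derivative (\<lambda>h. 0)) (at x)"
    proof (rule has_derivative_transform_within_open)
      show "open (- ?K)" "x \<in> - ?K" using that by (simp_all only: open_Compl closed_closure Compl_iff not_False_eq_True)
      show "0 = \<phi> y" if "y \<in> - ?K" for y using *[of y] that by simp
    qed
    then have "frechet_derivative \<phi> (at x) = (\<lambda>h. 0)"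
      using frechet_derivative_at[of \<phi> "\<lambda>h. 0" x] by simp
    then show ?thesis by (simp add: grad_def)
  qed
qed

lemma smooth_map_on_grad:
  assumes "smooth_map_on UNIV \<phi>"
  shows "(\<phi> has_derivative (\<lambda>h. grad \<phi> x \<bullet> h)) (at x)"
proof -
  have d: "(\<phi> has_derivative frechet_derivative \<phi> (at x)) (at x)"
    using smooth_map_on_has_derivative[OF assms] by simp
  interpret linear "frechet_derivative \<phi> (at x)"
    using d by (rule has_derivative_linear)
  have "frechet_derivative \<phi> (at x) h = grad \<phi> x \<bullet> h" for h
  proof -
    have "frechet_derivative \<phi> (at x) h = frechet_derivative \<phi> (at x) (\<Sum>b\<in>Basis. (h \<bullet> b) *\<^sub>R b)"
      by (simp add: euclidean_representation)
    also have "\<dots> = (\<Sum>b\<in>Basis. (h \<bullet> b) * frechet_derivative \<phi> (at x) b)"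
      by (simp only: sum scaleR) simp
    finally show ?thesis
      by (simp add: grad_def inner_sum_left inner_commute[of h] mult.commute)
  qed
  then show ?thesis using d by presburger
qed

lemma grad_eqI:
  assumes "(\<phi> has_derivative (\<lambda>h. g \<bullet> h)) (at x)"
  shows "grad \<phi> x = g"
proof -
  have "frechet_derivative \<phi> (at x) = (\<lambda>h. g \<bullet> h)"
    using frechet_derivative_at[OF assms] by simp
  then show ?thesis by (simp add: grad_def euclidean_representation)
qed

lemma grad_inner_Basis:
  "b \<in> Basis \<Longrightarrow> grad \<phi> x \<bullet> b = frechet_derivative \<phi> (at x) b"
  by (simp add: grad_def inner_sum_left inner_Basis if_distrib cong: if_cong)

lemma test_functions_partial:
  assumes "\<phi> \<in> test_functions \<Omega>" "b \<in> Basis"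
  shows "(\<lambda>x. grad \<phi> x \<bullet> b) \<in> test_functions \<Omega>"
proof -
  obtain K where K: "smooth_map_on UNIV \<phi>" "compact K" "K \<subseteq> \<Omega>" "\<And>x. x \<notin> K \<Longrightarrow> grad \<phi> x = 0"
    by (rule test_functionsE[OF assms(1)]) blast
  have "smooth_map_on UNIV (\<lambda>x. grad \<phi> x \<bullet> b)"
    using smooth_map_on_partial[OF K(1) assms(2)] by (simp add: grad_inner_Basis[OF assms(2)])
  then show ?thesis
    by (rule test_functionsI[OF _ K(2,3)]) (simp add: K(4))
qed

lemma test_functions_mono: "\<Omega> \<subseteq> \<Omega>' \<Longrightarrow> test_functions \<Omega> \<subseteq> test_functions \<Omega>'"
  by (auto simp: test_functions_def)

lemma test_functions_derivative:
  "\<phi> \<in> test_functions \<Omega> \<Longrightarrow> (\<phi> has_derivative (\<lambda>h. grad \<phi> x \<bullet> h)) (at x)"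
  by (simp add: smooth_map_on_grad test_functions_smooth)

lemma test_functions_cont_cs: "\<phi> \<in> test_functions \<Omega> \<Longrightarrow> cont_cs \<phi>"
proof -
  assume *: "\<phi> \<in> test_functions \<Omega>"
  obtain K where "compact K" "\<And>x. x \<notin> K \<Longrightarrow> \<phi> x = 0"
    by (rule test_functionsE[OF *]) blast
  with smooth_map_on_continuous[OF test_functions_smooth[OF *]] show "cont_cs \<phi>"
    unfolding cont_cs_def by blast
qed

lemma test_functions_outside: "\<phi> \<in> test_functions \<Omega> \<Longrightarrow> x \<notin> \<Omega> \<Longrightarrow> \<phi> x = 0"
  and test_functions_grad_outside: "\<phi> \<in> test_functions \<Omega> \<Longrightarrow> x \<notin> \<Omega> \<Longrightarrow> grad \<phi> x = 0"
  by (erule test_functionsE; blast)+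

lemma test_functions_grad_cont_cs:
  assumes "\<phi> \<in> test_functions \<Omega>"
  shows "cont_cs (grad \<phi>)"
proof -
  have "continuous_on UNIV (\<lambda>x. \<Sum>b\<in>Basis. (grad \<phi> x \<bullet> b) *\<^sub>R b)"
    using test_functions_cont_cs[OF test_functions_partial[OF assms]]
    by (intro continuous_on_sum continuous_on_scaleR continuous_on_const) (simp add: cont_cs_def)
  then have "continuous_on UNIV (grad \<phi>)" by (simp add: euclidean_representation)
  moreover obtain K where "compact K" "\<And>x. x \<notin> K \<Longrightarrow> grad \<phi> x = 0"
    by (rule test_functionsE[OF assms]) blast
  ultimately show ?thesis unfolding cont_cs_def by blast
qed

lemma smooth_map_on_add:
  "open S \<Longrightarrow> smooth_map_on S f \<Longrightarrow> smooth_map_on S g \<Longrightarrow> smooth_map_on S (\<lambda>x. f x + g x)"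
  by (simp add: smooth_map_on_def Ck_on_add)

lemma smooth_map_on_mult:
  "open S \<Longrightarrow> smooth_map_on S f \<Longrightarrow> smooth_map_on S g \<Longrightarrow> smooth_map_on S (\<lambda>x. f x * g x :: real)"
  by (simp add: smooth_map_on_def Ck_on_bilinear[OF _ bounded_bilinear_mult])

lemma smooth_map_on_const: "smooth_map_on S (\<lambda>x. c)"
  by (simp add: smooth_map_on_def Ck_on_const)

lemma test_functions_mult:
  assumes "\<phi> \<in> test_functions \<Omega>" "smooth_map_on UNIV f"
  shows "(\<lambda>x. \<phi> x * f x) \<in> test_functions \<Omega>"
proof -
  obtain K where "smooth_map_on UNIV \<phi>" "compact K" "K \<subseteq> \<Omega>" "\<And>x. x \<notin> K \<Longrightarrow> \<phi> x = 0"
    by (rule test_functionsE[OF assms(1)]) blast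
  then show ?thesis
    using assms(2) by (intro test_functionsI[where K = K] smooth_map_on_mult) auto
qed

lemma test_functions_cmult: "\<phi> \<in> test_functions \<Omega> \<Longrightarrow> (\<lambda>x. c * \<phi> x) \<in> test_functions \<Omega>"
  using test_functions_mult[OF _ smooth_map_on_const, of \<phi> \<Omega> c] by (simp add: mult.commute)

lemma test_functions_add:
  assumes "\<phi> \<in> test_functions \<Omega>" "\<psi> \<in> test_functions \<Omega>"
  shows "(\<lambda>x. \<phi> x + \<psi> x) \<in> test_functions \<Omega>"
proof -
  obtain K where "smooth_map_on UNIV \<phi>" "compact K" "K \<subseteq> \<Omega>" "\<And>x. x \<notin> K \<Longrightarrow> \<phi> x = 0"
    by (rule test_functionsE[OF assms(1)]) blast
  moreover obtain K' where
    "smooth_map_on UNIV \<psi>" "compact K'" "K' \<subseteq> \<Omega>" "\<And>x. x \<notin> K' \<Longrightarrow> \<psi> x = 0"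
    by (rule test_functionsE[OF assms(2)]) blast
  ultimately show ?thesis
    by (intro test_functionsI[where K = "K \<union> K'"] smooth_map_on_add) auto
qed

lemma grad_mult:
  assumes "smooth_map_on UNIV \<phi>" "smooth_map_on UNIV \<psi>"
  shows "grad (\<lambda>x. \<phi> x * \<psi> x) x = \<phi> x *\<^sub>R grad \<psi> x + \<psi> x *\<^sub>R grad \<phi> x"
  using has_derivative_mult[OF assms[THEN smooth_map_on_grad]]
  by (intro grad_eqI) (simp add: inner_add_left mult.commute)

lemma test_functions_lipschitz:
  assumes "\<phi> \<in> test_functions \<Omega>"
  obtains B where "B > 0" "\<And>x y. \<bar>\<phi> x - \<phi> y\<bar> \<le> B * norm (x - y)"
proof -
  obtain B where B: "B > 0" "\<And>x. norm (grad \<phi> x) \<le> B"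
    using cont_cs_bounded[OF test_functions_grad_cont_cs[OF assms]] by metis
  have "norm (\<phi> x - \<phi> y) \<le> B * norm (x - y)" for x y
  proof (rule differentiable_bound[of UNIV])
    show "(\<phi> has_derivative (\<lambda>h. grad \<phi> x \<bullet> h)) (at x within UNIV)" for x
      using test_functions_derivative[OF assms] by simp
    show "onorm (\<lambda>h. grad \<phi> x \<bullet> h) \<le> B" for x
    proof (rule onorm_le)
      show "norm (grad \<phi> x \<bullet> h) \<le> B * norm h" for h
        using Cauchy_Schwarz_ineq2[of "grad \<phi> x" h] mult_right_mono[OF B(2)[of x], of "norm h"] by simp
    qed
  qed auto
  with B(1) that show ?thesis by simp
qed

lemma integral_shift:
  fixes f :: "'a::euclidean_space \<Rightarrow> 'b::euclidean_space"
  assumes "f \<in> borel_measurable borel"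
  shows "(LINT x|lborel. f (a + x)) = (LINT x|lborel. f x)"
proof -
  have "(LINT x|lborel. f x) = (LINT x|distr lborel borel ((+) a). f x)"
    by (simp add: lborel_distr_plus)
  also have "\<dots> = (LINT x|lborel. f (a + x))"
    using assms by (subst integral_distr) auto
  finally show ?thesis by simp
qed

text \<open>By translation invariance the difference quotients have integral zero.\<close>

lemma integral_grad_eq_0:
  assumes "\<phi> \<in> test_functions \<Omega>"
  shows "(LINT x|lborel. grad \<phi> x) = 0"
proof -
  have gi: "integrable lborel (grad \<phi>)"
    using cont_cs_integrable[OF test_functions_grad_cont_cs[OF assms]] .
  obtain K where K: "compact K" "\<And>x. x \<notin> K \<Longrightarrow> \<phi> x = 0"
    using test_functions_cont_cs[OF assms] by (auto simp: cont_cs_def)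
  obtain B where B: "B > 0" "\<And>x y. \<bar>\<phi> x - \<phi> y\<bar> \<le> B * norm (x - y)"
    by (rule test_functions_lipschitz[OF assms]) blast
  have "(LINT x|lborel. grad \<phi> x \<bullet> b) = 0" if b: "b \<in> Basis" for b
  proof -
    define s where "s n x = (\<phi> (inverse (real (Suc n)) *\<^sub>R b + x) - \<phi> x) / inverse (real (Suc n))" for n x
    have s0: "(LINT x|lborel. s n x) = 0" for n
    proof -
      have "integrable lborel (\<lambda>x. \<phi> (a + x))" for a
        by (intro cont_cs_integrable cont_cs_shift test_functions_cont_cs[OF assms])
      from this[of 0] this show ?thesis
        unfolding s_def using integral_shift[OF cont_cs_measurable[OF test_functions_cont_cs[OF assms]]]
        by simp
    qed
    define K' where "K' = {x + y |x y. x \<in> K \<and> y \<in> cball (0::'a) 1}"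
    have "compact K'" unfolding K'_def by (intro compact_sums K compact_cball)
    have outside: "s n x = 0" if "x \<notin> K'" for n x
    proof -
      have "inverse (real (Suc n)) \<le> 1" by (simp add: field_simps)
      then have "- (inverse (real (Suc n)) *\<^sub>R b) \<in> cball 0 1" "0 \<in> cball (0::'a) 1"
        using b by auto
      moreover have "x = (inverse (real (Suc n)) *\<^sub>R b + x) + - (inverse (real (Suc n)) *\<^sub>R b)" "x = x + 0"
        by simp_all
      ultimately have "x \<notin> K" "inverse (real (Suc n)) *\<^sub>R b + x \<notin> K"
        using that unfolding K'_def by blast+
      then show ?thesis using K(2) by (simp add: s_def)
    qed
    have le: "norm (s n x) \<le> indicator K' x *\<^sub>R B" for n x
    proof (cases "x \<in> K'")
      case True
      have "norm (s n x) = \<bar>\<phi> (inverse (real (Suc n)) *\<^sub>R b + x) - \<phi> x\<bar> / inverse (real (Suc n))"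
        unfolding s_def by (simp del: of_nat_Suc)
      also have "\<dots> \<le> (B * inverse (real (Suc n))) / inverse (real (Suc n))"
        using B(2)[of "inverse (real (Suc n)) *\<^sub>R b + x" x] b by (intro divide_right_mono) auto
      also have "\<dots> = B" by simp
      finally show ?thesis using True by simp
    qed (use outside in simp)
    have "(\<lambda>n. LINT x|lborel. s n x) \<longlonglongrightarrow> (LINT x|lborel. grad \<phi> x \<bullet> b)"
    proof (rule integral_dominated_convergence)
      show "integrable lborel (\<lambda>x. indicator K' x *\<^sub>R B)"
        by (rule borel_integrable_compact[OF \<open>compact K'\<close>]) simp
      show "(\<lambda>x. grad \<phi> x \<bullet> b) \<in> borel_measurable lborel"
        using borel_measurable_integrable[OF gi] by measurable
      have [measurable]: "\<phi> \<in> borel_measurable borel"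
        using cont_cs_measurable[OF test_functions_cont_cs[OF assms]] .
      show "s n \<in> borel_measurable lborel" for n
        unfolding s_def by measurable
      show "AE x in lborel. norm (s n x) \<le> indicator K' x *\<^sub>R B" for n
        using le by simp
      have "(\<lambda>n. s n x) \<longlonglongrightarrow> grad \<phi> x \<bullet> b" for x
      proof -
        have "((\<lambda>t. \<phi> (x + t *\<^sub>R b)) has_derivative (\<lambda>t. grad \<phi> x \<bullet> (t *\<^sub>R b))) (at 0)"
          using test_functions_derivative[OF assms, of x]
          by (intro has_derivative_compose[where g = \<phi> and f = "\<lambda>t. x + t *\<^sub>R b", simplified])
             (auto intro!: derivative_eq_intros)
        then have "((\<lambda>t. \<phi> (x + t *\<^sub>R b)) has_real_derivative (grad \<phi> x \<bullet> b)) (at 0)"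
          by (simp add: has_field_derivative_def mult.commute mult_commute_abs)
        then have 1: "((\<lambda>h. (\<phi> (x + h *\<^sub>R b) - \<phi> x) / h) \<longlongrightarrow> grad \<phi> x \<bullet> b) (at 0)"
          by (simp add: DERIV_def)
        have 2: "filterlim (\<lambda>n. inverse (real (Suc n))) (at 0) sequentially"
          unfolding filterlim_at using LIMSEQ_inverse_real_of_nat by (simp del: of_nat_Suc)
        have "(\<lambda>n. (\<phi> (x + inverse (real (Suc n)) *\<^sub>R b) - \<phi> x) / inverse (real (Suc n))) \<longlonglongrightarrow> grad \<phi> x \<bullet> b"
          by (rule filterlim_compose[OF 1 2])
        then show ?thesis unfolding s_def by (simp add: add.commute[of x])
      qed
      then show "AE x in lborel. (\<lambda>n. s n x) \<longlonglongrightarrow> grad \<phi> x \<bullet> b" by simp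
    qed
    then show ?thesis unfolding s0 by (simp add: LIMSEQ_const_iff)
  qed
  then show ?thesis
    using gi by (simp add: euclidean_eq_iff[where 'a = 'a])
qed

lemma test_functions_is_weak_grad:
  assumes "\<phi> \<in> test_functions \<Omega>" "open \<Omega>"
  shows "is_weak_grad \<Omega> \<phi> (grad \<phi>)"
  unfolding is_weak_grad_def
proof
  fix \<psi> assume \<psi>: "\<psi> \<in> test_functions \<Omega>"
  note sm = test_functions_smooth[OF assms(1)] test_functions_smooth[OF \<psi>]
  note c = test_functions_cont_cs[OF assms(1)] test_functions_grad_cont_cs[OF assms(1)]
    test_functions_cont_cs[OF \<psi>] test_functions_grad_cont_cs[OF \<psi>]
  have cc: "cont_cs (\<lambda>x. \<phi> x *\<^sub>R grad \<psi> x)" "cont_cs (\<lambda>x. \<psi> x *\<^sub>R grad \<phi> x)"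
    by (rule cont_cs_scaleR(1)[OF c(4) cont_cs_continuous[OF c(1)]],
        rule cont_cs_scaleR(1)[OF c(2) cont_cs_continuous[OF c(3)]])
  have "(LINT x|lborel. \<phi> x *\<^sub>R grad \<psi> x + \<psi> x *\<^sub>R grad \<phi> x) = 0"
    using integral_grad_eq_0[OF test_functions_mult[OF assms(1) sm(2)]]
    by (simp add: grad_mult[OF sm])
  then have "(LINT x|lborel. \<phi> x *\<^sub>R grad \<psi> x) = - (LINT x|lborel. \<psi> x *\<^sub>R grad \<phi> x)"
    using cont_cs_integrable[OF cc(1)] cont_cs_integrable[OF cc(2)]
    by (simp add: eq_neg_iff_add_eq_0)
  then show "(LINT x|lebesgue_on \<Omega>. \<phi> x *\<^sub>R grad \<psi> x) = - (LINT x|lebesgue_on \<Omega>. \<psi> x *\<^sub>R grad \<phi> x)"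
    using integral_lebesgue_on_eq_lborel[OF cont_cs_measurable[OF cc(1)] assms(2)]
      integral_lebesgue_on_eq_lborel[OF cont_cs_measurable[OF cc(2)] assms(2)]
    by (simp add: test_functions_outside[OF assms(1)] test_functions_outside[OF \<psi>])
qed

subsection \<open>Mollification\<close>

lemma borel_version:
  fixes f :: "'a::euclidean_space \<Rightarrow> 'b::euclidean_space"
  assumes "f \<in> borel_measurable lebesgue"
  shows "\<exists>f'\<in>borel_measurable borel. AE x in lborel. f x = f' x"
proof -
  have "\<forall>b. \<exists>g. g \<in> borel_measurable borel \<and> (AE x in lborel. f x \<bullet> b = g x)"
  proof
    fix b :: 'b
    have "(\<lambda>x. f x \<bullet> b) \<in> borel_measurable (completion lborel)"
      by (rule borel_measurable_inner[OF assms borel_measurable_const])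
    from completion_ex_borel_measurable_real[OF this]
    show "\<exists>g. g \<in> borel_measurable borel \<and> (AE x in lborel. f x \<bullet> b = g x)"
      by (simp add: Bex_def)
  qed
  from choice[OF this] obtain g where
    g: "\<And>b. g b \<in> borel_measurable borel" "\<And>b. AE x in lborel. f x \<bullet> b = g b x" by blast
  have [measurable]: "g b \<in> borel_measurable borel" for b by fact
  have "AE x in lborel. \<forall>b\<in>Basis. f x \<bullet> b = g b x"
    using g(2) by (intro AE_finite_allI) auto
  then have "AE x in lborel. f x = (\<Sum>b\<in>Basis. g b x *\<^sub>R b)"
  proof eventually_elim
    case (elim x)
    have "(\<Sum>b\<in>Basis. g b x *\<^sub>R b) = (\<Sum>b\<in>Basis. (f x \<bullet> b) *\<^sub>R b)"
      using elim by (intro sum.cong) auto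
    then show ?case by (simp add: euclidean_representation)
  qed
  moreover have "(\<lambda>x. \<Sum>b\<in>Basis. g b x *\<^sub>R b) \<in> borel_measurable borel"
    using g(1) by (intro borel_measurable_sum borel_measurable_scaleR borel_measurable_const)
  ultimately show ?thesis by (rule bexI)
qed

lemma AE_lebesgue_on_iff:
  assumes "open (\<Omega> :: 'a::euclidean_space set)"
  shows "(AE x in lebesgue_on \<Omega>. P x) \<longleftrightarrow> (AE x in lborel. x \<in> \<Omega> \<longrightarrow> P x)"
  using assms by (subst AE_restrict_space_iff) (auto simp: AE_completion_iff)

lemma sq_int_lborel_imp_lebesgue_on:
  fixes f :: "'a::euclidean_space \<Rightarrow> 'b::euclidean_space"
  assumes "sq_int lborel f" "open \<Omega>"
  shows "sq_int (lebesgue_on \<Omega>) f"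
  using assms integrable_lebesgue_on[OF sq_int_integrable[OF assms(1)] assms(2)]
  by (auto simp: sq_int_def intro: borel_measurable_lebesgue_on_borel)

lemma ex_sq_int_lborel:
  fixes f :: "'a::euclidean_space \<Rightarrow> 'b::euclidean_space"
  assumes "sq_int (lebesgue_on \<Omega>) f" "open \<Omega>"
  obtains f' where "sq_int lborel f'" "AE x in lebesgue_on \<Omega>. f x = f' x" "\<And>x. x \<notin> \<Omega> \<Longrightarrow> f' x = 0"
proof -
  have \<Omega>: "\<Omega> \<inter> space lebesgue \<in> sets lebesgue" using assms(2) by simp
  have "(\<lambda>x. indicator \<Omega> x *\<^sub>R f x) \<in> borel_measurable lebesgue"
    using sq_int_measurable[OF assms(1)] by (simp add: borel_measurable_restrict_space_iff[OF \<Omega>])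
  from borel_version[OF this] obtain f0 where
    f0: "f0 \<in> borel_measurable borel" "AE x in lborel. indicator \<Omega> x *\<^sub>R f x = f0 x" by blast
  define f' where "f' x = indicator \<Omega> x *\<^sub>R f0 x" for x
  have [measurable]: "f' \<in> borel_measurable borel" "\<Omega> \<in> sets borel"
    unfolding f'_def using f0(1) assms(2) by auto
  have ae: "AE x in lborel. indicator \<Omega> x *\<^sub>R f x = f' x"
    using f0(2) by eventually_elim (auto simp: f'_def indicator_def)
  have 1: "integrable lebesgue (\<lambda>x. indicator \<Omega> x *\<^sub>R (norm (f x))\<^sup>2)"
    using sq_int_integrable[OF assms(1)] by (simp add: integrable_restrict_space[OF \<Omega>])
  have 2: "AE x in lebesgue. (norm (f' x))\<^sup>2 = indicator \<Omega> x *\<^sub>R (norm (f x))\<^sup>2"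
    using AE_completion[OF ae] by eventually_elim (auto simp: indicator_def split: if_splits)
  have 3: "(\<lambda>x. (norm (f' x))\<^sup>2) \<in> borel_measurable lebesgue"
    by (rule measurable_completion) measurable
  have "integrable lebesgue (\<lambda>x. (norm (f' x))\<^sup>2)"
    using integrable_cong_AE[OF 3 borel_measurable_integrable[OF 1] 2] 1 by blast
  then have "integrable lborel (\<lambda>x. (norm (f' x))\<^sup>2)"
    by (subst (asm) integrable_completion) auto
  then have "sq_int lborel f'" by (simp add: sq_int_def)
  moreover have "AE x in lebesgue_on \<Omega>. f x = f' x"
    unfolding AE_lebesgue_on_iff[OF assms(2)] using ae by eventually_elim auto
  moreover have "f' x = 0" if "x \<notin> \<Omega>" for x using that by (simp add: f'_def)
  ultimately show ?thesis by (rule that)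
qed

lemma l2norm_lebesgue_on_UNIV:
  assumes "f \<in> borel_measurable borel"
  shows "l2norm (lebesgue_on UNIV) f = l2norm lborel f"
  using assms integral_lebesgue_on_eq_lborel[of "\<lambda>x. (norm (f x))\<^sup>2" UNIV] by (simp add: l2norm_def)

definition bump :: "real \<Rightarrow> 'a::euclidean_space \<Rightarrow> real" where
  "bump e z = flat 0 (1 - (z \<bullet> z) / e\<^sup>2)"

definition moll :: "real \<Rightarrow> 'a::euclidean_space \<Rightarrow> real" where
  "moll e z = bump e z / (LINT z|lborel. bump e (z :: 'a))"

definition conv :: "('a::euclidean_space \<Rightarrow> real) \<Rightarrow> ('a \<Rightarrow> 'b::euclidean_space) \<Rightarrow> 'a \<Rightarrow> 'b" where
  "conv k f x = (LINT y|lborel. k (x - y) *\<^sub>R f y)"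

lemma smooth_map_on_bump: "smooth_map_on UNIV (\<lambda>y. bump e (x - y))"
  unfolding bump_def
proof (rule smooth_map_on_flat)
  have "Ck_on k UNIV (\<lambda>y::'a. x + (- 1) *\<^sub>R y)" for k
    by (intro Ck_on_add Ck_on_const Ck_on_bounded_linear[OF _ bounded_linear_scaleR_right] Ck_on_id open_UNIV)
  then have "Ck_on k UNIV (\<lambda>y::'a. x - y)" for k by simp
  then have "Ck_on k UNIV (\<lambda>y. 1 + (- (1 / e\<^sup>2)) *\<^sub>R ((x - y) \<bullet> (x - y)))" for k
    by (intro Ck_on_add Ck_on_const Ck_on_bounded_linear[OF _ bounded_linear_scaleR_right]
        Ck_on_bilinear[OF _ bounded_bilinear_inner] open_UNIV)
  then show "smooth_map_on UNIV (\<lambda>y. 1 - ((x - y) \<bullet> (x - y)) / e\<^sup>2)"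
    by (simp add: smooth_map_on_def)
qed simp

lemma bump_nonneg: "bump e z \<ge> 0"
  by (simp add: bump_def flat_0_nonneg)

lemma bump_minus: "bump e (- z) = bump e z"
  by (simp add: bump_def)

lemma bump_pos_iff:
  assumes "e > 0" shows "bump e z > 0 \<longleftrightarrow> norm z < e"
proof -
  have "bump e z > 0 \<longleftrightarrow> (norm z)\<^sup>2 < e\<^sup>2"
    using assms by (simp add: bump_def flat_0_pos_iff power2_norm_eq_inner)
  also have "\<dots> \<longleftrightarrow> norm z < e"
    using assms abs_le_square_iff[of e "norm z"] by (simp add: not_le[symmetric])
  finally show ?thesis .
qed

lemma bump_test: 
  assumes "e > 0" "cball x e \<subseteq> \<Omega>"
  shows "(\<lambda>y. bump e (x - y)) \<in> test_functions \<Omega>"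
proof (rule test_functionsI[OF smooth_map_on_bump compact_cball assms(2)])
  show "bump e (x - y) = 0" if "y \<notin> cball x e" for y
    using that bump_pos_iff[OF assms(1), of "x - y"] bump_nonneg[of e "x - y"]
    by (simp add: dist_norm)
qed

lemma bump_test_UNIV:
  assumes "e > 0" shows "bump e \<in> test_functions UNIV"
  using bump_test[OF assms, of 0 UNIV] by (simp add: bump_minus)

lemma integral_bump_pos:
  assumes "e > 0"
  shows "(LINT z|lborel. bump e (z::'a::euclidean_space)) > 0"
proof -
  have "(LINT z|lborel. bump e (z::'a)) \<noteq> 0"
  proof
    assume "(LINT z|lborel. bump e (z::'a)) = 0"
    then have "AE z in lborel. bump e (z::'a) = 0"
      using integral_nonneg_eq_0_iff_AE[OF cont_cs_integrable[OF test_functions_cont_cs[OF bump_test_UNIV[OF assms, where 'a = 'a]]]]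
      by (simp add: bump_nonneg)
    then have "AE z in lborel. z \<notin> ball (0::'a) e"
      by eventually_elim (metis bump_pos_iff[OF assms] less_irrefl mem_ball_0)
    then have "ball (0::'a) e \<in> null_sets lborel"
      by (subst (asm) AE_iff_null_sets[symmetric]) auto
    then have "negligible (ball (0::'a) e)"
      by (simp add: negligible_iff_null_sets null_sets_completionI)
    then show False using assms open_not_negligible[of "ball (0::'a) e"] by simp
  qed
  then show ?thesis
    by (simp add: bump_nonneg less_le)
qed

lemma moll_nonneg: "e > 0 \<Longrightarrow> moll e z \<ge> 0"
  using integral_bump_pos[of e, where 'a = 'a] by (simp add: moll_def bump_nonneg)

lemma moll_minus: "moll e (- z) = moll e z"
  by (simp add: moll_def bump_minus)

lemma moll_eq_0: "e > 0 \<Longrightarrow> norm z \<ge> e \<Longrightarrow> moll e z = 0"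
  using bump_pos_iff[of e z] bump_nonneg[of e z] by (simp add: moll_def)

lemma moll_test:
  assumes "e > 0" "cball x e \<subseteq> \<Omega>"
  shows "(\<lambda>y. moll e (x - y)) \<in> test_functions \<Omega>"
  using test_functions_cmult[OF bump_test[OF assms], of "1 / (LINT z|lborel. bump e (z::'a))"]
  by (simp add: moll_def)

lemma moll_test_UNIV: "e > 0 \<Longrightarrow> moll e \<in> test_functions UNIV"
  using moll_test[of e 0 UNIV] by (simp add: moll_minus)

lemma moll_integral: "e > 0 \<Longrightarrow> (LINT z|lborel. moll e (z::'a::euclidean_space)) = 1"
  using integral_bump_pos[of e, where 'a = 'a] by (simp add: moll_def)

lemma moll_integral_shift:
  fixes x y :: "'a::euclidean_space"
  assumes "e > 0"
  shows "(LINT x|lborel. moll e (x - y)) = 1" "(LINT y|lborel. moll e (x - y)) = 1"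
    "integrable lborel (\<lambda>x. moll e (x - y))" "integrable lborel (\<lambda>y. moll e (x - y))"
proof -
  note c = test_functions_cont_cs[OF moll_test_UNIV[OF assms, where 'a = 'a]]
  have 1: "(LINT x|lborel. moll e (a + x)) = 1" "integrable lborel (\<lambda>x. moll e (a + x))" for a :: 'a
    using integral_shift[OF cont_cs_measurable[OF c], of a] moll_integral[OF assms]
      cont_cs_integrable[OF cont_cs_shift[OF c]] by auto
  have 2: "moll e (x - y) = moll e (- x + y)" for y
    using moll_minus[of e "x - y"] by simp
  show "(LINT x|lborel. moll e (x - y)) = 1" "integrable lborel (\<lambda>x. moll e (x - y))"
    using 1[of "- y"] by simp_all
  show "(LINT y|lborel. moll e (x - y)) = 1" "integrable lborel (\<lambda>y. moll e (x - y))"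
    unfolding 2 using 1[of "- x"] by simp_all
qed

lemma cont_cs_reflect:
  assumes "cont_cs f"
  shows "cont_cs (\<lambda>y. f (x - y))"
proof -
  obtain K where K: "compact K" "\<And>x. x \<notin> K \<Longrightarrow> f x = 0" and c: "continuous_on UNIV f"
    using assms by (auto simp: cont_cs_def)
  have "compact ((\<lambda>y. x - y) ` K)"
    by (intro compact_continuous_image K continuous_intros)
  moreover have "f (x - y) = 0" if "y \<notin> (\<lambda>y. x - y) ` K" for y
  proof (rule K(2), rule notI)
    assume "x - y \<in> K"
    then have "x - (x - y) \<in> (\<lambda>y. x - y) ` K" by (rule imageI)
    with that show False by simp
  qed
  moreover have "continuous_on UNIV (\<lambda>y. f (x - y))"
    by (intro continuous_on_compose2[OF c] continuous_intros) auto
  ultimately show ?thesis unfolding cont_cs_def by blast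
qed

lemma cont_cs_sq_int_lborel: "cont_cs f \<Longrightarrow> sq_int lborel f"
  by (simp add: sq_int_def cont_cs_measurable cont_cs_integrable cont_cs_norm_sq)

lemma conv_integrable:
  assumes "cont_cs k" "sq_int lborel f"
  shows "integrable lborel (\<lambda>y. k (x - y) *\<^sub>R f y)"
  by (intro sq_int_scaleR assms cont_cs_sq_int_lborel cont_cs_reflect)

lemma conv_has_derivative:
  fixes f :: "'a::euclidean_space \<Rightarrow> real"
  assumes k: "k \<in> test_functions UNIV" and f: "sq_int lborel f"
  shows "(conv k f has_derivative (\<lambda>h. (LINT y|lborel. f y *\<^sub>R grad k (x - y)) \<bullet> h)) (at x)"
proof -
  define D where "D = (LINT y|lborel. f y *\<^sub>R grad k (x - y))"
  note kc = test_functions_cont_cs[OF k] and gc = test_functions_grad_cont_cs[OF k]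
  have gi: "integrable lborel (\<lambda>y. f y *\<^sub>R grad k (x - y))"
    by (intro sq_int_scaleR f cont_cs_sq_int_lborel cont_cs_reflect gc)
  obtain K where K: "compact K" "\<And>x. x \<notin> K \<Longrightarrow> k x = 0" "\<And>x. x \<notin> K \<Longrightarrow> grad k x = 0"
    by (rule test_functionsE[OF k]) blast
  obtain B where B: "B > 0" "\<And>x y. \<bar>k x - k y\<bar> \<le> B * norm (x - y)"
    by (rule test_functions_lipschitz[OF k]) blast
  obtain B' where B': "B' > 0" "\<And>x. norm (grad k x) \<le> B'"
    by (rule cont_cs_bounded[OF gc]) blast
  have [measurable]: "k \<in> borel_measurable borel" "grad k \<in> borel_measurable borel" "f \<in> borel_measurable borel"
    using cont_cs_measurable[OF kc] cont_cs_measurable[OF gc] sq_int_measurable[OF f] by simp_all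
  have "((\<lambda>y. norm ((conv k f y - conv k f x) - D \<bullet> (y - x)) / norm (y - x)) \<longlongrightarrow> 0) (at x within UNIV)"
    unfolding tendsto_at_iff_sequentially comp_def
  proof (intro allI impI)
    fix X assume X: "\<forall>i. X i \<in> UNIV - {x}" "X \<longlonglongrightarrow> x"
    have "bounded (range X)" using X(2) convergentI by (intro convergent_imp_bounded)
    then obtain R where R: "\<And>n. norm (X n) \<le> R" by (auto simp: bounded_iff)
    define R' where "R' = max R (norm x)"
    have R': "X n \<in> cball 0 R'" "x \<in> cball 0 R'" for n using R[of n] by (auto simp: R'_def)
    define K' where "K' = {a - b | a b. a \<in> cball 0 R' \<and> b \<in> K}"
    have "compact K'" unfolding K'_def by (intro compact_differences compact_cball K)
    define q where "q n y = (k (X n - y) - k (x - y) - grad k (x - y) \<bullet> (X n - x)) / norm (X n - x)" for n y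
    have pos: "norm (X n - x) > 0" for n using X(1) by (auto simp: Diff_iff)
    have qle: "\<bar>q n y\<bar> \<le> (B + B') * indicator K' y" for n y
    proof (cases "y \<in> K'")
      case True
      have "\<bar>k (X n - y) - k (x - y) - grad k (x - y) \<bullet> (X n - x)\<bar> \<le> B * norm (X n - x) + B' * norm (X n - x)"
        using B(2)[of "X n - y" "x - y"] Cauchy_Schwarz_ineq2[of "grad k (x - y)" "X n - x"]
          mult_right_mono[OF B'(2)[of "x - y"], of "norm (X n - x)"] by simp
      then show ?thesis
        using True pos[of n] by (simp add: q_def divide_le_eq distrib_right)
    next
      case False
      have "X n - y \<notin> K" "x - y \<notin> K"
      proof -
        have *: "a - y \<notin> K" if "a \<in> cball 0 R'" for a
        proof
          assume "a - y \<in> K"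
          moreover have "y = a - (a - y)" by simp
          ultimately show False using False that unfolding K'_def by blast
        qed
        then show "X n - y \<notin> K" "x - y \<notin> K" using R' by blast+
      qed
      then show ?thesis using K(2,3) B(1) B'(1) by (simp add: q_def)
    qed
    have lim: "(\<lambda>n. LINT y|lborel. q n y * f y) \<longlonglongrightarrow> (LINT y|(lborel :: 'a measure). 0)"
    proof (rule integral_dominated_convergence)
      have sqK: "sq_int lborel (\<lambda>y. (B + B') * indicator K' y)"
      proof -
        have "integrable lborel (\<lambda>y. indicator K' y *\<^sub>R (B + B')\<^sup>2)"
          by (rule borel_integrable_compact[OF \<open>compact K'\<close>]) simp
        then have "integrable lborel (\<lambda>y. (norm ((B + B') * indicator K' y))\<^sup>2)"
          by (rule Bochner_Integration.integrable_cong[THEN iffD1, rotated 2])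
             (auto simp: power_mult_distrib indicator_def)
        moreover have "(\<lambda>y. (B + B') * indicator K' y) \<in> borel_measurable borel"
          using borel_compact[OF \<open>compact K'\<close>] by (intro borel_measurable_times borel_measurable_indicator) auto
        ultimately show ?thesis by (simp add: sq_int_def)
      qed
      show "integrable lborel (\<lambda>y. norm ((B + B') * indicator K' y) * norm (f y))"
        by (rule sq_int_norm_mult[OF sqK f])
      show "(\<lambda>y. q n y * f y) \<in> borel_measurable lborel" for n
        unfolding q_def by measurable
      show "AE y in lborel. norm (q n y * f y) \<le> norm ((B + B') * indicator K' y) * norm (f y)" for n
        using order_trans[OF qle[of n] abs_ge_self] by (intro AE_I2) (simp add: abs_mult mult_right_mono)
      have "(\<lambda>n. q n y) \<longlonglongrightarrow> 0" for y
      proof -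
        have d: "((\<lambda>z. k (z - y)) has_derivative (\<lambda>h. grad k (x - y) \<bullet> h)) (at x)"
        proof -
          have "((\<lambda>z. z - y) has_derivative (\<lambda>h. h)) (at x)"
            by (auto intro!: derivative_eq_intros)
          from has_derivative_compose[OF this test_functions_derivative[OF k]] show ?thesis by simp
        qed
        have "((\<lambda>z. norm ((k (z - y) - k (x - y)) - grad k (x - y) \<bullet> (z - x)) / norm (z - x)) \<longlongrightarrow> 0) (at x)"
          using d unfolding has_derivative_iff_norm by blast
        then have "(\<lambda>n. norm ((k (X n - y) - k (x - y)) - grad k (x - y) \<bullet> (X n - x)) / norm (X n - x)) \<longlonglongrightarrow> 0"
          unfolding tendsto_at_iff_sequentially comp_def using X by blast
        then have "(\<lambda>n. norm (q n y)) \<longlonglongrightarrow> 0" by (simp add: q_def)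
        then show ?thesis by (simp only: tendsto_norm_zero_iff)
      qed
      then show "AE y in lborel. (\<lambda>n. q n y * f y) \<longlonglongrightarrow> 0"
        by (intro AE_I2 tendsto_mult_left_zero)
    qed simp
    have eq: "norm ((conv k f (X n) - conv k f x) - D \<bullet> (X n - x)) / norm (X n - x)
        = \<bar>LINT y|lborel. q n y * f y\<bar>" for n
    proof -
      have i: "integrable lborel (\<lambda>y. k (a - y) * f y)" for a
        using conv_integrable[OF kc f] by simp
      have i2: "integrable lborel (\<lambda>y. (f y *\<^sub>R grad k (x - y)) \<bullet> (X n - x))"
        using gi by (rule integrable_inner_left)
      have "(LINT y|lborel. q n y * f y)
          = (LINT y|lborel. (k (X n - y) * f y - k (x - y) * f y - (f y *\<^sub>R grad k (x - y)) \<bullet> (X n - x)) / norm (X n - x))"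
        by (intro Bochner_Integration.integral_cong) (auto simp: q_def algebra_simps diff_divide_distrib)
      also have "\<dots> = (conv k f (X n) - conv k f x - D \<bullet> (X n - x)) / norm (X n - x)"
        using i i2 gi by (simp add: conv_def D_def del: inner_scaleR_left)
      finally show ?thesis by simp
    qed
    show "(\<lambda>n. norm ((conv k f (X n) - conv k f x) - D \<bullet> (X n - x)) / norm (X n - x)) \<longlonglongrightarrow> 0"
      unfolding eq using tendsto_rabs[OF lim] by simp
  qed
  then show ?thesis
    unfolding has_derivative_iff_norm D_def by (simp add: bounded_linear_inner_right)
qed

lemma smooth_map_on_conv:
  fixes f :: "'a::euclidean_space \<Rightarrow> real"
  assumes "k \<in> test_functions UNIV" and f: "sq_int lborel f"
  shows "smooth_map_on UNIV (conv k f)"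
proof -
  have "Ck_on j UNIV (conv k f)" for j
    using assms(1)
  proof (induction j arbitrary: k)
    case 0
    have "continuous_on UNIV (conv k f)"
      using has_derivative_continuous[OF conv_has_derivative[OF 0 f]]
      by (intro continuous_at_imp_continuous_on) blast
    then show ?case by simp
  next
    case (Suc j)
    show ?case
    proof (rule Ck_on_SucI[OF open_UNIV conv_has_derivative[OF Suc.prems f]])
      fix b :: 'a assume b: "b \<in> Basis"
      have "(LINT y|lborel. f y *\<^sub>R grad k (x - y)) \<bullet> b = conv (\<lambda>x. grad k x \<bullet> b) f x" for x
      proof -
        have "integrable lborel (\<lambda>y. f y *\<^sub>R grad k (x - y))"
          by (intro sq_int_scaleR f cont_cs_sq_int_lborel cont_cs_reflect test_functions_grad_cont_cs[OF Suc.prems])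
        then have "(LINT y|lborel. f y *\<^sub>R grad k (x - y)) \<bullet> b = (LINT y|lborel. (f y *\<^sub>R grad k (x - y)) \<bullet> b)"
          by (rule integral_inner_left[symmetric])
        then show ?thesis by (simp add: conv_def mult.commute)
      qed
      then show "Ck_on j UNIV (\<lambda>x. (LINT y|lborel. f y *\<^sub>R grad k (x - y)) \<bullet> b)"
        using Suc.IH[OF test_functions_partial[OF Suc.prems b]] by (simp add: fun_eq_iff[symmetric])
    qed
  qed
  then show ?thesis by (simp add: smooth_map_on_def)
qed

lemma conv_measurable:
  assumes "cont_cs k" "sq_int lborel f"
  shows "conv k f \<in> borel_measurable borel"
proof -
  have [measurable]: "k \<in> borel_measurable borel" "f \<in> borel_measurable borel"
    using cont_cs_measurable[OF assms(1)] sq_int_measurable[OF assms(2)] by simp_all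
  show ?thesis unfolding conv_def by measurable
qed

text \<open>Jensen's inequality for the probability density \<open>moll e (x - y)\<close>, followed by Tonelli.\<close>

lemma conv_l2:
  fixes f :: "'a::euclidean_space \<Rightarrow> 'b::euclidean_space"
  assumes e: "e > 0" and f: "sq_int lborel f"
  shows "sq_int lborel (conv (moll e) f)" "l2norm lborel (conv (moll e) f) \<le> l2norm lborel f"
proof -
  note kc = test_functions_cont_cs[OF moll_test_UNIV[OF e, where 'a = 'a]]
  note cm = conv_measurable[OF kc f]
  have [measurable]: "(moll e :: 'a \<Rightarrow> real) \<in> borel_measurable borel" "f \<in> borel_measurable borel"
    using cont_cs_measurable[OF kc] sq_int_measurable[OF f] by simp_all
  note [measurable] = cm
  have J: "ennreal ((norm (conv (moll e) f x))\<^sup>2) \<le> (\<integral>\<^sup>+y. ennreal (moll e (x - y) * (norm (f y))\<^sup>2) \<partial>lborel)" for x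
  proof -
    obtain B where B: "B > 0" "\<And>x::'a. norm (moll e x) \<le> B"
      by (rule cont_cs_bounded[OF kc]) blast
    have i: "integrable lborel (\<lambda>y. moll e (x - y) * (norm (f y))\<^sup>2)"
    proof (rule Bochner_Integration.integrable_bound)
      show "integrable lborel (\<lambda>y. B * (norm (f y))\<^sup>2)"
        using f by (intro integrable_mult_right sq_int_integrable)
      show "AE y in lborel. norm (moll e (x - y) * (norm (f y))\<^sup>2) \<le> norm (B * (norm (f y))\<^sup>2)"
        using B by (intro AE_I2) (simp add: abs_mult mult_right_mono)
    qed measurable
    define a b where "a y = sqrt (moll e (x - y))" and "b y = sqrt (moll e (x - y)) * norm (f y)" for y
    have a2: "(norm (a y))\<^sup>2 = moll e (x - y)" and b2: "(norm (b y))\<^sup>2 = moll e (x - y) * (norm (f y))\<^sup>2"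
      and ab: "norm (a y) * norm (b y) = norm (moll e (x - y) *\<^sub>R f y)" for y
      using moll_nonneg[OF e, of "x - y"] by (simp_all add: a_def b_def power_mult_distrib)
    have "a \<in> borel_measurable borel" "b \<in> borel_measurable borel"
      unfolding a_def[abs_def] b_def[abs_def] by measurable
    then have sq: "sq_int lborel a" "sq_int lborel b"
      unfolding sq_int_def a2 b2 using i moll_integral_shift(4)[OF e, of x] by simp_all
    have "norm (conv (moll e) f x) \<le> (LINT y|lborel. norm (a y) * norm (b y))"
      unfolding conv_def ab by (rule integral_norm_bound)
    also have "\<dots> \<le> l2norm lborel a * l2norm lborel b"
      by (rule l2_Cauchy_Schwarz_norm[OF sq])
    also have "l2norm lborel a = 1"
      using moll_integral_shift(2)[OF e, of x] unfolding l2norm_def a2 by simp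
    finally have "(norm (conv (moll e) f x))\<^sup>2 \<le> (l2norm lborel b)\<^sup>2"
      by (intro power_mono) auto
    also have "\<dots> = (LINT y|lborel. moll e (x - y) * (norm (f y))\<^sup>2)"
      by (simp only: l2norm_sq b2)
    finally have "ennreal ((norm (conv (moll e) f x))\<^sup>2) \<le> ennreal (LINT y|lborel. moll e (x - y) * (norm (f y))\<^sup>2)"
      by (rule ennreal_leI)
    also have "\<dots> = (\<integral>\<^sup>+y. ennreal (moll e (x - y) * (norm (f y))\<^sup>2) \<partial>lborel)"
      using i by (intro nn_integral_eq_integral[symmetric]) (auto intro!: AE_I2 mult_nonneg_nonneg moll_nonneg[OF e])
    finally show ?thesis .
  qed
  have "(\<integral>\<^sup>+x. ennreal ((norm (conv (moll e) f x))\<^sup>2) \<partial>lborel)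
      \<le> (\<integral>\<^sup>+x. (\<integral>\<^sup>+y. ennreal (moll e (x - y) * (norm (f y))\<^sup>2) \<partial>lborel) \<partial>lborel)"
    by (intro nn_integral_mono J)
  also have "\<dots> = (\<integral>\<^sup>+y. (\<integral>\<^sup>+x. ennreal (moll e (x - y) * (norm (f y))\<^sup>2) \<partial>lborel) \<partial>lborel)"
    by (rule lborel_pair.Fubini'[symmetric]) measurable
  also have "\<dots> = (\<integral>\<^sup>+y. ennreal ((norm (f y))\<^sup>2) \<partial>lborel)"
  proof (rule nn_integral_cong)
    fix y
    have "(\<integral>\<^sup>+x. ennreal (moll e (x - y) * (norm (f y))\<^sup>2) \<partial>lborel)
        = (\<integral>\<^sup>+x. ennreal (moll e (x - y)) * ennreal ((norm (f y))\<^sup>2) \<partial>lborel)"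
      by (intro nn_integral_cong ennreal_mult moll_nonneg[OF e]) simp
    also have "\<dots> = (\<integral>\<^sup>+x. ennreal (moll e (x - y)) \<partial>lborel) * ennreal ((norm (f y))\<^sup>2)"
      by (rule nn_integral_multc) measurable
    also have "(\<integral>\<^sup>+x. ennreal (moll e (x - y)) \<partial>lborel) = 1"
      using moll_integral_shift(1,3)[OF e, of y]
      by (subst nn_integral_eq_integral) (auto intro!: AE_I2 moll_nonneg[OF e])
    finally show "(\<integral>\<^sup>+x. ennreal (moll e (x - y) * (norm (f y))\<^sup>2) \<partial>lborel) = ennreal ((norm (f y))\<^sup>2)"
      by simp
  qed
  also have "\<dots> = ennreal ((l2norm lborel f)\<^sup>2)"
    unfolding l2norm_sq using sq_int_integrable[OF f] by (intro nn_integral_eq_integral) auto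
  finally have le: "(\<integral>\<^sup>+x. ennreal ((norm (conv (moll e) f x))\<^sup>2) \<partial>lborel) \<le> ennreal ((l2norm lborel f)\<^sup>2)" .
  have i: "integrable lborel (\<lambda>x. (norm (conv (moll e) f x))\<^sup>2)"
    using le by (intro integrableI_bounded) (auto intro: le_less_trans)
  with cm show "sq_int lborel (conv (moll e) f)" by (simp add: sq_int_def)
  have "ennreal ((l2norm lborel (conv (moll e) f))\<^sup>2) \<le> ennreal ((l2norm lborel f)\<^sup>2)"
    using le unfolding l2norm_sq[of _ "conv (moll e) f"] by (subst (asm) nn_integral_eq_integral[OF i]) auto
  then show "l2norm lborel (conv (moll e) f) \<le> l2norm lborel f"
    by (simp add: l2norm_nonneg power2_le_iff_abs_le)
qed

lemma l2norm_dominated_convergence: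
  assumes F: "\<And>n. F n \<in> borel_measurable M" "G \<in> borel_measurable M"
    and lim: "AE x in M. (\<lambda>n. F n x) \<longlonglongrightarrow> G x"
    and w: "sq_int M w" "\<And>n. AE x in M. norm (F n x) \<le> norm (w x)"
  shows "(\<lambda>n. l2norm M (\<lambda>x. F n x - G x)) \<longlonglongrightarrow> 0"
proof -
  have [measurable]: "F n \<in> borel_measurable M" "G \<in> borel_measurable M" for n by fact+
  have ae: "AE x in M. \<forall>n. norm (F n x) \<le> norm (w x)"
    using w(2) by (simp add: AE_all_countable)
  have "(\<lambda>n. LINT x|M. (norm (F n x - G x))\<^sup>2) \<longlonglongrightarrow> (LINT x|M. 0)"
  proof (rule integral_dominated_convergence)
    show "integrable M (\<lambda>x. 4 * (norm (w x))\<^sup>2)"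
      using w(1) by (intro integrable_mult_right sq_int_integrable)
    show "AE x in M. (\<lambda>n. (norm (F n x - G x))\<^sup>2) \<longlonglongrightarrow> 0"
      using lim
    proof eventually_elim
      case (elim x)
      from tendsto_power[OF tendsto_norm[OF LIM_zero[OF elim]], of 2] show ?case by simp
    qed
    show "AE x in M. norm ((norm (F n x - G x))\<^sup>2) \<le> 4 * (norm (w x))\<^sup>2" for n
      using lim ae
    proof eventually_elim
      case (elim x)
      have "norm (G x) \<le> norm (w x)"
        using elim(2) by (intro LIMSEQ_le_const2[OF tendsto_norm[OF elim(1)]]) auto
      then have "norm (F n x - G x) \<le> 2 * norm (w x)"
        using norm_triangle_ineq4[of "F n x" "G x"] elim(2)[rule_format, of n] by linarith
      then have "(norm (F n x - G x))\<^sup>2 \<le> (2 * norm (w x))\<^sup>2"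
        by (intro power_mono) auto
      then show ?case by (simp add: power_mult_distrib)
    qed
  qed measurable
  from tendsto_real_sqrt[OF this] show ?thesis by (simp add: l2norm_def)
qed

definition clip :: "real \<Rightarrow> 'b::euclidean_space \<Rightarrow> 'b" where
  "clip R v = (R / max R (norm v)) *\<^sub>R v"

definition cutoff :: "real \<Rightarrow> 'a::euclidean_space \<Rightarrow> real" where
  "cutoff R x = max 0 (min 1 (2 - norm x / R))"

lemma clip_continuous: "R > 0 \<Longrightarrow> continuous_on S (clip R)"
  unfolding clip_def[abs_def] by (intro continuous_intros) (auto simp: max_def)

lemma norm_clip:
  assumes "R > 0" shows "norm (clip R v) \<le> R" "norm (clip R v) \<le> norm v"
proof -
  have "norm (clip R v) = R / max R (norm v) * norm v"
    using assms by (simp add: clip_def max_def)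
  moreover have "R / max R (norm v) * norm v \<le> R" "R / max R (norm v) * norm v \<le> norm v"
    using assms by (auto simp: max_def field_simps mult_left_le_one_le)
  ultimately show "norm (clip R v) \<le> R" "norm (clip R v) \<le> norm v" by simp_all
qed

lemma cutoff_bounds: "0 \<le> cutoff R x" "cutoff R x \<le> 1"
  by (auto simp: cutoff_def)

lemma cutoff_cont_cs:
  assumes "R > 0" shows "cont_cs (cutoff R)"
  unfolding cont_cs_def
proof (intro conjI exI allI impI)
  show "continuous_on UNIV (cutoff R)"
    unfolding cutoff_def[abs_def]
    by (intro continuous_on_max continuous_on_min continuous_on_const continuous_on_diff continuous_on_divide
        continuous_on_norm continuous_on_id) (use assms in auto)
  show "compact (cball (0::'a) (2 * R))" by simp
  show "cutoff R x = 0" if "x \<notin> cball 0 (2 * R)" for x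
    using that assms by (simp add: cutoff_def max_def min_def field_simps)
qed

lemma clip_cutoff_tendsto:
  "(\<lambda>n. cutoff (real (Suc n)) x *\<^sub>R clip (real (Suc n)) v) \<longlonglongrightarrow> v"
proof (rule tendsto_eventually)
  obtain N where N: "norm x + norm v \<le> real N" using real_arch_simple by blast
  have "cutoff (real (Suc n)) x *\<^sub>R clip (real (Suc n)) v = v" if "n \<ge> N" for n
  proof -
    have *: "norm x \<le> real (Suc n)" "norm v \<le> real (Suc n)"
      using N that norm_ge_zero[of x] norm_ge_zero[of v] by linarith+
    then have "norm x / real (Suc n) \<le> 1" by (simp add: divide_le_eq)
    then have "cutoff (real (Suc n)) x = 1" by (simp add: cutoff_def)
    moreover have "clip (real (Suc n)) v = v" using * by (simp add: clip_def max_absorb1)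
    ultimately show ?thesis by simp
  qed
  then show "\<forall>\<^sub>F n in sequentially. cutoff (real (Suc n)) x *\<^sub>R clip (real (Suc n)) v = v"
    unfolding eventually_sequentially by blast
qed

lemma cont_cs_dense:
  fixes f :: "'a::euclidean_space \<Rightarrow> 'b::euclidean_space"
  assumes f: "sq_int lborel f" and "e > 0"
  obtains g where "cont_cs g" "l2norm lborel (\<lambda>x. f x - g x) < e"
proof -
  define T where "T R h x = cutoff R x *\<^sub>R clip R (h x)" for R and h :: "'a \<Rightarrow> 'b" and x
  have [measurable]: "f \<in> borel_measurable borel" using sq_int_measurable[OF f] by simp
  have Tm: "T R f \<in> borel_measurable borel" if "R > 0" for R
  proof -
    have [measurable]: "(cutoff R :: 'a \<Rightarrow> real) \<in> borel_measurable borel"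
        "(clip R :: 'b \<Rightarrow> 'b) \<in> borel_measurable borel"
      by (rule cont_cs_measurable[OF cutoff_cont_cs[OF that]],
          rule borel_measurable_continuous_onI[OF clip_continuous[OF that]])
    show ?thesis unfolding T_def[abs_def] by measurable
  qed
  have Tle: "norm (T R h x) \<le> norm (h x)" "norm (T R h x) \<le> norm (R * cutoff R x)" if "R > 0" for R h x
  proof -
    have "norm (T R h x) = cutoff R x * norm (clip R (h x))"
      by (simp add: T_def cutoff_bounds)
    moreover have "cutoff R x * norm (clip R (h x)) \<le> 1 * norm (h x)"
      "cutoff R x * norm (clip R (h x)) \<le> cutoff R x * R"
      by (intro mult_mono mult_left_mono norm_clip[OF that] cutoff_bounds; simp)+
    moreover have "norm (R * cutoff R x) = cutoff R x * R" 
      using that by (simp add: abs_mult cutoff_bounds)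
    ultimately show "norm (T R h x) \<le> norm (h x)" "norm (T R h x) \<le> norm (R * cutoff R x)"
      by simp_all
  qed
  have "(\<lambda>n. l2norm lborel (\<lambda>x. T (real (Suc n)) f x - f x)) \<longlonglongrightarrow> 0"
  proof (rule l2norm_dominated_convergence[OF _ _ _ f])
    show "T (real (Suc n)) f \<in> borel_measurable lborel" for n using Tm[of "real (Suc n)"] by simp
    show "AE x in lborel. (\<lambda>n. T (real (Suc n)) f x) \<longlonglongrightarrow> f x"
      unfolding T_def by (intro AE_I2 clip_cutoff_tendsto)
    show "AE x in lborel. norm (T (real (Suc n)) f x) \<le> norm (f x)" for n
      by (intro AE_I2 Tle(1)) simp
  qed simp
  then have "\<forall>\<^sub>F n in sequentially. l2norm lborel (\<lambda>x. T (real (Suc n)) f x - f x) < e / 2"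
    using \<open>e > 0\<close> by (intro order_tendstoD) auto
  then obtain n where n: "l2norm lborel (\<lambda>x. T (real (Suc n)) f x - f x) < e / 2"
    by (auto simp: eventually_sequentially)
  define R where "R = real (Suc n)"
  have "R > 0" by (simp add: R_def)
  have "f \<in> borel_measurable lebesgue"
    by (intro measurable_completion) simp
  then have "f measurable_on UNIV"
    by (intro lebesgue_measurable_imp_measurable_on) auto
  then obtain N g where N: "negligible N" and g: "\<And>n. continuous_on UNIV (g n)"
    "\<And>x. x \<notin> N \<Longrightarrow> (\<lambda>n. g n x) \<longlonglongrightarrow> f x"
    unfolding measurable_on_def by auto
  have Tg: "cont_cs (T R (g m))" for m
    unfolding T_def[abs_def]
    by (intro cont_cs_scaleR(2) cutoff_cont_cs \<open>R > 0\<close> continuous_on_compose2[OF clip_continuous[OF \<open>R > 0\<close>] g(1)]) auto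
  have "N \<in> null_sets (completion lborel)" using N by (simp add: negligible_iff_null_sets)
  then have "AE x in completion lborel. x \<notin> N" by (rule AE_not_in)
  then have aeN: "AE x in lborel. x \<notin> N" by (simp add: AE_completion_iff)
  have "(\<lambda>m. l2norm lborel (\<lambda>x. T R (g m) x - T R f x)) \<longlonglongrightarrow> 0"
  proof (rule l2norm_dominated_convergence)
    show "sq_int lborel (\<lambda>x. R * cutoff R x)"
      by (intro sq_int_cmult cont_cs_sq_int_lborel cutoff_cont_cs \<open>R > 0\<close>)
    show "AE x in lborel. (\<lambda>m. T R (g m) x) \<longlonglongrightarrow> T R f x"
      using aeN
    proof eventually_elim
      case (elim x)
      have "continuous_on UNIV (clip R :: 'b \<Rightarrow> 'b)" by (rule clip_continuous[OF \<open>R > 0\<close>])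
      then have "isCont (clip R) (f x)" by (simp add: continuous_on_eq_continuous_at)
      from isCont_tendsto_compose[OF this g(2)[OF elim]] show ?case
        unfolding T_def by (intro tendsto_intros)
    qed
    show "AE x in lborel. norm (T R (g m) x) \<le> norm (R * cutoff R x)" for m
      using Tle(2)[OF \<open>R > 0\<close>] by simp
  qed (use Tm[OF \<open>R > 0\<close>] cont_cs_measurable[OF Tg] in auto)
  then have "\<forall>\<^sub>F m in sequentially. l2norm lborel (\<lambda>x. T R (g m) x - T R f x) < e / 2"
    using \<open>e > 0\<close> by (intro order_tendstoD) auto
  then obtain m where m: "l2norm lborel (\<lambda>x. T R (g m) x - T R f x) < e / 2"
    by (auto simp: eventually_sequentially)
  have sT: "sq_int lborel (T R f)"
    by (rule sq_int_bound[OF f]) (use Tm Tle \<open>R > 0\<close> in auto)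
  have "l2norm lborel (\<lambda>x. f x - T R (g m) x) \<le> l2norm lborel (\<lambda>x. f x - T R f x) + l2norm lborel (\<lambda>x. T R f x - T R (g m) x)"
    by (rule l2norm_triangle_diff[OF f sT cont_cs_sq_int_lborel[OF Tg]])
  also have "\<dots> < e"
    using n m l2norm_minus[of lborel f "T R f"] l2norm_minus[of lborel "T R f" "T R (g m)"]
    unfolding R_def[symmetric] by linarith
  finally show ?thesis using that[OF Tg] by blast
qed

lemma conv_diff:
  fixes f g :: "'a::euclidean_space \<Rightarrow> 'b::euclidean_space"
  assumes "e > 0" "sq_int lborel f" "sq_int lborel g"
  shows "conv (moll e) (\<lambda>x. f x - g x) x = conv (moll e) f x - conv (moll e) g x"
  using conv_integrable[OF test_functions_cont_cs[OF moll_test_UNIV[OF assms(1)]] assms(2), of x]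
    conv_integrable[OF test_functions_cont_cs[OF moll_test_UNIV[OF assms(1)]] assms(3), of x]
  by (simp add: conv_def scaleR_diff_right)

lemma conv_minus_eq:
  fixes f :: "'a::euclidean_space \<Rightarrow> 'b::euclidean_space"
  assumes e: "e > 0" and f: "sq_int lborel f"
  shows "norm (conv (moll e) f x - v) \<le> (LINT y|lborel. moll e (x - y) * norm (f y - v))"
    "integrable lborel (\<lambda>y. moll e (x - y) * norm (f y - v))"
proof -
  note i = conv_integrable[OF test_functions_cont_cs[OF moll_test_UNIV[OF e]] f]
  note j = moll_integral_shift[OF e, where 'a = 'a]
  have "conv (moll e) f x - v = (LINT y|lborel. moll e (x - y) *\<^sub>R f y) - (LINT y|lborel. moll e (x - y)) *\<^sub>R v"
    using j by (simp add: conv_def)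
  also have "\<dots> = (LINT y|lborel. moll e (x - y) *\<^sub>R f y) - (LINT y|lborel. moll e (x - y) *\<^sub>R v)"
    using j by simp
  also have "\<dots> = (LINT y|lborel. moll e (x - y) *\<^sub>R f y - moll e (x - y) *\<^sub>R v)"
    using i j by (intro Bochner_Integration.integral_diff[symmetric] integrable_scaleR_left)
  also have "\<dots> = (LINT y|lborel. moll e (x - y) *\<^sub>R (f y - v))"
    by (simp add: scaleR_diff_right)
  finally have eq: "conv (moll e) f x - v = (LINT y|lborel. moll e (x - y) *\<^sub>R (f y - v))" .
  have "norm (moll e (x - y) *\<^sub>R (f y - v)) = moll e (x - y) * norm (f y - v)" for y
    by (simp add: moll_nonneg[OF e])
  then have "(\<lambda>y. norm (moll e (x - y) *\<^sub>R (f y - v))) = (\<lambda>y. moll e (x - y) * norm (f y - v))"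
    by (rule ext)
  then show "norm (conv (moll e) f x - v) \<le> (LINT y|lborel. moll e (x - y) * norm (f y - v))"
    unfolding eq using integral_norm_bound[of lborel "\<lambda>y. moll e (x - y) *\<^sub>R (f y - v)"] by (simp only:)
  have "integrable lborel (\<lambda>y. norm (moll e (x - y) *\<^sub>R f y - moll e (x - y) *\<^sub>R v))"
    using i j by (intro integrable_norm Bochner_Integration.integrable_diff integrable_scaleR_left)
  moreover have "norm (moll e (x - y) *\<^sub>R f y - moll e (x - y) *\<^sub>R v) = moll e (x - y) * norm (f y - v)" for y
    using moll_nonneg[OF e, of "x - y"] by (simp flip: scaleR_diff_right)
  ultimately show "integrable lborel (\<lambda>y. moll e (x - y) * norm (f y - v))"
    by simp
qed

lemma conv_minus_le:
  fixes f :: "'a::euclidean_space \<Rightarrow> 'b::euclidean_space"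
  assumes e: "e > 0" and f: "sq_int lborel f"
    and d: "\<And>y. dist x y < e \<Longrightarrow> norm (f y - v) \<le> d"
  shows "norm (conv (moll e) f x - v) \<le> d"
proof -
  have "(LINT y|lborel. moll e (x - y) * norm (f y - v)) \<le> (LINT y|lborel. moll e (x - y) * d)"
  proof (rule integral_mono[OF conv_minus_eq(2)[OF e f]])
    show "integrable lborel (\<lambda>y. moll e (x - y) * d)"
      using moll_integral_shift(4)[OF e, of x] by simp
    show "moll e (x - y) * norm (f y - v) \<le> moll e (x - y) * d" for y
    proof (cases "dist x y < e")
      case True
      then show ?thesis by (intro mult_left_mono d moll_nonneg[OF e])
    next
      case False
      then show ?thesis using moll_eq_0[OF e, of "x - y"] by (simp add: dist_norm)
    qed
  qed
  also have "\<dots> = d" using moll_integral_shift(2)[OF e, of x] by simp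
  finally show ?thesis using conv_minus_eq(1)[OF e f, of x v] by simp
qed

lemma inverse_Suc_tendsto: "(\<lambda>n. inverse (real (Suc n))) \<longlonglongrightarrow> 0"
  by (rule LIMSEQ_inverse_real_of_nat)

lemma eventually_inverse_Suc_less: "d > 0 \<Longrightarrow> \<forall>\<^sub>F n in sequentially. inverse (real (Suc n)) < d"
  by (rule order_tendstoD(2)[OF inverse_Suc_tendsto])

lemma moll_tendsto_cont_cs:
  assumes g: "cont_cs (g :: 'a::euclidean_space \<Rightarrow> 'b::euclidean_space)"
  shows "(\<lambda>n. l2norm lborel (\<lambda>x. conv (moll (inverse (real (Suc n)))) g x - g x)) \<longlonglongrightarrow> 0"
proof -
  let ?e = "\<lambda>n. inverse (real (Suc n))"
  obtain K where K: "compact K" "\<And>x. x \<notin> K \<Longrightarrow> g x = 0" and c: "continuous_on UNIV g"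
    using g by (auto simp: cont_cs_def)
  obtain B where B: "B > 0" "\<And>x. norm (g x) \<le> B" by (rule cont_cs_bounded[OF g]) blast
  note gs = cont_cs_sq_int_lborel[OF g]
  have pos: "?e n > 0" "?e n \<le> 1" for n by (simp_all add: inverse_le_1_iff)
  define K' where "K' = {a + b | a b. a \<in> K \<and> b \<in> cball (0::'a) 1}"
  have "compact K'" unfolding K'_def by (intro compact_sums K compact_cball)
  show ?thesis
  proof (rule l2norm_dominated_convergence)
    show "conv (moll (?e n)) g \<in> borel_measurable lborel" for n
      using conv_measurable[OF test_functions_cont_cs[OF moll_test_UNIV[OF pos(1)]] gs] by simp
    show "g \<in> borel_measurable lborel" using cont_cs_measurable[OF g] by simp
    show "AE x in lborel. (\<lambda>n. conv (moll (?e n)) g x) \<longlonglongrightarrow> g x"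
    proof (intro AE_I2 tendstoI)
      fix x :: 'a and d :: real assume "d > 0"
      have "isCont g x" using c by (simp add: continuous_on_eq_continuous_at)
      then obtain s where s: "s > 0" "\<And>y. dist y x < s \<Longrightarrow> dist (g y) (g x) < d / 2"
        using \<open>d > 0\<close> unfolding continuous_at_eps_delta by (metis half_gt_zero)
      show "\<forall>\<^sub>F n in sequentially. dist (conv (moll (?e n)) g x) (g x) < d"
        using eventually_inverse_Suc_less[OF s(1)]
      proof eventually_elim
        case (elim n)
        have "norm (conv (moll (?e n)) g x - g x) \<le> d / 2"
        proof (rule conv_minus_le[OF pos(1) gs])
          fix y assume "dist x y < ?e n"
          then have "dist y x < s" using elim by (simp add: dist_commute)
          then show "norm (g y - g x) \<le> d / 2" using s(2)[of y] by (simp add: dist_norm)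
        qed
        then show ?case using \<open>d > 0\<close> by (simp add: dist_norm)
      qed
    qed
    have "integrable lborel (\<lambda>x. indicator K' x *\<^sub>R B\<^sup>2)"
      by (rule borel_integrable_compact[OF \<open>compact K'\<close>]) simp
    also have "(\<lambda>x. indicator K' x *\<^sub>R B\<^sup>2) = (\<lambda>x. (norm (indicator K' x * B))\<^sup>2)"
      by (rule ext) (simp add: indicator_def)
    finally have i: "integrable lborel (\<lambda>x. (norm (indicator K' x * B))\<^sup>2)" .
    have m: "(\<lambda>x. indicator K' x * B) \<in> borel_measurable lborel"
      using borel_compact[OF \<open>compact K'\<close>] by (intro borel_measurable_times borel_measurable_indicator) auto
    show "sq_int lborel (\<lambda>x. indicator K' x * B)"
      unfolding sq_int_def by (rule conjI[OF m i])
    show "AE x in lborel. norm (conv (moll (?e n)) g x) \<le> norm (indicator K' x * B)" for n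
    proof (rule AE_I2)
      fix x
      have "norm (conv (moll (?e n)) g x - 0) \<le> indicator K' x * B"
      proof (rule conv_minus_le[OF pos(1) gs])
        fix y assume y: "dist x y < ?e n"
        show "norm (g y - 0) \<le> indicator K' x * B"
        proof (cases "y \<in> K")
          case True
          have "x - y \<in> cball 0 1" using y pos(2)[of n] by (simp add: dist_norm norm_minus_commute)
          moreover have "x = y + (x - y)" by simp
          ultimately have "x \<in> K'" unfolding K'_def using True by blast
          then show ?thesis using B by simp
        qed (use K(2) B(1) in simp)
      qed
      then show "norm (conv (moll (?e n)) g x) \<le> norm (indicator K' x * B)" using B(1) by simp
    qed
  qed
qed

lemma moll_tendsto:
  assumes f: "sq_int lborel (f :: 'a::euclidean_space \<Rightarrow> 'b::euclidean_space)"
  shows "(\<lambda>n. l2norm lborel (\<lambda>x. conv (moll (inverse (real (Suc n)))) f x - f x)) \<longlonglongrightarrow> 0"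
proof (rule tendstoI)
  fix d :: real assume "d > 0"
  let ?e = "\<lambda>n. inverse (real (Suc n))"
  have pos: "?e n > 0" for n by simp
  obtain g where g: "cont_cs g" "l2norm lborel (\<lambda>x. f x - g x) < d / 3"
    by (rule cont_cs_dense[OF f, of "d / 3"]) (use \<open>d > 0\<close> in auto)
  note gs = cont_cs_sq_int_lborel[OF g(1)]
  have "\<forall>\<^sub>F n in sequentially. l2norm lborel (\<lambda>x. conv (moll (?e n)) g x - g x) < d / 3"
    using \<open>d > 0\<close> by (intro order_tendstoD[OF moll_tendsto_cont_cs[OF g(1)]]) auto
  then show "\<forall>\<^sub>F n in sequentially. dist (l2norm lborel (\<lambda>x. conv (moll (?e n)) f x - f x)) 0 < d"
  proof eventually_elim
    case (elim n)
    note cf = conv_l2[OF pos[of n] f] and cg = conv_l2[OF pos[of n] gs]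
      and cd = conv_l2[OF pos[of n] sq_int_diff[OF f gs]]
    have 1: "l2norm lborel (\<lambda>x. conv (moll (?e n)) f x - f x)
        \<le> l2norm lborel (\<lambda>x. conv (moll (?e n)) f x - conv (moll (?e n)) g x)
          + l2norm lborel (\<lambda>x. conv (moll (?e n)) g x - f x)"
      by (rule l2norm_triangle_diff[OF cf(1) cg(1) f])
    have 2: "l2norm lborel (\<lambda>x. conv (moll (?e n)) g x - f x)
        \<le> l2norm lborel (\<lambda>x. conv (moll (?e n)) g x - g x) + l2norm lborel (\<lambda>x. g x - f x)"
      by (rule l2norm_triangle_diff[OF cg(1) gs f])
    have 3: "l2norm lborel (\<lambda>x. conv (moll (?e n)) f x - conv (moll (?e n)) g x) \<le> l2norm lborel (\<lambda>x. f x - g x)"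
      using cd(2) unfolding conv_diff[OF pos[of n] f gs] .
    have "l2norm lborel (\<lambda>x. conv (moll (?e n)) f x - f x) < d"
      using 1 2 3 g(2) elim l2norm_minus[of lborel f g] by linarith
    then show ?case
      unfolding dist_real_def by (simp only: diff_zero abs_of_nonneg[OF l2norm_nonneg])
  qed
qed

subsection \<open>Weak gradients\<close>

lemma test_functions_sq_int:
  assumes "\<phi> \<in> test_functions \<Omega>" "open \<Omega>"
  shows "sq_int (lebesgue_on \<Omega>) \<phi>" "sq_int (lebesgue_on \<Omega>) (grad \<phi>)"
  by (intro cont_cs_sq_int assms test_functions_cont_cs[OF assms(1)] test_functions_grad_cont_cs[OF assms(1)])+

lemma test_functions_separate:
  fixes g :: "'a::euclidean_space \<Rightarrow> 'b::euclidean_space"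
  assumes \<Omega>: "open \<Omega>" and g: "sq_int (lebesgue_on \<Omega>) g"
    and 0: "\<And>\<phi>. \<phi> \<in> test_functions \<Omega> \<Longrightarrow> (LINT x|lebesgue_on \<Omega>. \<phi> x *\<^sub>R g x) = 0"
  shows "AE x in lebesgue_on \<Omega>. g x = 0"
proof -
  obtain g' where g': "sq_int lborel g'" "AE x in lebesgue_on \<Omega>. g x = g' x" "\<And>x. x \<notin> \<Omega> \<Longrightarrow> g' x = 0"
    by (rule ex_sq_int_lborel[OF g \<Omega>]) blast
  let ?e = "\<lambda>n. inverse (real (Suc n))"
  have pos: "?e n > 0" for n by simp
  have conv0: "conv (moll e) g' x = 0" if e: "e > 0" "cball x e \<subseteq> \<Omega>" for x e
  proof -
    have t: "(\<lambda>y. moll e (x - y)) \<in> test_functions \<Omega>" by (rule moll_test[OF e])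
    have m: "(\<lambda>y. moll e (x - y) *\<^sub>R g' y) \<in> borel_measurable borel"
      using cont_cs_measurable[OF test_functions_cont_cs[OF t]] sq_int_measurable[OF g'(1)]
      by (intro borel_measurable_scaleR) simp_all
    have "conv (moll e) g' x = (LINT y|lebesgue_on \<Omega>. moll e (x - y) *\<^sub>R g' y)"
      unfolding conv_def by (rule integral_lebesgue_on_eq_lborel[OF m \<Omega>, symmetric]) (simp add: g'(3))
    also have "\<dots> = (LINT y|lebesgue_on \<Omega>. moll e (x - y) *\<^sub>R g y)"
    proof (rule integral_cong_AE)
      show "(\<lambda>y. moll e (x - y) *\<^sub>R g' y) \<in> borel_measurable (lebesgue_on \<Omega>)"
        by (rule borel_measurable_lebesgue_on_borel[OF m])
      show "(\<lambda>y. moll e (x - y) *\<^sub>R g y) \<in> borel_measurable (lebesgue_on \<Omega>)"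
        by (intro borel_measurable_scaleR sq_int_measurable[OF g]
            borel_measurable_lebesgue_on_borel cont_cs_measurable[OF test_functions_cont_cs[OF t]])
      show "AE y in lebesgue_on \<Omega>. moll e (x - y) *\<^sub>R g' y = moll e (x - y) *\<^sub>R g y"
        using g'(2) by eventually_elim simp
    qed
    also have "\<dots> = 0" by (rule 0[OF t])
    finally show ?thesis .
  qed
  obtain r where r: "strict_mono r" "AE x in lborel. (\<lambda>n. conv (moll (?e (r n))) g' x) \<longlonglongrightarrow> g' x"
    using l2_tendsto_AE_subseq[OF g'(1) conv_l2(1)[OF pos g'(1)] moll_tendsto[OF g'(1)]] by blast
  have "AE x in lborel. x \<in> \<Omega> \<longrightarrow> g' x = 0"
    using r(2)
  proof eventually_elim
    case (elim x)
    show ?case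
    proof
      assume "x \<in> \<Omega>"
      then obtain d where d: "d > 0" "cball x d \<subseteq> \<Omega>" using \<Omega> open_contains_cball by blast
      have "\<forall>\<^sub>F n in sequentially. ?e (r n) < d"
        using eventually_inverse_Suc_less[OF d(1)] filterlim_subseq[OF r(1)] by (rule eventually_compose_filterlim)
      then have "\<forall>\<^sub>F n in sequentially. conv (moll (?e (r n))) g' x = 0"
      proof eventually_elim
        case (elim n)
        then have "cball x (?e (r n)) \<subseteq> \<Omega>" using d(2) by (meson less_imp_le subset_cball subset_trans)
        then show ?case by (rule conv0[OF pos])
      qed
      then have "(\<lambda>n. conv (moll (?e (r n))) g' x) \<longlonglongrightarrow> 0" by (rule tendsto_eventually)
      from LIMSEQ_unique[OF elim this] show "g' x = 0" .
    qed
  qed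
  then have "AE x in lebesgue_on \<Omega>. g' x = 0" by (simp add: AE_lebesgue_on_iff[OF \<Omega>])
  with g'(2) show ?thesis by eventually_elim simp
qed

definition has_wgrad :: "'a::euclidean_space set \<Rightarrow> ('a \<Rightarrow> real) \<Rightarrow> ('a \<Rightarrow> 'a) \<Rightarrow> bool" where
  "has_wgrad \<Omega> u g \<longleftrightarrow> sq_int (lebesgue_on \<Omega>) u \<and> sq_int (lebesgue_on \<Omega>) g \<and> is_weak_grad \<Omega> u g"

lemma has_wgradD:
  assumes "has_wgrad \<Omega> u g"
  shows "sq_int (lebesgue_on \<Omega>) u" "sq_int (lebesgue_on \<Omega>) g" "is_weak_grad \<Omega> u g"
  using assms by (auto simp: has_wgrad_def)

lemma has_wgrad_unique:
  assumes "open \<Omega>" "has_wgrad \<Omega> u g" "has_wgrad \<Omega> u h"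
  shows "AE x in lebesgue_on \<Omega>. g x = h x"
proof -
  have "AE x in lebesgue_on \<Omega>. g x - h x = 0"
  proof (rule test_functions_separate[OF assms(1)])
    show "sq_int (lebesgue_on \<Omega>) (\<lambda>x. g x - h x)"
      using assms by (intro sq_int_diff) (auto dest: has_wgradD)
    fix \<phi> assume \<phi>: "\<phi> \<in> test_functions \<Omega>"
    have "(LINT x|lebesgue_on \<Omega>. \<phi> x *\<^sub>R g x) = (LINT x|lebesgue_on \<Omega>. \<phi> x *\<^sub>R h x)"
      using has_wgradD(3)[OF assms(2)] has_wgradD(3)[OF assms(3)] \<phi> by (simp add: is_weak_grad_def)
    then show "(LINT x|lebesgue_on \<Omega>. \<phi> x *\<^sub>R (g x - h x)) = 0"
      using sq_int_scaleR[OF test_functions_sq_int(1)[OF \<phi> assms(1)] has_wgradD(2)[OF assms(2)]]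
        sq_int_scaleR[OF test_functions_sq_int(1)[OF \<phi> assms(1)] has_wgradD(2)[OF assms(3)]]
      by (simp add: scaleR_diff_right)
  qed
  then show ?thesis by eventually_elim simp
qed

lemma has_wgrad_add:
  assumes "open \<Omega>" "has_wgrad \<Omega> u g" "has_wgrad \<Omega> v h"
  shows "has_wgrad \<Omega> (\<lambda>x. u x + v x) (\<lambda>x. g x + h x)"
proof -
  note u = has_wgradD[OF assms(2)] and v = has_wgradD[OF assms(3)]
  have "is_weak_grad \<Omega> (\<lambda>x. u x + v x) (\<lambda>x. g x + h x)"
    unfolding is_weak_grad_def
  proof
    fix \<phi> assume \<phi>: "\<phi> \<in> test_functions \<Omega>"
    note t = test_functions_sq_int[OF \<phi> assms(1)]
    show "(LINT x|lebesgue_on \<Omega>. (u x + v x) *\<^sub>R grad \<phi> x) = - (LINT x|lebesgue_on \<Omega>. \<phi> x *\<^sub>R (g x + h x))"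
      using u(3) v(3) \<phi> sq_int_scaleR[OF u(1) t(2)] sq_int_scaleR[OF v(1) t(2)]
        sq_int_scaleR[OF t(1) u(2)] sq_int_scaleR[OF t(1) v(2)]
      by (simp add: is_weak_grad_def scaleR_add_left scaleR_add_right)
  qed
  then show ?thesis using u v by (simp add: has_wgrad_def sq_int_add)
qed

lemma has_wgrad_cmult:
  assumes "has_wgrad \<Omega> u g"
  shows "has_wgrad \<Omega> (\<lambda>x. c * u x) (\<lambda>x. c *\<^sub>R g x)"
proof -
  note u = has_wgradD[OF assms]
  have "is_weak_grad \<Omega> (\<lambda>x. c * u x) (\<lambda>x. c *\<^sub>R g x)"
    unfolding is_weak_grad_def
  proof
    fix \<phi> assume \<phi>: "\<phi> \<in> test_functions \<Omega>"
    have "(LINT x|lebesgue_on \<Omega>. (c * u x) *\<^sub>R grad \<phi> x) = c *\<^sub>R (LINT x|lebesgue_on \<Omega>. u x *\<^sub>R grad \<phi> x)"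
      by (simp flip: scaleR_scaleR)
    also have "\<dots> = - (c *\<^sub>R (LINT x|lebesgue_on \<Omega>. \<phi> x *\<^sub>R g x))"
      using u(3) \<phi> by (simp add: is_weak_grad_def)
    also have "c *\<^sub>R (LINT x|lebesgue_on \<Omega>. \<phi> x *\<^sub>R g x) = (LINT x|lebesgue_on \<Omega>. \<phi> x *\<^sub>R c *\<^sub>R g x)"
      by (simp flip: integral_scaleR_right add: mult.commute)
    finally show "(LINT x|lebesgue_on \<Omega>. (c * u x) *\<^sub>R grad \<phi> x) = - (LINT x|lebesgue_on \<Omega>. \<phi> x *\<^sub>R c *\<^sub>R g x)" .
  qed
  then show ?thesis using u by (simp add: has_wgrad_def sq_int_scale sq_int_cmult)
qed

lemma has_wgrad_diff:
  assumes "open \<Omega>" "has_wgrad \<Omega> u g" "has_wgrad \<Omega> v h"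
  shows "has_wgrad \<Omega> (\<lambda>x. u x - v x) (\<lambda>x. g x - h x)"
  using has_wgrad_add[OF assms(1,2) has_wgrad_cmult[OF assms(3), of "-1"]] by simp

lemma has_wgrad_test:
  assumes "open \<Omega>" "\<phi> \<in> test_functions \<Omega>"
  shows "has_wgrad \<Omega> \<phi> (grad \<phi>)"
  using assms by (simp add: has_wgrad_def test_functions_sq_int test_functions_is_weak_grad)

lemma l2_scaleR_tendsto:
  assumes "sq_int M f" "\<And>n. sq_int M (fs n)" "sq_int M g"
    and "(\<lambda>n. l2norm M (\<lambda>x. fs n x - f x)) \<longlonglongrightarrow> 0"
  shows "(\<lambda>n. LINT x|M. fs n x *\<^sub>R g x) \<longlonglongrightarrow> (LINT x|M. f x *\<^sub>R g x)"
proof (rule LIM_zero_cancel, rule Lim_null_comparison)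
  have "norm ((LINT x|M. fs n x *\<^sub>R g x) - (LINT x|M. f x *\<^sub>R g x)) \<le> l2norm M (\<lambda>x. fs n x - f x) * l2norm M g" for n
    using l2_Cauchy_Schwarz_scaleR[OF sq_int_diff[OF assms(2)[of n] assms(1)] assms(3)] assms
    by (simp add: scaleR_diff_left sq_int_scaleR)
  then show "\<forall>\<^sub>F n in sequentially. norm ((LINT x|M. fs n x *\<^sub>R g x) - (LINT x|M. f x *\<^sub>R g x))
      \<le> l2norm M (\<lambda>x. fs n x - f x) * l2norm M g" by simp
  show "(\<lambda>n. l2norm M (\<lambda>x. fs n x - f x) * l2norm M g) \<longlonglongrightarrow> 0"
    using tendsto_mult_right[OF assms(4), of "l2norm M g"] by simp
qed

lemma l2_scaleR_tendsto':
  assumes "sq_int M f" "\<And>n. sq_int M (fs n)" "sq_int M g"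
    and "(\<lambda>n. l2norm M (\<lambda>x. fs n x - f x)) \<longlonglongrightarrow> 0"
  shows "(\<lambda>n. LINT x|M. g x *\<^sub>R fs n x) \<longlonglongrightarrow> (LINT x|M. g x *\<^sub>R f x)"
proof (rule LIM_zero_cancel, rule Lim_null_comparison)
  have "norm ((LINT x|M. g x *\<^sub>R fs n x) - (LINT x|M. g x *\<^sub>R f x)) \<le> l2norm M g * l2norm M (\<lambda>x. fs n x - f x)" for n
    using l2_Cauchy_Schwarz_scaleR[OF assms(3) sq_int_diff[OF assms(2)[of n] assms(1)]] assms
    by (simp add: scaleR_diff_right sq_int_scaleR)
  then show "\<forall>\<^sub>F n in sequentially. norm ((LINT x|M. g x *\<^sub>R fs n x) - (LINT x|M. g x *\<^sub>R f x))
      \<le> l2norm M g * l2norm M (\<lambda>x. fs n x - f x)" by simp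
  show "(\<lambda>n. l2norm M g * l2norm M (\<lambda>x. fs n x - f x)) \<longlonglongrightarrow> 0"
    using tendsto_mult_left[OF assms(4), of "l2norm M g"] by simp
qed

lemma has_wgrad_limit:
  assumes "open \<Omega>" "\<And>n. has_wgrad \<Omega> (us n) (gs n)"
    and "sq_int (lebesgue_on \<Omega>) u" "sq_int (lebesgue_on \<Omega>) g"
    and "(\<lambda>n. l2norm (lebesgue_on \<Omega>) (\<lambda>x. us n x - u x)) \<longlonglongrightarrow> 0"
    and "(\<lambda>n. l2norm (lebesgue_on \<Omega>) (\<lambda>x. gs n x - g x)) \<longlonglongrightarrow> 0"
  shows "has_wgrad \<Omega> u g"
  unfolding has_wgrad_def is_weak_grad_def
proof (intro conjI ballI assms(3,4))
  fix \<phi> assume \<phi>: "\<phi> \<in> test_functions \<Omega>"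
  note t = test_functions_sq_int[OF \<phi> assms(1)] and w = has_wgradD[OF assms(2)]
  have "(LINT x|lebesgue_on \<Omega>. us n x *\<^sub>R grad \<phi> x) = - (LINT x|lebesgue_on \<Omega>. \<phi> x *\<^sub>R gs n x)" for n
    using w(3)[of n] \<phi> by (simp add: is_weak_grad_def)
  then have "(\<lambda>n. - (LINT x|lebesgue_on \<Omega>. \<phi> x *\<^sub>R gs n x)) \<longlonglongrightarrow> (LINT x|lebesgue_on \<Omega>. u x *\<^sub>R grad \<phi> x)"
    using l2_scaleR_tendsto[OF assms(3) w(1) t(2) assms(5)] by simp
  then show "(LINT x|lebesgue_on \<Omega>. u x *\<^sub>R grad \<phi> x) = - (LINT x|lebesgue_on \<Omega>. \<phi> x *\<^sub>R g x)"
    using tendsto_minus[OF l2_scaleR_tendsto'[OF assms(4) w(2) t(1) assms(6)]] by (rule LIMSEQ_unique)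
qed

lemma has_wgrad_wgrad:
  assumes "u \<in> H1 \<Omega>"
  shows "has_wgrad \<Omega> u (wgrad \<Omega> u)"
proof -
  obtain g where g: "g \<in> L2 \<Omega>" "is_weak_grad \<Omega> u g" and u: "u \<in> L2 \<Omega>"
    using assms by (auto simp: H1_def)
  from g have "wgrad \<Omega> u \<in> L2 \<Omega> \<and> is_weak_grad \<Omega> u (wgrad \<Omega> u)"
    unfolding wgrad_def by (intro someI[of "\<lambda>g. g \<in> L2 \<Omega> \<and> is_weak_grad \<Omega> u g" g]) simp
  with u show ?thesis by (simp add: has_wgrad_def L2_eq_sq_int)
qed

lemma has_wgrad_imp_H1: "has_wgrad \<Omega> u g \<Longrightarrow> u \<in> H1 \<Omega>"
  by (auto simp: H1_def has_wgrad_def L2_eq_sq_int)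

lemma H1_norm_nonneg: "H1_norm \<Omega> u \<ge> 0"
  by (simp add: H1_norm_def)

lemma H1_norm_eq:
  assumes "open \<Omega>" "has_wgrad \<Omega> u g"
  shows "H1_norm \<Omega> u = l2norm (lebesgue_on \<Omega>) (\<lambda>x. (u x, g x))"
proof -
  note w = has_wgrad_wgrad[OF has_wgrad_imp_H1[OF assms(2)]]
  have ae: "AE x in lebesgue_on \<Omega>. wgrad \<Omega> u x = g x"
    by (rule has_wgrad_unique[OF assms(1) w assms(2)])
  have m: "wgrad \<Omega> u \<in> borel_measurable (lebesgue_on \<Omega>)" "g \<in> borel_measurable (lebesgue_on \<Omega>)"
    "u \<in> borel_measurable (lebesgue_on \<Omega>)"
    by (rule sq_int_measurable[OF has_wgradD(2)[OF w]], rule sq_int_measurable[OF has_wgradD(2)[OF assms(2)]],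
        rule sq_int_measurable[OF has_wgradD(1)[OF w]])
  have "(LINT x|lebesgue_on \<Omega>. (norm (wgrad \<Omega> u x))\<^sup>2 + (u x)\<^sup>2) = (LINT x|lebesgue_on \<Omega>. (norm (u x, g x))\<^sup>2)"
  proof (rule integral_cong_AE)
    show "AE x in lebesgue_on \<Omega>. (norm (wgrad \<Omega> u x))\<^sup>2 + (u x)\<^sup>2 = (norm (u x, g x))\<^sup>2"
      using ae by eventually_elim (simp add: norm_Pair)
  qed (use m in measurable)
  then show ?thesis by (simp add: H1_norm_def l2norm_def)
qed

subsection \<open>Density of the test functions\<close>

lemma l2norm_Pair_le:
  assumes "sq_int M f" "sq_int M g"
  shows "l2norm M (\<lambda>x. (f x, g x)) \<le> l2norm M f + l2norm M g"
proof (rule power2_le_imp_le)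
  show "(l2norm M (\<lambda>x. (f x, g x)))\<^sup>2 \<le> (l2norm M f + l2norm M g)\<^sup>2"
    using l2norm_nonneg[of M f] l2norm_nonneg[of M g]
    by (simp add: l2norm_Pair_sq[OF assms] power2_sum)
qed (simp add: l2norm_nonneg)

lemma l2norm_le_Pair:
  assumes "sq_int M f" "sq_int M g"
  shows "l2norm M f \<le> l2norm M (\<lambda>x. (f x, g x))" "l2norm M g \<le> l2norm M (\<lambda>x. (f x, g x))"
  by (rule power2_le_imp_le; simp add: l2norm_Pair_sq[OF assms] l2norm_nonneg)+

lemma grad_conv:
  assumes e: "e > 0" and u: "sq_int lborel u" and g: "sq_int lborel g" and w: "is_weak_grad UNIV u g"
  shows "grad (conv (moll e) u) x = conv (moll e) g x"
proof -
  note k = moll_test_UNIV[OF e, where 'a = 'a]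
  note km = cont_cs_measurable[OF test_functions_cont_cs[OF k]] cont_cs_measurable[OF test_functions_grad_cont_cs[OF k]]
  have um: "u \<in> borel_measurable borel" "g \<in> borel_measurable borel"
    using sq_int_measurable[OF u] sq_int_measurable[OF g] by simp_all
  note [measurable] = km um
  have t: "(\<lambda>y. moll e (x - y)) \<in> test_functions UNIV" by (rule moll_test[OF e]) simp
  have gt: "grad (\<lambda>y. moll e (x - y)) y = - grad (moll e) (x - y)" for y
  proof (rule grad_eqI)
    have 1: "((\<lambda>y. x - y) has_derivative (\<lambda>h. - h)) (at y)"
      by (auto intro!: derivative_eq_intros)
    show "((\<lambda>y. moll e (x - y)) has_derivative (\<lambda>h. - grad (moll e) (x - y) \<bullet> h)) (at y)"
      using has_derivative_compose[OF 1 test_functions_derivative[OF k]] by simp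
  qed
  have "(LINT y|lborel. u y *\<^sub>R grad (moll e) (x - y)) = - (LINT y|lborel. u y *\<^sub>R grad (\<lambda>y. moll e (x - y)) y)"
    by (simp add: gt)
  also have "(LINT y|lborel. u y *\<^sub>R grad (\<lambda>y. moll e (x - y)) y)
      = (LINT y|lebesgue_on UNIV. u y *\<^sub>R grad (\<lambda>y. moll e (x - y)) y)"
    by (rule integral_lebesgue_on_eq_lborel[symmetric]) (simp_all add: gt)
  also have "\<dots> = - (LINT y|lebesgue_on UNIV. moll e (x - y) *\<^sub>R g y)"
    using w t by (simp only: is_weak_grad_def)
  also have "(LINT y|lebesgue_on UNIV. moll e (x - y) *\<^sub>R g y) = conv (moll e) g x"
    unfolding conv_def by (rule integral_lebesgue_on_eq_lborel) simp_all
  finally show ?thesis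
    using conv_has_derivative[OF k u, of x] by (intro grad_eqI) simp
qed

definition plateau :: "real \<Rightarrow> 'a::euclidean_space \<Rightarrow> real" where
  "plateau R x = exp 1 * bump R x"

lemma plateau_test: "R > 0 \<Longrightarrow> plateau R \<in> test_functions UNIV"
  unfolding plateau_def[abs_def] by (intro test_functions_cmult bump_test_UNIV)

lemma plateau_bounds: "0 \<le> plateau R x" "plateau R x \<le> 1"
proof -
  show "0 \<le> plateau R x" by (simp add: plateau_def bump_nonneg)
  have "bump R x \<le> exp (- 1)" unfolding bump_def by (rule flat_0_le) simp
  then have "exp 1 * bump R x \<le> exp 1 * exp (- 1)" by (intro mult_left_mono) auto
  also have "\<dots> = 1" by (simp flip: exp_add)
  finally show "plateau R x \<le> 1" by (simp add: plateau_def)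
qed

lemma plateau_tendsto: "(\<lambda>n. plateau (real (Suc n)) x) \<longlonglongrightarrow> 1"
proof -
  have "(\<lambda>n. 1 - (x \<bullet> x) * (inverse (real (Suc n)))\<^sup>2) \<longlonglongrightarrow> 1 - (x \<bullet> x) * 0\<^sup>2"
    by (intro tendsto_intros inverse_Suc_tendsto)
  moreover have "isCont (flat 0) 1" by (rule DERIV_isCont[OF flat_has_derivative])
  ultimately have "(\<lambda>n. flat 0 (1 - (x \<bullet> x) * (inverse (real (Suc n)))\<^sup>2)) \<longlonglongrightarrow> flat 0 1"
    by (intro isCont_tendsto_compose[where g = "flat 0"]) simp_all
  then have "(\<lambda>n. exp 1 * flat 0 (1 - (x \<bullet> x) * (inverse (real (Suc n)))\<^sup>2)) \<longlonglongrightarrow> exp 1 * flat 0 1"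
    by (rule tendsto_mult_left)
  moreover have "exp 1 * flat 0 1 = 1" by (simp add: flat_def flip: exp_add)
  ultimately show ?thesis
    by (simp add: plateau_def bump_def divide_inverse power_inverse del: of_nat_Suc)
qed

lemma grad_plateau:
  assumes "R > 0"
  shows "grad (plateau R) x = (1 / R) *\<^sub>R grad (plateau 1) ((1 / R) *\<^sub>R x)"
proof (rule grad_eqI)
  have eq: "plateau R = (\<lambda>x. plateau 1 ((1 / R) *\<^sub>R x))"
    by (simp add: fun_eq_iff plateau_def bump_def power2_eq_square)
  have 1: "((\<lambda>x. (1 / R) *\<^sub>R x) has_derivative (\<lambda>h. (1 / R) *\<^sub>R h)) (at x)"
    by (auto intro!: derivative_eq_intros)
  show "(plateau R has_derivative (\<lambda>h. (1 / R) *\<^sub>R grad (plateau 1) ((1 / R) *\<^sub>R x) \<bullet> h)) (at x)"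
    unfolding eq
    using has_derivative_compose[OF 1 test_functions_derivative[OF plateau_test[of 1]]] by simp
qed

lemma test_functions_dense_UNIV:
  fixes u :: "'a::euclidean_space \<Rightarrow> real"
  assumes "has_wgrad UNIV u g" "d > 0"
  shows "\<exists>\<phi>\<in>test_functions UNIV. l2norm (lebesgue_on UNIV) (\<lambda>x. (u x - \<phi> x, g x - grad \<phi> x)) < d"
proof -
  let ?M = "lebesgue_on UNIV :: 'a measure"
  note w = has_wgradD[OF assms(1)]
  obtain u' where u': "sq_int lborel u'" "AE x in ?M. u x = u' x"
    by (rule ex_sq_int_lborel[OF w(1)]) auto
  obtain g' where g': "sq_int lborel g'" "AE x in ?M. g x = g' x"
    by (rule ex_sq_int_lborel[OF w(2)]) auto
  note u'M = sq_int_lborel_imp_lebesgue_on[OF u'(1) open_UNIV] and g'M = sq_int_lborel_imp_lebesgue_on[OF g'(1) open_UNIV]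
  have "is_weak_grad UNIV u' g'"
    unfolding is_weak_grad_def
  proof
    fix \<phi> :: "'a \<Rightarrow> real" assume \<phi>: "\<phi> \<in> test_functions UNIV"
    note t = test_functions_sq_int[OF \<phi> open_UNIV]
    have "(LINT x|?M. u' x *\<^sub>R grad \<phi> x) = (LINT x|?M. u x *\<^sub>R grad \<phi> x)"
    proof (rule integral_cong_AE)
      show "AE x in ?M. u' x *\<^sub>R grad \<phi> x = u x *\<^sub>R grad \<phi> x" using u'(2) by eventually_elim simp
    qed (intro borel_measurable_scaleR sq_int_measurable[OF u'M] sq_int_measurable[OF w(1)] sq_int_measurable[OF t(2)])+
    moreover have "(LINT x|?M. \<phi> x *\<^sub>R g' x) = (LINT x|?M. \<phi> x *\<^sub>R g x)"
    proof (rule integral_cong_AE)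
      show "AE x in ?M. \<phi> x *\<^sub>R g' x = \<phi> x *\<^sub>R g x" using g'(2) by eventually_elim simp
    qed (intro borel_measurable_scaleR sq_int_measurable[OF g'M] sq_int_measurable[OF w(2)] sq_int_measurable[OF t(1)])+
    ultimately show "(LINT x|?M. u' x *\<^sub>R grad \<phi> x) = - (LINT x|?M. \<phi> x *\<^sub>R g' x)"
      using w(3) \<phi> by (simp add: is_weak_grad_def)
  qed
  note gc = grad_conv[OF _ u'(1) g'(1) this]
  let ?e = "\<lambda>n. inverse (real (Suc n))"
  have pos: "?e n > 0" for n by simp
  have "(\<lambda>n. l2norm lborel (\<lambda>x. conv (moll (?e n)) u' x - u' x) + l2norm lborel (\<lambda>x. conv (moll (?e n)) g' x - g' x)) \<longlonglongrightarrow> 0 + 0"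
    by (intro tendsto_add moll_tendsto u' g')
  then have "\<forall>\<^sub>F n in sequentially. l2norm lborel (\<lambda>x. conv (moll (?e n)) u' x - u' x)
      + l2norm lborel (\<lambda>x. conv (moll (?e n)) g' x - g' x) < d / 2"
    using assms(2) by (intro order_tendstoD(2)) auto
  then obtain n where n: "l2norm lborel (\<lambda>x. conv (moll (?e n)) u' x - u' x)
      + l2norm lborel (\<lambda>x. conv (moll (?e n)) g' x - g' x) < d / 2"
    by (auto simp: eventually_sequentially)
  define v h where "v = conv (moll (?e n)) u'" and "h = conv (moll (?e n)) g'"
  have v: "sq_int lborel v" "smooth_map_on UNIV v" and h: "sq_int lborel h" and gv: "grad v = h"
    unfolding v_def h_def
    using conv_l2(1)[OF pos u'(1)] conv_l2(1)[OF pos g'(1)] smooth_map_on_conv[OF moll_test_UNIV[OF pos] u'(1)] gc[OF pos]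
    by auto
  obtain B where B: "B > 0" "\<And>x::'a. norm (grad (plateau 1) x) \<le> B"
    by (rule cont_cs_bounded[OF test_functions_grad_cont_cs[OF plateau_test[of 1]]]) auto
  define \<phi> where "\<phi> m x = plateau (real (Suc m)) x * v x" for m x
  have \<phi>: "\<phi> m \<in> test_functions UNIV" for m
    unfolding \<phi>_def by (intro test_functions_mult plateau_test v) simp
  have gp: "grad (\<phi> m) x = plateau (real (Suc m)) x *\<^sub>R h x + v x *\<^sub>R grad (plateau (real (Suc m))) x" for m x
    unfolding \<phi>_def using grad_mult[OF test_functions_smooth[OF plateau_test] v(2)] by (simp add: gv)
  have pm1: "(plateau (real (Suc m)) :: 'a \<Rightarrow> real) \<in> borel_measurable lborel" for m
    using cont_cs_measurable[OF test_functions_cont_cs[OF plateau_test[of "real (Suc m)"]]]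
    by (simp del: of_nat_Suc)
  have pm2: "(grad (plateau (real (Suc m))) :: 'a \<Rightarrow> 'a) \<in> borel_measurable lborel" for m
    using cont_cs_measurable[OF test_functions_grad_cont_cs[OF plateau_test[of "real (Suc m)"]]]
    by (simp del: of_nat_Suc)
  note pm = pm1 pm2
  have lim: "(\<lambda>m. l2norm lborel (\<lambda>x. plateau (real (Suc m)) x *\<^sub>R F x - F x)) \<longlonglongrightarrow> 0"
    if F: "sq_int lborel F" for F :: "'a \<Rightarrow> 'c::euclidean_space"
  proof (rule l2norm_dominated_convergence[OF _ _ _ F])
    show "(\<lambda>x. plateau (real (Suc m)) x *\<^sub>R F x) \<in> borel_measurable lborel" for m
      by (intro borel_measurable_scaleR pm sq_int_measurable F)
    show "AE x in lborel. (\<lambda>m. plateau (real (Suc m)) x *\<^sub>R F x) \<longlonglongrightarrow> F x"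
    proof (rule AE_I2)
      fix x show "(\<lambda>m. plateau (real (Suc m)) x *\<^sub>R F x) \<longlonglongrightarrow> F x"
        using tendsto_scaleR[OF plateau_tendsto[of x] tendsto_const[of "F x"]] by (simp del: of_nat_Suc)
    qed
    show "AE x in lborel. norm (plateau (real (Suc m)) x *\<^sub>R F x) \<le> norm (F x)" for m
      by (intro AE_I2) (simp add: plateau_bounds mult_left_le_one_le)
  qed (rule sq_int_measurable[OF F])
  have gs: "sq_int lborel (grad (\<phi> m))" for m
    by (intro cont_cs_sq_int_lborel test_functions_grad_cont_cs[OF \<phi>])
  have ps: "sq_int lborel (\<phi> m)" for m
    by (intro cont_cs_sq_int_lborel test_functions_cont_cs[OF \<phi>])
  have phs: "sq_int lborel (\<lambda>x. plateau (real (Suc m)) x *\<^sub>R h x)" for m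
  proof (rule sq_int_bound[OF h])
    show "(\<lambda>x. plateau (real (Suc m)) x *\<^sub>R h x) \<in> borel_measurable lborel"
      by (intro borel_measurable_scaleR pm sq_int_measurable[OF h])
    show "AE x in lborel. norm (plateau (real (Suc m)) x *\<^sub>R h x) \<le> norm (h x)"
      by (intro AE_I2) (simp add: plateau_bounds mult_left_le_one_le)
  qed
  have pgle: "norm (v x *\<^sub>R grad (plateau (real (Suc m))) x) \<le> norm ((B * ?e m) * v x)" for m x
  proof -
    have "norm (v x *\<^sub>R grad (plateau (real (Suc m))) x) = \<bar>v x\<bar> * (?e m * norm (grad (plateau 1) ((1 / real (Suc m)) *\<^sub>R x)))"
      by (subst grad_plateau) (simp_all add: divide_inverse abs_mult del: of_nat_Suc)
    also have "\<dots> \<le> \<bar>v x\<bar> * (?e m * B)"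
      using B by (intro mult_left_mono) auto
    also have "\<dots> = norm ((B * ?e m) * v x)"
      using B(1) by (simp add: abs_mult mult.commute mult.left_commute del: of_nat_Suc)
    finally show ?thesis .
  qed
  have pgm: "(\<lambda>x. v x *\<^sub>R grad (plateau (real (Suc m))) x) \<in> borel_measurable lborel" for m
    by (intro borel_measurable_scaleR pm sq_int_measurable v)
  have pgs: "sq_int lborel (\<lambda>x. v x *\<^sub>R grad (plateau (real (Suc m))) x)"
    and pgn: "l2norm lborel (\<lambda>x. v x *\<^sub>R grad (plateau (real (Suc m))) x) \<le> B * ?e m * l2norm lborel v" for m
  proof -
    have s: "sq_int lborel (\<lambda>x. (B * ?e m) * v x)" by (intro sq_int_cmult v)
    show "sq_int lborel (\<lambda>x. v x *\<^sub>R grad (plateau (real (Suc m))) x)"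
      by (rule sq_int_bound[OF s pgm]) (simp only: pgle AE_I2)
    have "l2norm lborel (\<lambda>x. v x *\<^sub>R grad (plateau (real (Suc m))) x) \<le> l2norm lborel (\<lambda>x. (B * ?e m) * v x)"
      by (rule l2norm_mono[OF s pgm]) (simp only: pgle AE_I2)
    also have "\<dots> = B * ?e m * l2norm lborel v"
      using l2norm_scale[of lborel "B * ?e m" v] B(1) by simp
    finally show "l2norm lborel (\<lambda>x. v x *\<^sub>R grad (plateau (real (Suc m))) x) \<le> B * ?e m * l2norm lborel v" .
  qed
  have "(\<lambda>m. l2norm lborel (\<lambda>x. plateau (real (Suc m)) x *\<^sub>R v x - v x) + (l2norm lborel (\<lambda>x. plateau (real (Suc m)) x *\<^sub>R h x - h x)
      + B * ?e m * l2norm lborel v)) \<longlonglongrightarrow> 0 + (0 + B * 0 * l2norm lborel v)"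
    by (intro tendsto_intros lim v h inverse_Suc_tendsto)
  then have "\<forall>\<^sub>F m in sequentially. l2norm lborel (\<lambda>x. plateau (real (Suc m)) x *\<^sub>R v x - v x)
      + (l2norm lborel (\<lambda>x. plateau (real (Suc m)) x *\<^sub>R h x - h x) + B * ?e m * l2norm lborel v) < d / 2"
    using assms(2) by (intro order_tendstoD(2)) auto
  then obtain m where m: "l2norm lborel (\<lambda>x. plateau (real (Suc m)) x *\<^sub>R v x - v x)
      + (l2norm lborel (\<lambda>x. plateau (real (Suc m)) x *\<^sub>R h x - h x) + B * ?e m * l2norm lborel v) < d / 2"
    by (auto simp: eventually_sequentially)
  have "l2norm lborel (\<lambda>x. grad (\<phi> m) x - h x)
      \<le> l2norm lborel (\<lambda>x. plateau (real (Suc m)) x *\<^sub>R h x - h x) + B * ?e m * l2norm lborel v"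
    using l2norm_triangle[OF sq_int_diff[OF phs h] pgs, of m m] pgn[of m]
    by (simp add: gp algebra_simps del: of_nat_Suc)
  moreover have "l2norm lborel (\<lambda>x. \<phi> m x - v x) = l2norm lborel (\<lambda>x. plateau (real (Suc m)) x *\<^sub>R v x - v x)"
    by (simp add: \<phi>_def)
  ultimately have est1: "l2norm lborel (\<lambda>x. v x - \<phi> m x) + l2norm lborel (\<lambda>x. h x - grad (\<phi> m) x) < d / 2"
    using m l2norm_minus[of lborel "\<phi> m" v] l2norm_minus[of lborel "grad (\<phi> m)" h] by linarith
  have est2: "l2norm lborel (\<lambda>x. u' x - v x) + l2norm lborel (\<lambda>x. g' x - h x) < d / 2"
    using n l2norm_minus[of lborel u' v] l2norm_minus[of lborel g' h] by (simp only: v_def h_def)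
  have "l2norm lborel (\<lambda>x. u' x - \<phi> m x) + l2norm lborel (\<lambda>x. g' x - grad (\<phi> m) x) < d"
    using est1 est2 l2norm_triangle_diff[OF u'(1) v(1) ps, of m] l2norm_triangle_diff[OF g'(1) h gs, of m] by linarith
  moreover have "l2norm lborel (\<lambda>x. (u' x - \<phi> m x, g' x - grad (\<phi> m) x))
      \<le> l2norm lborel (\<lambda>x. u' x - \<phi> m x) + l2norm lborel (\<lambda>x. g' x - grad (\<phi> m) x)"
    by (intro l2norm_Pair_le sq_int_diff u' g' ps gs)
  ultimately have lt: "l2norm lborel (\<lambda>x. (u' x - \<phi> m x, g' x - grad (\<phi> m) x)) < d" by linarith
  note sp = sq_int_Pair[OF sq_int_diff[OF u'(1) ps] sq_int_diff[OF g'(1) gs], of m m]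
  have "l2norm ?M (\<lambda>x. (u x - \<phi> m x, g x - grad (\<phi> m) x)) = l2norm ?M (\<lambda>x. (u' x - \<phi> m x, g' x - grad (\<phi> m) x))"
  proof (rule l2norm_cong_AE)
    show "(\<lambda>x. (u' x - \<phi> m x, g' x - grad (\<phi> m) x)) \<in> borel_measurable ?M"
      using sq_int_measurable[OF sp] by (intro borel_measurable_lebesgue_on_borel) simp
    show "(\<lambda>x. (u x - \<phi> m x, g x - grad (\<phi> m) x)) \<in> borel_measurable ?M"
      by (intro sq_int_measurable[OF sq_int_Pair] sq_int_diff w test_functions_sq_int[OF \<phi>]) auto
    show "AE x in ?M. (u x - \<phi> m x, g x - grad (\<phi> m) x) = (u' x - \<phi> m x, g' x - grad (\<phi> m) x)"
      using u'(2) g'(2) by eventually_elim simp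
  qed
  also have "\<dots> = l2norm lborel (\<lambda>x. (u' x - \<phi> m x, g' x - grad (\<phi> m) x))"
    using sq_int_measurable[OF sp] by (intro l2norm_lebesgue_on_UNIV) simp
  finally have "l2norm ?M (\<lambda>x. (u x - \<phi> m x, g x - grad (\<phi> m) x)) < d" using lt by simp
  with \<phi>[of m] show ?thesis by (intro bexI[of _ "\<phi> m"])
qed

subsection \<open>The Ladyzhenskaya inequality\<close>

lemma square_le_line_integral:
  fixes b v :: "'a::euclidean_space"
  assumes \<phi>: "\<phi> \<in> test_functions UNIV" and b: "b \<in> Basis"
  shows "ennreal ((\<phi> (v + s *\<^sub>R b))\<^sup>2)
    \<le> (\<integral>\<^sup>+t. ennreal (2 * \<bar>\<phi> (v + t *\<^sub>R b)\<bar> * norm (grad \<phi> (v + t *\<^sub>R b))) \<partial>lborel)"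
proof -
  obtain K where K: "compact K" "\<And>x. x \<notin> K \<Longrightarrow> \<phi> x = 0"
    by (rule test_functionsE[OF \<phi>]) blast
  obtain R where R: "\<And>x. x \<in> K \<Longrightarrow> norm x \<le> R"
    using compact_imp_bounded[OF K(1)] by (auto simp: bounded_iff)
  define a where "a = min s (- (\<bar>R\<bar> + norm v + 1))"
  have "norm (v + a *\<^sub>R b) \<ge> \<bar>a\<bar> - norm v"
    using norm_triangle_ineq4[of "v + a *\<^sub>R b" v] b by simp
  moreover have "\<bar>a\<bar> \<ge> \<bar>R\<bar> + norm v + 1" using norm_ge_zero[of v] unfolding a_def by linarith
  ultimately have "norm (v + a *\<^sub>R b) > R" by linarith
  then have 0: "\<phi> (v + a *\<^sub>R b) = 0" using R K(2) by (meson not_le)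
  let ?F = "\<lambda>t. (\<phi> (v + t *\<^sub>R b))\<^sup>2"
    and ?f = "\<lambda>t. 2 * \<phi> (v + t *\<^sub>R b) * (grad \<phi> (v + t *\<^sub>R b) \<bullet> b)"
  have cl: "continuous_on UNIV (\<lambda>t. v + t *\<^sub>R b)" by (intro continuous_intros)
  have c1: "continuous_on UNIV (\<lambda>t. \<phi> (v + t *\<^sub>R b))"
    by (rule continuous_on_compose2[OF cont_cs_continuous[OF test_functions_cont_cs[OF \<phi>]] cl]) auto
  have c2: "continuous_on UNIV (\<lambda>t. grad \<phi> (v + t *\<^sub>R b))"
    by (rule continuous_on_compose2[OF cont_cs_continuous[OF test_functions_grad_cont_cs[OF \<phi>]] cl]) auto
  have cf: "continuous_on UNIV ?f" by (intro continuous_intros c1 c2)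
  have d: "(?F has_real_derivative ?f t) (at t)" for t
  proof -
    have 1: "((\<lambda>t. v + t *\<^sub>R b) has_derivative (\<lambda>h. h *\<^sub>R b)) (at t)"
      by (auto intro!: derivative_eq_intros)
    have "((\<lambda>t. \<phi> (v + t *\<^sub>R b)) has_derivative (\<lambda>h. grad \<phi> (v + t *\<^sub>R b) \<bullet> (h *\<^sub>R b))) (at t)"
      by (rule has_derivative_compose[OF 1 test_functions_derivative[OF \<phi>]])
    then have 2: "((\<lambda>t. \<phi> (v + t *\<^sub>R b)) has_real_derivative (grad \<phi> (v + t *\<^sub>R b) \<bullet> b)) (at t)"
      by (simp add: has_field_derivative_def mult_commute_abs)
    show ?thesis by (rule DERIV_cong[OF DERIV_power[OF 2, of 2]]) simp
  qed
  have "has_bochner_integral lborel (\<lambda>t. ?f t * indicator {a..s} t) (?F s - ?F a)"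
  proof (rule has_bochner_integral_FTC_Icc_real)
    show "a \<le> s" by (simp add: a_def)
    show "isCont ?f t" for t using cf by (simp add: continuous_on_eq_continuous_at)
  qed (rule d)
  then have i: "integrable lborel (\<lambda>t. ?f t * indicator {a..s} t)"
    and eq: "?F s = (LINT t|lborel. ?f t * indicator {a..s} t)"
    using 0 by (simp_all add: has_bochner_integral_iff)
  have "ennreal (?F s) \<le> ennreal (norm (LINT t|lborel. ?f t * indicator {a..s} t))"
    unfolding eq by (intro ennreal_leI) simp
  also have "\<dots> \<le> (\<integral>\<^sup>+t. ennreal (norm (?f t * indicator {a..s} t)) \<partial>lborel)"
    by (rule integral_norm_bound_ennreal[OF i])
  also have "\<dots> \<le> (\<integral>\<^sup>+t. ennreal (2 * \<bar>\<phi> (v + t *\<^sub>R b)\<bar> * norm (grad \<phi> (v + t *\<^sub>R b))) \<partial>lborel)"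
  proof (intro nn_integral_mono ennreal_leI)
    fix t
    have "\<bar>grad \<phi> (v + t *\<^sub>R b) \<bullet> b\<bar> \<le> norm (grad \<phi> (v + t *\<^sub>R b))"
      by (rule Basis_le_norm[OF b])
    then have "2 * \<bar>\<phi> (v + t *\<^sub>R b)\<bar> * \<bar>grad \<phi> (v + t *\<^sub>R b) \<bullet> b\<bar>
        \<le> 2 * \<bar>\<phi> (v + t *\<^sub>R b)\<bar> * norm (grad \<phi> (v + t *\<^sub>R b))"
      by (intro mult_left_mono) auto
    then show "norm (?f t * indicator {a..s} t) \<le> 2 * \<bar>\<phi> (v + t *\<^sub>R b)\<bar> * norm (grad \<phi> (v + t *\<^sub>R b))"
      by (auto simp: abs_mult indicator_def)
  qed
  finally show ?thesis .
qed

interpretation lborel_product: product_sigma_finite "\<lambda>_::'i. lborel :: real measure"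
  by standard

lemma nn_integral_lborel_PiM:
  fixes f :: "'a::euclidean_space \<Rightarrow> ennreal"
  assumes [measurable]: "f \<in> borel_measurable borel"
  shows "(\<integral>\<^sup>+x. f x \<partial>lborel) = (\<integral>\<^sup>+w. f (\<Sum>b\<in>Basis. w b *\<^sub>R b) \<partial>(\<Pi>\<^sub>M b\<in>Basis. lborel))"
  by (subst lborel_eq, subst nn_integral_distr) auto

lemma nn_integral_lborel_1:
  fixes f :: "'a::euclidean_space \<Rightarrow> ennreal"
  assumes [measurable]: "f \<in> borel_measurable borel" and B: "Basis = {b :: 'a}"
  shows "(\<integral>\<^sup>+x. f x \<partial>lborel) = (\<integral>\<^sup>+x. f (x *\<^sub>R b) \<partial>lborel)"
  unfolding nn_integral_lborel_PiM[OF assms(1)] B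
  by (subst lborel_product.product_nn_integral_insert) (simp_all add: PiM_empty)

lemma nn_integral_lborel_2:
  fixes f :: "'a::euclidean_space \<Rightarrow> ennreal"
  assumes [measurable]: "f \<in> borel_measurable borel" and B: "Basis = {b, c :: 'a}" "b \<noteq> c"
  shows "(\<integral>\<^sup>+x. f x \<partial>lborel) = (\<integral>\<^sup>+y. \<integral>\<^sup>+x. f (x *\<^sub>R b + y *\<^sub>R c) \<partial>lborel \<partial>lborel)"
  unfolding nn_integral_lborel_PiM[OF assms(1)] B(1) using B(2)
  by (subst lborel_product.product_nn_integral_insert, simp, simp, measurable,
      subst lborel_product.product_nn_integral_insert, simp, simp, measurable)
     (simp_all add: PiM_empty)

lemma nn_integral_lborel_3:
  fixes f :: "'a::euclidean_space \<Rightarrow> ennreal"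
  assumes [measurable]: "f \<in> borel_measurable borel" and B: "Basis = {b, c, d :: 'a}" "b \<noteq> c" "b \<noteq> d" "c \<noteq> d"
  shows "(\<integral>\<^sup>+x. f x \<partial>lborel) = (\<integral>\<^sup>+z. \<integral>\<^sup>+y. \<integral>\<^sup>+x. f (x *\<^sub>R b + (y *\<^sub>R c + z *\<^sub>R d)) \<partial>lborel \<partial>lborel \<partial>lborel)"
  unfolding nn_integral_lborel_PiM[OF assms(1)] B(1) using B(2-)
  by (subst lborel_product.product_nn_integral_insert, simp, simp, measurable,
      subst lborel_product.product_nn_integral_insert, simp, simp, measurable,
      subst lborel_product.product_nn_integral_insert, simp, simp, measurable)
     (simp_all add: PiM_empty)

lemma nn_integral_two_lines:
  fixes G :: "real \<Rightarrow> real \<Rightarrow> ennreal"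
  assumes [measurable]: "(\<lambda>p. G (fst p) (snd p)) \<in> borel_measurable (borel \<Otimes>\<^sub>M borel)"
    "(\<lambda>p. D (fst p) (snd p)) \<in> borel_measurable (borel \<Otimes>\<^sub>M borel)"
    and 1: "\<And>x y. G x y \<le> (\<integral>\<^sup>+t. D t y \<partial>lborel)" and 2: "\<And>x y. G x y \<le> (\<integral>\<^sup>+t. D x t \<partial>lborel)"
  shows "(\<integral>\<^sup>+y. \<integral>\<^sup>+x. G x y * G x y \<partial>lborel \<partial>lborel)
    \<le> (\<integral>\<^sup>+y. \<integral>\<^sup>+x. D x y \<partial>lborel \<partial>lborel) * (\<integral>\<^sup>+y. \<integral>\<^sup>+x. D x y \<partial>lborel \<partial>lborel)"
proof -
  have m: "(\<lambda>(x, y). D x y) \<in> borel_measurable (lborel \<Otimes>\<^sub>M lborel)"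
    using assms(2) by (simp add: case_prod_unfold cong: measurable_cong_sets)
  have [measurable]: "(\<lambda>x. D x y) \<in> borel_measurable borel" "(\<lambda>y. D x y) \<in> borel_measurable borel" for x y
    using measurable_compose[OF _ assms(2), of "\<lambda>x. (x, y)" borel] measurable_compose[OF _ assms(2), of "\<lambda>y. (x, y)" borel]
    by simp_all
  have "(\<lambda>p. (snd p, fst p)) \<in> (borel \<Otimes>\<^sub>M lborel) \<rightarrow>\<^sub>M (borel \<Otimes>\<^sub>M (borel :: real measure))"
    by measurable
  from measurable_compose[OF this assms(2)]
  have m': "(\<lambda>(y, t). D t y) \<in> borel_measurable ((borel :: real measure) \<Otimes>\<^sub>M lborel)"
    by (simp add: case_prod_unfold)
  have m'': "(\<lambda>(x, t). D x t) \<in> borel_measurable (borel \<Otimes>\<^sub>M lborel)"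
    using assms(2) by (simp add: case_prod_unfold cong: measurable_cong_sets)
  have [measurable]: "(\<lambda>y. \<integral>\<^sup>+t. D t y \<partial>lborel) \<in> borel_measurable borel"
    "(\<lambda>x. \<integral>\<^sup>+t. D x t \<partial>lborel) \<in> borel_measurable borel"
    by (rule lborel.borel_measurable_nn_integral[OF m'], rule lborel.borel_measurable_nn_integral[OF m''])
  have "(\<integral>\<^sup>+y. \<integral>\<^sup>+x. G x y * G x y \<partial>lborel \<partial>lborel)
      \<le> (\<integral>\<^sup>+y. \<integral>\<^sup>+x. (\<integral>\<^sup>+t. D t y \<partial>lborel) * (\<integral>\<^sup>+t. D x t \<partial>lborel) \<partial>lborel \<partial>lborel)"
    by (intro nn_integral_mono mult_mono 1 2) auto
  also have "\<dots> = (\<integral>\<^sup>+y. (\<integral>\<^sup>+t. D t y \<partial>lborel) * (\<integral>\<^sup>+x. \<integral>\<^sup>+t. D x t \<partial>lborel \<partial>lborel) \<partial>lborel)"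
    by (intro nn_integral_cong nn_integral_cmult) simp
  also have "\<dots> = (\<integral>\<^sup>+y. \<integral>\<^sup>+t. D t y \<partial>lborel \<partial>lborel) * (\<integral>\<^sup>+x. \<integral>\<^sup>+t. D x t \<partial>lborel \<partial>lborel)"
    by (rule nn_integral_multc) simp
  also have "(\<integral>\<^sup>+x. \<integral>\<^sup>+t. D x t \<partial>lborel \<partial>lborel) = (\<integral>\<^sup>+t. \<integral>\<^sup>+x. D x t \<partial>lborel \<partial>lborel)"
    by (rule lborel_pair.Fubini'[OF m, symmetric])
  finally show ?thesis .
qed

lemma nn_integral_Cauchy_Schwarz_2:
  fixes g h :: "real \<Rightarrow> real \<Rightarrow> ennreal"
  assumes "(\<lambda>p. g (fst p) (snd p)) \<in> borel_measurable (borel \<Otimes>\<^sub>M borel)"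
    "(\<lambda>p. h (fst p) (snd p)) \<in> borel_measurable (borel \<Otimes>\<^sub>M borel)"
  shows "(\<integral>\<^sup>+y. \<integral>\<^sup>+x. g y x * h y x \<partial>lborel \<partial>lborel)\<^sup>2
    \<le> (\<integral>\<^sup>+y. \<integral>\<^sup>+x. (g y x)\<^sup>2 \<partial>lborel \<partial>lborel) * (\<integral>\<^sup>+y. \<integral>\<^sup>+x. (h y x)\<^sup>2 \<partial>lborel \<partial>lborel)"
proof -
  have m [measurable]: "(\<lambda>p. g (fst p) (snd p)) \<in> borel_measurable (lborel \<Otimes>\<^sub>M lborel)"
    "(\<lambda>p. h (fst p) (snd p)) \<in> borel_measurable (lborel \<Otimes>\<^sub>M lborel)"
    using assms by (simp_all cong: measurable_cong_sets)
  have "(\<integral>\<^sup>+p. g (fst p) (snd p) * h (fst p) (snd p) \<partial>(lborel \<Otimes>\<^sub>M lborel))\<^sup>2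
    \<le> (\<integral>\<^sup>+p. (g (fst p) (snd p))\<^sup>2 \<partial>(lborel \<Otimes>\<^sub>M lborel)) * (\<integral>\<^sup>+p. (h (fst p) (snd p))\<^sup>2 \<partial>(lborel \<Otimes>\<^sub>M lborel))"
    by (rule Cauchy_Schwarz_nn_integral[OF m])
  moreover have "(\<integral>\<^sup>+p. g (fst p) (snd p) * h (fst p) (snd p) \<partial>(lborel \<Otimes>\<^sub>M lborel))
      = (\<integral>\<^sup>+y. \<integral>\<^sup>+x. g y x * h y x \<partial>lborel \<partial>lborel)"
    by (subst lborel.nn_integral_fst[symmetric]) simp_all
  moreover have "(\<integral>\<^sup>+p. (g (fst p) (snd p))\<^sup>2 \<partial>(lborel \<Otimes>\<^sub>M lborel)) = (\<integral>\<^sup>+y. \<integral>\<^sup>+x. (g y x)\<^sup>2 \<partial>lborel \<partial>lborel)"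
    by (subst lborel.nn_integral_fst[symmetric]) simp_all
  moreover have "(\<integral>\<^sup>+p. (h (fst p) (snd p))\<^sup>2 \<partial>(lborel \<Otimes>\<^sub>M lborel)) = (\<integral>\<^sup>+y. \<integral>\<^sup>+x. (h y x)\<^sup>2 \<partial>lborel \<partial>lborel)"
    by (subst lborel.nn_integral_fst[symmetric]) simp_all
  ultimately show ?thesis by simp
qed

text \<open>Every point value of \<open>\<phi>\<^sup>2\<close> is bounded by the integral of \<open>2 \<bar>\<phi>\<bar> \<bar>\<nabla>\<phi>\<bar>\<close> over each of the lines
  through that point that are parallel to an axis. In dimension three, two of these
  bounds are used on each horizontal plane, and the third one bounds the \<open>L\<^sup>2\<close> norm on a plane.\<close>

lemma ladyzhenskaya_nn:
  fixes \<phi> :: "'a::euclidean_space \<Rightarrow> real"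
  assumes \<phi>: "\<phi> \<in> test_functions UNIV" and dim: "DIM('a) \<le> 3"
  defines "G \<equiv> \<lambda>x. ennreal ((\<phi> x)\<^sup>2)" and "H \<equiv> \<lambda>x. ennreal ((norm (grad \<phi> x))\<^sup>2)"
  shows "(\<integral>\<^sup>+x. G x * G x \<partial>lborel) \<le> 4 * ((\<integral>\<^sup>+x. G x \<partial>lborel) + (\<integral>\<^sup>+x. H x \<partial>lborel))\<^sup>2"
proof -
  have pm [measurable]: "\<phi> \<in> borel_measurable borel" "grad \<phi> \<in> borel_measurable borel"
    using cont_cs_measurable[OF test_functions_cont_cs[OF \<phi>]]
      cont_cs_measurable[OF test_functions_grad_cont_cs[OF \<phi>]] by simp_all
  define g h D where "g x = ennreal \<bar>\<phi> x\<bar>" and "h x = ennreal (norm (grad \<phi> x))"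
    and "D x = ennreal (2 * \<bar>\<phi> x\<bar> * norm (grad \<phi> x))" for x
  have [measurable]: "G \<in> borel_measurable borel" "H \<in> borel_measurable borel" "g \<in> borel_measurable borel"
    "h \<in> borel_measurable borel" "D \<in> borel_measurable borel"
    unfolding G_def H_def g_def[abs_def] h_def[abs_def] D_def[abs_def] by measurable
  have line: "G (s *\<^sub>R b + v) \<le> (\<integral>\<^sup>+t. D (t *\<^sub>R b + v) \<partial>lborel)" if "b \<in> Basis" for s b v
    using square_le_line_integral[OF \<phi> that, of v s] unfolding G_def D_def by (simp add: add.commute)
  have Dle: "D x \<le> G x + H x" for x
  proof -
    have "2 * \<bar>\<phi> x\<bar> * norm (grad \<phi> x) \<le> (\<phi> x)\<^sup>2 + (norm (grad \<phi> x))\<^sup>2"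
      using sum_squares_bound[of "\<bar>\<phi> x\<bar>" "norm (grad \<phi> x)"] by simp
    then show ?thesis unfolding D_def G_def H_def by (simp flip: ennreal_plus add: ennreal_leI)
  qed
  have Deq: "D x = 2 * (g x * h x)" and Geq: "G x = (g x)\<^sup>2" and Heq: "H x = (h x)\<^sup>2" for x
    unfolding D_def g_def h_def G_def H_def
    by (simp_all add: ennreal_mult ennreal_power mult.assoc flip: ennreal_numeral)
  let ?a = "\<integral>\<^sup>+x. G x \<partial>lborel" and ?b = "\<integral>\<^sup>+x. H x \<partial>lborel" and ?d = "\<integral>\<^sup>+x. D x \<partial>lborel"
  have dle: "?d \<le> ?a + ?b"
  proof -
    have "?d \<le> (\<integral>\<^sup>+x. G x + H x \<partial>lborel)" by (intro nn_integral_mono Dle)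
    also have "\<dots> = ?a + ?b" by (rule nn_integral_add) measurable
    finally show ?thesis .
  qed
  have sq_le: "s \<le> 4 * s" for s :: ennreal
    using mult_right_mono[of 1 4 s] by simp
  have ab: "?a \<le> ?a + ?b" "?b \<le> ?a + ?b" by simp_all
  have "DIM('a) > 0" by (rule DIM_positive)
  with dim consider "card (Basis :: 'a set) = 1" | "card (Basis :: 'a set) = 2" | "card (Basis :: 'a set) = 3"
    by linarith
  then show ?thesis
  proof cases
    case 1
    then obtain b where B: "Basis = {b :: 'a}" by (auto simp: card_1_singleton_iff)
    have "(\<integral>\<^sup>+x. G x * G x \<partial>lborel) = (\<integral>\<^sup>+x. G (x *\<^sub>R b) * G (x *\<^sub>R b) \<partial>lborel)"
      by (rule nn_integral_lborel_1[OF _ B]) measurable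
    also have "\<dots> \<le> (\<integral>\<^sup>+x. (\<integral>\<^sup>+t. D (t *\<^sub>R b) \<partial>lborel) * G (x *\<^sub>R b) \<partial>lborel)"
      using line[of b _ 0] B by (intro nn_integral_mono mult_right_mono) auto
    also have "\<dots> = (\<integral>\<^sup>+t. D (t *\<^sub>R b) \<partial>lborel) * (\<integral>\<^sup>+x. G (x *\<^sub>R b) \<partial>lborel)"
      by (rule nn_integral_cmult) measurable
    also have "\<dots> = ?d * ?a"
      by (subst (1 2) nn_integral_lborel_1[OF _ B]) simp_all
    also have "\<dots> \<le> (?a + ?b) * (?a + ?b)"
      by (intro mult_mono dle ab) auto
    also have "\<dots> \<le> 4 * (?a + ?b)\<^sup>2"
      using sq_le[of "(?a + ?b)\<^sup>2"] by (simp add: power2_eq_square)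
    finally show ?thesis .
  next
    case 2
    then obtain b c where B: "Basis = {b, c :: 'a}" "b \<noteq> c" by (auto simp: card_2_iff)
    have bB: "b \<in> Basis" "c \<in> Basis" by (simp_all add: B(1))
    define p where "p x y = x *\<^sub>R b + y *\<^sub>R c" for x y :: real
    have m: "(\<lambda>q. G (p (fst q) (snd q))) \<in> borel_measurable (borel \<Otimes>\<^sub>M borel)"
      "(\<lambda>q. D (p (fst q) (snd q))) \<in> borel_measurable (borel \<Otimes>\<^sub>M borel)"
      unfolding p_def by measurable
    have "(\<integral>\<^sup>+x. G x * G x \<partial>lborel) = (\<integral>\<^sup>+y. \<integral>\<^sup>+x. G (p x y) * G (p x y) \<partial>lborel \<partial>lborel)"
      unfolding p_def by (rule nn_integral_lborel_2[OF _ B]) measurable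
    also have "\<dots> \<le> (\<integral>\<^sup>+y. \<integral>\<^sup>+x. D (p x y) \<partial>lborel \<partial>lborel) * (\<integral>\<^sup>+y. \<integral>\<^sup>+x. D (p x y) \<partial>lborel \<partial>lborel)"
    proof (rule nn_integral_two_lines[OF m])
      show "G (p x y) \<le> (\<integral>\<^sup>+t. D (p t y) \<partial>lborel)" for x y
        unfolding p_def by (rule line[OF bB(1)])
      show "G (p x y) \<le> (\<integral>\<^sup>+t. D (p x t) \<partial>lborel)" for x y
        unfolding p_def using line[OF bB(2), of y "x *\<^sub>R b"] by (simp add: add.commute)
    qed
    also have "(\<integral>\<^sup>+y. \<integral>\<^sup>+x. D (p x y) \<partial>lborel \<partial>lborel) = ?d"
      unfolding p_def by (rule nn_integral_lborel_2[OF _ B, symmetric]) measurable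
    also have "?d * ?d \<le> (?a + ?b) * (?a + ?b)"
      by (intro mult_mono dle) auto
    also have "\<dots> \<le> 4 * (?a + ?b)\<^sup>2"
      using sq_le[of "(?a + ?b)\<^sup>2"] by (simp add: power2_eq_square)
    finally show ?thesis .
  next
    case 3
    then obtain b c d where B: "Basis = {b, c, d :: 'a}" "b \<noteq> c" "b \<noteq> d" "c \<noteq> d"
      by (auto simp: card_3_iff)
    have bB: "b \<in> Basis" "c \<in> Basis" "d \<in> Basis" by (simp_all add: B(1))
    define p where "p x y z = x *\<^sub>R b + (y *\<^sub>R c + z *\<^sub>R d)" for x y z :: real
    have [measurable]: "(\<lambda>q. p (f1 q) (f2 q) (f3 q)) \<in> borel_measurable M"
      if [measurable]: "f1 \<in> borel_measurable M" "f2 \<in> borel_measurable M" "f3 \<in> borel_measurable M"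
      for f1 f2 f3 and M :: "'m measure"
      unfolding p_def by measurable
    have i3: "(\<integral>\<^sup>+x. F x \<partial>lborel) = (\<integral>\<^sup>+z. \<integral>\<^sup>+y. \<integral>\<^sup>+x. F (p x y z) \<partial>lborel \<partial>lborel \<partial>lborel)"
      if "F \<in> borel_measurable borel" for F :: "'a \<Rightarrow> ennreal"
      unfolding p_def by (rule nn_integral_lborel_3[OF that B])
    have mF: "(\<lambda>q. F (p (fst q) (snd q) z)) \<in> borel_measurable (borel \<Otimes>\<^sub>M borel)"
        "(\<lambda>q. F (p (snd q) (fst q) z)) \<in> borel_measurable (borel \<Otimes>\<^sub>M borel)"
      if [measurable]: "F \<in> borel_measurable borel" for F :: "'a \<Rightarrow> ennreal" and z
      unfolding p_def by measurable
    have plane: "(\<integral>\<^sup>+y. \<integral>\<^sup>+x. G (p x y z) \<partial>lborel \<partial>lborel) \<le> ?d" for z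
    proof -
      have "(\<integral>\<^sup>+y. \<integral>\<^sup>+x. G (p x y z) \<partial>lborel \<partial>lborel)
          \<le> (\<integral>\<^sup>+y. \<integral>\<^sup>+x. \<integral>\<^sup>+t. D (p x y t) \<partial>lborel \<partial>lborel \<partial>lborel)"
      proof (intro nn_integral_mono)
        fix x y
        show "G (p x y z) \<le> (\<integral>\<^sup>+t. D (p x y t) \<partial>lborel)"
          unfolding p_def using line[OF bB(3), of z "x *\<^sub>R b + y *\<^sub>R c"]
          by (simp add: add.commute add.left_commute)
      qed
      also have "\<dots> = (\<integral>\<^sup>+y. \<integral>\<^sup>+t. \<integral>\<^sup>+x. D (p x y t) \<partial>lborel \<partial>lborel \<partial>lborel)"
        by (intro nn_integral_cong lborel_pair.Fubini'[symmetric]) (unfold p_def, measurable)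
      also have "\<dots> = (\<integral>\<^sup>+t. \<integral>\<^sup>+y. \<integral>\<^sup>+x. D (p x y t) \<partial>lborel \<partial>lborel \<partial>lborel)"
        by (intro lborel_pair.Fubini'[symmetric]) (unfold p_def, measurable)
      also have "\<dots> = ?d" by (rule i3[symmetric]) measurable
      finally show ?thesis .
    qed
    have "(\<integral>\<^sup>+y. \<integral>\<^sup>+x. G (p x y z) * G (p x y z) \<partial>lborel \<partial>lborel)
        \<le> (4 * ?d) * (\<integral>\<^sup>+y. \<integral>\<^sup>+x. H (p x y z) \<partial>lborel \<partial>lborel)" for z
    proof -
      let ?D = "\<integral>\<^sup>+y. \<integral>\<^sup>+x. D (p x y z) \<partial>lborel \<partial>lborel"
      have "(\<integral>\<^sup>+y. \<integral>\<^sup>+x. G (p x y z) * G (p x y z) \<partial>lborel \<partial>lborel) \<le> ?D * ?D"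
      proof (rule nn_integral_two_lines[OF mF(1) mF(1)])
        show "G (p x y z) \<le> (\<integral>\<^sup>+t. D (p t y z) \<partial>lborel)" for x y
          unfolding p_def by (rule line[OF bB(1)])
        show "G (p x y z) \<le> (\<integral>\<^sup>+t. D (p x t z) \<partial>lborel)" for x y
          unfolding p_def using line[OF bB(2), of y "x *\<^sub>R b + z *\<^sub>R d"]
          by (simp add: add.commute add.left_commute)
      qed measurable
      also have "?D = 2 * (\<integral>\<^sup>+y. \<integral>\<^sup>+x. g (p x y z) * h (p x y z) \<partial>lborel \<partial>lborel)"
        unfolding Deq
      proof (subst nn_integral_cmult[symmetric])
        show "(\<lambda>y. \<integral>\<^sup>+x. g (p x y z) * h (p x y z) \<partial>lborel) \<in> borel_measurable lborel"
          unfolding p_def by measurable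
        show "(\<integral>\<^sup>+y. \<integral>\<^sup>+x. 2 * (g (p x y z) * h (p x y z)) \<partial>lborel \<partial>lborel)
            = (\<integral>\<^sup>+y. 2 * \<integral>\<^sup>+x. g (p x y z) * h (p x y z) \<partial>lborel \<partial>lborel)"
          by (intro nn_integral_cong nn_integral_cmult) (unfold p_def, measurable)
      qed
      also have "\<dots> * \<dots> = 4 * (\<integral>\<^sup>+y. \<integral>\<^sup>+x. g (p x y z) * h (p x y z) \<partial>lborel \<partial>lborel)\<^sup>2"
      proof -
        have "2 * s * (2 * s) = 4 * s\<^sup>2" for s :: ennreal
          by (simp add: power2_eq_square mult.assoc mult.left_commute[of s 2] flip: mult.assoc[of 2 2])
        then show ?thesis .
      qed
      also have "\<dots> \<le> 4 * ((\<integral>\<^sup>+y. \<integral>\<^sup>+x. (g (p x y z))\<^sup>2 \<partial>lborel \<partial>lborel) * (\<integral>\<^sup>+y. \<integral>\<^sup>+x. (h (p x y z))\<^sup>2 \<partial>lborel \<partial>lborel))"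
        by (intro mult_left_mono nn_integral_Cauchy_Schwarz_2 mF(2)) (simp, measurable)
      also have "\<dots> = (4 * (\<integral>\<^sup>+y. \<integral>\<^sup>+x. G (p x y z) \<partial>lborel \<partial>lborel)) * (\<integral>\<^sup>+y. \<integral>\<^sup>+x. H (p x y z) \<partial>lborel \<partial>lborel)"
        unfolding Geq Heq by (simp add: mult.assoc)
      also have "\<dots> \<le> (4 * ?d) * (\<integral>\<^sup>+y. \<integral>\<^sup>+x. H (p x y z) \<partial>lborel \<partial>lborel)"
        by (intro mult_right_mono mult_left_mono plane) auto
      finally show ?thesis .
    qed
    then have "(\<integral>\<^sup>+z. \<integral>\<^sup>+y. \<integral>\<^sup>+x. G (p x y z) * G (p x y z) \<partial>lborel \<partial>lborel \<partial>lborel)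
        \<le> (\<integral>\<^sup>+z. (4 * ?d) * (\<integral>\<^sup>+y. \<integral>\<^sup>+x. H (p x y z) \<partial>lborel \<partial>lborel) \<partial>lborel)"
      by (rule nn_integral_mono)
    also have "\<dots> = (4 * ?d) * (\<integral>\<^sup>+z. \<integral>\<^sup>+y. \<integral>\<^sup>+x. H (p x y z) \<partial>lborel \<partial>lborel \<partial>lborel)"
      by (rule nn_integral_cmult) (unfold p_def, measurable)
    also have "(\<integral>\<^sup>+z. \<integral>\<^sup>+y. \<integral>\<^sup>+x. H (p x y z) \<partial>lborel \<partial>lborel \<partial>lborel) = ?b"
      by (rule i3[symmetric]) measurable
    also have "4 * ?d * ?b \<le> 4 * (?a + ?b) * (?a + ?b)"
      by (intro mult_mono mult_left_mono dle ab) auto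
    also have "\<dots> = 4 * (?a + ?b)\<^sup>2" by (simp only: power2_eq_square mult.assoc)
    also have "(\<integral>\<^sup>+z. \<integral>\<^sup>+y. \<integral>\<^sup>+x. G (p x y z) * G (p x y z) \<partial>lborel \<partial>lborel \<partial>lborel) = (\<integral>\<^sup>+x. G x * G x \<partial>lborel)"
      by (rule i3[symmetric]) measurable
    finally show ?thesis .
  qed
qed

subsection \<open>Local compactness\<close>

lemma nn_integral_lborel_shift:
  fixes f :: "'a::euclidean_space \<Rightarrow> ennreal"
  assumes "f \<in> borel_measurable borel"
  shows "(\<integral>\<^sup>+x. f (a + x) \<partial>lborel) = (\<integral>\<^sup>+x. f x \<partial>lborel)"
proof -
  have "(\<integral>\<^sup>+x. f x \<partial>lborel) = (\<integral>\<^sup>+x. f x \<partial>distr lborel borel ((+) a))"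
    by (simp add: lborel_distr_plus)
  also have "\<dots> = (\<integral>\<^sup>+x. f (a + x) \<partial>lborel)"
    using assms by (subst nn_integral_distr) auto
  finally show ?thesis by simp
qed

lemma square_increment_le:
  fixes x z :: "'a::euclidean_space"
  assumes \<phi>: "\<phi> \<in> test_functions UNIV"
  shows "ennreal ((\<phi> (x + z) - \<phi> x)\<^sup>2)
    \<le> (\<integral>\<^sup>+t. ennreal ((norm z)\<^sup>2 * (norm (grad \<phi> (t *\<^sub>R z + x)))\<^sup>2) * indicator {0..1} t \<partial>lborel)"
proof -
  let ?f = "\<lambda>t. grad \<phi> (t *\<^sub>R z + x) \<bullet> z"
  have c2: "continuous_on UNIV (\<lambda>t. grad \<phi> (t *\<^sub>R z + x))"
    by (rule continuous_on_compose2[OF cont_cs_continuous[OF test_functions_grad_cont_cs[OF \<phi>]]])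
       (auto intro!: continuous_intros)
  have cf: "continuous_on UNIV ?f" by (intro continuous_intros c2)
  have d: "((\<lambda>t. \<phi> (t *\<^sub>R z + x)) has_real_derivative ?f t) (at t)" for t
  proof -
    have 1: "((\<lambda>t. t *\<^sub>R z + x) has_derivative (\<lambda>h. h *\<^sub>R z)) (at t)"
      by (auto intro!: derivative_eq_intros)
    have "((\<lambda>t. \<phi> (t *\<^sub>R z + x)) has_derivative (\<lambda>h. grad \<phi> (t *\<^sub>R z + x) \<bullet> (h *\<^sub>R z))) (at t)"
      by (rule has_derivative_compose[OF 1 test_functions_derivative[OF \<phi>]])
    then show ?thesis by (simp add: has_field_derivative_def mult_commute_abs)
  qed
  have "has_bochner_integral lborel (\<lambda>t. ?f t * indicator {0..1} t) (\<phi> (1 *\<^sub>R z + x) - \<phi> (0 *\<^sub>R z + x))"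
  proof (rule has_bochner_integral_FTC_Icc_real)
    show "isCont ?f t" for t using cf by (simp add: continuous_on_eq_continuous_at)
  qed (simp, rule d)
  then have eq: "\<phi> (x + z) - \<phi> x = (LINT t|lborel. ?f t * indicator {0..1} t)"
    by (simp add: has_bochner_integral_iff add.commute)
  have fm: "?f \<in> borel_measurable borel" using cf by (rule borel_measurable_continuous_onI)
  define a b where "a t = (indicator {0..1} t :: real)" and "b t = ?f t * indicator {0..1} t" for t :: real
  have ab: "a t \<bullet> b t = ?f t * indicator {0..1} t" for t by (simp add: a_def b_def indicator_def)
  have a2: "(norm (a t))\<^sup>2 = indicator {0..1} t *\<^sub>R 1" for t by (simp add: a_def indicator_def)
  have b2: "(norm (b t))\<^sup>2 = indicator {0..1} t *\<^sub>R (?f t)\<^sup>2" for t by (simp add: b_def indicator_def)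
  have ia: "integrable lborel (\<lambda>t. indicator {0..1::real} t *\<^sub>R (1::real))"
    and ib: "integrable lborel (\<lambda>t. indicator {0..1} t *\<^sub>R (?f t)\<^sup>2)"
    by (rule borel_integrable_compact; auto intro!: continuous_intros continuous_on_subset[OF c2])+
  have ma: "a \<in> borel_measurable lborel" unfolding a_def[abs_def] by measurable
  have mb: "b \<in> borel_measurable lborel" unfolding b_def[abs_def] using fm by measurable
  have sa: "sq_int lborel a" unfolding sq_int_def a2 using ma ia by blast
  have sb: "sq_int lborel b" unfolding sq_int_def b2 using mb ib by blast
  have "l2norm lborel a = 1" unfolding l2norm_def a2 by simp
  then have "\<bar>\<phi> (x + z) - \<phi> x\<bar> \<le> l2norm lborel b"
    using l2_Cauchy_Schwarz[OF sa sb] unfolding ab eq by simp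
  then have "(\<phi> (x + z) - \<phi> x)\<^sup>2 \<le> (l2norm lborel b)\<^sup>2"
    using power_mono[of "\<bar>\<phi> (x + z) - \<phi> x\<bar>" _ 2] by simp
  also have "\<dots> = (LINT t|lborel. indicator {0..1} t *\<^sub>R (?f t)\<^sup>2)"
    unfolding l2norm_sq b2 ..
  finally have "ennreal ((\<phi> (x + z) - \<phi> x)\<^sup>2) \<le> ennreal (LINT t|lborel. indicator {0..1} t *\<^sub>R (?f t)\<^sup>2)"
    by (rule ennreal_leI)
  also have "\<dots> = (\<integral>\<^sup>+t. ennreal (indicator {0..1} t *\<^sub>R (?f t)\<^sup>2) \<partial>lborel)"
    by (rule nn_integral_eq_integral[OF ib, symmetric]) simp
  also have "\<dots> \<le> (\<integral>\<^sup>+t. ennreal ((norm z)\<^sup>2 * (norm (grad \<phi> (t *\<^sub>R z + x)))\<^sup>2) * indicator {0..1} t \<partial>lborel)"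
  proof (rule nn_integral_mono)
    fix t :: real
    have "\<bar>?f t\<bar>\<^sup>2 \<le> (norm (grad \<phi> (t *\<^sub>R z + x)) * norm z)\<^sup>2"
      by (intro power_mono Cauchy_Schwarz_ineq2) simp
    then show "ennreal (indicator {0..1} t *\<^sub>R (?f t)\<^sup>2)
        \<le> ennreal ((norm z)\<^sup>2 * (norm (grad \<phi> (t *\<^sub>R z + x)))\<^sup>2) * indicator {0..1} t"
      by (auto simp: indicator_def power_mult_distrib mult.commute intro!: ennreal_leI)
  qed
  finally show ?thesis .
qed

lemma l2_increment_le:
  fixes z :: "'a::euclidean_space"
  assumes \<phi>: "\<phi> \<in> test_functions UNIV"
  shows "(\<integral>\<^sup>+x. ennreal ((\<phi> (x + z) - \<phi> x)\<^sup>2) \<partial>lborel)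
    \<le> ennreal ((norm z)\<^sup>2) * (\<integral>\<^sup>+x. ennreal ((norm (grad \<phi> x))\<^sup>2) \<partial>lborel)"
proof -
  have [measurable]: "grad \<phi> \<in> borel_measurable borel"
    by (rule cont_cs_measurable[OF test_functions_grad_cont_cs[OF \<phi>]])
  let ?b = "\<integral>\<^sup>+x. ennreal ((norm (grad \<phi> x))\<^sup>2) \<partial>lborel"
  have "(\<integral>\<^sup>+x. ennreal ((\<phi> (x + z) - \<phi> x)\<^sup>2) \<partial>lborel)
      \<le> (\<integral>\<^sup>+x. \<integral>\<^sup>+t. ennreal ((norm z)\<^sup>2 * (norm (grad \<phi> (t *\<^sub>R z + x)))\<^sup>2) * indicator {0..1} (t::real) \<partial>lborel \<partial>lborel)"
    by (intro nn_integral_mono square_increment_le[OF \<phi>])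
  also have "\<dots> = (\<integral>\<^sup>+t. \<integral>\<^sup>+x. ennreal ((norm z)\<^sup>2 * (norm (grad \<phi> (t *\<^sub>R z + x)))\<^sup>2) * indicator {0..1} (t::real) \<partial>lborel \<partial>lborel)"
    by (rule pair_sigma_finite.Fubini'[OF pair_sigma_finite.intro[OF sigma_finite_lborel sigma_finite_lborel], symmetric]) measurable
  also have "\<dots> = (\<integral>\<^sup>+t. (ennreal ((norm z)\<^sup>2) * ?b) * indicator {0..1} (t::real) \<partial>lborel)"
  proof (rule nn_integral_cong)
    fix t :: real
    have "(\<integral>\<^sup>+x. ennreal ((norm z)\<^sup>2 * (norm (grad \<phi> (t *\<^sub>R z + x)))\<^sup>2) * indicator {0..1} t \<partial>lborel)
        = (\<integral>\<^sup>+x. ennreal ((norm z)\<^sup>2) * ennreal ((norm (grad \<phi> (t *\<^sub>R z + x)))\<^sup>2) \<partial>lborel) * indicator {0..1} t"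
      by (subst nn_integral_multc[symmetric]) (simp_all add: ennreal_mult)
    also have "(\<integral>\<^sup>+x. ennreal ((norm z)\<^sup>2) * ennreal ((norm (grad \<phi> (t *\<^sub>R z + x)))\<^sup>2) \<partial>lborel)
        = ennreal ((norm z)\<^sup>2) * (\<integral>\<^sup>+x. ennreal ((norm (grad \<phi> (t *\<^sub>R z + x)))\<^sup>2) \<partial>lborel)"
      by (rule nn_integral_cmult) measurable
    also have "(\<integral>\<^sup>+x. ennreal ((norm (grad \<phi> (t *\<^sub>R z + x)))\<^sup>2) \<partial>lborel) = ?b"
      by (rule nn_integral_lborel_shift) measurable
    finally show "(\<integral>\<^sup>+x. ennreal ((norm z)\<^sup>2 * (norm (grad \<phi> (t *\<^sub>R z + x)))\<^sup>2) * indicator {0..1} t \<partial>lborel)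
        = (ennreal ((norm z)\<^sup>2) * ?b) * indicator {0..1} t" .
  qed
  also have "\<dots> = ennreal ((norm z)\<^sup>2) * ?b"
    by (subst nn_integral_cmult) simp_all
  finally show ?thesis .
qed

definition cell_index :: "real \<Rightarrow> 'a::euclidean_space \<Rightarrow> 'a" where
  "cell_index h x = (\<Sum>b\<in>Basis. of_int \<lfloor>(x \<bullet> b) / h\<rfloor> *\<^sub>R b)"

definition cell :: "real \<Rightarrow> 'a::euclidean_space \<Rightarrow> 'a set" where
  "cell h k = {y. cell_index h y = k}"

lemma cell_index_inner: "b \<in> Basis \<Longrightarrow> cell_index h x \<bullet> b = of_int \<lfloor>(x \<bullet> b) / h\<rfloor>"
  by (simp add: cell_index_def inner_sum_left inner_Basis if_distrib cong: if_cong)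

lemma cell_borel: "cell h k \<in> sets borel"
proof -
  have [measurable]: "cell_index h \<in> borel_measurable borel"
    unfolding cell_index_def[abs_def] by measurable
  have "cell h k = cell_index h -` {k} \<inter> space borel" by (auto simp: cell_def)
  also have "\<dots> \<in> sets borel" by measurable
  finally show ?thesis .
qed

lemma cell_dist:
  assumes "h > 0" "cell_index h y = cell_index h (x :: 'a::euclidean_space)"
  shows "dist x y \<le> h * DIM('a)"
proof -
  have "\<bar>(x - y) \<bullet> b\<bar> \<le> h" if b: "b \<in> Basis" for b
  proof -
    have "\<lfloor>(y \<bullet> b) / h\<rfloor> = \<lfloor>(x \<bullet> b) / h\<rfloor>"
      using arg_cong[OF assms(2), of "\<lambda>v. v \<bullet> b"] by (simp add: cell_index_inner[OF b])
    then have "\<bar>(x \<bullet> b) / h - (y \<bullet> b) / h\<bar> \<le> 1" by linarith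
    then have "\<bar>((x - y) \<bullet> b) / h\<bar> \<le> 1" by (simp add: inner_diff_left diff_divide_distrib)
    then show ?thesis using assms(1) by (simp add: abs_divide)
  qed
  then have "(\<Sum>b\<in>Basis. \<bar>(x - y) \<bullet> b\<bar>) \<le> (\<Sum>b\<in>(Basis :: 'a set). h)"
    by (intro sum_mono)
  then show ?thesis
    using norm_le_l1[of "x - y"] by (simp add: dist_norm mult.commute)
qed

lemma cell_bounded:
  assumes "h > 0" shows "bounded (cell h k :: 'a::euclidean_space set)"
proof (cases "cell h k = {}")
  case False
  then obtain x where "cell_index h x = k" by (auto simp: cell_def)
  then have "cell h k \<subseteq> cball x (h * DIM('a))"
    using cell_dist[OF assms, of _ x] by (auto simp: cell_def)
  then show ?thesis using bounded_cball bounded_subset by blast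
qed simp

lemma cell_emeasure_finite: "h > 0 \<Longrightarrow> emeasure lborel (cell h k) < \<infinity>"
  by (rule emeasure_bounded_finite[OF cell_bounded])

lemma cell_measure_ge:
  assumes "h > 0"
  shows "measure lborel (cell h (cell_index h (x :: 'a::euclidean_space))) \<ge> h ^ DIM('a)"
proof -
  let ?k = "cell_index h x"
  have sub: "box (h *\<^sub>R ?k) (h *\<^sub>R ?k + h *\<^sub>R One) \<subseteq> cell h ?k"
  proof
    fix y assume y: "y \<in> box (h *\<^sub>R ?k) (h *\<^sub>R ?k + h *\<^sub>R One)"
    have "\<lfloor>(y \<bullet> b) / h\<rfloor> = \<lfloor>(x \<bullet> b) / h\<rfloor>" if b: "b \<in> Basis" for b
    proof -
      have "h * of_int \<lfloor>(x \<bullet> b) / h\<rfloor> < y \<bullet> b" "y \<bullet> b < h * of_int \<lfloor>(x \<bullet> b) / h\<rfloor> + h"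
        using y b by (auto simp: mem_box inner_add_left cell_index_inner[OF b])
      then have "of_int \<lfloor>(x \<bullet> b) / h\<rfloor> < (y \<bullet> b) / h" "(y \<bullet> b) / h < of_int \<lfloor>(x \<bullet> b) / h\<rfloor> + 1"
        using assms by (simp_all add: field_simps)
      then show ?thesis by linarith
    qed
    then have "cell_index h y = ?k" unfolding cell_index_def by (intro sum.cong) auto
    then show "y \<in> cell h ?k" by (simp add: cell_def)
  qed
  have "h ^ DIM('a) = measure lborel (box (h *\<^sub>R ?k) (h *\<^sub>R ?k + h *\<^sub>R One))"
    using assms by (subst measure_lborel_box_eq) (simp add: inner_add_left)
  also have "\<dots> \<le> measure lborel (cell h ?k)"
    by (rule measure_mono_fmeasurable[OF sub])
       (use cell_borel cell_emeasure_finite[OF assms] in \<open>auto simp: fmeasurable_def\<close>)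
  finally show ?thesis .
qed

lemma finite_cell_index:
  assumes "h > 0" shows "finite (cell_index h ` cball (0 :: 'a::euclidean_space) m)"
proof -
  define Z where "Z = {- \<lceil>m / h\<rceil> - 1 .. \<lceil>m / h\<rceil> + 1}"
  have "cell_index h ` cball 0 m \<subseteq> (\<lambda>f. \<Sum>b\<in>(Basis :: 'a set). of_int (f b) *\<^sub>R b) ` (Basis \<rightarrow>\<^sub>E Z)"
  proof
    fix k :: 'a assume "k \<in> cell_index h ` cball 0 m"
    then obtain x :: 'a where x: "norm x \<le> m" "k = cell_index h x" by auto
    define f where "f = restrict (\<lambda>b. \<lfloor>(x \<bullet> b) / h\<rfloor>) (Basis :: 'a set)"
    have "\<lfloor>(x \<bullet> b) / h\<rfloor> \<in> Z" if b: "b \<in> Basis" for b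
    proof -
      have "\<bar>x \<bullet> b\<bar> \<le> m" using Basis_le_norm[OF b, of x] x(1) by linarith
      then have "\<bar>(x \<bullet> b) / h\<bar> \<le> m / h" using assms by (simp add: abs_divide divide_right_mono)
      then show ?thesis unfolding Z_def atLeastAtMost_iff by linarith
    qed
    then have "f \<in> Basis \<rightarrow>\<^sub>E Z" by (auto simp: f_def)
    moreover have "k = (\<Sum>b\<in>Basis. of_int (f b) *\<^sub>R b)"
      unfolding x(2) cell_index_def by (intro sum.cong) (auto simp: f_def)
    ultimately show "k \<in> (\<lambda>f. \<Sum>b\<in>(Basis :: 'a set). of_int (f b) *\<^sub>R b) ` (Basis \<rightarrow>\<^sub>E Z)" by blast
  qed
  moreover have "finite (Basis \<rightarrow>\<^sub>E Z :: ('a \<Rightarrow> int) set)" by (intro finite_PiE) (auto simp: Z_def)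
  ultimately show ?thesis by (meson finite_imageI finite_subset)
qed

lemma cell_average_bound:
  fixes \<phi> :: "'a::euclidean_space \<Rightarrow> real"
  assumes \<phi>: "\<phi> \<in> test_functions UNIV" and h: "h > 0"
  shows "ennreal ((\<phi> x)\<^sup>2)
    \<le> ennreal (2 / (h ^ DIM('a))\<^sup>2 * (LINT y|lborel. indicator (cell h (cell_index h x)) y * \<phi> y)\<^sup>2)
      + ennreal (2 / h ^ DIM('a)) * (\<integral>\<^sup>+z. ennreal ((\<phi> (x + z) - \<phi> x)\<^sup>2) * indicator (cball 0 (h * DIM('a))) z \<partial>lborel)"
proof -
  define q where "q = cell h (cell_index h x)"
  define w where "w = measure lborel q"
  have pm [measurable]: "\<phi> \<in> borel_measurable borel"
    by (rule cont_cs_measurable[OF test_functions_cont_cs[OF \<phi>]])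
  have qb [measurable]: "q \<in> sets borel" unfolding q_def by (rule cell_borel)
  have qf: "emeasure lborel q < \<infinity>" unfolding q_def by (rule cell_emeasure_finite[OF h])
  have wge: "w \<ge> h ^ DIM('a)" unfolding w_def q_def by (rule cell_measure_ge[OF h])
  have hp: "h ^ DIM('a) > 0" using h by simp
  then have w0: "w > 0" using wge by linarith
  obtain B where B: "B > 0" "\<And>x. norm (\<phi> x) \<le> B" by (rule cont_cs_bounded[OF test_functions_cont_cs[OF \<phi>]]) blast
  have iq: "integrable lborel (indicator q :: 'a \<Rightarrow> real)" using qf by (simp add: integrable_indicator_iff)
  have bnd: "integrable lborel (\<lambda>y. indicator q y * f y)"
    if [measurable]: "f \<in> borel_measurable borel" and "\<And>y. \<bar>f y\<bar> \<le> C" for f :: "'a \<Rightarrow> real" and C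
  proof (rule Bochner_Integration.integrable_bound)
    show "integrable lborel (\<lambda>y. indicator q y * C)" using iq by simp
    show "AE y in lborel. norm (indicator q y * f y) \<le> norm (indicator q y * C)"
      by (intro AE_I2) (simp add: indicator_def order_trans[OF that(2) abs_ge_self])
  qed measurable
  have i1: "integrable lborel (\<lambda>y. indicator q y * \<phi> y)" by (rule bnd[of _ B]) (use B in auto)
  have dB: "\<bar>\<phi> x - \<phi> y\<bar> \<le> 2 * B" for y using B(2)[of x] B(2)[of y] by simp
  have i2: "integrable lborel (\<lambda>y. indicator q y * (\<phi> x - \<phi> y))" by (rule bnd[OF _ dB]) measurable
  have i3: "integrable lborel (\<lambda>y. indicator q y * (\<phi> x - \<phi> y)\<^sup>2)"
  proof (rule bnd)
    show "\<bar>(\<phi> x - \<phi> y)\<^sup>2\<bar> \<le> (2 * B)\<^sup>2" for y using power_mono[OF dB[of y], of 2] by simp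
  qed measurable
  define I J where "I = (LINT y|lborel. indicator q y * \<phi> y)" and "J = (LINT y|lborel. indicator q y * (\<phi> x - \<phi> y)\<^sup>2)"
  have wx: "w * \<phi> x = I + (LINT y|lborel. indicator q y * (\<phi> x - \<phi> y))"
  proof -
    have "I + (LINT y|lborel. indicator q y * (\<phi> x - \<phi> y)) = (LINT y|lborel. indicator q y * \<phi> y + indicator q y * (\<phi> x - \<phi> y))"
      unfolding I_def using i1 i2 by simp
    also have "\<dots> = (LINT y|lborel. indicator q y * \<phi> x)" by (simp add: algebra_simps)
    also have "\<dots> = w * \<phi> x" using iq by (simp add: w_def)
    finally show ?thesis by simp
  qed
  have CS: "(LINT y|lborel. indicator q y * (\<phi> x - \<phi> y))\<^sup>2 \<le> w * J"
  proof -
    define a b where "a y = (indicator q y :: real)" and "b y = indicator q y * (\<phi> x - \<phi> y)" for y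
    have ab: "a y \<bullet> b y = indicator q y * (\<phi> x - \<phi> y)" and a2: "(norm (a y))\<^sup>2 = indicator q y"
      and b2: "(norm (b y))\<^sup>2 = indicator q y * (\<phi> x - \<phi> y)\<^sup>2" for y by (simp_all add: a_def b_def indicator_def)
    have "a \<in> borel_measurable lborel" "b \<in> borel_measurable lborel"
      unfolding a_def[abs_def] b_def[abs_def] by measurable
    then have s: "sq_int lborel a" "sq_int lborel b" unfolding sq_int_def a2 b2 using iq i3 by blast+
    have "\<bar>LINT y|lborel. indicator q y * (\<phi> x - \<phi> y)\<bar>\<^sup>2 \<le> (l2norm lborel a * l2norm lborel b)\<^sup>2"
      using l2_Cauchy_Schwarz[OF s] unfolding ab by (intro power_mono) auto
    also have "\<dots> = w * J"
      unfolding power_mult_distrib l2norm_sq a2 b2 J_def w_def by simp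
    finally show ?thesis by simp
  qed
  have J0: "J \<ge> 0" unfolding J_def by (intro integral_nonneg_AE AE_I2) simp
  have "(w * \<phi> x)\<^sup>2 \<le> 2 * I\<^sup>2 + 2 * (w * J)"
  proof -
    have "(s + t)\<^sup>2 \<le> 2 * s\<^sup>2 + 2 * t\<^sup>2" for s t :: real
      using sum_squares_bound[of s t] by (simp add: power2_sum)
    from this[of I "LINT y|lborel. indicator q y * (\<phi> x - \<phi> y)"] CS show ?thesis unfolding wx by linarith
  qed
  then have "(\<phi> x)\<^sup>2 \<le> (2 * I\<^sup>2 + 2 * (w * J)) / w\<^sup>2"
    using w0 by (simp add: pos_le_divide_eq power_mult_distrib mult.commute)
  also have "\<dots> = 2 * I\<^sup>2 / w\<^sup>2 + 2 * J / w" using w0 by (simp add: field_simps power2_eq_square)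
  also have "\<dots> \<le> 2 * I\<^sup>2 / (h ^ DIM('a))\<^sup>2 + 2 * J / h ^ DIM('a)"
    using wge hp J0 h by (intro add_mono divide_left_mono power_mono mult_pos_pos zero_less_power w0) auto
  finally have "ennreal ((\<phi> x)\<^sup>2) \<le> ennreal (2 / (h ^ DIM('a))\<^sup>2 * I\<^sup>2 + 2 / h ^ DIM('a) * J)"
    by (intro ennreal_leI) (simp add: field_simps)
  also have "\<dots> = ennreal (2 / (h ^ DIM('a))\<^sup>2 * I\<^sup>2) + ennreal (2 / h ^ DIM('a)) * ennreal J"
    using hp J0 ennreal_mult[of "2 / h ^ DIM('a)" J] by (subst ennreal_plus) simp_all
  also have "ennreal J \<le> (\<integral>\<^sup>+z. ennreal ((\<phi> (x + z) - \<phi> x)\<^sup>2) * indicator (cball 0 (h * DIM('a))) z \<partial>lborel)"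
  proof -
    have "ennreal J = (\<integral>\<^sup>+y. ennreal (indicator q y * (\<phi> x - \<phi> y)\<^sup>2) \<partial>lborel)"
      unfolding J_def using i3 by (intro nn_integral_eq_integral[symmetric]) auto
    also have "\<dots> = (\<integral>\<^sup>+z. ennreal (indicator q (x + z) * (\<phi> x - \<phi> (x + z))\<^sup>2) \<partial>lborel)"
      by (rule nn_integral_lborel_shift[symmetric]) measurable
    also have "\<dots> \<le> (\<integral>\<^sup>+z. ennreal ((\<phi> (x + z) - \<phi> x)\<^sup>2) * indicator (cball 0 (h * DIM('a))) z \<partial>lborel)"
    proof (rule nn_integral_mono)
      fix z
      show "ennreal (indicator q (x + z) * (\<phi> x - \<phi> (x + z))\<^sup>2)
        \<le> ennreal ((\<phi> (x + z) - \<phi> x)\<^sup>2) * indicator (cball 0 (h * DIM('a))) z"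
      proof (cases "x + z \<in> q")
        case True
        then have "dist x (x + z) \<le> h * DIM('a)"
          unfolding q_def cell_def by (intro cell_dist[OF h]) simp
        then have "z \<in> cball 0 (h * DIM('a))" by (simp add: dist_norm)
        then show ?thesis using True by (simp add: power2_commute)
      qed simp
    qed
    finally show ?thesis .
  qed
  finally show ?thesis unfolding I_def q_def by (simp add: mult_left_mono add_left_mono)
qed

lemma local_compactness:
  assumes "\<eta> > 0"
  shows "\<exists>F C. finite F \<and> C \<ge> 0 \<and> (\<forall>q\<in>F. q \<in> sets borel \<and> bounded q) \<and>
    (\<forall>\<phi>\<in>test_functions (UNIV :: 'a::euclidean_space set).
      (LINT x|lborel. indicator (cball 0 m) x * (\<phi> x)\<^sup>2)
      \<le> \<eta> * (LINT x|lborel. (norm (grad \<phi> x))\<^sup>2) + C * (\<Sum>q\<in>F. (LINT x|lborel. indicator q x * \<phi> x)\<^sup>2))"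
proof -
  define N V where "N = real DIM('a)" and "V = unit_ball_vol DIM('a)"
  have N: "N > 0" and V: "V > 0" unfolding N_def V_def by simp_all
  define h where "h = sqrt (\<eta> / (2 * V * N ^ DIM('a) * N\<^sup>2))"
  have h: "h > 0" and h2: "h\<^sup>2 = \<eta> / (2 * V * N ^ DIM('a) * N\<^sup>2)"
    unfolding h_def using assms N V by simp_all
  define F where "F = cell h ` cell_index h ` cball (0::'a) m"
  define C where "C = 2 / (h ^ DIM('a))\<^sup>2 * measure lborel (cball (0::'a) m)"
  have "finite F" unfolding F_def by (intro finite_imageI finite_cell_index h)
  moreover have "C \<ge> 0" unfolding C_def by simp
  moreover have "\<forall>q\<in>F. q \<in> sets borel \<and> bounded q" unfolding F_def using cell_borel cell_bounded[OF h] by auto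
  moreover have "(LINT x|lborel. indicator (cball 0 m) x * (\<phi> x)\<^sup>2)
      \<le> \<eta> * (LINT x|lborel. (norm (grad \<phi> x))\<^sup>2) + C * (\<Sum>q\<in>F. (LINT x|lborel. indicator q x * \<phi> x)\<^sup>2)"
    if \<phi>: "\<phi> \<in> test_functions UNIV" for \<phi> :: "'a \<Rightarrow> real"
  proof -
    have [measurable]: "\<phi> \<in> borel_measurable borel"
      by (rule cont_cs_measurable[OF test_functions_cont_cs[OF \<phi>]])
    have [measurable]: "cball (0::'a) s \<in> sets borel" for s by simp
    let ?Q = "cball (0::'a) m" and ?r = "h * real DIM('a)"
    define S b where "S = (\<Sum>q\<in>F. (LINT x|lborel. indicator q x * \<phi> x)\<^sup>2)"
      and "b = (LINT x|lborel. (norm (grad \<phi> x))\<^sup>2)"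
    have S0: "S \<ge> 0" unfolding S_def by (intro sum_nonneg) simp
    have b0: "b \<ge> 0" unfolding b_def by simp
    have bnn: "(\<integral>\<^sup>+x. ennreal ((norm (grad \<phi> x))\<^sup>2) \<partial>lborel) = ennreal b"
      unfolding b_def by (intro nn_integral_eq_integral cont_cs_integrable cont_cs_norm_sq test_functions_grad_cont_cs[OF \<phi>]) simp
    define c where "c = 2 / (h ^ DIM('a))\<^sup>2 * S"
    have c0: "c \<ge> 0" unfolding c_def using S0 by simp
    have le: "ennreal (indicator ?Q x * (\<phi> x)\<^sup>2) \<le> ennreal c * indicator ?Q x
        + ennreal (2 / h ^ DIM('a)) * (\<integral>\<^sup>+z. ennreal ((\<phi> (x + z) - \<phi> x)\<^sup>2) * indicator (cball 0 ?r) z \<partial>lborel)" for x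
    proof (cases "x \<in> ?Q")
      case True
      have "(LINT y|lborel. indicator (cell h (cell_index h x)) y * \<phi> y)\<^sup>2 \<le> S"
        unfolding S_def using True \<open>finite F\<close>
        by (intro member_le_sum[of "cell h (cell_index h x)" F]) (auto simp: F_def)
      then have "ennreal (2 / (h ^ DIM('a))\<^sup>2 * (LINT y|lborel. indicator (cell h (cell_index h x)) y * \<phi> y)\<^sup>2) \<le> ennreal c"
        unfolding c_def by (intro ennreal_leI mult_left_mono) auto
      with cell_average_bound[OF \<phi> h, of x] show ?thesis
        using True by (simp add: order_trans[OF _ add_right_mono])
    qed simp
    have "(\<integral>\<^sup>+x. \<integral>\<^sup>+z. ennreal ((\<phi> (x + z) - \<phi> x)\<^sup>2) * indicator (cball 0 ?r) z \<partial>lborel \<partial>lborel)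
        = (\<integral>\<^sup>+z. \<integral>\<^sup>+x. ennreal ((\<phi> (x + z) - \<phi> x)\<^sup>2) * indicator (cball 0 ?r) z \<partial>lborel \<partial>lborel)"
      by (rule lborel_pair.Fubini'[symmetric]) measurable
    also have "\<dots> \<le> (\<integral>\<^sup>+z. ennreal (?r\<^sup>2 * b) * indicator (cball (0::'a) ?r) z \<partial>lborel)"
    proof (rule nn_integral_mono)
      fix z :: 'a
      show "(\<integral>\<^sup>+x. ennreal ((\<phi> (x + z) - \<phi> x)\<^sup>2) * indicator (cball 0 ?r) z \<partial>lborel)
          \<le> ennreal (?r\<^sup>2 * b) * indicator (cball 0 ?r) z"
      proof (cases "z \<in> cball 0 ?r")
        case True
        have "(\<integral>\<^sup>+x. ennreal ((\<phi> (x + z) - \<phi> x)\<^sup>2) \<partial>lborel) \<le> ennreal ((norm z)\<^sup>2) * ennreal b"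
          using l2_increment_le[OF \<phi>, of z] unfolding bnn .
        also have "\<dots> = ennreal ((norm z)\<^sup>2 * b)" using b0 by (simp add: ennreal_mult)
        also have "\<dots> \<le> ennreal (?r\<^sup>2 * b)"
          using True b0 by (intro ennreal_leI mult_right_mono power_mono) auto
        finally show ?thesis using True by simp
      qed simp
    qed
    also have "\<dots> = ennreal (?r\<^sup>2 * b) * emeasure lborel (cball (0::'a) ?r)"
      by (subst nn_integral_cmult) simp_all
    also have "emeasure lborel (cball (0::'a) ?r) = ennreal (V * ?r ^ DIM('a))"
      unfolding V_def using h by (intro emeasure_cball) simp
    finally have JJ: "(\<integral>\<^sup>+x. \<integral>\<^sup>+z. ennreal ((\<phi> (x + z) - \<phi> x)\<^sup>2) * indicator (cball 0 ?r) z \<partial>lborel \<partial>lborel)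
        \<le> ennreal (?r\<^sup>2 * b) * ennreal (V * ?r ^ DIM('a))" .
    have "ennreal (LINT x|lborel. indicator ?Q x * (\<phi> x)\<^sup>2) = (\<integral>\<^sup>+x. ennreal (indicator ?Q x * (\<phi> x)\<^sup>2) \<partial>lborel)"
    proof (rule nn_integral_eq_integral[symmetric])
      have "integrable lborel (\<lambda>x. indicator ?Q x *\<^sub>R (\<phi> x)\<^sup>2)"
        by (rule borel_integrable_compact)
           (auto intro!: continuous_intros continuous_on_subset[OF cont_cs_continuous[OF test_functions_cont_cs[OF \<phi>]]])
      then show "integrable lborel (\<lambda>x. indicator ?Q x * (\<phi> x)\<^sup>2)" by simp
    qed simp
    also have "\<dots> \<le> (\<integral>\<^sup>+x. ennreal c * indicator ?Q x
        + ennreal (2 / h ^ DIM('a)) * (\<integral>\<^sup>+z. ennreal ((\<phi> (x + z) - \<phi> x)\<^sup>2) * indicator (cball 0 ?r) z \<partial>lborel) \<partial>lborel)"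
      by (intro nn_integral_mono le)
    also have "\<dots> = (\<integral>\<^sup>+x. ennreal c * indicator ?Q x \<partial>lborel)
        + (\<integral>\<^sup>+x. ennreal (2 / h ^ DIM('a)) * (\<integral>\<^sup>+z. ennreal ((\<phi> (x + z) - \<phi> x)\<^sup>2) * indicator (cball 0 ?r) z \<partial>lborel) \<partial>lborel)"
      by (rule nn_integral_add) measurable
    also have "(\<integral>\<^sup>+x. ennreal c * indicator ?Q x \<partial>lborel) = ennreal c * emeasure lborel ?Q"
      by (rule nn_integral_cmult_indicator) simp
    also have "(\<integral>\<^sup>+x. ennreal (2 / h ^ DIM('a)) * (\<integral>\<^sup>+z. ennreal ((\<phi> (x + z) - \<phi> x)\<^sup>2) * indicator (cball 0 ?r) z \<partial>lborel) \<partial>lborel)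
        = ennreal (2 / h ^ DIM('a)) * (\<integral>\<^sup>+x. \<integral>\<^sup>+z. ennreal ((\<phi> (x + z) - \<phi> x)\<^sup>2) * indicator (cball 0 ?r) z \<partial>lborel \<partial>lborel)"
      by (rule nn_integral_cmult) measurable
    also have "ennreal c * emeasure lborel ?Q + ennreal (2 / h ^ DIM('a))
          * (\<integral>\<^sup>+x. \<integral>\<^sup>+z. ennreal ((\<phi> (x + z) - \<phi> x)\<^sup>2) * indicator (cball 0 ?r) z \<partial>lborel \<partial>lborel)
        \<le> ennreal c * emeasure lborel ?Q + ennreal (2 / h ^ DIM('a)) * (ennreal (?r\<^sup>2 * b) * ennreal (V * ?r ^ DIM('a)))"
      by (intro add_left_mono mult_left_mono JJ) simp
    also have "emeasure lborel ?Q = ennreal (measure lborel ?Q)"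
      by (rule emeasure_eq_ennreal_measure) (use emeasure_bounded_finite[OF bounded_cball, of "0::'a" m] in auto)
    also have "ennreal c * ennreal (measure lborel ?Q) + ennreal (2 / h ^ DIM('a)) * (ennreal (?r\<^sup>2 * b) * ennreal (V * ?r ^ DIM('a)))
        = ennreal (c * measure lborel ?Q + 2 / h ^ DIM('a) * ((?r\<^sup>2 * b) * (V * ?r ^ DIM('a))))"
    proof -
      have *: "ennreal s * ennreal t + ennreal p * (ennreal u * ennreal v) = ennreal (s * t + p * (u * v))"
        if "s \<ge> 0" "t \<ge> 0" "p \<ge> 0" "u \<ge> 0" "v \<ge> 0" for s t p u v
        using that by (simp add: ennreal_mult)
      have "0 \<le> 2 / h ^ DIM('a)" "0 \<le> ?r\<^sup>2 * b" "0 \<le> V * ?r ^ DIM('a)"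
        using b0 h V by simp_all
      then show ?thesis by (rule *[OF c0 measure_nonneg])
    qed
    also have "c * measure lborel ?Q = C * S" unfolding c_def C_def by simp
    also have "2 / h ^ DIM('a) * ((?r\<^sup>2 * b) * (V * ?r ^ DIM('a))) = (2 * V * N ^ DIM('a) * N\<^sup>2) * h\<^sup>2 * b"
      using h unfolding N_def by (simp add: power_mult_distrib field_simps)
    also have "\<dots> = \<eta> * b" using N V by (simp add: h2)
    finally have "ennreal (LINT x|lborel. indicator ?Q x * (\<phi> x)\<^sup>2) \<le> ennreal (C * S + \<eta> * b)" .
    then show ?thesis
      using \<open>C \<ge> 0\<close> S0 b0 assms unfolding S_def[symmetric] b_def[symmetric]
      by (subst (asm) ennreal_le_iff) (auto simp: add.commute)
  qed
  ultimately show ?thesis by blast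
qed

subsection \<open>The energy space\<close>

lemma l2_fatou:
  assumes f: "\<And>n. sq_int M (fs n)" "f \<in> borel_measurable M"
    and lim: "AE x in M. (\<lambda>n. fs n x) \<longlonglongrightarrow> f x"
    and c: "\<And>n. l2norm M (fs n) \<le> c n" "c \<longlonglongrightarrow> C"
  shows "sq_int M f \<and> l2norm M f \<le> C"
proof -
  have [measurable]: "fs n \<in> borel_measurable M" "f \<in> borel_measurable M" for n
    using f sq_int_measurable by blast+
  have c0: "c n \<ge> 0" for n using c(1)[of n] l2norm_nonneg[of M "fs n"] by linarith
  then have C0: "C \<ge> 0" by (intro LIMSEQ_le_const[OF c(2)]) auto
  have "(\<integral>\<^sup>+x. ennreal ((norm (f x))\<^sup>2) \<partial>M) = (\<integral>\<^sup>+x. liminf (\<lambda>n. ennreal ((norm (fs n x))\<^sup>2)) \<partial>M)"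
  proof (rule nn_integral_cong_AE)
    show "AE x in M. ennreal ((norm (f x))\<^sup>2) = liminf (\<lambda>n. ennreal ((norm (fs n x))\<^sup>2))"
      using lim
    proof eventually_elim
      case (elim x)
      have "(\<lambda>n. ennreal ((norm (fs n x))\<^sup>2)) \<longlonglongrightarrow> ennreal ((norm (f x))\<^sup>2)"
        by (intro tendsto_ennrealI tendsto_intros elim)
      from lim_imp_Liminf[OF _ this] show ?case by simp
    qed
  qed
  also have "\<dots> \<le> liminf (\<lambda>n. \<integral>\<^sup>+x. ennreal ((norm (fs n x))\<^sup>2) \<partial>M)"
    by (rule nn_integral_liminf) measurable
  also have "\<dots> \<le> liminf (\<lambda>n. ennreal ((c n)\<^sup>2))"
  proof (intro Liminf_mono always_eventually allI)
    fix n
    have "(\<integral>\<^sup>+x. ennreal ((norm (fs n x))\<^sup>2) \<partial>M) = ennreal ((l2norm M (fs n))\<^sup>2)"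
      unfolding l2norm_sq by (intro nn_integral_eq_integral sq_int_integrable f) auto
    also have "\<dots> \<le> ennreal ((c n)\<^sup>2)"
      using c(1)[of n] by (intro ennreal_leI power_mono) (auto simp: l2norm_nonneg)
    finally show "(\<integral>\<^sup>+x. ennreal ((norm (fs n x))\<^sup>2) \<partial>M) \<le> ennreal ((c n)\<^sup>2)" .
  qed
  also have "\<dots> = ennreal (C\<^sup>2)"
    by (rule lim_imp_Liminf) (auto intro!: tendsto_ennrealI tendsto_intros c(2))
  finally have le: "(\<integral>\<^sup>+x. ennreal ((norm (f x))\<^sup>2) \<partial>M) \<le> ennreal (C\<^sup>2)" .
  have i: "integrable M (\<lambda>x. (norm (f x))\<^sup>2)"
    using le by (intro integrableI_bounded) (auto intro: le_less_trans)
  have "ennreal ((l2norm M f)\<^sup>2) \<le> ennreal (C\<^sup>2)"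
    using le unfolding l2norm_sq by (subst (asm) nn_integral_eq_integral[OF i]) auto
  then have "(l2norm M f)\<^sup>2 \<le> C\<^sup>2" by simp
  then have "l2norm M f \<le> C" using C0 by (rule power2_le_imp_le)
  with i show ?thesis by (simp add: sq_int_def)
qed

locale sobolev =
  fixes \<Omega> :: "'a::euclidean_space set" and lam :: real
  assumes open_dom: "open \<Omega>" and lam_pos: "lam > 0" and dim_le: "DIM('a) \<le> 3"
begin

abbreviation M :: "'a measure" where "M \<equiv> lebesgue_on \<Omega>"
abbreviation W :: "('a \<Rightarrow> real) \<Rightarrow> 'a \<Rightarrow> 'a" where "W \<equiv> wgrad \<Omega>"

definition ip :: "('a \<Rightarrow> real) \<Rightarrow> ('a \<Rightarrow> real) \<Rightarrow> real" where
  "ip u v = (LINT x|M. W u x \<bullet> W v x + lam * u x * v x)"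

definition nrm :: "('a \<Rightarrow> real) \<Rightarrow> real" where
  "nrm u = sqrt (ip u u)"

lemma ip_eq:
  assumes "has_wgrad \<Omega> u g" "has_wgrad \<Omega> v h"
  shows "ip u v = (LINT x|M. g x \<bullet> h x) + lam * (LINT x|M. u x * v x)"
proof -
  note u = has_wgradD[OF assms(1)] and v = has_wgradD[OF assms(2)]
  note wu = has_wgrad_wgrad[OF has_wgrad_imp_H1[OF assms(1)]] and wv = has_wgrad_wgrad[OF has_wgrad_imp_H1[OF assms(2)]]
  note m = sq_int_measurable[OF has_wgradD(2)[OF wu]] sq_int_measurable[OF has_wgradD(2)[OF wv]]
    sq_int_measurable[OF u(1)] sq_int_measurable[OF u(2)] sq_int_measurable[OF v(1)] sq_int_measurable[OF v(2)]
  have "ip u v = (LINT x|M. g x \<bullet> h x + lam * (u x * v x))"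
    unfolding ip_def
  proof (rule integral_cong_AE)
    show "AE x in M. W u x \<bullet> W v x + lam * u x * v x = g x \<bullet> h x + lam * (u x * v x)"
      using has_wgrad_unique[OF open_dom wu assms(1)] has_wgrad_unique[OF open_dom wv assms(2)]
      by eventually_elim simp
  qed (intro borel_measurable_add borel_measurable_inner borel_measurable_times borel_measurable_const m)+
  also have "\<dots> = (LINT x|M. g x \<bullet> h x) + lam * (LINT x|M. u x * v x)"
    using sq_int_inner[OF u(2) v(2)] sq_int_mult[OF u(1) v(1)] by simp
  finally show ?thesis .
qed

lemma ip_commute: "ip u v = ip v u"
  unfolding ip_def by (simp add: inner_commute mult_ac)

lemma H1_add: "u \<in> H1 \<Omega> \<Longrightarrow> v \<in> H1 \<Omega> \<Longrightarrow> (\<lambda>x. u x + v x) \<in> H1 \<Omega>"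
  by (rule has_wgrad_imp_H1[OF has_wgrad_add[OF open_dom has_wgrad_wgrad has_wgrad_wgrad]])

lemma H1_cmult: "u \<in> H1 \<Omega> \<Longrightarrow> (\<lambda>x. c * u x) \<in> H1 \<Omega>"
  by (rule has_wgrad_imp_H1[OF has_wgrad_cmult[OF has_wgrad_wgrad]])

lemma H1_diff: "u \<in> H1 \<Omega> \<Longrightarrow> v \<in> H1 \<Omega> \<Longrightarrow> (\<lambda>x. u x - v x) \<in> H1 \<Omega>"
  by (rule has_wgrad_imp_H1[OF has_wgrad_diff[OF open_dom has_wgrad_wgrad has_wgrad_wgrad]])

lemma H1_test: "\<phi> \<in> test_functions \<Omega> \<Longrightarrow> \<phi> \<in> H1 \<Omega>"
  by (rule has_wgrad_imp_H1[OF has_wgrad_test[OF open_dom]])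

lemma H1_sq_int: "u \<in> H1 \<Omega> \<Longrightarrow> sq_int M u" "u \<in> H1 \<Omega> \<Longrightarrow> sq_int M (W u)"
  by (simp_all add: has_wgradD[OF has_wgrad_wgrad])

lemma ip_add_left:
  assumes "u \<in> H1 \<Omega>" "v \<in> H1 \<Omega>" "w \<in> H1 \<Omega>"
  shows "ip (\<lambda>x. u x + v x) w = ip u w + ip v w"
proof -
  note u = has_wgrad_wgrad[OF assms(1)] and v = has_wgrad_wgrad[OF assms(2)] and w = has_wgrad_wgrad[OF assms(3)]
  note s = H1_sq_int[OF assms(1)] H1_sq_int[OF assms(2)] H1_sq_int[OF assms(3)]
  show ?thesis
    unfolding ip_eq[OF has_wgrad_add[OF open_dom u v] w] ip_eq[OF u w] ip_eq[OF v w]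
    using sq_int_inner[OF s(2) s(6)] sq_int_inner[OF s(4) s(6)] sq_int_mult[OF s(1) s(5)] sq_int_mult[OF s(3) s(5)]
    by (simp add: inner_add_left distrib_right distrib_left)
qed

lemma ip_cmult_left:
  assumes "u \<in> H1 \<Omega>" "v \<in> H1 \<Omega>"
  shows "ip (\<lambda>x. c * u x) v = c * ip u v"
proof -
  note u = has_wgrad_wgrad[OF assms(1)] and v = has_wgrad_wgrad[OF assms(2)]
  show ?thesis
    unfolding ip_eq[OF has_wgrad_cmult[OF u] v] ip_eq[OF u v]
    by (simp add: mult.assoc distrib_left)
qed

lemma ip_diff_left:
  assumes "u \<in> H1 \<Omega>" "v \<in> H1 \<Omega>" "w \<in> H1 \<Omega>"
  shows "ip (\<lambda>x. u x - v x) w = ip u w - ip v w"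
  using ip_add_left[OF assms(1) H1_cmult[OF assms(2), of "-1"] assms(3)] ip_cmult_left[OF assms(2,3), of "-1"] by simp

lemma ip_add_right: "u \<in> H1 \<Omega> \<Longrightarrow> v \<in> H1 \<Omega> \<Longrightarrow> w \<in> H1 \<Omega> \<Longrightarrow> ip w (\<lambda>x. u x + v x) = ip w u + ip w v"
  and ip_cmult_right: "u \<in> H1 \<Omega> \<Longrightarrow> v \<in> H1 \<Omega> \<Longrightarrow> ip v (\<lambda>x. c * u x) = c * ip v u"
  and ip_diff_right: "u \<in> H1 \<Omega> \<Longrightarrow> v \<in> H1 \<Omega> \<Longrightarrow> w \<in> H1 \<Omega> \<Longrightarrow> ip w (\<lambda>x. u x - v x) = ip w u - ip w v"
  using ip_add_left[of u v w] ip_cmult_left[of u v c] ip_diff_left[of u v w]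
    ip_commute[of w u] ip_commute[of w v] ip_commute[of v u] ip_commute[of w "\<lambda>x. u x + v x"]
    ip_commute[of w "\<lambda>x. u x - v x"] ip_commute[of v "\<lambda>x. c * u x"] by simp_all

lemma ip_self: "u \<in> H1 \<Omega> \<Longrightarrow> ip u u = (l2norm M (W u))\<^sup>2 + lam * (l2norm M u)\<^sup>2"
  unfolding l2norm_sq power2_norm_eq_inner inner_real_def
  by (rule ip_eq[OF has_wgrad_wgrad has_wgrad_wgrad])

lemma ip_nonneg: "u \<in> H1 \<Omega> \<Longrightarrow> ip u u \<ge> 0"
  using lam_pos by (simp add: ip_self)

lemma nrm_sq: "u \<in> H1 \<Omega> \<Longrightarrow> (nrm u)\<^sup>2 = ip u u"
  by (simp add: nrm_def ip_nonneg)

lemma nrm_nonneg: "u \<in> H1 \<Omega> \<Longrightarrow> nrm u \<ge> 0"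
  by (simp add: nrm_def ip_nonneg)

lemma ip_Cauchy_Schwarz:
  assumes "u \<in> H1 \<Omega>" "v \<in> H1 \<Omega>"
  shows "\<bar>ip u v\<bar> \<le> nrm u * nrm v"
proof -
  have "ip u u + 2 * ip u v * t + ip v v * t\<^sup>2 \<ge> 0" for t
    using ip_nonneg[OF H1_add[OF assms(1) H1_cmult[OF assms(2)], of t]] assms
    by (simp add: ip_add_left ip_add_right ip_cmult_left ip_cmult_right H1_add H1_cmult ip_commute[of v u]
        power2_eq_square algebra_simps)
  then have "(ip u v)\<^sup>2 \<le> ip u u * ip v v"
    by (intro discriminant_nonpos ip_nonneg assms) auto
  also have "\<dots> = (nrm u * nrm v)\<^sup>2" by (simp add: power_mult_distrib nrm_sq assms)
  finally show ?thesis using nrm_nonneg[OF assms(1)] nrm_nonneg[OF assms(2)] by (simp add: abs_le_square_iff[symmetric])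
qed

lemma nrm_triangle:
  assumes "u \<in> H1 \<Omega>" "v \<in> H1 \<Omega>"
  shows "nrm (\<lambda>x. u x + v x) \<le> nrm u + nrm v"
proof (rule power2_le_imp_le)
  show "(nrm (\<lambda>x. u x + v x))\<^sup>2 \<le> (nrm u + nrm v)\<^sup>2"
    using ip_Cauchy_Schwarz[OF assms] assms
    by (simp add: nrm_sq H1_add power2_sum ip_add_left ip_add_right ip_commute[of v u])
qed (simp add: nrm_nonneg assms)

lemma nrm_cmult: "u \<in> H1 \<Omega> \<Longrightarrow> nrm (\<lambda>x. c * u x) = \<bar>c\<bar> * nrm u"
  by (simp add: nrm_def ip_cmult_left ip_cmult_right H1_cmult real_sqrt_mult mult.assoc[symmetric]
      flip: power2_eq_square)

lemma nrm_minus: "u \<in> H1 \<Omega> \<Longrightarrow> v \<in> H1 \<Omega> \<Longrightarrow> nrm (\<lambda>x. u x - v x) = nrm (\<lambda>x. v x - u x)"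
  using nrm_cmult[OF H1_diff, of u v "-1"] by simp

lemma nrm_triangle_diff:
  assumes "u \<in> H1 \<Omega>" "v \<in> H1 \<Omega>" "w \<in> H1 \<Omega>"
  shows "nrm (\<lambda>x. u x - w x) \<le> nrm (\<lambda>x. u x - v x) + nrm (\<lambda>x. v x - w x)"
  using nrm_triangle[OF H1_diff[OF assms(1,2)] H1_diff[OF assms(2,3)]] by simp

lemma nrm_diff_le:
  assumes "u \<in> H1 \<Omega>" "v \<in> H1 \<Omega>"
  shows "\<bar>nrm u - nrm v\<bar> \<le> nrm (\<lambda>x. u x - v x)"
  using nrm_triangle[OF H1_diff[OF assms] assms(2)] nrm_triangle[OF H1_diff[OF assms(2,1)] assms(1)] nrm_minus[OF assms]
  by simp

lemma H1_norm_sq: "u \<in> H1 \<Omega> \<Longrightarrow> (H1_norm \<Omega> u)\<^sup>2 = (l2norm M u)\<^sup>2 + (l2norm M (W u))\<^sup>2"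
  using H1_norm_eq[OF open_dom has_wgrad_wgrad, of u] l2norm_Pair_sq[OF H1_sq_int, of u u] by simp

definition eqc :: real where "eqc = sqrt (1 + lam + 1 / lam)"

lemma eqc_pos: "eqc > 0" and eqc_sq: "eqc\<^sup>2 = 1 + lam + 1 / lam"
  using lam_pos by (simp_all add: eqc_def add_pos_pos)

lemma H1_norm_le_nrm: "H1_norm \<Omega> u \<le> eqc * nrm u" and nrm_le_H1_norm: "nrm u \<le> eqc * H1_norm \<Omega> u"
  if "u \<in> H1 \<Omega>"
proof -
  let ?a = "(l2norm M u)\<^sup>2" and ?b = "(l2norm M (W u))\<^sup>2"
  have 1: "?a + ?b \<le> (1 + lam + 1 / lam) * (?b + lam * ?a)"
    using lam_pos by (simp add: field_simps add_nonneg_nonneg)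
  show "H1_norm \<Omega> u \<le> eqc * nrm u"
  proof (rule power2_le_imp_le)
    show "(H1_norm \<Omega> u)\<^sup>2 \<le> (eqc * nrm u)\<^sup>2"
      using 1 that by (simp add: power_mult_distrib eqc_sq nrm_sq ip_self H1_norm_sq)
  qed (use eqc_pos nrm_nonneg[OF that] in simp)
  have 2: "?b + lam * ?a \<le> (1 + lam + 1 / lam) * (?a + ?b)"
    using lam_pos by (simp add: field_simps add_nonneg_nonneg)
  show "nrm u \<le> eqc * H1_norm \<Omega> u"
  proof (rule power2_le_imp_le)
    show "(nrm u)\<^sup>2 \<le> (eqc * H1_norm \<Omega> u)\<^sup>2"
      using 2 that by (simp add: power_mult_distrib eqc_sq nrm_sq ip_self H1_norm_sq)
  qed (intro mult_nonneg_nonneg less_imp_le[OF eqc_pos] H1_norm_nonneg)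
qed

lemma l2_le_nrm:
  assumes u: "u \<in> H1 \<Omega>" shows "l2norm M u \<le> eqc * nrm u"
proof -
  have "(l2norm M u)\<^sup>2 \<le> (H1_norm \<Omega> u)\<^sup>2" unfolding H1_norm_sq[OF u] by simp
  then have "l2norm M u \<le> H1_norm \<Omega> u" by (rule power2_le_imp_le[OF _ H1_norm_nonneg])
  with H1_norm_le_nrm[OF u] show ?thesis by linarith
qed

lemma W_l2_le_nrm:
  assumes u: "u \<in> H1 \<Omega>" shows "l2norm M (W u) \<le> nrm u"
proof (rule power2_le_imp_le[OF _ nrm_nonneg[OF u]])
  show "(l2norm M (W u))\<^sup>2 \<le> (nrm u)\<^sup>2" unfolding nrm_sq[OF u] ip_self[OF u] using lam_pos by simp
qed

lemma nrm_eq_0_imp: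
  assumes "u \<in> H1 \<Omega>" "nrm u = 0"
  shows "AE x in M. u x = 0"
  using l2_le_nrm[OF assms(1)] assms(2) l2norm_nonneg[of M u] l2norm_eq_0_iff[OF H1_sq_int(1)[OF assms(1)]] by simp

abbreviation D :: "('a \<Rightarrow> real) set" where "D \<equiv> H10 \<Omega>"

lemma D_H1: "u \<in> D \<Longrightarrow> u \<in> H1 \<Omega>"
  by (simp add: H10_def)

lemma D_iff: "u \<in> D \<longleftrightarrow> u \<in> H1 \<Omega> \<and> (\<forall>e>0. \<exists>\<phi>\<in>test_functions \<Omega>. nrm (\<lambda>x. u x - \<phi> x) < e)"
proof (intro iffI conjI allI impI)
  assume u: "u \<in> D"
  show h: "u \<in> H1 \<Omega>" using u by (rule D_H1)
  fix e :: real assume "e > 0"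
  then have "e / eqc > 0" using eqc_pos by simp
  then obtain \<phi> where p: "\<phi> \<in> test_functions \<Omega>" "H1_norm \<Omega> (\<lambda>x. u x - \<phi> x) < e / eqc"
    using u unfolding H10_def by blast
  have "nrm (\<lambda>x. u x - \<phi> x) \<le> eqc * H1_norm \<Omega> (\<lambda>x. u x - \<phi> x)"
    by (intro nrm_le_H1_norm H1_diff h H1_test p)
  also have "\<dots> < e" using p(2) eqc_pos by (simp add: field_simps)
  finally show "\<exists>\<phi>\<in>test_functions \<Omega>. nrm (\<lambda>x. u x - \<phi> x) < e" using p(1) by blast
next
  assume u: "u \<in> H1 \<Omega> \<and> (\<forall>e>0. \<exists>\<phi>\<in>test_functions \<Omega>. nrm (\<lambda>x. u x - \<phi> x) < e)"
  have "\<exists>\<phi>\<in>test_functions \<Omega>. H1_norm \<Omega> (\<lambda>x. u x - \<phi> x) < e" if "e > 0" for e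
  proof -
    have "e / eqc > 0" using eqc_pos that by simp
    then obtain \<phi> where p: "\<phi> \<in> test_functions \<Omega>" "nrm (\<lambda>x. u x - \<phi> x) < e / eqc"
      using u by blast
    have "H1_norm \<Omega> (\<lambda>x. u x - \<phi> x) \<le> eqc * nrm (\<lambda>x. u x - \<phi> x)"
      by (rule H1_norm_le_nrm[OF H1_diff[OF conjunct1[OF u] H1_test[OF p(1)]]])
    also have "\<dots> < e" using p(2) eqc_pos by (simp add: field_simps)
    finally show ?thesis using p(1) by blast
  qed
  with u show "u \<in> D" by (simp add: H10_def)
qed

lemma D_approx:
  assumes "u \<in> D"
  obtains \<phi> where "\<And>n::nat. \<phi> n \<in> test_functions \<Omega>" "(\<lambda>n. nrm (\<lambda>x. u x - \<phi> n x)) \<longlonglongrightarrow> 0"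
proof -
  have "\<forall>n. \<exists>\<phi>. \<phi> \<in> test_functions \<Omega> \<and> nrm (\<lambda>x. u x - \<phi> x) < inverse (real (Suc n))"
  proof
    fix n
    have "inverse (real (Suc n)) > 0" by simp
    then show "\<exists>\<phi>. \<phi> \<in> test_functions \<Omega> \<and> nrm (\<lambda>x. u x - \<phi> x) < inverse (real (Suc n))"
      using assms unfolding D_iff by blast
  qed
  from choice[OF this] obtain \<phi> where p: "\<And>n. \<phi> n \<in> test_functions \<Omega>"
      "\<And>n. nrm (\<lambda>x. u x - \<phi> n x) < inverse (real (Suc n))" by blast
  have "(\<lambda>n. nrm (\<lambda>x. u x - \<phi> n x)) \<longlonglongrightarrow> 0"
  proof (rule tendsto_sandwich[OF _ _ tendsto_const inverse_Suc_tendsto])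
    show "\<forall>\<^sub>F n in sequentially. 0 \<le> nrm (\<lambda>x. u x - \<phi> n x)"
      by (intro always_eventually allI nrm_nonneg H1_diff H1_test p D_H1 assms)
    show "\<forall>\<^sub>F n in sequentially. nrm (\<lambda>x. u x - \<phi> n x) \<le> inverse (real (Suc n))"
      by (intro always_eventually allI less_imp_le p)
  qed
  with p(1) show ?thesis by (rule that)
qed

lemma D_test: "\<phi> \<in> test_functions \<Omega> \<Longrightarrow> \<phi> \<in> D"
proof -
  assume p: "\<phi> \<in> test_functions \<Omega>"
  have "nrm (\<lambda>x. \<phi> x - \<phi> x) = 0"
    using nrm_cmult[OF H1_test[OF p], of 0] by simp
  then have "\<exists>\<psi>\<in>test_functions \<Omega>. nrm (\<lambda>x. \<phi> x - \<psi> x) < e" if "e > 0" for e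
    using that by (intro bexI[OF _ p]) simp
  with H1_test[OF p] show "\<phi> \<in> D" unfolding D_iff by blast
qed

lemma D_add:
  assumes "u \<in> D" "v \<in> D" shows "(\<lambda>x. u x + v x) \<in> D"
  unfolding D_iff
proof (intro conjI allI impI)
  note h = D_H1[OF assms(1)] D_H1[OF assms(2)]
  show "(\<lambda>x. u x + v x) \<in> H1 \<Omega>" by (intro H1_add h)
  fix e :: real assume "e > 0"
  then have "e / 2 > 0" by simp
  obtain \<phi> where p: "\<phi> \<in> test_functions \<Omega>" "nrm (\<lambda>x. u x - \<phi> x) < e / 2"
    using assms(1) \<open>e / 2 > 0\<close> unfolding D_iff by blast
  obtain \<psi> where q: "\<psi> \<in> test_functions \<Omega>" "nrm (\<lambda>x. v x - \<psi> x) < e / 2"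
    using assms(2) \<open>e / 2 > 0\<close> unfolding D_iff by blast
  have "nrm (\<lambda>x. u x + v x - (\<phi> x + \<psi> x)) = nrm (\<lambda>x. (u x - \<phi> x) + (v x - \<psi> x))"
    by (simp add: algebra_simps)
  also have "\<dots> \<le> nrm (\<lambda>x. u x - \<phi> x) + nrm (\<lambda>x. v x - \<psi> x)"
    by (intro nrm_triangle H1_diff h H1_test p q)
  finally have "nrm (\<lambda>x. u x + v x - (\<phi> x + \<psi> x)) < e" using p(2) q(2) by linarith
  then show "\<exists>\<phi>\<in>test_functions \<Omega>. nrm (\<lambda>x. u x + v x - \<phi> x) < e"
    using test_functions_add[OF p(1) q(1)] by (intro bexI[of _ "\<lambda>x. \<phi> x + \<psi> x"])
qed

lemma D_cmult:
  assumes "u \<in> D" shows "(\<lambda>x. c * u x) \<in> D"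
  unfolding D_iff
proof (intro conjI allI impI)
  note h = D_H1[OF assms]
  show "(\<lambda>x. c * u x) \<in> H1 \<Omega>" by (intro H1_cmult h)
  fix e :: real assume "e > 0"
  then have e: "e / (\<bar>c\<bar> + 1) > 0" by (simp add: add_nonneg_pos)
  obtain \<phi> where p: "\<phi> \<in> test_functions \<Omega>" "nrm (\<lambda>x. u x - \<phi> x) < e / (\<bar>c\<bar> + 1)"
    using assms e unfolding D_iff by blast
  have "nrm (\<lambda>x. c * u x - c * \<phi> x) = \<bar>c\<bar> * nrm (\<lambda>x. u x - \<phi> x)"
    using nrm_cmult[OF H1_diff[OF h H1_test[OF p(1)]], of c] by (simp add: right_diff_distrib)
  also have "\<dots> \<le> (\<bar>c\<bar> + 1) * nrm (\<lambda>x. u x - \<phi> x)"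
    using nrm_nonneg[OF H1_diff[OF h H1_test[OF p(1)]]] by (simp add: mult_right_mono)
  also have "\<dots> < e" using p(2) by (simp add: field_simps add_nonneg_pos)
  finally show "\<exists>\<phi>\<in>test_functions \<Omega>. nrm (\<lambda>x. c * u x - \<phi> x) < e"
    using test_functions_cmult[OF p(1)] by (intro bexI[of _ "\<lambda>x. c * \<phi> x"])
qed

lemma D_diff: "u \<in> D \<Longrightarrow> v \<in> D \<Longrightarrow> (\<lambda>x. u x - v x) \<in> D"
  using D_add[OF _ D_cmult[of v "-1"], of u] by simp

lemma D_closed:
  assumes "u \<in> H1 \<Omega>" "\<And>n. us n \<in> D" "(\<lambda>n. nrm (\<lambda>x. us n x - u x)) \<longlonglongrightarrow> 0"
  shows "u \<in> D"
  unfolding D_iff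
proof (intro conjI allI impI assms(1))
  fix e :: real assume "e > 0"
  then have "\<forall>\<^sub>F n in sequentially. nrm (\<lambda>x. us n x - u x) < e / 2"
    using assms(3) by (intro order_tendstoD(2)) auto
  then obtain n where n: "nrm (\<lambda>x. us n x - u x) < e / 2" by (auto simp: eventually_sequentially)
  have "e / 2 > 0" using \<open>e > 0\<close> by simp
  then obtain \<phi> where p: "\<phi> \<in> test_functions \<Omega>" "nrm (\<lambda>x. us n x - \<phi> x) < e / 2"
    using assms(2)[of n] unfolding D_iff by blast
  have "nrm (\<lambda>x. u x - \<phi> x) \<le> nrm (\<lambda>x. u x - us n x) + nrm (\<lambda>x. us n x - \<phi> x)"
    by (intro nrm_triangle_diff assms(1) D_H1 assms(2) H1_test p)
  then have "nrm (\<lambda>x. u x - \<phi> x) < e"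
    using n p(2) nrm_minus[OF assms(1) D_H1[OF assms(2)], of n] by linarith
  then show "\<exists>\<phi>\<in>test_functions \<Omega>. nrm (\<lambda>x. u x - \<phi> x) < e" using p(1) by blast
qed

abbreviation H :: "('a \<Rightarrow> real) set" where "H \<equiv> Hsp \<Omega>"

lemma H_D: "u \<in> H \<Longrightarrow> u \<in> D"
proof (cases "\<Omega> = UNIV")
  case True
  assume "u \<in> H"
  then have u: "u \<in> H1 UNIV" using True by (simp add: Hsp_def)
  have "\<exists>\<phi>\<in>test_functions UNIV. H1_norm UNIV (\<lambda>x. u x - \<phi> x) < e" if "e > 0" for e
  proof -
    note w = has_wgrad_wgrad[OF u]
    obtain \<phi> where p: "\<phi> \<in> test_functions UNIV"
        "l2norm (lebesgue_on UNIV) (\<lambda>x. (u x - \<phi> x, wgrad UNIV u x - grad \<phi> x)) < e"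
      using test_functions_dense_UNIV[OF w \<open>e > 0\<close>] by blast
    then show ?thesis
      using H1_norm_eq[OF open_UNIV has_wgrad_diff[OF open_UNIV w has_wgrad_test[OF open_UNIV p(1)]]]
      by (intro bexI[of _ \<phi>]) simp_all
  qed
  with u show "u \<in> D" by (simp add: H10_def True)
qed (simp add: Hsp_def)

lemma H_H1: "u \<in> H \<Longrightarrow> u \<in> H1 \<Omega>"
  using H_D D_H1 by blast

lemma H_add: "u \<in> H \<Longrightarrow> v \<in> H \<Longrightarrow> (\<lambda>x. u x + v x) \<in> H"
proof (cases "\<Omega> = UNIV")
  case True
  assume uv: "u \<in> H" "v \<in> H"
  have "radially_symmetric (\<lambda>x. u x + v x)"
    unfolding radially_symmetric_def
  proof (intro allI impI)
    fix T :: "'a \<Rightarrow> 'a" assume T: "orthogonal_transformation T"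
    have "AE x in lebesgue. u (T x) = u x" "AE x in lebesgue. v (T x) = v x"
      using uv T True by (simp_all add: Hsp_def radially_symmetric_def)
    then show "AE x in lebesgue. u (T x) + v (T x) = u x + v x" by eventually_elim simp
  qed
  then show "(\<lambda>x. u x + v x) \<in> H"
    using H1_add[of u v] uv True by (simp add: Hsp_def)
qed (simp add: Hsp_def D_add)

lemma H_cmult: "u \<in> H \<Longrightarrow> (\<lambda>x. c * u x) \<in> H"
proof (cases "\<Omega> = UNIV")
  case True
  assume u: "u \<in> H"
  have "radially_symmetric (\<lambda>x. c * u x)"
    unfolding radially_symmetric_def
  proof (intro allI impI)
    fix T :: "'a \<Rightarrow> 'a" assume T: "orthogonal_transformation T"
    have "AE x in lebesgue. u (T x) = u x"
      using u T True by (simp add: Hsp_def radially_symmetric_def)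
    then show "AE x in lebesgue. c * u (T x) = c * u x" by eventually_elim simp
  qed
  then show "(\<lambda>x. c * u x) \<in> H"
    using H1_cmult[of u c] u True by (simp add: Hsp_def)
qed (simp add: Hsp_def D_cmult)

lemma H_diff: "u \<in> H \<Longrightarrow> v \<in> H \<Longrightarrow> (\<lambda>x. u x - v x) \<in> H"
  using H_add[OF _ H_cmult[of v "-1"], of u] by simp

lemma AE_orthogonal_transformation:
  assumes T: "orthogonal_transformation (T :: 'a \<Rightarrow> 'a)" and P: "AE x in lebesgue. P x"
  shows "AE x in lebesgue. P (T x)"
proof -
  obtain N where N: "negligible N" "{x. \<not> P x} \<subseteq> N"
    using P unfolding eventually_ae_filter_negligible by blast
  define S where "S = inv T"
  have S: "orthogonal_transformation S" "\<And>x. S (T x) = x"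
    unfolding S_def using orthogonal_transformation_inv[OF T] inv_f_f[OF orthogonal_transformation_inj[OF T]] by simp_all
  have "negligible (S ` N)"
    by (rule negligible_differentiable_image_negligible[OF order_refl N(1)])
       (intro linear_imp_differentiable_on orthogonal_transformation_linear S(1))
  moreover have "{x. \<not> P (T x)} \<subseteq> S ` N"
  proof
    fix x assume "x \<in> {x. \<not> P (T x)}"
    then have "T x \<in> N" using N(2) by auto
    then have "S (T x) \<in> S ` N" by (rule imageI)
    then show "x \<in> S ` N" by (simp only: S(2))
  qed
  ultimately show ?thesis unfolding eventually_ae_filter_negligible by blast
qed

lemma H_complete:
  assumes "\<And>n. us n \<in> H" and "\<And>e. e > 0 \<Longrightarrow> \<exists>N. \<forall>m\<ge>N. \<forall>n\<ge>N. nrm (\<lambda>x. us m x - us n x) < e"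
  shows "\<exists>u\<in>H. (\<lambda>n. nrm (\<lambda>x. us n x - u x)) \<longlonglongrightarrow> 0"
proof -
  note h = H_H1[OF assms(1)]
  obtain w :: "'a \<Rightarrow> real" where w: "sq_int M w" "\<And>x. w x > 0"
    using ex_positive_sq_int_weight[OF open_dom] by blast
  let ?f = "\<lambda>n x. (us n x, W (us n) x)"
  have sf: "sq_int M (?f n)" for n by (intro sq_int_Pair H1_sq_int h)
  have eq: "l2norm M (\<lambda>x. ?f m x - ?f n x) = H1_norm \<Omega> (\<lambda>x. us m x - us n x)" for m n
    using H1_norm_eq[OF open_dom has_wgrad_diff[OF open_dom has_wgrad_wgrad[OF h] has_wgrad_wgrad[OF h]], of m n] by simp
  have C: "\<exists>N. \<forall>m\<ge>N. \<forall>n\<ge>N. l2norm M (\<lambda>x. ?f m x - ?f n x) < e" if "e > 0" for e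
  proof -
    have "e / eqc > 0" using that eqc_pos by simp
    then obtain N where N: "\<And>m n. m \<ge> N \<Longrightarrow> n \<ge> N \<Longrightarrow> nrm (\<lambda>x. us m x - us n x) < e / eqc"
      using assms(2) by blast
    have "l2norm M (\<lambda>x. ?f m x - ?f n x) < e" if "m \<ge> N" "n \<ge> N" for m n
    proof -
      have "l2norm M (\<lambda>x. ?f m x - ?f n x) \<le> eqc * nrm (\<lambda>x. us m x - us n x)"
        unfolding eq by (intro H1_norm_le_nrm H1_diff h)
      also have "\<dots> < e" using N[OF that] eqc_pos by (simp add: field_simps)
      finally show ?thesis .
    qed
    then show ?thesis by blast
  qed
  obtain f where f: "sq_int M f" "(\<lambda>n. l2norm M (\<lambda>x. ?f n x - f x)) \<longlonglongrightarrow> 0"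
    using l2_complete[OF w sf C] by blast
  define u g where "u = (\<lambda>x. fst (f x))" and "g = (\<lambda>x. snd (f x))"
  have ug: "sq_int M u" "sq_int M g"
    unfolding u_def g_def by (intro sq_int_linear[OF f(1)] bounded_linear_fst bounded_linear_snd)+
  have f_eq: "f x = (u x, g x)" for x by (simp add: u_def g_def)
  have P: "l2norm M (\<lambda>x. ?f n x - f x) = l2norm M (\<lambda>x. (us n x - u x, W (us n) x - g x))" for n
    by (simp add: f_eq)
  note ds = sq_int_diff[OF H1_sq_int(1)[OF h] ug(1)] sq_int_diff[OF H1_sq_int(2)[OF h] ug(2)]
  have lu: "(\<lambda>n. l2norm M (\<lambda>x. us n x - u x)) \<longlonglongrightarrow> 0"
    by (rule tendsto_sandwich[OF _ _ tendsto_const f(2)])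
       (auto simp: P l2norm_nonneg intro!: always_eventually l2norm_le_Pair(1) ds)
  have lg: "(\<lambda>n. l2norm M (\<lambda>x. W (us n) x - g x)) \<longlonglongrightarrow> 0"
    by (rule tendsto_sandwich[OF _ _ tendsto_const f(2)])
       (auto simp: P l2norm_nonneg intro!: always_eventually l2norm_le_Pair(2) ds)
  have wu: "has_wgrad \<Omega> u g"
    by (rule has_wgrad_limit[OF open_dom has_wgrad_wgrad[OF h] ug lu lg])
  note uH1 = has_wgrad_imp_H1[OF wu]
  have lim: "(\<lambda>n. nrm (\<lambda>x. us n x - u x)) \<longlonglongrightarrow> 0"
  proof (rule tendsto_sandwich[OF _ _ tendsto_const])
    show "\<forall>\<^sub>F n in sequentially. 0 \<le> nrm (\<lambda>x. us n x - u x)"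
      by (intro always_eventually allI nrm_nonneg H1_diff h uH1)
    have "nrm (\<lambda>x. us n x - u x) \<le> eqc * l2norm M (\<lambda>x. ?f n x - f x)" for n
      using nrm_le_H1_norm[OF H1_diff[OF h uH1], of n]
        H1_norm_eq[OF open_dom has_wgrad_diff[OF open_dom has_wgrad_wgrad[OF h] wu], of n] by (simp add: P)
    then show "\<forall>\<^sub>F n in sequentially. nrm (\<lambda>x. us n x - u x) \<le> eqc * l2norm M (\<lambda>x. ?f n x - f x)" by simp
    show "(\<lambda>n. eqc * l2norm M (\<lambda>x. ?f n x - f x)) \<longlonglongrightarrow> 0"
      using tendsto_mult_left[OF f(2), of eqc] by simp
  qed
  have "u \<in> H"
  proof (cases "\<Omega> = UNIV")
    case True
    obtain r where r: "AE x in M. (\<lambda>n. us (r n) x) \<longlonglongrightarrow> u x"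
      using l2_tendsto_AE_subseq[OF ug(1) H1_sq_int(1)[OF h] lu] by blast
    then have r': "AE x in lebesgue. (\<lambda>n. us (r n) x) \<longlonglongrightarrow> u x"
      unfolding True lebesgue_on_UNIV_eq .
    have "radially_symmetric u"
      unfolding radially_symmetric_def
    proof (intro allI impI)
      fix T :: "'a \<Rightarrow> 'a" assume T: "orthogonal_transformation T"
      have "AE x in lebesgue. us (r n) (T x) = us (r n) x" for n
        using assms(1)[of "r n"] T True by (simp add: Hsp_def radially_symmetric_def)
      then have "AE x in lebesgue. \<forall>n. us (r n) (T x) = us (r n) x" by (simp add: AE_all_countable)
      then show "AE x in lebesgue. u (T x) = u x"
        using r' AE_orthogonal_transformation[OF T r']
        by eventually_elim (simp add: LIMSEQ_unique)
    qed
    with uH1 show ?thesis by (simp add: Hsp_def True)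
  next
    case False
    then show ?thesis using D_closed[OF uH1 H_D[OF assms(1)] lim] by (simp add: Hsp_def)
  qed
  with lim show ?thesis by blast
qed

end

context sobolev
begin

subsection \<open>The quartic form\<close>

lemma H1_norm_test_sq:
  assumes p: "\<phi> \<in> test_functions \<Omega>"
  shows "(H1_norm \<Omega> \<phi>)\<^sup>2 = (LINT x|lborel. (\<phi> x)\<^sup>2) + (LINT x|lborel. (norm (grad \<phi> x))\<^sup>2)"
proof -
  note t = test_functions_sq_int[OF p open_dom]
  have "(H1_norm \<Omega> \<phi>)\<^sup>2 = (l2norm M \<phi>)\<^sup>2 + (l2norm M (grad \<phi>))\<^sup>2"
    unfolding H1_norm_eq[OF open_dom has_wgrad_test[OF open_dom p]] by (rule l2norm_Pair_sq[OF t])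
  also have "(l2norm M \<phi>)\<^sup>2 = (LINT x|lborel. (norm (\<phi> x))\<^sup>2)"
    unfolding l2norm_sq
    by (rule integral_lebesgue_on_eq_lborel[OF cont_cs_measurable[OF cont_cs_norm_sq[OF test_functions_cont_cs[OF p]]] open_dom])
       (simp add: test_functions_outside[OF p])
  also have "(l2norm M (grad \<phi>))\<^sup>2 = (LINT x|lborel. (norm (grad \<phi> x))\<^sup>2)"
    unfolding l2norm_sq
    by (rule integral_lebesgue_on_eq_lborel[OF cont_cs_measurable[OF cont_cs_norm_sq[OF test_functions_grad_cont_cs[OF p]]] open_dom])
       (simp add: test_functions_grad_outside[OF p])
  finally show ?thesis by simp
qed

lemma L4_test:
  assumes p: "\<phi> \<in> test_functions \<Omega>"
  shows "sq_int M (\<lambda>x. (\<phi> x)\<^sup>2)" "l2norm M (\<lambda>x. (\<phi> x)\<^sup>2) \<le> 2 * (H1_norm \<Omega> \<phi>)\<^sup>2"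
proof -
  have pU: "\<phi> \<in> test_functions UNIV" using p test_functions_mono[of \<Omega> UNIV] by blast
  note pc = test_functions_cont_cs[OF p] and gc = test_functions_grad_cont_cs[OF p]
  have c2: "cont_cs (\<lambda>x. (\<phi> x)\<^sup>2)" using cont_cs_power[OF pc, of 1] by (simp add: numeral_2_eq_2)
  show "sq_int M (\<lambda>x. (\<phi> x)\<^sup>2)" by (rule cont_cs_sq_int[OF c2 open_dom])
  define a b where "a = (LINT x|lborel. (\<phi> x)\<^sup>2)" and "b = (LINT x|lborel. (norm (grad \<phi> x))\<^sup>2)"
  have ab0: "a \<ge> 0" "b \<ge> 0" unfolding a_def b_def by simp_all
  have an: "(\<integral>\<^sup>+x. ennreal ((\<phi> x)\<^sup>2) \<partial>lborel) = ennreal a"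
    unfolding a_def by (intro nn_integral_eq_integral cont_cs_integrable c2) simp
  have bn: "(\<integral>\<^sup>+x. ennreal ((norm (grad \<phi> x))\<^sup>2) \<partial>lborel) = ennreal b"
    unfolding b_def by (intro nn_integral_eq_integral cont_cs_integrable cont_cs_norm_sq gc) simp
  have c4: "cont_cs (\<lambda>x. (norm ((\<phi> x)\<^sup>2))\<^sup>2)" by (rule cont_cs_norm_sq[OF c2])
  have "(l2norm M (\<lambda>x. (\<phi> x)\<^sup>2))\<^sup>2 = (LINT x|lborel. (norm ((\<phi> x)\<^sup>2))\<^sup>2)"
    unfolding l2norm_sq
    by (rule integral_lebesgue_on_eq_lborel[OF cont_cs_measurable[OF c4] open_dom])
       (simp add: test_functions_outside[OF p])
  then have "ennreal ((l2norm M (\<lambda>x. (\<phi> x)\<^sup>2))\<^sup>2) = (\<integral>\<^sup>+x. ennreal ((norm ((\<phi> x)\<^sup>2))\<^sup>2) \<partial>lborel)"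
    using nn_integral_eq_integral[OF cont_cs_integrable[OF c4]] by simp
  also have "\<dots> = (\<integral>\<^sup>+x. ennreal ((\<phi> x)\<^sup>2) * ennreal ((\<phi> x)\<^sup>2) \<partial>lborel)"
    by (intro nn_integral_cong) (simp add: ennreal_mult[symmetric] power2_eq_square)
  also have "\<dots> \<le> 4 * (ennreal a + ennreal b)\<^sup>2"
    using ladyzhenskaya_nn[OF pU dim_le] unfolding an bn .
  also have "\<dots> = ennreal ((2 * (a + b))\<^sup>2)"
  proof -
    have "ennreal a + ennreal b = ennreal (a + b)" using ab0 by simp
    then have "4 * (ennreal a + ennreal b)\<^sup>2 = 4 * ennreal ((a + b)\<^sup>2)"
      using ennreal_power[of "a + b" 2] ab0 by simp
    also have "\<dots> = ennreal (4 * (a + b)\<^sup>2)" by (simp add: ennreal_mult)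
    also have "4 * (a + b)\<^sup>2 = (2 * (a + b))\<^sup>2" by (simp only: power_mult_distrib) simp
    finally show ?thesis .
  qed
  finally have "(l2norm M (\<lambda>x. (\<phi> x)\<^sup>2))\<^sup>2 \<le> (2 * (a + b))\<^sup>2" by simp
  then have "l2norm M (\<lambda>x. (\<phi> x)\<^sup>2) \<le> 2 * (a + b)" by (rule power2_le_imp_le) (use ab0 in simp)
  then show "l2norm M (\<lambda>x. (\<phi> x)\<^sup>2) \<le> 2 * (H1_norm \<Omega> \<phi>)\<^sup>2"
    unfolding H1_norm_test_sq[OF p] a_def b_def .
qed

definition KK :: real where "KK = 2 * eqc\<^sup>2"

lemma KK_pos: "KK > 0"
  using eqc_pos by (simp add: KK_def)

lemma D_l2_tendsto:
  assumes u: "u \<in> D" and p: "\<And>n. \<phi> n \<in> D" and lim: "(\<lambda>n. nrm (\<lambda>x. u x - \<phi> n x)) \<longlonglongrightarrow> 0"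
  shows "(\<lambda>n. l2norm M (\<lambda>x. \<phi> n x - u x)) \<longlonglongrightarrow> 0" "(\<lambda>n. nrm (\<phi> n)) \<longlonglongrightarrow> nrm u"
proof -
  note h = D_H1[OF u] D_H1[OF p]
  show "(\<lambda>n. l2norm M (\<lambda>x. \<phi> n x - u x)) \<longlonglongrightarrow> 0"
  proof (rule tendsto_sandwich[OF _ _ tendsto_const])
    show "\<forall>\<^sub>F n in sequentially. 0 \<le> l2norm M (\<lambda>x. \<phi> n x - u x)" by (simp add: l2norm_nonneg)
    show "\<forall>\<^sub>F n in sequentially. l2norm M (\<lambda>x. \<phi> n x - u x) \<le> eqc * nrm (\<lambda>x. u x - \<phi> n x)"
      using l2_le_nrm[OF H1_diff[OF h(2,1)]] nrm_minus[OF h(2,1)] by (intro always_eventually allI) simp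
    show "(\<lambda>n. eqc * nrm (\<lambda>x. u x - \<phi> n x)) \<longlonglongrightarrow> 0"
      using tendsto_mult_left[OF lim, of eqc] by simp
  qed
  show "(\<lambda>n. nrm (\<phi> n)) \<longlonglongrightarrow> nrm u"
  proof (rule LIM_zero_cancel, rule Lim_null_comparison[OF _ lim])
    show "\<forall>\<^sub>F n in sequentially. norm (nrm (\<phi> n) - nrm u) \<le> nrm (\<lambda>x. u x - \<phi> n x)"
      using nrm_diff_le[OF h(2,1)] nrm_minus[OF h(2,1)] by (intro always_eventually allI) simp
  qed
qed

lemma D_L4:
  assumes u: "u \<in> D"
  shows "sq_int M (\<lambda>x. (u x)\<^sup>2)" "l2norm M (\<lambda>x. (u x)\<^sup>2) \<le> KK * (nrm u)\<^sup>2"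
proof -
  obtain \<phi> where p: "\<And>n::nat. \<phi> n \<in> test_functions \<Omega>" "(\<lambda>n. nrm (\<lambda>x. u x - \<phi> n x)) \<longlonglongrightarrow> 0"
    by (rule D_approx[OF u]) blast
  note pD = D_test[OF p(1)]
  note lim = D_l2_tendsto[OF u pD p(2)]
  note us = H1_sq_int(1)[OF D_H1[OF u]]
  obtain r where r: "strict_mono r" "AE x in M. (\<lambda>n. \<phi> (r n) x) \<longlonglongrightarrow> u x"
    using l2_tendsto_AE_subseq[OF us H1_sq_int(1)[OF D_H1[OF pD]] lim(1)] by blast
  have "sq_int M (\<lambda>x. (u x)\<^sup>2) \<and> l2norm M (\<lambda>x. (u x)\<^sup>2) \<le> 2 * (eqc * nrm u)\<^sup>2"
  proof (rule l2_fatou)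
    show "sq_int M (\<lambda>x. (\<phi> (r n) x)\<^sup>2)" for n by (rule L4_test(1)[OF p(1)])
    show "(\<lambda>x. (u x)\<^sup>2) \<in> borel_measurable M"
      using sq_int_measurable[OF us] by (intro borel_measurable_power)
    show "AE x in M. (\<lambda>n. (\<phi> (r n) x)\<^sup>2) \<longlonglongrightarrow> (u x)\<^sup>2"
      using r(2) by eventually_elim (intro tendsto_power)
    show "l2norm M (\<lambda>x. (\<phi> (r n) x)\<^sup>2) \<le> 2 * (eqc * nrm (\<phi> (r n)))\<^sup>2" for n
      using L4_test(2)[OF p(1), of "r n"] power_mono[OF H1_norm_le_nrm[OF H1_test[OF p(1)]] H1_norm_nonneg, of "r n" 2]
      by linarith
    have "(\<lambda>n. nrm (\<phi> (r n))) \<longlonglongrightarrow> nrm u"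
      using LIMSEQ_subseq_LIMSEQ[OF lim(2) r(1)] by (simp add: comp_def)
    then show "(\<lambda>n. 2 * (eqc * nrm (\<phi> (r n)))\<^sup>2) \<longlonglongrightarrow> 2 * (eqc * nrm u)\<^sup>2"
      by (intro tendsto_intros)
  qed
  then show "sq_int M (\<lambda>x. (u x)\<^sup>2)" "l2norm M (\<lambda>x. (u x)\<^sup>2) \<le> KK * (nrm u)\<^sup>2"
    by (simp_all add: KK_def power_mult_distrib mult.assoc)
qed

lemma D_prod:
  assumes u: "u \<in> D" and v: "v \<in> D"
  shows "sq_int M (\<lambda>x. u x * v x)" "l2norm M (\<lambda>x. u x * v x) \<le> KK * (nrm u * nrm v)"
proof -
  note us = H1_sq_int(1)[OF D_H1[OF u]] and vs = H1_sq_int(1)[OF D_H1[OF v]]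
  note u2 = D_L4[OF u] and v2 = D_L4[OF v]
  show "sq_int M (\<lambda>x. u x * v x)"
  proof (rule sq_int_bound[OF sq_int_add[OF u2(1) v2(1)]])
    show "(\<lambda>x. u x * v x) \<in> borel_measurable M"
      by (intro borel_measurable_times sq_int_measurable us vs)
    have "\<bar>a * b\<bar> \<le> a\<^sup>2 + b\<^sup>2" for a b :: real
    proof -
      have "2 * (\<bar>a\<bar> * \<bar>b\<bar>) \<le> a\<^sup>2 + b\<^sup>2" using sum_squares_bound[of "\<bar>a\<bar>" "\<bar>b\<bar>"] by (simp add: mult.assoc)
      moreover have "\<bar>a\<bar> * \<bar>b\<bar> \<ge> 0" by simp
      ultimately show ?thesis unfolding abs_mult by linarith
    qed
    then show "AE x in M. norm (u x * v x) \<le> norm ((u x)\<^sup>2 + (v x)\<^sup>2)"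
      by (intro AE_I2) (simp add: abs_of_nonneg)
  qed
  have "(l2norm M (\<lambda>x. u x * v x))\<^sup>2 = (LINT x|M. (u x)\<^sup>2 \<bullet> (v x)\<^sup>2)"
    unfolding l2norm_sq by (intro Bochner_Integration.integral_cong) (simp_all add: power_mult_distrib)
  also have "\<dots> \<le> l2norm M (\<lambda>x. (u x)\<^sup>2) * l2norm M (\<lambda>x. (v x)\<^sup>2)"
    using l2_Cauchy_Schwarz[OF u2(1) v2(1)] by linarith
  also have "\<dots> \<le> (KK * (nrm u)\<^sup>2) * (KK * (nrm v)\<^sup>2)"
    using u2(2) v2(2) KK_pos by (intro mult_mono) (auto simp: l2norm_nonneg)
  also have "\<dots> = (KK * (nrm u * nrm v))\<^sup>2" by (simp add: power_mult_distrib power2_eq_square)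
  finally show "l2norm M (\<lambda>x. u x * v x) \<le> KK * (nrm u * nrm v)"
    by (rule power2_le_imp_le) (use KK_pos nrm_nonneg[OF D_H1[OF u]] nrm_nonneg[OF D_H1[OF v]] in simp)
qed

definition qf :: "('a \<Rightarrow> real) \<Rightarrow> ('a \<Rightarrow> real) \<Rightarrow> ('a \<Rightarrow> real) \<Rightarrow> ('a \<Rightarrow> real) \<Rightarrow> real" where
  "qf a b c d = (LINT x|M. a x * b x * (c x * d x))"

lemma qf_integrable:
  "a \<in> D \<Longrightarrow> b \<in> D \<Longrightarrow> c \<in> D \<Longrightarrow> d \<in> D \<Longrightarrow> integrable M (\<lambda>x. a x * b x * (c x * d x))"
  by (intro sq_int_mult D_prod)

lemma qf_bound:
  assumes "a \<in> D" "b \<in> D" "c \<in> D" "d \<in> D"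
  shows "\<bar>qf a b c d\<bar> \<le> KK\<^sup>2 * (nrm a * nrm b * nrm c * nrm d)"
proof -
  note n = nrm_nonneg[OF D_H1[OF assms(1)]] nrm_nonneg[OF D_H1[OF assms(2)]]
    nrm_nonneg[OF D_H1[OF assms(3)]] nrm_nonneg[OF D_H1[OF assms(4)]]
  have "\<bar>qf a b c d\<bar> \<le> l2norm M (\<lambda>x. a x * b x) * l2norm M (\<lambda>x. c x * d x)"
    using l2_Cauchy_Schwarz[OF D_prod(1)[OF assms(1,2)] D_prod(1)[OF assms(3,4)]] by (simp add: qf_def)
  also have "\<dots> \<le> (KK * (nrm a * nrm b)) * (KK * (nrm c * nrm d))"
    using KK_pos n by (intro mult_mono D_prod assms) (auto simp: l2norm_nonneg)
  finally show ?thesis by (simp add: power2_eq_square mult_ac)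
qed

lemma qf_swap12: "qf a b c d = qf b a c d"
  and qf_swap34: "qf a b c d = qf a b d c"
  and qf_swap: "qf a b c d = qf c d a b"
  unfolding qf_def by (simp_all add: mult_ac)

lemma qf_add1:
  assumes "a \<in> D" "a' \<in> D" "b \<in> D" "c \<in> D" "d \<in> D"
  shows "qf (\<lambda>x. a x + a' x) b c d = qf a b c d + qf a' b c d"
  using qf_integrable[OF assms(1,3-5)] qf_integrable[OF assms(2-5)] unfolding qf_def by (simp add: distrib_right)

lemma qf_diff1:
  assumes "a \<in> D" "a' \<in> D" "b \<in> D" "c \<in> D" "d \<in> D"
  shows "qf (\<lambda>x. a x - a' x) b c d = qf a b c d - qf a' b c d"
  using qf_integrable[OF assms(1,3-5)] qf_integrable[OF assms(2-5)] unfolding qf_def by (simp add: left_diff_distrib)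

lemma qf_cmult1: "qf (\<lambda>x. s * a x) b c d = s * qf a b c d"
  unfolding qf_def by (simp add: mult.assoc)

lemma qf_add2: "a \<in> D \<Longrightarrow> b \<in> D \<Longrightarrow> c \<in> D \<Longrightarrow> d \<in> D \<Longrightarrow> b' \<in> D
    \<Longrightarrow> qf a (\<lambda>x. b x + b' x) c d = qf a b c d + qf a b' c d"
  by (subst (1 2 3) qf_swap12) (rule qf_add1)

lemma qf_diff2: "a \<in> D \<Longrightarrow> b \<in> D \<Longrightarrow> c \<in> D \<Longrightarrow> d \<in> D \<Longrightarrow> b' \<in> D
    \<Longrightarrow> qf a (\<lambda>x. b x - b' x) c d = qf a b c d - qf a b' c d"
  by (subst (1 2 3) qf_swap12) (rule qf_diff1)

lemma qf_cmult2: "qf a (\<lambda>x. s * b x) c d = s * qf a b c d"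
  by (subst (1 2) qf_swap12) (rule qf_cmult1)

lemma qf_add3: "a \<in> D \<Longrightarrow> b \<in> D \<Longrightarrow> c \<in> D \<Longrightarrow> d \<in> D \<Longrightarrow> c' \<in> D
    \<Longrightarrow> qf a b (\<lambda>x. c x + c' x) d = qf a b c d + qf a b c' d"
  by (subst (1 2 3) qf_swap) (rule qf_add1)

lemma qf_diff3: "a \<in> D \<Longrightarrow> b \<in> D \<Longrightarrow> c \<in> D \<Longrightarrow> d \<in> D \<Longrightarrow> c' \<in> D
    \<Longrightarrow> qf a b (\<lambda>x. c x - c' x) d = qf a b c d - qf a b c' d"
  by (subst (1 2 3) qf_swap) (rule qf_diff1)

lemma qf_cmult3: "qf a b (\<lambda>x. s * c x) d = s * qf a b c d"
  by (subst (1 2) qf_swap) (rule qf_cmult1)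

lemma qf_add4: "a \<in> D \<Longrightarrow> b \<in> D \<Longrightarrow> c \<in> D \<Longrightarrow> d \<in> D \<Longrightarrow> d' \<in> D
    \<Longrightarrow> qf a b c (\<lambda>x. d x + d' x) = qf a b c d + qf a b c d'"
  by (subst (1 2 3) qf_swap34) (rule qf_add3)

lemma qf_diff4: "a \<in> D \<Longrightarrow> b \<in> D \<Longrightarrow> c \<in> D \<Longrightarrow> d \<in> D \<Longrightarrow> d' \<in> D
    \<Longrightarrow> qf a b c (\<lambda>x. d x - d' x) = qf a b c d - qf a b c d'"
  by (subst (1 2 3) qf_swap34) (rule qf_diff3)

lemma qf_cmult4: "qf a b c (\<lambda>x. s * d x) = s * qf a b c d"
  by (subst (1 2) qf_swap34) (rule qf_cmult3)

lemmas qf_linear = qf_add1 qf_diff1 qf_cmult1 qf_add2 qf_diff2 qf_cmult2 qf_add3 qf_diff3 qf_cmult3 qf_add4 qf_diff4 qf_cmult4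
lemmas D_intros = D_add D_diff D_cmult

subsection \<open>Weak solutions\<close>

lemma weak_solution_iff:
  assumes u: "u \<in> H1 \<Omega>"
  shows "weak_solution \<Omega> lam u f \<longleftrightarrow> (\<forall>\<phi>\<in>test_functions \<Omega>. ip u \<phi> = (LINT x|M. f x * \<phi> x))"
proof -
  have "(LINT x|M. W u x \<bullet> grad \<phi> x + lam * u x * \<phi> x) = ip u \<phi>" if p: "\<phi> \<in> test_functions \<Omega>" for \<phi>
    unfolding ip_def
  proof (rule integral_cong_AE)
    note w = has_wgrad_wgrad[OF H1_test[OF p]]
    show "AE x in M. W u x \<bullet> grad \<phi> x + lam * u x * \<phi> x = W u x \<bullet> W \<phi> x + lam * u x * \<phi> x"
      using has_wgrad_unique[OF open_dom w has_wgrad_test[OF open_dom p]] by eventually_elim simp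
  qed (intro borel_measurable_add borel_measurable_inner borel_measurable_times borel_measurable_const
      sq_int_measurable[OF H1_sq_int(1)[OF u]] sq_int_measurable[OF H1_sq_int(2)[OF u]]
      sq_int_measurable[OF H1_sq_int(1)[OF H1_test[OF p]]] sq_int_measurable[OF H1_sq_int(2)[OF H1_test[OF p]]]
      sq_int_measurable[OF test_functions_sq_int(2)[OF p open_dom]])+
  then show ?thesis unfolding weak_solution_def by (simp cong: ball_cong)
qed

lemma D_extend:
  assumes u: "u \<in> H1 \<Omega>" and eq: "\<And>\<phi>. \<phi> \<in> test_functions \<Omega> \<Longrightarrow> ip u \<phi> = L \<phi>"
    and L: "\<And>\<phi> \<psi>. \<phi> \<in> D \<Longrightarrow> \<psi> \<in> D \<Longrightarrow> \<bar>L \<phi> - L \<psi>\<bar> \<le> C * nrm (\<lambda>x. \<phi> x - \<psi> x)"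
    and p: "\<phi> \<in> D"
  shows "ip u \<phi> = L \<phi>"
proof -
  obtain \<psi> where q: "\<And>n::nat. \<psi> n \<in> test_functions \<Omega>" "(\<lambda>n. nrm (\<lambda>x. \<phi> x - \<psi> n x)) \<longlonglongrightarrow> 0"
    by (rule D_approx[OF p]) blast
  have "\<bar>ip u \<phi> - L \<phi>\<bar> \<le> (nrm u + C) * nrm (\<lambda>x. \<phi> x - \<psi> n x)" for n
  proof -
    have "\<bar>ip u (\<lambda>x. \<phi> x - \<psi> n x)\<bar> \<le> nrm u * nrm (\<lambda>x. \<phi> x - \<psi> n x)"
      by (rule ip_Cauchy_Schwarz[OF u H1_diff[OF D_H1[OF p] H1_test[OF q(1)]]])
    moreover have "ip u (\<lambda>x. \<phi> x - \<psi> n x) = ip u \<phi> - ip u (\<psi> n)"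
      by (rule ip_diff_right[OF D_H1[OF p] H1_test[OF q(1)] u])
    ultimately show ?thesis
      using L[OF p D_test[OF q(1)], of n] eq[OF q(1), of n] unfolding distrib_right by linarith
  qed
  moreover have "(\<lambda>n. (nrm u + C) * nrm (\<lambda>x. \<phi> x - \<psi> n x)) \<longlonglongrightarrow> 0"
    using tendsto_mult_left[OF q(2), of "nrm u + C"] by simp
  ultimately have "\<bar>ip u \<phi> - L \<phi>\<bar> \<le> 0" by (intro LIMSEQ_le_const) auto
  then show ?thesis by simp
qed

lemma qf_weak_extend:
  assumes u: "u \<in> H1 \<Omega>" and fin: "finite J" and a: "\<And>j. j \<in> J \<Longrightarrow> a j \<in> D \<and> b j \<in> D \<and> c j \<in> D"
    and f: "\<And>x. f x = (\<Sum>j\<in>J. s j * (a j x * b j x * c j x))"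
  shows "weak_solution \<Omega> lam u f \<longleftrightarrow> (\<forall>\<phi>\<in>D. ip u \<phi> = (\<Sum>j\<in>J. s j * qf (a j) (b j) (c j) \<phi>))"
proof -
  let ?L = "\<lambda>\<phi>. \<Sum>j\<in>J. s j * qf (a j) (b j) (c j) \<phi>"
  have L: "(LINT x|M. f x * \<phi> x) = ?L \<phi>" if p: "\<phi> \<in> D" for \<phi>
  proof -
    have "(LINT x|M. f x * \<phi> x) = (LINT x|M. (\<Sum>j\<in>J. s j * (a j x * b j x * (c j x * \<phi> x))))"
      unfolding f by (simp add: sum_distrib_right mult.assoc)
    also have "\<dots> = (\<Sum>j\<in>J. (LINT x|M. s j * (a j x * b j x * (c j x * \<phi> x))))"
      by (rule Bochner_Integration.integral_sum) (use a p in \<open>auto intro!: integrable_mult_right qf_integrable\<close>)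
    also have "\<dots> = ?L \<phi>" by (simp add: qf_def)
    finally show ?thesis .
  qed
  define C where "C = (\<Sum>j\<in>J. \<bar>s j\<bar> * (KK\<^sup>2 * (nrm (a j) * nrm (b j) * nrm (c j))))"
  have bnd: "\<bar>?L \<phi> - ?L \<psi>\<bar> \<le> C * nrm (\<lambda>x. \<phi> x - \<psi> x)" if p: "\<phi> \<in> D" "\<psi> \<in> D" for \<phi> \<psi>
  proof -
    have "?L \<phi> - ?L \<psi> = (\<Sum>j\<in>J. s j * qf (a j) (b j) (c j) (\<lambda>x. \<phi> x - \<psi> x))"
      unfolding sum_subtractf[symmetric] using a p by (intro sum.cong) (auto simp: qf_diff4 right_diff_distrib)
    also have "\<bar>\<dots>\<bar> \<le> (\<Sum>j\<in>J. \<bar>s j * qf (a j) (b j) (c j) (\<lambda>x. \<phi> x - \<psi> x)\<bar>)"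
      by (rule sum_abs)
    also have "\<dots> \<le> (\<Sum>j\<in>J. \<bar>s j\<bar> * (KK\<^sup>2 * (nrm (a j) * nrm (b j) * nrm (c j) * nrm (\<lambda>x. \<phi> x - \<psi> x))))"
      using a p by (intro sum_mono) (auto simp: abs_mult intro!: mult_left_mono qf_bound D_diff)
    also have "\<dots> = C * nrm (\<lambda>x. \<phi> x - \<psi> x)"
      unfolding C_def sum_distrib_right by (simp add: mult.assoc)
    finally show ?thesis .
  qed
  show ?thesis
  proof
    assume "weak_solution \<Omega> lam u f"
    then have "ip u \<phi> = ?L \<phi>" if "\<phi> \<in> test_functions \<Omega>" for \<phi>
      using L[OF D_test[OF that]] that unfolding weak_solution_iff[OF u] by simp
    then show "\<forall>\<phi>\<in>D. ip u \<phi> = ?L \<phi>" using D_extend[OF u _ bnd] by blast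
  next
    assume "\<forall>\<phi>\<in>D. ip u \<phi> = ?L \<phi>"
    then show "weak_solution \<Omega> lam u f"
      unfolding weak_solution_iff[OF u] using L[OF D_test] D_test by simp
  qed
qed

subsection \<open>Compactness of the multiplication by a square\<close>

definition avg :: "'a set \<Rightarrow> ('a \<Rightarrow> real) \<Rightarrow> real" where
  "avg q u = (LINT x|M. indicator q x * u x)"

lemma sq_int_indicator:
  assumes "q \<in> sets borel" "bounded q"
  shows "sq_int M (indicator q :: 'a \<Rightarrow> real)"
proof -
  have "integrable lborel (indicator q :: 'a \<Rightarrow> real)"
    using assms emeasure_bounded_finite[OF assms(2)] by (simp add: integrable_indicator_iff)
  moreover have "(norm (indicator q x :: real))\<^sup>2 = indicator q x" for x by (simp add: indicator_def)
  ultimately have "sq_int lborel (indicator q :: 'a \<Rightarrow> real)" using assms(1) by (simp add: sq_int_def)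
  then show ?thesis by (rule sq_int_lborel_imp_lebesgue_on[OF _ open_dom])
qed

lemma avg_bound:
  assumes q: "q \<in> sets borel" "bounded q" and u: "u \<in> D"
  shows "\<bar>avg q u\<bar> \<le> l2norm M (indicator q :: 'a \<Rightarrow> real) * eqc * nrm u"
proof -
  have "\<bar>avg q u\<bar> \<le> l2norm M (indicator q :: 'a \<Rightarrow> real) * l2norm M u"
    using l2_Cauchy_Schwarz[OF sq_int_indicator[OF q] H1_sq_int(1)[OF D_H1[OF u]]] by (simp add: avg_def)
  also have "\<dots> \<le> l2norm M (indicator q :: 'a \<Rightarrow> real) * (eqc * nrm u)"
    by (intro mult_left_mono l2_le_nrm D_H1 u) (simp add: l2norm_nonneg)
  finally show ?thesis by (simp add: mult.assoc)
qed

lemma avg_diff: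
  assumes q: "q \<in> sets borel" "bounded q" and u: "u \<in> D" "v \<in> D"
  shows "avg q (\<lambda>x. u x - v x) = avg q u - avg q v"
  using sq_int_mult[OF sq_int_indicator[OF q] H1_sq_int(1)[OF D_H1[OF u(1)]]]
    sq_int_mult[OF sq_int_indicator[OF q] H1_sq_int(1)[OF D_H1[OF u(2)]]]
  by (simp add: avg_def right_diff_distrib)

lemma qf_compact:
  assumes U: "U \<in> D" and k: "\<kappa> > 0"
  shows "\<exists>F C. finite F \<and> C \<ge> 0 \<and> (\<forall>q\<in>F. q \<in> sets borel \<and> bounded q) \<and>
    (\<forall>u\<in>D. qf U U u u \<le> \<kappa> * (nrm u)\<^sup>2 + C * (\<Sum>q\<in>F. (avg q u)\<^sup>2))"
proof -
  note U2 = D_L4[OF U] and Us = H1_sq_int(1)[OF D_H1[OF U]]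
  have Um [measurable]: "U \<in> borel_measurable M" by (rule sq_int_measurable[OF Us])
  define G where "G n x = (if norm x \<le> real n \<and> (U x)\<^sup>2 \<le> real n then (U x)\<^sup>2 else 0)" for n x
  have normm: "(\<lambda>x. norm x) \<in> borel_measurable M"
    by (rule borel_measurable_lebesgue_on_borel) simp
  note [measurable] = normm
  have Gm [measurable]: "G n \<in> borel_measurable M" for n
    unfolding G_def by measurable
  have Glim: "(\<lambda>n. l2norm M (\<lambda>x. G n x - (U x)\<^sup>2)) \<longlonglongrightarrow> 0"
  proof (rule l2norm_dominated_convergence[OF Gm _ _ U2(1)])
    show "(\<lambda>x. (U x)\<^sup>2) \<in> borel_measurable M" by (rule sq_int_measurable[OF U2(1)])
    show "AE x in M. (\<lambda>n. G n x) \<longlonglongrightarrow> (U x)\<^sup>2"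
    proof (rule AE_I2)
      fix x
      obtain N where N: "norm x + (U x)\<^sup>2 \<le> real N" using real_arch_simple by blast
      have "G n x = (U x)\<^sup>2" if "n \<ge> N" for n
      proof -
        have "norm x \<le> real n" "(U x)\<^sup>2 \<le> real n"
          using N that norm_ge_zero[of x] zero_le_power2[of "U x"] of_nat_mono[OF that, where 'a = real] by linarith+
        then show ?thesis by (simp add: G_def)
      qed
      then show "(\<lambda>n. G n x) \<longlonglongrightarrow> (U x)\<^sup>2"
        by (intro tendsto_eventually) (auto simp: eventually_sequentially)
    qed
    show "AE x in M. norm (G n x) \<le> norm ((U x)\<^sup>2)" for n
      by (intro AE_I2) (simp add: G_def)
  qed
  have "\<kappa> / (2 * KK) > 0" using k KK_pos by simp
  then have "\<forall>\<^sub>F n in sequentially. l2norm M (\<lambda>x. G n x - (U x)\<^sup>2) < \<kappa> / (2 * KK)"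
    by (rule order_tendstoD(2)[OF Glim])
  then obtain n where n: "l2norm M (\<lambda>x. G n x - (U x)\<^sup>2) < \<kappa> / (2 * KK)"
    by (auto simp: eventually_sequentially)
  let ?m = "real n" and ?Q = "cball (0::'a) (real n)"
  have "\<kappa> / (2 * (?m + 1)) > 0" using k by (simp add: add_nonneg_pos)
  from local_compactness[OF this, of ?m] obtain F C where F: "finite F" "C \<ge> 0" "\<And>q. q \<in> F \<Longrightarrow> q \<in> sets borel \<and> bounded q"
    and FC: "\<And>\<phi>::'a \<Rightarrow> real. \<phi> \<in> test_functions UNIV \<Longrightarrow>
      (LINT x|lborel. indicator ?Q x * (\<phi> x)\<^sup>2)
      \<le> \<kappa> / (2 * (?m + 1)) * (LINT x|lborel. (norm (grad \<phi> x))\<^sup>2) + C * (\<Sum>q\<in>F. (LINT x|lborel. indicator q x * \<phi> x)\<^sup>2)"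
    by blast
  have test: "qf U U \<phi> \<phi> \<le> \<kappa> * (nrm \<phi>)\<^sup>2 + (?m * C) * (\<Sum>q\<in>F. (avg q \<phi>)\<^sup>2)"
    if p: "\<phi> \<in> test_functions \<Omega>" for \<phi>
  proof -
    have pU: "\<phi> \<in> test_functions UNIV" using p test_functions_mono[of \<Omega> UNIV] by blast
    note pD = D_test[OF p] and pH = H1_test[OF p]
    note p2 = D_L4[OF pD]
    note pc = test_functions_cont_cs[OF p]
    have pm: "\<phi> \<in> borel_measurable borel" by (rule cont_cs_measurable[OF pc])
    have Gs: "sq_int M (G n)"
      by (rule sq_int_bound[OF U2(1) Gm]) (intro AE_I2, simp add: G_def)
    have e1: "qf U U \<phi> \<phi> = (LINT x|M. ((U x)\<^sup>2 - G n x) \<bullet> (\<phi> x)\<^sup>2) + (LINT x|M. G n x \<bullet> (\<phi> x)\<^sup>2)"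
      using sq_int_inner[OF sq_int_diff[OF U2(1) Gs] p2(1)] sq_int_inner[OF Gs p2(1)]
      by (subst Bochner_Integration.integral_add[symmetric])
         (auto simp: qf_def power2_eq_square algebra_simps intro!: Bochner_Integration.integral_cong)
    have "(LINT x|M. ((U x)\<^sup>2 - G n x) \<bullet> (\<phi> x)\<^sup>2) \<le> l2norm M (\<lambda>x. (U x)\<^sup>2 - G n x) * l2norm M (\<lambda>x. (\<phi> x)\<^sup>2)"
      using l2_Cauchy_Schwarz[OF sq_int_diff[OF U2(1) Gs] p2(1)] by linarith
    also have "\<dots> \<le> \<kappa> / (2 * KK) * (KK * (nrm \<phi>)\<^sup>2)"
      using n l2norm_minus[of M "G n" "\<lambda>x. (U x)\<^sup>2"] p2(2) k KK_pos by (intro mult_mono) (auto simp: l2norm_nonneg)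
    also have "\<dots> = \<kappa> / 2 * (nrm \<phi>)\<^sup>2" using KK_pos by simp
    finally have e2: "(LINT x|M. ((U x)\<^sup>2 - G n x) \<bullet> (\<phi> x)\<^sup>2) \<le> \<kappa> / 2 * (nrm \<phi>)\<^sup>2" .
    have ci: "integrable lborel (\<lambda>x. indicator ?Q x * (\<phi> x)\<^sup>2)"
    proof -
      have "integrable lborel (\<lambda>x. indicator ?Q x *\<^sub>R (\<phi> x)\<^sup>2)"
        by (rule borel_integrable_compact)
           (auto intro!: continuous_intros continuous_on_subset[OF cont_cs_continuous[OF pc]])
      then show ?thesis by simp
    qed
    have "(LINT x|M. G n x \<bullet> (\<phi> x)\<^sup>2) \<le> (LINT x|M. ?m * (indicator ?Q x * (\<phi> x)\<^sup>2))"
    proof (rule integral_mono[OF sq_int_inner[OF Gs p2(1)]])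
      show "integrable M (\<lambda>x. ?m * (indicator ?Q x * (\<phi> x)\<^sup>2))"
        by (intro integrable_mult_right integrable_lebesgue_on ci open_dom)
      show "G n x \<bullet> (\<phi> x)\<^sup>2 \<le> ?m * (indicator ?Q x * (\<phi> x)\<^sup>2)" for x
        by (auto simp: G_def indicator_def intro: mult_right_mono)
    qed
    also have "\<dots> = ?m * (LINT x|M. indicator ?Q x * (\<phi> x)\<^sup>2)" by simp
    also have "(LINT x|M. indicator ?Q x * (\<phi> x)\<^sup>2) = (LINT x|lborel. indicator ?Q x * (\<phi> x)\<^sup>2)"
      by (rule integral_lebesgue_on_eq_lborel[OF _ open_dom])
         (use borel_measurable_integrable[OF ci] in \<open>simp_all add: test_functions_outside[OF p]\<close>)
    also have "?m * \<dots> \<le> ?m * (\<kappa> / (2 * (?m + 1)) * (LINT x|lborel. (norm (grad \<phi> x))\<^sup>2) + C * (\<Sum>q\<in>F. (LINT x|lborel. indicator q x * \<phi> x)\<^sup>2))"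
      by (intro mult_left_mono FC[OF pU]) simp
    also have "(\<Sum>q\<in>F. (LINT x|lborel. indicator q x * \<phi> x)\<^sup>2) = (\<Sum>q\<in>F. (avg q \<phi>)\<^sup>2)"
    proof (rule sum.cong[OF refl])
      fix q assume q: "q \<in> F"
      have "(\<lambda>x. indicator q x * \<phi> x) \<in> borel_measurable borel"
        using F(3)[OF q] pm by (intro borel_measurable_times borel_measurable_indicator) auto
      from integral_lebesgue_on_eq_lborel[OF this open_dom]
      show "(LINT x|lborel. indicator q x * \<phi> x)\<^sup>2 = (avg q \<phi>)\<^sup>2"
        by (simp add: avg_def test_functions_outside[OF p])
    qed
    also have "(LINT x|lborel. (norm (grad \<phi> x))\<^sup>2) \<le> (nrm \<phi>)\<^sup>2"
    proof -
      have "(LINT x|lborel. (norm (grad \<phi> x))\<^sup>2) = (l2norm M (grad \<phi>))\<^sup>2"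
        unfolding l2norm_sq
        by (rule integral_lebesgue_on_eq_lborel[OF cont_cs_measurable[OF cont_cs_norm_sq[OF test_functions_grad_cont_cs[OF p]]] open_dom, symmetric])
           (simp add: test_functions_grad_outside[OF p])
      also have "\<dots> = (l2norm M (W \<phi>))\<^sup>2"
      proof -
        note w = has_wgrad_wgrad[OF pH]
        have "l2norm M (grad \<phi>) = l2norm M (W \<phi>)"
          by (rule l2norm_cong_AE[OF sq_int_measurable[OF test_functions_sq_int(2)[OF p open_dom]]
                sq_int_measurable[OF H1_sq_int(2)[OF pH]] has_wgrad_unique[OF open_dom has_wgrad_test[OF open_dom p] w]])
        then show ?thesis by simp
      qed
      also have "\<dots> \<le> (nrm \<phi>)\<^sup>2" by (intro power_mono W_l2_le_nrm[OF pH]) (simp add: l2norm_nonneg)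
      finally show ?thesis .
    qed
    finally have e3: "(LINT x|M. G n x \<bullet> (\<phi> x)\<^sup>2) \<le> ?m * (\<kappa> / (2 * (?m + 1)) * (nrm \<phi>)\<^sup>2 + C * (\<Sum>q\<in>F. (avg q \<phi>)\<^sup>2))"
      using k by (simp add: mult_left_mono divide_right_mono add_nonneg_pos)
    have "?m * (\<kappa> / (2 * (?m + 1))) \<le> \<kappa> / 2" using k by (simp add: field_simps)
    then have "?m * (\<kappa> / (2 * (?m + 1))) * (nrm \<phi>)\<^sup>2 \<le> \<kappa> / 2 * (nrm \<phi>)\<^sup>2" by (intro mult_right_mono) auto
    moreover have "?m * (\<kappa> / (2 * (?m + 1)) * (nrm \<phi>)\<^sup>2 + C * (\<Sum>q\<in>F. (avg q \<phi>)\<^sup>2))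
        = ?m * (\<kappa> / (2 * (?m + 1))) * (nrm \<phi>)\<^sup>2 + ?m * C * (\<Sum>q\<in>F. (avg q \<phi>)\<^sup>2)"
      by (simp only: distrib_left mult.assoc)
    moreover have "\<kappa> / 2 * (nrm \<phi>)\<^sup>2 + \<kappa> / 2 * (nrm \<phi>)\<^sup>2 = \<kappa> * (nrm \<phi>)\<^sup>2" by simp
    ultimately show ?thesis using e1 e2 e3 by linarith
  qed
  have "qf U U u u \<le> \<kappa> * (nrm u)\<^sup>2 + (?m * C) * (\<Sum>q\<in>F. (avg q u)\<^sup>2)" if u: "u \<in> D" for u
  proof -
    obtain \<phi> where p: "\<And>n::nat. \<phi> n \<in> test_functions \<Omega>" "(\<lambda>n. nrm (\<lambda>x. u x - \<phi> n x)) \<longlonglongrightarrow> 0"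
      by (rule D_approx[OF u]) blast
    note pD = D_test[OF p(1)]
    note lim = D_l2_tendsto[OF u pD p(2)]
    have lq: "(\<lambda>n. qf U U (\<phi> n) (\<phi> n)) \<longlonglongrightarrow> qf U U u u"
    proof (rule LIM_zero_cancel, rule Lim_null_comparison)
      have "\<bar>qf U U (\<phi> n) (\<phi> n) - qf U U u u\<bar> \<le> KK\<^sup>2 * (nrm U * nrm U * (nrm u + nrm (\<phi> n)) * nrm (\<lambda>x. u x - \<phi> n x))" for n
      proof -
        have "qf U U u u - qf U U (\<phi> n) (\<phi> n) = qf U U (\<lambda>x. u x + \<phi> n x) (\<lambda>x. u x - \<phi> n x)"
          using U u pD[of n] by (simp add: qf_linear D_intros qf_swap34[of U U "\<phi> n" u])
        moreover have "\<bar>qf U U (\<lambda>x. u x + \<phi> n x) (\<lambda>x. u x - \<phi> n x)\<bar>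
            \<le> KK\<^sup>2 * (nrm U * nrm U * nrm (\<lambda>x. u x + \<phi> n x) * nrm (\<lambda>x. u x - \<phi> n x))"
          by (intro qf_bound U D_intros u pD)
        moreover have "\<dots> \<le> KK\<^sup>2 * (nrm U * nrm U * (nrm u + nrm (\<phi> n)) * nrm (\<lambda>x. u x - \<phi> n x))"
          by (intro mult_left_mono mult_right_mono nrm_triangle D_H1 u pD nrm_nonneg H1_diff U mult_nonneg_nonneg) auto
        ultimately show ?thesis by linarith
      qed
      then show "\<forall>\<^sub>F n in sequentially. norm (qf U U (\<phi> n) (\<phi> n) - qf U U u u)
          \<le> KK\<^sup>2 * (nrm U * nrm U * (nrm u + nrm (\<phi> n)) * nrm (\<lambda>x. u x - \<phi> n x))" by simp
      have "(\<lambda>n. KK\<^sup>2 * (nrm U * nrm U * (nrm u + nrm (\<phi> n)) * nrm (\<lambda>x. u x - \<phi> n x)))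
          \<longlonglongrightarrow> KK\<^sup>2 * (nrm U * nrm U * (nrm u + nrm u) * 0)"
        by (intro tendsto_intros lim p)
      then show "(\<lambda>n. KK\<^sup>2 * (nrm U * nrm U * (nrm u + nrm (\<phi> n)) * nrm (\<lambda>x. u x - \<phi> n x))) \<longlonglongrightarrow> 0" by simp
    qed
    have la: "(\<lambda>n. avg q (\<phi> n)) \<longlonglongrightarrow> avg q u" if "q \<in> F" for q
    proof (rule LIM_zero_cancel, rule Lim_null_comparison)
      note q = conjunct1[OF F(3)[OF that]] conjunct2[OF F(3)[OF that]]
      show "\<forall>\<^sub>F n in sequentially. norm (avg q (\<phi> n) - avg q u) \<le> l2norm M (indicator q :: 'a \<Rightarrow> real) * eqc * nrm (\<lambda>x. u x - \<phi> n x)"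
        using avg_bound[OF q D_diff[OF u pD]] avg_diff[OF q u pD] by (simp add: abs_minus_commute)
      show "(\<lambda>n. l2norm M (indicator q :: 'a \<Rightarrow> real) * eqc * nrm (\<lambda>x. u x - \<phi> n x)) \<longlonglongrightarrow> 0"
        using tendsto_mult_left[OF p(2), of "l2norm M (indicator q :: 'a \<Rightarrow> real) * eqc"] by simp
    qed
    show ?thesis
    proof (rule LIMSEQ_le[OF lq])
      show "(\<lambda>n. \<kappa> * (nrm (\<phi> n))\<^sup>2 + (?m * C) * (\<Sum>q\<in>F. (avg q (\<phi> n))\<^sup>2)) \<longlonglongrightarrow> \<kappa> * (nrm u)\<^sup>2 + (?m * C) * (\<Sum>q\<in>F. (avg q u)\<^sup>2)"
        by (intro tendsto_intros lim la)
      show "\<exists>N. \<forall>n\<ge>N. qf U U (\<phi> n) (\<phi> n) \<le> \<kappa> * (nrm (\<phi> n))\<^sup>2 + (?m * C) * (\<Sum>q\<in>F. (avg q (\<phi> n))\<^sup>2)"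
        using test[OF p(1)] by blast
    qed
  qed
  with F show ?thesis by (intro exI[of _ F] exI[of _ "?m * C"]) auto
qed

end

subsection \<open>Second variation at the ground state\<close>

locale ground_state = sobolev \<Omega> lam for \<Omega> :: "'a::euclidean_space set" and lam +
  fixes U :: "'a \<Rightarrow> real"
  assumes least: "least_energy_positive_solution \<Omega> lam U"
    and nondeg: "nondegenerate \<Omega> lam U" and dom_nonempty: "\<Omega> \<noteq> {}"
begin

lemma U_H: "U \<in> H" and U_pos: "AE x in M. U x > 0"
  using least by (auto simp: least_energy_positive_solution_def scalar_positive_solution_def)

lemmas U_D = H_D[OF U_H] and U_H1 = H_H1[OF U_H]

lemma U_eq: "\<phi> \<in> D \<Longrightarrow> ip U \<phi> = qf U U U \<phi>"
proof -
  have w: "weak_solution \<Omega> lam U (\<lambda>x. U x ^ 3)"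
    using least by (auto simp: least_energy_positive_solution_def scalar_positive_solution_def)
  have "\<forall>\<phi>\<in>D. ip U \<phi> = (\<Sum>j\<in>{()}. 1 * qf U U U \<phi>)"
    by (subst qf_weak_extend[OF U_H1, symmetric, where f = "\<lambda>x. U x ^ 3"])
       (auto simp: U_D w power3_eq_cube w[unfolded power3_eq_cube])
  then show "\<phi> \<in> D \<Longrightarrow> ip U \<phi> = qf U U U \<phi>" by simp
qed

definition S :: real where "S = qf U U U U"

lemma S_pos: "S > 0"
proof -
  have i: "integrable M (\<lambda>x. U x * U x * (U x * U x))" by (intro qf_integrable U_D)
  have nn: "S \<ge> 0" unfolding S_def qf_def by (intro integral_nonneg_AE AE_I2) simp
  have "S \<noteq> 0"
  proof
    assume "S = 0"
    then have "AE x in M. U x * U x * (U x * U x) = 0"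
      using integral_nonneg_eq_0_iff_AE[OF i] by (simp add: S_def qf_def)
    with U_pos have "AE x in M. False" by eventually_elim simp
    then have "AE x in lborel. x \<notin> \<Omega>" by (simp add: AE_lebesgue_on_iff[OF open_dom])
    then have "\<Omega> \<in> null_sets lborel"
      using open_dom by (subst (asm) AE_iff_null_sets[symmetric]) auto
    then have "negligible \<Omega>" by (simp add: negligible_iff_null_sets null_sets_completionI)
    then show False using open_not_negligible[OF open_dom dom_nonempty] by simp
  qed
  with nn show ?thesis by simp
qed

lemma ip_UU: "ip U U = S"
  by (simp add: U_eq U_D S_def)

lemma energy_eq: "energy \<Omega> lam w = ip w w / 2 - qf w w w w / 4"
  unfolding energy_def ip_def qf_def power2_norm_eq_inner
  by (simp add: power2_eq_square power4_eq_xxxx mult.assoc)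

lemma ground_state_quotient:
  assumes w: "w \<in> H"
  shows "S * qf w w w w \<le> (ip w w)\<^sup>2"
proof (cases "qf w w w w > 0")
  case False
  then have "S * qf w w w w \<le> 0" using S_pos by (simp add: mult_le_0_iff)
  then show ?thesis using zero_le_power2[of "ip w w"] by linarith
next
  case True
  let ?q = "qf w w w w" and ?p = "ip w w"
  note wD = H_D[OF w] and wH = H_H1[OF w]
  have nz: "\<not> (AE x in M. w x = 0)"
  proof
    assume "AE x in M. w x = 0"
    then have "AE x in M. w x * w x * (w x * w x) = 0" by eventually_elim simp
    then have "?q = 0" unfolding qf_def by (rule integral_eq_zero_AE)
    with True show False by simp
  qed
  have p: "?p > 0"
  proof -
    have "nrm w \<noteq> 0" using nrm_eq_0_imp[OF wH] nz by blast
    then show ?thesis using nrm_sq[OF wH] ip_nonneg[OF wH] by (metis less_le zero_eq_power2)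
  qed
  define t where "t = sqrt (?p / ?q)"
  have t2: "t\<^sup>2 = ?p / ?q" and t0: "t > 0" unfolding t_def using p True by simp_all
  let ?w = "\<lambda>x. t * w x"
  have wt: "?w \<in> H" by (rule H_cmult[OF w])
  have i: "ip ?w ?w = t\<^sup>2 * ?p"
    by (simp add: ip_cmult_left ip_cmult_right H1_cmult wH power2_eq_square mult.assoc)
  have q: "qf ?w ?w ?w ?w = (t\<^sup>2)\<^sup>2 * ?q"
    by (simp add: qf_cmult1 qf_cmult2 qf_cmult3 qf_cmult4 power2_eq_square mult.assoc)
  have eqn: "(t\<^sup>2)\<^sup>2 * ?q = t\<^sup>2 * ?p" unfolding t2 using True by (simp add: field_simps power2_eq_square)
  have "?w \<in> nehari \<Omega> lam"
    unfolding nehari_def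
  proof (intro CollectI conjI wt)
    show "\<not> (AE x in M. t * w x = 0)" using nz t0 by simp
    have "(LINT x|M. (norm (W ?w x))\<^sup>2 + lam * (t * w x)\<^sup>2) = ip ?w ?w"
      unfolding ip_def power2_norm_eq_inner by (simp add: power2_eq_square mult.assoc)
    moreover have "(LINT x|M. (t * w x) ^ 4) = qf ?w ?w ?w ?w"
      unfolding qf_def by (simp add: power4_eq_xxxx mult.assoc)
    ultimately show "(LINT x|M. (norm (W ?w x))\<^sup>2 + lam * (t * w x)\<^sup>2) = (LINT x|M. (t * w x) ^ 4)"
      using i q eqn by simp
  qed
  then have "energy \<Omega> lam U \<le> energy \<Omega> lam ?w"
    using least by (simp add: least_energy_positive_solution_def)
  then have "S \<le> t\<^sup>2 * ?p"
    unfolding energy_eq i q eqn ip_UU S_def[symmetric] by linarith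
  also have "\<dots> = ?p\<^sup>2 / ?q" unfolding t2 by (simp add: power2_eq_square)
  finally show ?thesis using True by (simp add: pos_le_divide_eq)
qed

lemma second_variation:
  assumes p: "\<phi> \<in> H" and orth: "qf U U U \<phi> = 0"
  shows "3 * qf U U \<phi> \<phi> \<le> ip \<phi> \<phi>"
proof -
  note pD = H_D[OF p] and pH = H_H1[OF p]
  let ?n = "ip \<phi> \<phi>" and ?a = "qf U U \<phi> \<phi>" and ?b = "qf U \<phi> \<phi> \<phi>" and ?c = "qf \<phi> \<phi> \<phi> \<phi>"
  have perm: "qf U U \<phi> U = 0" "qf U \<phi> U U = 0" "qf \<phi> U U U = 0"
    "qf U \<phi> U \<phi> = ?a" "qf U \<phi> \<phi> U = ?a" "qf \<phi> U U \<phi> = ?a" "qf \<phi> U \<phi> U = ?a" "qf \<phi> \<phi> U U = ?a"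
    "qf \<phi> U \<phi> \<phi> = ?b" "qf \<phi> \<phi> U \<phi> = ?b" "qf \<phi> \<phi> \<phi> U = ?b"
    using orth unfolding qf_def by (simp_all add: mult_ac)
  have ineq: "6 * ?a + t * (4 * ?b) + t\<^sup>2 * ?c \<le> 2 * ?n + t\<^sup>2 * (?n\<^sup>2 / S)" if t: "t \<noteq> 0" for t
  proof -
    let ?w = "\<lambda>x. U x + t * \<phi> x"
    have w: "?w \<in> H" by (intro H_add H_cmult U_H p)
    have i: "ip ?w ?w = S + t\<^sup>2 * ?n"
    proof -
      have "ip U \<phi> = 0" using U_eq[OF pD] orth by simp
      then show ?thesis
        by (simp add: ip_add_left ip_add_right ip_cmult_left ip_cmult_right H1_cmult H1_add U_H1 pH ip_UU
            ip_commute[of \<phi> U] power2_eq_square)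
    qed
    have q: "qf ?w ?w ?w ?w = S + 6 * t\<^sup>2 * ?a + 4 * t ^ 3 * ?b + t ^ 4 * ?c"
      using U_D pD
      by (simp add: qf_add1 qf_add2 qf_add3 qf_add4 qf_cmult1 qf_cmult2 qf_cmult3 qf_cmult4 D_intros perm orth
          S_def[symmetric] power2_eq_square power3_eq_cube power4_eq_xxxx algebra_simps)
    have "S * (S + 6 * t\<^sup>2 * ?a + 4 * t ^ 3 * ?b + t ^ 4 * ?c) \<le> (S + t\<^sup>2 * ?n)\<^sup>2"
      using ground_state_quotient[OF w] unfolding i q .
    moreover have "S * (S + 6 * t\<^sup>2 * ?a + 4 * t ^ 3 * ?b + t ^ 4 * ?c)
        = S * S + S * t\<^sup>2 * (6 * ?a + t * (4 * ?b) + t\<^sup>2 * ?c)"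
      by (simp add: algebra_simps power2_eq_square power3_eq_cube power4_eq_xxxx)
    moreover have "(S + t\<^sup>2 * ?n)\<^sup>2 = S * S + (2 * (S * t\<^sup>2 * ?n) + (t\<^sup>2 * ?n)\<^sup>2)"
      unfolding power2_sum by (simp add: power2_eq_square[of S])
    moreover have "S * t\<^sup>2 * (2 * ?n + t\<^sup>2 * (?n\<^sup>2 / S)) = 2 * (S * t\<^sup>2 * ?n) + (t\<^sup>2 * ?n)\<^sup>2"
      using S_pos by (simp add: distrib_left power_mult_distrib power2_eq_square)
    ultimately have "S * t\<^sup>2 * (6 * ?a + t * (4 * ?b) + t\<^sup>2 * ?c) \<le> S * t\<^sup>2 * (2 * ?n + t\<^sup>2 * (?n\<^sup>2 / S))"
      by linarith
    moreover have "S * t\<^sup>2 > 0" using S_pos t by simp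
    ultimately show ?thesis by (simp only: mult_le_cancel_left_pos)
  qed
  have lim: "(\<lambda>n. inverse (real (Suc n))) \<longlonglongrightarrow> 0" by (rule inverse_Suc_tendsto)
  have "6 * ?a + 0 * (4 * ?b) + 0\<^sup>2 * ?c \<le> 2 * ?n + 0\<^sup>2 * (?n\<^sup>2 / S)"
  proof (rule LIMSEQ_le)
    show "(\<lambda>n. 6 * ?a + inverse (real (Suc n)) * (4 * ?b) + (inverse (real (Suc n)))\<^sup>2 * ?c)
        \<longlonglongrightarrow> 6 * ?a + 0 * (4 * ?b) + 0\<^sup>2 * ?c"
      by (intro tendsto_intros lim)
    show "(\<lambda>n. 2 * ?n + (inverse (real (Suc n)))\<^sup>2 * (?n\<^sup>2 / S)) \<longlonglongrightarrow> 2 * ?n + 0\<^sup>2 * (?n\<^sup>2 / S)"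
      by (rule tendsto_add[OF tendsto_const tendsto_mult[OF tendsto_power[OF lim] tendsto_const]])
    show "\<exists>N. \<forall>n\<ge>N. 6 * ?a + inverse (real (Suc n)) * (4 * ?b) + (inverse (real (Suc n)))\<^sup>2 * ?c
        \<le> 2 * ?n + (inverse (real (Suc n)))\<^sup>2 * (?n\<^sup>2 / S)"
      using ineq by (intro exI[of _ 0] allI impI) simp
  qed
  then show ?thesis by simp
qed

end

subsection \<open>Linear algebra of the coupling matrices\<close>

lemma orthogonal_projection_exists:
  fixes K :: "'v::euclidean_space set"
  assumes "subspace K"
  shows "\<exists>P. linear P \<and> (\<forall>x. P x \<in> K) \<and> (\<forall>x. \<forall>k\<in>K. P x \<bullet> k = x \<bullet> k)"
proof -
  obtain B where B: "B \<subseteq> K" "pairwise orthogonal B" "\<And>x. x \<in> B \<Longrightarrow> norm x = 1" "independent B" "span B = K"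
    by (rule orthonormal_basis_subspace[OF assms]) blast
  have fin: "finite B" using B(4) by (rule independent_imp_finite)
  define P where "P x = (\<Sum>b\<in>B. (x \<bullet> b) *\<^sub>R b)" for x
  have lin: "linear P"
    unfolding P_def[abs_def]
    by (intro linear_compose_sum ballI bounded_linear.linear bounded_linear_intros)
  have inK: "P x \<in> K" for x
    unfolding P_def using B(1) assms by (intro subspace_sum subspace_scale) auto
  have "P x \<bullet> k = x \<bullet> k" if "k \<in> K" for x k
  proof -
    have "k \<in> span B" using that B(5) by simp
    then show ?thesis
    proof (induction rule: span_induct_alt)
      case base
      then show ?case by simp
    next
      case (step c b k)
      have "P x \<bullet> b = (\<Sum>b'\<in>B. (x \<bullet> b') * (b' \<bullet> b))" by (simp add: P_def inner_sum_left)
      also have "\<dots> = (\<Sum>b'\<in>B. if b' = b then x \<bullet> b else 0)"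
      proof (rule sum.cong[OF refl])
        fix b' assume "b' \<in> B"
        then show "(x \<bullet> b') * (b' \<bullet> b) = (if b' = b then x \<bullet> b else 0)"
          using B(2,3) step(1) by (auto simp: pairwise_def orthogonal_def dot_square_norm)
      qed
      also have "\<dots> = x \<bullet> b" using fin step(1) by simp
      finally show ?case using step(2) by (simp add: inner_add_right)
    qed
  qed
  with lin inK show ?thesis by blast
qed

locale coupling =
  fixes A E :: "real^'n^'n" and c :: "real^'n" and P :: "real^'n \<Rightarrow> real^'n"
  assumes A_sym: "A $ i $ j = A $ j $ i" and A_nonneg: "A $ i $ j \<ge> 0"
    and c_pos: "c $ i > 0" and A_c: "(\<Sum>j\<in>UNIV. A $ i $ j * (c $ j)\<^sup>2) = 1"
    and compl: "complementary E A c"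
    and P_linear: "linear P" and P_mem: "P x \<in> mat_kernel A"
    and P_inner: "k \<in> mat_kernel A \<Longrightarrow> P x \<bullet> k = x \<bullet> k"
begin

definition c2 :: "real^'n" where "c2 = (\<chi> i. (c $ i)\<^sup>2)"

lemma c2_nth: "c2 $ i = (c $ i)\<^sup>2"
  by (simp add: c2_def)

lemma A_inner: "(A *v x) \<bullet> y = x \<bullet> (A *v y)"
proof -
  have "transpose A = A" by (simp add: transpose_def vec_eq_iff A_sym)
  then have "A *v x = x v* A" using transpose_matrix_vector[of A x] by simp
  then show ?thesis using dot_lmul_matrix[of x A y] by simp
qed

lemma E_inner: "(E *v x) \<bullet> y = x \<bullet> (E *v y)"
proof -
  have "transpose E = E" using compl by (simp add: complementary_def)
  then have "E *v x = x v* E" using transpose_matrix_vector[of E x] by simp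
  then show ?thesis using dot_lmul_matrix[of x E y] by simp
qed

lemma E_sym: "E $ i $ j = E $ j $ i"
proof -
  have "transpose E = E" using compl by (simp add: complementary_def)
  then have "transpose E $ i $ j = E $ i $ j" by simp
  then show ?thesis by (simp add: transpose_def)
qed

lemma K_subspace: "subspace (mat_kernel A)"
  unfolding mat_kernel_def subspace_def
  by (simp add: matrix_vector_right_distrib matrix_vector_mult_scaleR)

lemma A_c2: "A *v c2 = 1"
  by (simp add: matrix_vector_mult_def vec_eq_iff c2_nth A_c)

lemma P_fix: "k \<in> mat_kernel A \<Longrightarrow> P k = k"
proof -
  assume k: "k \<in> mat_kernel A"
  have "P k - k \<in> mat_kernel A" using subspace_diff[OF K_subspace P_mem k] .
  then have "(P k - k) \<bullet> (P k - k) = 0"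
    using P_inner[of "P k - k" k] by (simp add: inner_diff_left)
  then show ?thesis by simp
qed

lemma P_norm_le: "norm (P x) \<le> norm x"
proof (cases "P x = 0")
  case False
  have "norm (P x) * norm (P x) = x \<bullet> P x"
    using P_inner[OF P_mem, of x x] by (simp add: dot_square_norm power2_eq_square)
  also have "\<dots> \<le> norm x * norm (P x)" by (rule norm_cauchy_schwarz)
  finally show ?thesis using False by simp
qed simp

lemma P_eq_0: "(\<And>k. k \<in> mat_kernel A \<Longrightarrow> x \<bullet> k = 0) \<Longrightarrow> P x = 0"
  using P_inner[OF P_mem, of x x] P_mem[of x] by simp

lemma P_A: "P (A *v x) = 0"
  by (rule P_eq_0) (simp add: A_inner, simp add: mat_kernel_def)

lemma E_c2: "\<gamma> \<in> mat_kernel A \<Longrightarrow> (E *v \<gamma>) \<bullet> c2 = 0"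
proof (cases "\<gamma> = 0")
  case False
  assume "\<gamma> \<in> mat_kernel A"
  then have "orthogonal (E *v \<gamma>) (\<chi> i. (c $ i)\<^sup>2)" using False compl unfolding complementary_def by blast
  then show ?thesis unfolding orthogonal_def c2_def .
qed simp

lemma coupling_bounded_below:
  obtains \<kappa> where "\<kappa> > 0" "\<And>w. \<kappa> * norm w \<le> norm (A *v w + P (E *v w))"
proof -
  let ?L = "\<lambda>w. A *v w + P (E *v w)"
  have lin: "linear ?L"
    by (intro linear_compose_add matrix_vector_mul_linear linear_compose[OF matrix_vector_mul_linear P_linear, unfolded comp_def])
  have "w = 0" if w: "?L w = 0" for w
  proof -
    have "(A *v w) \<bullet> P (E *v w) = 0"
      using P_mem[of "E *v w"] by (simp add: A_inner mat_kernel_def)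
    moreover have "?L w \<bullet> P (E *v w) = 0" unfolding w by simp
    ultimately have PE: "P (E *v w) = 0" by (simp add: inner_add_left)
    with w have wK: "w \<in> mat_kernel A" by (simp add: mat_kernel_def)
    have "(E *v w) \<bullet> \<eta> = 0" if "\<eta> \<in> mat_kernel A" for \<eta>
      using P_inner[OF that, of "E *v w"] PE by simp
    then show "w = 0" using wK compl unfolding complementary_def by blast
  qed
  then have "inj ?L" unfolding linear_injective_0[OF lin] by blast
  then show ?thesis by (rule linear_inj_bounded_below_pos[OF lin]) (rule that)
qed

lemma perturbed_solution:
  "\<exists>\<epsilon>1>0. \<exists>C\<ge>0. \<forall>\<epsilon>. 0 < \<epsilon> \<and> \<epsilon> < \<epsilon>1 \<longrightarrow> (\<exists>x. (A + \<epsilon> *\<^sub>R E) *v x = 1 \<and> norm (x - c2) \<le> C * \<epsilon>)"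
proof -
  obtain \<kappa> where k: "\<kappa> > 0" "\<And>w. \<kappa> * norm w \<le> norm (A *v w + P (E *v w))"
    by (rule coupling_bounded_below) blast
  obtain b where b: "b > 0" "\<And>w. norm (E *v w) \<le> b * norm w"
    by (rule linear_bounded_pos[OF matrix_vector_mul_linear[of E]]) blast
  define C where "C = 2 / \<kappa> * norm (E *v c2)"
  have C0: "C \<ge> 0" unfolding C_def using k(1) by simp
  have "\<exists>x. (A + \<epsilon> *\<^sub>R E) *v x = 1 \<and> norm (x - c2) \<le> C * \<epsilon>" if e: "0 < \<epsilon>" "\<epsilon> < \<kappa> / (4 * b)" for \<epsilon>
  proof -
    let ?L = "\<lambda>w. (A *v w + P (E *v w)) + \<epsilon> *\<^sub>R (E *v w - P (E *v w))"
    have linPE: "linear (\<lambda>w. P (E *v w))"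
      by (rule linear_compose[OF matrix_vector_mul_linear P_linear, unfolded comp_def])
    have lin: "linear ?L"
      by (intro linear_compose_add linear_compose_scale_right linear_compose_sub matrix_vector_mul_linear linPE)
    have lower: "\<kappa> / 2 * norm w \<le> norm (?L w)" for w
    proof -
      have "norm (E *v w - P (E *v w)) \<le> 2 * (b * norm w)"
        using norm_triangle_ineq4[of "E *v w" "P (E *v w)"] P_norm_le[of "E *v w"] b(2)[of w] by linarith
      then have "\<epsilon> * norm (E *v w - P (E *v w)) \<le> \<epsilon> * (2 * (b * norm w))"
        using e by (intro mult_left_mono) auto
      also have "\<dots> \<le> \<kappa> / (4 * b) * (2 * (b * norm w))"
        using e b(1) by (intro mult_right_mono) auto
      also have "\<dots> = \<kappa> / 2 * norm w" using b(1) by simp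
      finally have "norm (\<epsilon> *\<^sub>R (E *v w - P (E *v w))) \<le> \<kappa> / 2 * norm w" using e by simp
      moreover have "norm (A *v w + P (E *v w)) - norm (\<epsilon> *\<^sub>R (E *v w - P (E *v w))) \<le> norm (?L w)"
        by (rule norm_diff_ineq)
      moreover have "\<kappa> * norm w = \<kappa> / 2 * norm w + \<kappa> / 2 * norm w" by simp
      ultimately show ?thesis using k(2)[of w] by linarith
    qed
    have "inj ?L"
      unfolding linear_injective_0[OF lin]
    proof (intro allI impI)
      fix w assume "?L w = 0"
      then have "\<kappa> / 2 * norm w \<le> 0" using lower[of w] by simp
      then show "w = 0" using k(1) by (simp add: mult_le_0_iff)
    qed
    then have surj: "surj ?L" by (rule linear_injective_imp_surjective[OF lin]) simp
    obtain w where w': "- \<epsilon> *\<^sub>R (E *v c2) = ?L w" using surjD[OF surj] by blast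
    note w = w'[symmetric]
    have PEc: "P (E *v c2) = 0"
    proof (rule P_eq_0)
      fix k assume k: "k \<in> mat_kernel A"
      show "(E *v c2) \<bullet> k = 0" unfolding E_inner using E_c2[OF k] by (simp add: inner_commute)
    qed
    have PP: "P (P y) = P y" for y by (rule P_fix[OF P_mem])
    have "P (?L w) = P (E *v w)"
      using linear_add[OF P_linear] linear_diff[OF P_linear] linear_scale[OF P_linear] by (simp add: P_A PP)
    moreover have "P (?L w) = 0"
      unfolding w using linear_scale[OF P_linear, of "- \<epsilon>" "E *v c2"] PEc by simp
    ultimately have PE: "P (E *v w) = 0" by simp
    have eq: "A *v w + \<epsilon> *\<^sub>R (E *v w) = - \<epsilon> *\<^sub>R (E *v c2)" using w PE by simp
    have "(A + \<epsilon> *\<^sub>R E) *v (c2 + w) = A *v c2 + \<epsilon> *\<^sub>R (E *v c2) + (A *v w + \<epsilon> *\<^sub>R (E *v w))"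
      by (simp add: matrix_vector_mult_add_rdistrib matrix_vector_right_distrib scaleR_matrix_vector_assoc[symmetric] scaleR_add_right)
    also have "\<dots> = 1" unfolding eq A_c2 by simp
    finally have 1: "(A + \<epsilon> *\<^sub>R E) *v (c2 + w) = 1" .
    have "\<kappa> / 2 * norm w \<le> \<epsilon> * norm (E *v c2)" using lower[of w] e unfolding w by simp
    then have "norm w \<le> C * \<epsilon>" using k(1) by (simp add: C_def field_simps)
    with 1 show ?thesis by (intro exI[of _ "c2 + w"]) simp
  qed
  moreover have "\<kappa> / (4 * b) > 0" using k(1) b(1) by simp
  ultimately show ?thesis using C0 by blast
qed

end

lemma convergent_subseq_finite:
  fixes f :: "'i \<Rightarrow> nat \<Rightarrow> real"
  assumes "finite I" "\<And>i. i \<in> I \<Longrightarrow> bounded (range (f i))"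
  shows "\<exists>r. strict_mono r \<and> (\<forall>i\<in>I. convergent (\<lambda>n. f i (r n)))"
  using assms
proof (induction I rule: finite_induct)
  case empty
  show ?case by (intro exI[of _ id]) (simp add: strict_mono_def)
next
  case (insert a I)
  then obtain r where r: "strict_mono r" "\<And>i. i \<in> I \<Longrightarrow> convergent (\<lambda>n. f i (r n))" by auto
  have "bounded (range (f a))" using insert.prems[of a] by simp
  then have "bounded (range (\<lambda>n. f a (r n)))" by (rule bounded_subset) auto
  from bounded_imp_convergent_subsequence[OF this] obtain l s where
    s: "strict_mono s" "((\<lambda>n. f a (r n)) \<circ> s) \<longlonglongrightarrow> l" by blast
  have "convergent (\<lambda>n. f i (r (s n)))" if "i \<in> insert a I" for i
  proof (cases "i = a")
    case True
    then show ?thesis using s(2) by (auto simp: convergent_def comp_def)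
  next
    case False
    then obtain l' where "(\<lambda>n. f i (r n)) \<longlonglongrightarrow> l'" using r(2)[of i] \<open>i \<in> insert a I\<close> by (auto simp: convergent_def)
    from LIMSEQ_subseq_LIMSEQ[OF this s(1)] show ?thesis by (auto simp: convergent_def comp_def)
  qed
  moreover have "strict_mono (\<lambda>n. r (s n))" using strict_mono_o[OF r(1) s(1)] by (simp add: comp_def)
  ultimately show ?case by (intro exI[of _ "\<lambda>n. r (s n)"]) auto
qed

subsection \<open>The linearized system\<close>

locale linearized = ground_state \<Omega> lam U + coupling A E c P
  for \<Omega> :: "'a::euclidean_space set" and lam :: real and U :: "'a \<Rightarrow> real"
    and A E :: "real^'n^'n" and c :: "real^'n" and P :: "real^'n \<Rightarrow> real^'n"
begin

definition tf :: "('n \<Rightarrow> 'a \<Rightarrow> real) \<Rightarrow> 'n \<Rightarrow> ('a \<Rightarrow> real) \<Rightarrow> real" where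
  "tf \<theta> i \<phi> = ip (\<theta> i) \<phi> - qf U U (\<theta> i) \<phi> - 2 * (\<Sum>j\<in>UNIV. c $ i * A $ i $ j * c $ j * qf U U (\<theta> j) \<phi>)"

definition mean :: "('a \<Rightarrow> real) \<Rightarrow> real" where
  "mean u = qf U U U u / S"

definition vn :: "('n \<Rightarrow> 'a \<Rightarrow> real) \<Rightarrow> real" where
  "vn \<theta> = (\<Sum>i\<in>UNIV. nrm (\<theta> i))"

lemma vn_nonneg: "(\<And>i. \<theta> i \<in> H) \<Longrightarrow> vn \<theta> \<ge> 0"
  unfolding vn_def by (intro sum_nonneg nrm_nonneg H_H1)

lemma nrm_le_vn: "(\<And>i. \<theta> i \<in> H) \<Longrightarrow> nrm (\<theta> i) \<le> vn \<theta>"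
  unfolding vn_def by (rule member_le_sum) (auto intro: nrm_nonneg H_H1)

lemma mean_diff: "u \<in> D \<Longrightarrow> v \<in> D \<Longrightarrow> mean (\<lambda>x. u x - v x) = mean u - mean v"
  and mean_cmult: "mean (\<lambda>x. s * u x) = s * mean u"
  and mean_U: "mean U = 1"
  using S_pos by (simp_all add: mean_def qf_diff4 qf_cmult4 U_D diff_divide_distrib S_def[symmetric])

lemma mean_bound: "u \<in> D \<Longrightarrow> \<bar>mean u\<bar> \<le> KK\<^sup>2 * nrm U ^ 3 / S * nrm u"
  using qf_bound[OF U_D U_D U_D, of u] S_pos
  by (simp add: mean_def abs_divide divide_right_mono power3_eq_cube mult.assoc)

lemma qf_UU_nonneg: "qf U U u u \<ge> 0"
proof -
  have "U x * U x * (u x * u x) \<ge> 0" for x by simp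
  then show ?thesis unfolding qf_def by (intro integral_nonneg_AE AE_I2)
qed

lemma qf_UU_eq_0:
  assumes "u \<in> D" "qf U U u u = 0"
  shows "AE x in M. u x = 0"
proof -
  have "AE x in M. U x * U x * (u x * u x) = 0"
    using integral_nonneg_eq_0_iff_AE[OF qf_integrable[OF U_D U_D assms(1) assms(1)]] assms(2) by (simp add: qf_def)
  with U_pos show ?thesis by eventually_elim simp
qed

lemma qf_AE_0: "AE x in M. u x = 0 \<Longrightarrow> qf a b u d = 0"
  unfolding qf_def by (rule integral_eq_zero_AE) (auto elim!: eventually_mono)

text \<open>The matrix \<open>c\<^sub>i a\<^sub>i\<^sub>j c\<^sub>j\<close> is bounded by the identity: with \<open>\<theta>\<^sub>i = c\<^sub>i y\<^sub>i\<close>, the difference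
  of the two forms is a combination of the squares of \<open>y\<^sub>i - y\<^sub>j\<close>.\<close>

lemma coupling_form:
  assumes t: "\<And>i. \<theta> i \<in> D"
  shows "(\<Sum>i\<in>UNIV. qf U U (\<theta> i) (\<theta> i)) - (\<Sum>i\<in>UNIV. \<Sum>j\<in>UNIV. c $ i * A $ i $ j * c $ j * qf U U (\<theta> j) (\<theta> i))
    = (\<Sum>i\<in>UNIV. \<Sum>j\<in>UNIV. (c $ i)\<^sup>2 * A $ i $ j * (c $ j)\<^sup>2
        * qf U U (\<lambda>x. (1 / c $ i) * \<theta> i x - (1 / c $ j) * \<theta> j x) (\<lambda>x. (1 / c $ i) * \<theta> i x - (1 / c $ j) * \<theta> j x)) / 2"
proof -
  define Q where "Q i j = qf U U (\<theta> i) (\<theta> j)" for i j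
  have Qsym: "Q i j = Q j i" for i j unfolding Q_def by (rule qf_swap34)
  have cn: "c $ i \<noteq> 0" for i using c_pos[of i] by simp
  have exp: "qf U U (\<lambda>x. (1 / c $ i) * \<theta> i x - (1 / c $ j) * \<theta> j x) (\<lambda>x. (1 / c $ i) * \<theta> i x - (1 / c $ j) * \<theta> j x)
    = Q i i / (c $ i)\<^sup>2 - 2 * Q j i / (c $ i * c $ j) + Q j j / (c $ j)\<^sup>2" for i j
    using t[of i] t[of j] U_D cn Qsym[of i j] unfolding Q_def
    by (simp add: qf_diff3 qf_diff4 qf_cmult3 qf_cmult4 D_intros del: times_divide_eq_left) (simp add: field_simps power2_eq_square)
  have summand: "(c $ i)\<^sup>2 * A $ i $ j * (c $ j)\<^sup>2 * (Q i i / (c $ i)\<^sup>2 - 2 * Q j i / (c $ i * c $ j) + Q j j / (c $ j)\<^sup>2)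
      = Q i i * (A $ i $ j * (c $ j)\<^sup>2) - 2 * (c $ i * A $ i $ j * c $ j * Q j i) + Q j j * (A $ j $ i * (c $ i)\<^sup>2)" for i j
    using cn A_sym[of i j] by (simp add: field_simps power2_eq_square)
  have s1: "(\<Sum>i\<in>UNIV. \<Sum>j\<in>UNIV. Q i i * (A $ i $ j * (c $ j)\<^sup>2)) = (\<Sum>i\<in>UNIV. Q i i)"
    by (simp add: sum_distrib_left[symmetric] A_c)
  have s2: "(\<Sum>i\<in>UNIV. \<Sum>j\<in>UNIV. Q j j * (A $ j $ i * (c $ i)\<^sup>2)) = (\<Sum>i\<in>UNIV. Q i i)"
    by (subst sum.swap) (rule s1)
  show ?thesis
    unfolding exp summand sum.distrib sum_subtractf s1 s2 by (simp add: Q_def sum_distrib_left[symmetric])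
qed

lemma coupling_form_le:
  assumes t: "\<And>i. \<theta> i \<in> D"
  shows "(\<Sum>i\<in>UNIV. \<Sum>j\<in>UNIV. c $ i * A $ i $ j * c $ j * qf U U (\<theta> j) (\<theta> i)) \<le> (\<Sum>i\<in>UNIV. qf U U (\<theta> i) (\<theta> i))"
proof -
  have "(\<Sum>i\<in>UNIV. \<Sum>j\<in>UNIV. (c $ i)\<^sup>2 * A $ i $ j * (c $ j)\<^sup>2
        * qf U U (\<lambda>x. (1 / c $ i) * \<theta> i x - (1 / c $ j) * \<theta> j x) (\<lambda>x. (1 / c $ i) * \<theta> i x - (1 / c $ j) * \<theta> j x)) \<ge> 0"
    by (intro sum_nonneg mult_nonneg_nonneg A_nonneg qf_UU_nonneg) auto
  then show ?thesis using coupling_form[of \<theta>, OF t] by linarith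
qed

lemma coupling_form_eq:
  assumes t: "\<And>i. \<theta> i \<in> D"
    and eq: "(\<Sum>i\<in>UNIV. \<Sum>j\<in>UNIV. c $ i * A $ i $ j * c $ j * qf U U (\<theta> j) (\<theta> i)) = (\<Sum>i\<in>UNIV. qf U U (\<theta> i) (\<theta> i))"
    and p: "\<phi> \<in> D"
  shows "(\<Sum>j\<in>UNIV. c $ i * A $ i $ j * c $ j * qf U U (\<theta> j) \<phi>) = qf U U (\<theta> i) \<phi>"
proof -
  let ?z = "\<lambda>i j x. (1 / c $ i) * \<theta> i x - (1 / c $ j) * \<theta> j x"
  let ?t = "\<lambda>i j. (c $ i)\<^sup>2 * A $ i $ j * (c $ j)\<^sup>2 * qf U U (?z i j) (?z i j)"
  have zD: "?z i j \<in> D" for i j by (intro D_intros t)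
  have cn: "c $ i \<noteq> 0" for i using c_pos[of i] by simp
  have nn: "?t i j \<ge> 0" for i j by (intro mult_nonneg_nonneg A_nonneg qf_UU_nonneg) auto
  have sum0: "(\<Sum>i\<in>UNIV. \<Sum>j\<in>UNIV. ?t i j) = 0"
    using coupling_form[of \<theta>, OF t] eq by simp
  have t0: "?t i j = 0" for i j
  proof -
    have "\<forall>i\<in>UNIV. (\<Sum>j\<in>UNIV. ?t i j) = 0"
      by (rule iffD1[OF sum_nonneg_eq_0_iff sum0]) (rule finite, rule sum_nonneg, rule nn)
    then have s: "(\<Sum>j\<in>UNIV. ?t i j) = 0" by blast
    have "\<forall>j\<in>UNIV. ?t i j = 0"
      by (rule iffD1[OF sum_nonneg_eq_0_iff s]) (rule finite, rule nn)
    then show ?thesis by blast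
  qed
  have q: "c $ i * A $ i $ j * c $ j * qf U U (\<theta> j) \<phi> = A $ i $ j * (c $ j)\<^sup>2 * qf U U (\<theta> i) \<phi>" for j
  proof (cases "A $ i $ j = 0")
    case False
    then have "qf U U (?z i j) (?z i j) = 0" using t0[of i j] cn by simp
    from qf_AE_0[OF qf_UU_eq_0[OF zD this]] have "qf U U (?z i j) \<phi> = 0" .
    then have "(1 / c $ i) * qf U U (\<theta> i) \<phi> = (1 / c $ j) * qf U U (\<theta> j) \<phi>"
      using t[of i] t[of j] p U_D by (simp add: qf_diff3 qf_cmult3 D_intros del: times_divide_eq_left)
    then have "c $ i * qf U U (\<theta> j) \<phi> = c $ j * qf U U (\<theta> i) \<phi>" using cn[of i] cn[of j] by (simp add: field_simps)
    then have "A $ i $ j * c $ j * (c $ i * qf U U (\<theta> j) \<phi>) = A $ i $ j * c $ j * (c $ j * qf U U (\<theta> i) \<phi>)" by simp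
    then show ?thesis by (simp add: power2_eq_square mult_ac)
  qed simp
  have "(\<Sum>j\<in>UNIV. c $ i * A $ i $ j * c $ j * qf U U (\<theta> j) \<phi>) = (\<Sum>j\<in>UNIV. A $ i $ j * (c $ j)\<^sup>2) * qf U U (\<theta> i) \<phi>"
    unfolding sum_distrib_right by (intro sum.cong refl q)
  then show ?thesis by (simp add: A_c)
qed

lemma linearized_kernel:
  assumes t: "\<And>i. \<theta> i \<in> H" and tf0: "\<And>i \<phi>. \<phi> \<in> D \<Longrightarrow> tf \<theta> i \<phi> = 0"
    and P0: "P (\<chi> i. 2 * c $ i * mean (\<theta> i)) = 0"
  shows "nrm (\<theta> i) = 0"
proof -
  note tD = H_D[OF t] and tH = H_H1[OF t]
  define k where "k = (\<chi> i. 2 * c $ i * mean (\<theta> i))"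
  have Am: "(\<Sum>j\<in>UNIV. A $ i $ j * (c $ j * mean (\<theta> j))) = 0" for i
  proof -
    have "ip (\<theta> i) U = qf U U (\<theta> i) U"
      using U_eq[OF tD] ip_commute[of U "\<theta> i"] qf_swap34[of U U U "\<theta> i"] by simp
    then have "2 * (\<Sum>j\<in>UNIV. c $ i * A $ i $ j * c $ j * qf U U (\<theta> j) U) = 0"
      using tf0[OF U_D, of i] by (simp add: tf_def)
    moreover have "qf U U (\<theta> j) U = S * mean (\<theta> j)" for j
      using S_pos qf_swap34[of U U U "\<theta> j"] by (simp add: mean_def)
    moreover have "c $ i * S * (\<Sum>j\<in>UNIV. A $ i $ j * (c $ j * mean (\<theta> j)))
        = (\<Sum>j\<in>UNIV. c $ i * A $ i $ j * c $ j * (S * mean (\<theta> j)))"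
      unfolding sum_distrib_left by (intro sum.cong refl) (simp add: mult_ac)
    ultimately have "c $ i * S * (\<Sum>j\<in>UNIV. A $ i $ j * (c $ j * mean (\<theta> j))) = 0" by simp
    then show ?thesis using c_pos[of i] S_pos by simp
  qed
  have "(A *v k) $ i = 0" for i
  proof -
    have "(A *v k) $ i = 2 * (\<Sum>j\<in>UNIV. A $ i $ j * (c $ j * mean (\<theta> j)))"
      unfolding sum_distrib_left matrix_vector_mult_def k_def by (simp, intro sum.cong refl) simp
    also have "\<dots> = 0" by (simp add: Am)
    finally show ?thesis .
  qed
  then have "k \<in> mat_kernel A" by (simp add: mat_kernel_def vec_eq_iff)
  then have "k = 0" using P_fix[of k] P0 by (simp add: k_def)
  then have "2 * c $ i * mean (\<theta> i) = 0" for i by (simp add: k_def vec_eq_iff)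
  then have m0: "qf U U U (\<theta> i) = 0" for i
  proof -
    have "c $ i \<noteq> 0" "S \<noteq> 0" using c_pos[of i] S_pos by simp_all
    moreover have "2 * c $ i * mean (\<theta> i) = 0" by fact
    ultimately show ?thesis by (simp add: mean_def)
  qed
  have sv: "3 * qf U U (\<theta> i) (\<theta> i) \<le> ip (\<theta> i) (\<theta> i)" for i by (rule second_variation[OF t m0])
  have ipe: "ip (\<theta> i) (\<theta> i) = qf U U (\<theta> i) (\<theta> i) + 2 * (\<Sum>j\<in>UNIV. c $ i * A $ i $ j * c $ j * qf U U (\<theta> j) (\<theta> i))" for i
    using tf0[OF tD, of i i] by (simp add: tf_def)
  have "3 * (\<Sum>i\<in>UNIV. qf U U (\<theta> i) (\<theta> i)) \<le> (\<Sum>i\<in>UNIV. ip (\<theta> i) (\<theta> i))"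
    unfolding sum_distrib_left by (intro sum_mono sv)
  also have "\<dots> = (\<Sum>i\<in>UNIV. qf U U (\<theta> i) (\<theta> i)) + 2 * (\<Sum>i\<in>UNIV. \<Sum>j\<in>UNIV. c $ i * A $ i $ j * c $ j * qf U U (\<theta> j) (\<theta> i))"
    unfolding ipe sum.distrib sum_distrib_left ..
  finally have eq: "(\<Sum>i\<in>UNIV. \<Sum>j\<in>UNIV. c $ i * A $ i $ j * c $ j * qf U U (\<theta> j) (\<theta> i)) = (\<Sum>i\<in>UNIV. qf U U (\<theta> i) (\<theta> i))"
    using coupling_form_le[of \<theta>, OF tD] by linarith
  have three: "ip (\<theta> i) \<phi> = 3 * qf U U (\<theta> i) \<phi>" if "\<phi> \<in> D" for \<phi>
    using tf0[OF that, of i] coupling_form_eq[of \<theta>, OF tD eq that, of i] by (simp add: tf_def)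
  have "weak_solution \<Omega> lam (\<theta> i) (\<lambda>x. 3 * (U x)\<^sup>2 * \<theta> i x)"
    by (subst qf_weak_extend[OF tH, where J = "{()}" and s = "\<lambda>_. 3" and a = "\<lambda>_. U" and b = "\<lambda>_. U" and c = "\<lambda>_. \<theta> i"])
       (auto simp: U_D tD three power2_eq_square)
  then have "AE x in M. \<theta> i x = 0" using nondeg t unfolding nondegenerate_def by blast
  then have "ip (\<theta> i) (\<theta> i) = 0" using three[OF tD] qf_AE_0 by simp
  then show ?thesis by (simp add: nrm_def)
qed

end

context linearized
begin

definition shift :: "('n \<Rightarrow> 'a \<Rightarrow> real) \<Rightarrow> real^'n" where
  "shift \<theta> = (\<chi> i. 2 * c $ i * mean (\<theta> i))"

lemma vn_cmult: "(\<And>i. \<theta> i \<in> H) \<Longrightarrow> vn (\<lambda>i x. s * \<theta> i x) = \<bar>s\<bar> * vn \<theta>"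
  by (simp add: vn_def nrm_cmult H_H1 sum_distrib_left)

lemma vn_diff_le:
  assumes "\<And>i. \<theta> i \<in> H" "\<And>i. \<eta> i \<in> H"
  shows "\<bar>vn \<theta> - vn \<eta>\<bar> \<le> vn (\<lambda>i x. \<theta> i x - \<eta> i x)"
proof -
  have "\<bar>vn \<theta> - vn \<eta>\<bar> \<le> (\<Sum>i\<in>UNIV. \<bar>nrm (\<theta> i) - nrm (\<eta> i)\<bar>)"
    unfolding vn_def sum_subtractf[symmetric] by (rule sum_abs)
  also have "\<dots> \<le> (\<Sum>i\<in>UNIV. nrm (\<lambda>x. \<theta> i x - \<eta> i x))"
    by (intro sum_mono nrm_diff_le H_H1 assms)
  finally show ?thesis by (simp add: vn_def)
qed

lemma shift_cmult: "shift (\<lambda>i x. s * \<theta> i x) = s *\<^sub>R shift \<theta>"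
  by (simp add: shift_def vec_eq_iff mean_cmult)

lemma shift_diff:
  "(\<And>i. \<theta> i \<in> H) \<Longrightarrow> (\<And>i. \<eta> i \<in> H) \<Longrightarrow> shift (\<lambda>i x. \<theta> i x - \<eta> i x) = shift \<theta> - shift \<eta>"
  by (simp add: shift_def vec_eq_iff mean_diff H_D right_diff_distrib)

lemma shift_bound: "\<exists>C\<ge>0. \<forall>\<theta>. (\<forall>i. \<theta> i \<in> H) \<longrightarrow> norm (shift \<theta>) \<le> C * vn \<theta>"
proof (intro exI[of _ "\<Sum>i\<in>UNIV. 2 * c $ i * (KK\<^sup>2 * nrm U ^ 3 / S)"] conjI allI impI)
  have n: "nrm U \<ge> 0" by (rule nrm_nonneg[OF U_H1])
  have q: "0 \<le> KK\<^sup>2 * nrm U ^ 3 / S" using n S_pos by simp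
  have q2: "0 \<le> 2 * c $ i * (KK\<^sup>2 * nrm U ^ 3 / S)" for i using q c_pos[of i] by (intro mult_nonneg_nonneg) auto
  show "0 \<le> (\<Sum>i\<in>UNIV. 2 * c $ i * (KK\<^sup>2 * nrm U ^ 3 / S))" by (intro sum_nonneg q2)
  fix \<theta> :: "'n \<Rightarrow> 'a \<Rightarrow> real" assume "\<forall>i. \<theta> i \<in> H"
  then have t: "\<theta> i \<in> H" for i by blast
  have "norm (shift \<theta>) \<le> (\<Sum>i\<in>UNIV. \<bar>shift \<theta> $ i\<bar>)" by (rule norm_le_l1_cart)
  also have "\<dots> \<le> (\<Sum>i\<in>UNIV. 2 * c $ i * (KK\<^sup>2 * nrm U ^ 3 / S) * vn \<theta>)"
  proof (rule sum_mono)
    fix i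
    have "\<bar>shift \<theta> $ i\<bar> = 2 * c $ i * \<bar>mean (\<theta> i)\<bar>" using c_pos[of i] by (simp add: shift_def abs_mult)
    also have "\<dots> \<le> 2 * c $ i * (KK\<^sup>2 * nrm U ^ 3 / S * nrm (\<theta> i))"
      using c_pos[of i] by (intro mult_left_mono mean_bound H_D t) auto
    also have "\<dots> = 2 * c $ i * (KK\<^sup>2 * nrm U ^ 3 / S) * nrm (\<theta> i)" by simp
    also have "\<dots> \<le> 2 * c $ i * (KK\<^sup>2 * nrm U ^ 3 / S) * vn \<theta>"
      by (rule mult_left_mono[OF nrm_le_vn[of \<theta>, OF t] q2])
    finally show "\<bar>shift \<theta> $ i\<bar> \<le> 2 * c $ i * (KK\<^sup>2 * nrm U ^ 3 / S) * vn \<theta>" .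
  qed
  finally show "norm (shift \<theta>) \<le> (\<Sum>i\<in>UNIV. 2 * c $ i * (KK\<^sup>2 * nrm U ^ 3 / S)) * vn \<theta>"
    by (simp add: sum_distrib_right)
qed

lemma tf_cmult: "(\<And>i. \<theta> i \<in> H) \<Longrightarrow> \<phi> \<in> D \<Longrightarrow> tf (\<lambda>i x. s * \<theta> i x) i \<phi> = s * tf \<theta> i \<phi>"
proof -
  assume t: "\<And>i. \<theta> i \<in> H" and p: "\<phi> \<in> D"
  have "(\<Sum>j\<in>UNIV. c $ i * A $ i $ j * c $ j * (s * qf U U (\<theta> j) \<phi>)) = s * (\<Sum>j\<in>UNIV. c $ i * A $ i $ j * c $ j * qf U U (\<theta> j) \<phi>)"
    unfolding sum_distrib_left by (intro sum.cong refl) (simp add: mult_ac)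
  then show ?thesis
    unfolding tf_def by (simp only: ip_cmult_left[OF H_H1[OF t] D_H1[OF p]] qf_cmult3) (simp add: algebra_simps)
qed

lemma tf_diff:
  assumes t: "\<And>i. \<theta> i \<in> H" and e: "\<And>i. \<eta> i \<in> H" and p: "\<phi> \<in> D"
  shows "tf (\<lambda>i x. \<theta> i x - \<eta> i x) i \<phi> = tf \<theta> i \<phi> - tf \<eta> i \<phi>"
proof -
  have q: "qf U U (\<lambda>x. \<theta> j x - \<eta> j x) \<phi> = qf U U (\<theta> j) \<phi> - qf U U (\<eta> j) \<phi>" for j
    by (intro qf_diff3 U_D H_D t e p)
  show ?thesis
    unfolding tf_def ip_diff_left[OF H_H1[OF t] H_H1[OF e] D_H1[OF p]] q right_diff_distrib sum_subtractf by simp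
qed

lemma tf_bound: "\<exists>C\<ge>0. \<forall>\<theta> i. \<forall>\<phi>\<in>D. (\<forall>i. \<theta> i \<in> H) \<longrightarrow> \<bar>tf \<theta> i \<phi>\<bar> \<le> C * vn \<theta> * nrm \<phi>"
proof -
  define B where "B = KK\<^sup>2 * (nrm U * nrm U)"
  define M0 where "M0 = (\<Sum>i\<in>UNIV. \<Sum>j\<in>UNIV. c $ i * A $ i $ j * c $ j)"
  have cA: "c $ i * A $ i $ j * c $ j \<ge> 0" for i j
    using c_pos[of i] c_pos[of j] A_nonneg[of i j] by simp
  have B0: "B \<ge> 0" unfolding B_def using nrm_nonneg[OF U_H1] by simp
  have M00: "M0 \<ge> 0" unfolding M0_def by (intro sum_nonneg cA)
  have "\<bar>tf \<theta> i \<phi>\<bar> \<le> (1 + B + 2 * (M0 * B)) * vn \<theta> * nrm \<phi>" if t: "\<And>i. \<theta> i \<in> H" and p: "\<phi> \<in> D" for \<theta> i \<phi>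
  proof -
    have v: "nrm (\<theta> j) \<le> vn \<theta>" for j by (rule nrm_le_vn[of \<theta>, OF t])
    have v0: "vn \<theta> \<ge> 0" by (rule vn_nonneg[of \<theta>, OF t])
    have p0: "nrm \<phi> \<ge> 0" by (rule nrm_nonneg[OF D_H1[OF p]])
    have q: "\<bar>qf U U (\<theta> j) \<phi>\<bar> \<le> B * vn \<theta> * nrm \<phi>" for j
    proof -
      have "\<bar>qf U U (\<theta> j) \<phi>\<bar> \<le> B * nrm (\<theta> j) * nrm \<phi>"
        using qf_bound[OF U_D U_D H_D[OF t] p] by (simp add: B_def mult.assoc)
      also have "\<dots> \<le> B * vn \<theta> * nrm \<phi>" by (intro mult_right_mono mult_left_mono v p0 B0)
      finally show ?thesis .
    qed
    have i: "\<bar>ip (\<theta> i) \<phi>\<bar> \<le> vn \<theta> * nrm \<phi>"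
      using ip_Cauchy_Schwarz[OF H_H1[OF t] D_H1[OF p], of i] mult_right_mono[OF v p0, of i] by linarith
    have "\<bar>\<Sum>j\<in>UNIV. c $ i * A $ i $ j * c $ j * qf U U (\<theta> j) \<phi>\<bar> \<le> (\<Sum>j\<in>UNIV. c $ i * A $ i $ j * c $ j * (B * vn \<theta> * nrm \<phi>))"
      by (rule order_trans[OF sum_abs]) (intro sum_mono, simp only: abs_mult[of _ "qf _ _ _ _"] abs_of_nonneg[OF cA], intro mult_left_mono q cA)
    also have "\<dots> = (\<Sum>j\<in>UNIV. c $ i * A $ i $ j * c $ j) * (B * vn \<theta> * nrm \<phi>)"
      by (simp only: sum_distrib_right)
    also have "\<dots> \<le> M0 * (B * vn \<theta> * nrm \<phi>)"
      unfolding M0_def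
      by (intro mult_right_mono member_le_sum[where f = "\<lambda>i. \<Sum>j\<in>UNIV. c $ i * A $ i $ j * c $ j"] sum_nonneg cA mult_nonneg_nonneg v0 p0 B0) auto
    finally have "\<bar>\<Sum>j\<in>UNIV. c $ i * A $ i $ j * c $ j * qf U U (\<theta> j) \<phi>\<bar> \<le> M0 * (B * vn \<theta> * nrm \<phi>)" .
    then have "\<bar>tf \<theta> i \<phi>\<bar> \<le> vn \<theta> * nrm \<phi> + B * vn \<theta> * nrm \<phi> + 2 * (M0 * (B * vn \<theta> * nrm \<phi>))"
      using i q[of i] unfolding tf_def by linarith
    then show ?thesis by (simp add: algebra_simps)
  qed
  moreover have "1 + B + 2 * (M0 * B) \<ge> 0" using B0 M00 by simp
  ultimately show ?thesis by blast
qed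

lemma garding:
  assumes t: "\<And>i. \<theta> i \<in> H" and d: "\<And>i. \<bar>tf \<theta> i (\<theta> i)\<bar> \<le> \<delta> * nrm (\<theta> i)"
    and F: "\<And>u. u \<in> D \<Longrightarrow> qf U U u u \<le> 1 / 6 * (nrm u)\<^sup>2 + C * (\<Sum>q\<in>F. (avg q u)\<^sup>2)"
  shows "(\<Sum>i\<in>UNIV. (nrm (\<theta> i))\<^sup>2) \<le> 2 * (\<delta> * vn \<theta>) + 6 * C * (\<Sum>i\<in>UNIV. \<Sum>q\<in>F. (avg q (\<theta> i))\<^sup>2)"
proof -
  note tD = H_D[OF t] and tH = H_H1[OF t]
  have "(nrm (\<theta> i))\<^sup>2 \<le> \<delta> * nrm (\<theta> i) + qf U U (\<theta> i) (\<theta> i) + 2 * (\<Sum>j\<in>UNIV. c $ i * A $ i $ j * c $ j * qf U U (\<theta> j) (\<theta> i))" for i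
    using d[of i] nrm_sq[OF tH, of i] unfolding tf_def by linarith
  then have "(\<Sum>i\<in>UNIV. (nrm (\<theta> i))\<^sup>2) \<le> (\<Sum>i\<in>UNIV. \<delta> * nrm (\<theta> i) + qf U U (\<theta> i) (\<theta> i) + 2 * (\<Sum>j\<in>UNIV. c $ i * A $ i $ j * c $ j * qf U U (\<theta> j) (\<theta> i)))"
    by (intro sum_mono)
  also have "\<dots> = \<delta> * vn \<theta> + (\<Sum>i\<in>UNIV. qf U U (\<theta> i) (\<theta> i)) + 2 * (\<Sum>i\<in>UNIV. \<Sum>j\<in>UNIV. c $ i * A $ i $ j * c $ j * qf U U (\<theta> j) (\<theta> i))"
    by (simp add: sum.distrib vn_def sum_distrib_left)
  also have "\<dots> \<le> \<delta> * vn \<theta> + 3 * (\<Sum>i\<in>UNIV. qf U U (\<theta> i) (\<theta> i))"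
    using coupling_form_le[of \<theta>, OF tD] by linarith
  finally have 1: "(\<Sum>i\<in>UNIV. (nrm (\<theta> i))\<^sup>2) \<le> \<delta> * vn \<theta> + 3 * (\<Sum>i\<in>UNIV. qf U U (\<theta> i) (\<theta> i))" .
  have "(\<Sum>i\<in>UNIV. qf U U (\<theta> i) (\<theta> i)) \<le> (\<Sum>i\<in>UNIV. 1 / 6 * (nrm (\<theta> i))\<^sup>2 + C * (\<Sum>q\<in>F. (avg q (\<theta> i))\<^sup>2))"
    by (intro sum_mono F tD)
  also have "\<dots> = 1 / 6 * (\<Sum>i\<in>UNIV. (nrm (\<theta> i))\<^sup>2) + C * (\<Sum>i\<in>UNIV. \<Sum>q\<in>F. (avg q (\<theta> i))\<^sup>2)"
    by (simp only: sum.distrib sum_distrib_left)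
  finally show ?thesis using 1 by linarith
qed

lemma linearized_compactness:
  assumes t: "\<And>n i. \<Theta> n i \<in> H" and v1: "\<And>n. vn (\<Theta> n) = 1"
    and d: "\<And>n i \<phi>. \<phi> \<in> D \<Longrightarrow> \<bar>tf (\<Theta> n) i \<phi>\<bar> \<le> \<delta> n * nrm \<phi>" and d0: "\<delta> \<longlonglongrightarrow> 0"
  shows "\<exists>r \<theta>. strict_mono r \<and> (\<forall>i. \<theta> i \<in> H) \<and> (\<lambda>n. vn (\<lambda>i x. \<Theta> (r n) i x - \<theta> i x)) \<longlonglongrightarrow> 0"
proof -
  note tD = H_D[OF t] and tH = H_H1[OF t]
  obtain F C where F: "finite F" "C \<ge> 0" "\<And>q. q \<in> F \<Longrightarrow> q \<in> sets borel \<and> bounded q"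
    and FC: "\<And>u. u \<in> D \<Longrightarrow> qf U U u u \<le> 1 / 6 * (nrm u)\<^sup>2 + C * (\<Sum>q\<in>F. (avg q u)\<^sup>2)"
    using qf_compact[OF U_D, of "1/6"] by auto
  have "\<exists>r. strict_mono r \<and> (\<forall>p\<in>F \<times> UNIV. convergent (\<lambda>n. (\<lambda>(q, i) n. avg q (\<Theta> n i)) p (r n)))"
  proof (rule convergent_subseq_finite)
    show "finite (F \<times> (UNIV :: 'n set))" using F(1) by simp
    fix p assume "p \<in> F \<times> (UNIV :: 'n set)"
    then obtain q i where p: "p = (q, i)" and q: "q \<in> F" by auto
    have "\<bar>avg q (\<Theta> n i)\<bar> \<le> l2norm M (indicator q :: 'a \<Rightarrow> real) * eqc" for n
    proof -
      have "\<bar>avg q (\<Theta> n i)\<bar> \<le> l2norm M (indicator q :: 'a \<Rightarrow> real) * eqc * nrm (\<Theta> n i)"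
        using F(3)[OF q] by (intro avg_bound tD) auto
      also have "\<dots> \<le> l2norm M (indicator q :: 'a \<Rightarrow> real) * eqc * 1"
        using nrm_le_vn[of "\<Theta> n", OF t, of i] v1[of n] eqc_pos by (intro mult_left_mono) (auto simp: l2norm_def)
      finally show ?thesis by simp
    qed
    then show "bounded (range ((\<lambda>(q, i) n. avg q (\<Theta> n i)) p))" unfolding p by (auto simp: bounded_iff)
  qed
  then obtain r where r: "strict_mono r"
    and cv: "\<And>q i. q \<in> F \<Longrightarrow> convergent (\<lambda>n. avg q (\<Theta> (r n) i))" by fastforce
  define l where "l q i = lim (\<lambda>n. avg q (\<Theta> (r n) i))" for q i
  have l: "(\<lambda>n. avg q (\<Theta> (r n) i)) \<longlonglongrightarrow> l q i" if "q \<in> F" for q i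
    unfolding l_def using cv[OF that] by (simp add: convergent_LIMSEQ_iff)
  define s where "s n = \<bar>\<delta> (r n)\<bar> + (\<Sum>i\<in>UNIV. \<Sum>q\<in>F. (avg q (\<Theta> (r n) i) - l q i)\<^sup>2)" for n
  have "s \<longlonglongrightarrow> \<bar>0\<bar> + (\<Sum>i\<in>(UNIV :: 'n set). \<Sum>q\<in>F. (l q i - l q i)\<^sup>2)"
    unfolding s_def[abs_def]
    by (intro tendsto_intros l LIMSEQ_subseq_LIMSEQ[OF d0 r, unfolded comp_def])
  then have s0: "s \<longlonglongrightarrow> 0" by simp
  have key: "(nrm (\<lambda>x. \<Theta> (r m) i x - \<Theta> (r n) i x))\<^sup>2 \<le> (4 + 12 * C) * (s m + s n)" for m n i
  proof -
    let ?d = "\<lambda>i x. \<Theta> (r m) i x - \<Theta> (r n) i x"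
    have dH: "?d i \<in> H" for i by (intro H_diff t)
    have dn: "\<bar>tf ?d i \<phi>\<bar> \<le> (\<bar>\<delta> (r m)\<bar> + \<bar>\<delta> (r n)\<bar>) * nrm \<phi>" if "\<phi> \<in> D" for i \<phi>
    proof -
      have "\<delta> (r m) * nrm \<phi> \<le> \<bar>\<delta> (r m)\<bar> * nrm \<phi>" "\<delta> (r n) * nrm \<phi> \<le> \<bar>\<delta> (r n)\<bar> * nrm \<phi>"
        by (intro mult_right_mono nrm_nonneg D_H1 that abs_ge_self)+
      then show ?thesis using d[OF that, of "r m" i] d[OF that, of "r n" i]
        unfolding tf_diff[of "\<Theta> (r m)" "\<Theta> (r n)", OF t t that] distrib_right by linarith
    qed
    have v2: "vn ?d \<le> 2"
    proof -
      have "vn ?d \<le> (\<Sum>i\<in>UNIV. nrm (\<Theta> (r m) i) + nrm (\<Theta> (r n) i))"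
        unfolding vn_def
      proof (rule sum_mono)
        fix i show "nrm (?d i) \<le> nrm (\<Theta> (r m) i) + nrm (\<Theta> (r n) i)"
          using nrm_triangle[OF tH H1_cmult[OF tH, where c = "-1"]] nrm_cmult[OF tH, where c = "-1"] by simp
      qed
      also have "\<dots> = vn (\<Theta> (r m)) + vn (\<Theta> (r n))" by (simp only: sum.distrib vn_def)
      finally show ?thesis by (simp add: v1)
    qed
    have av: "(\<Sum>i\<in>UNIV. \<Sum>q\<in>F. (avg q (?d i))\<^sup>2) \<le> 2 * (s m - \<bar>\<delta> (r m)\<bar>) + 2 * (s n - \<bar>\<delta> (r n)\<bar>)"
    proof -
      have "(avg q (?d i))\<^sup>2 \<le> 2 * (avg q (\<Theta> (r m) i) - l q i)\<^sup>2 + 2 * (avg q (\<Theta> (r n) i) - l q i)\<^sup>2" if q: "q \<in> F" for q i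
      proof -
        have "avg q (?d i) = (avg q (\<Theta> (r m) i) - l q i) - (avg q (\<Theta> (r n) i) - l q i)"
          using F(3)[OF q] by (subst avg_diff) (auto intro: tD)
        moreover have "(a - b)\<^sup>2 \<le> 2 * a\<^sup>2 + 2 * b\<^sup>2" for a b :: real
          using zero_le_power2[of "a + b"] by (simp add: power2_sum power2_diff)
        ultimately show ?thesis by (simp only:)
      qed
      then have "(\<Sum>i\<in>UNIV. \<Sum>q\<in>F. (avg q (?d i))\<^sup>2) \<le> (\<Sum>i\<in>UNIV. \<Sum>q\<in>F. 2 * (avg q (\<Theta> (r m) i) - l q i)\<^sup>2 + 2 * (avg q (\<Theta> (r n) i) - l q i)\<^sup>2)"
        by (intro sum_mono)
      also have "\<dots> = 2 * (s m - \<bar>\<delta> (r m)\<bar>) + 2 * (s n - \<bar>\<delta> (r n)\<bar>)"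
        by (simp only: s_def sum.distrib sum_distrib_left add_diff_cancel_left')
      finally show ?thesis .
    qed
    have "(nrm (?d i))\<^sup>2 \<le> (\<Sum>i\<in>UNIV. (nrm (?d i))\<^sup>2)" by (rule member_le_sum) auto
    also have "\<dots> \<le> 2 * ((\<bar>\<delta> (r m)\<bar> + \<bar>\<delta> (r n)\<bar>) * vn ?d) + 6 * C * (\<Sum>i\<in>UNIV. \<Sum>q\<in>F. (avg q (?d i))\<^sup>2)"
      by (rule garding[of ?d, OF dH _ FC]) (rule dn[OF H_D[OF dH]])
    also have "\<dots> \<le> 2 * ((\<bar>\<delta> (r m)\<bar> + \<bar>\<delta> (r n)\<bar>) * 2) + 6 * C * (2 * (s m - \<bar>\<delta> (r m)\<bar>) + 2 * (s n - \<bar>\<delta> (r n)\<bar>))"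
      using F(2) by (intro add_mono mult_left_mono v2 av) auto
    also have "\<dots> \<le> 2 * ((s m + s n) * 2) + 6 * C * (2 * s m + 2 * s n)"
    proof -
      have "\<bar>\<delta> (r k)\<bar> \<le> s k" for k unfolding s_def by (simp add: sum_nonneg)
      then show ?thesis using F(2) by (intro add_mono mult_left_mono mult_right_mono) auto
    qed
    finally show ?thesis by (simp add: algebra_simps)
  qed
  have "\<exists>u\<in>H. (\<lambda>n. nrm (\<lambda>x. \<Theta> (r n) i x - u x)) \<longlonglongrightarrow> 0" for i
  proof (rule H_complete[OF t])
    fix e :: real assume e: "e > 0"
    define b where "b = e\<^sup>2 / (2 * (4 + 12 * C) + 1)"
    have b: "b > 0" unfolding b_def using e F(2) by (intro divide_pos_pos) auto
    obtain N where N: "\<And>n. n \<ge> N \<Longrightarrow> s n < b" using order_tendstoD(2)[OF s0 b] by (auto simp: eventually_sequentially)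
    show "\<exists>N. \<forall>m\<ge>N. \<forall>n\<ge>N. nrm (\<lambda>x. \<Theta> (r m) i x - \<Theta> (r n) i x) < e"
    proof (intro exI[of _ N] allI impI)
      fix m n assume "m \<ge> N" "n \<ge> N"
      then have "s m + s n \<le> 2 * b" using N[of m] N[of n] by linarith
      then have "(4 + 12 * C) * (s m + s n) \<le> (4 + 12 * C) * (2 * b)" using F(2) by (intro mult_left_mono) auto
      also have "\<dots> < (2 * (4 + 12 * C) + 1) * b" using b by (simp add: algebra_simps)
      also have "\<dots> = e\<^sup>2" using F(2) by (simp add: b_def)
      finally have "(nrm (\<lambda>x. \<Theta> (r m) i x - \<Theta> (r n) i x))\<^sup>2 < e\<^sup>2" using key[of m i n] by linarith
      then show "nrm (\<lambda>x. \<Theta> (r m) i x - \<Theta> (r n) i x) < e" by (rule power2_less_imp_less) (use e in simp)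
    qed
  qed
  then obtain \<theta> where "\<And>i. \<theta> i \<in> H" "\<And>i. (\<lambda>n. nrm (\<lambda>x. \<Theta> (r n) i x - \<theta> i x)) \<longlonglongrightarrow> 0" by metis
  moreover from this(2) have "(\<lambda>n. vn (\<lambda>i x. \<Theta> (r n) i x - \<theta> i x)) \<longlonglongrightarrow> 0"
    unfolding vn_def by (rule tendsto_null_sum)
  ultimately show ?thesis using r by blast
qed

lemma T_estimate:
  "\<exists>C>0. \<forall>\<theta> \<delta>. (\<forall>i. \<theta> i \<in> H) \<and> (\<forall>i. \<forall>\<phi>\<in>D. \<bar>tf \<theta> i \<phi>\<bar> \<le> \<delta> * nrm \<phi>) \<longrightarrow> vn \<theta> \<le> C * (\<delta> + norm (P (shift \<theta>)))"
proof (rule ccontr)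
  assume neg: "\<not> ?thesis"
  have "\<exists>\<theta>. (\<forall>i. \<theta> i \<in> H) \<and> vn \<theta> = 1 \<and> (\<forall>i. \<forall>\<phi>\<in>D. \<bar>tf \<theta> i \<phi>\<bar> \<le> 1 / real (Suc n) * nrm \<phi>) \<and> norm (P (shift \<theta>)) \<le> 1 / real (Suc n)" for n
  proof -
    have "real (Suc n) > 0" by simp
    with neg obtain \<theta> \<delta> where t: "\<And>i. \<theta> i \<in> H" and d: "\<And>i \<phi>. \<phi> \<in> D \<Longrightarrow> \<bar>tf \<theta> i \<phi>\<bar> \<le> \<delta> * nrm \<phi>"
      and big: "\<not> vn \<theta> \<le> real (Suc n) * (\<delta> + norm (P (shift \<theta>)))" by blast
    have U0: "nrm U > 0" using ip_UU S_pos by (simp add: nrm_def)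
    have d0: "\<delta> \<ge> 0"
      using order_trans[OF abs_ge_zero d[OF U_D]] U0 by (simp add: zero_le_mult_iff)
    have "0 \<le> real (Suc n) * (\<delta> + norm (P (shift \<theta>)))" using d0 by (intro mult_nonneg_nonneg add_nonneg_nonneg) auto
    then have v: "vn \<theta> > 0" using big by linarith
    define a where "a = 1 / vn \<theta>"
    have a: "a > 0" using v by (simp add: a_def)
    have sm: "a * (\<delta> + norm (P (shift \<theta>))) \<le> 1 / real (Suc n)"
      using big v by (simp add: a_def field_simps)
    have 1: "\<bar>tf (\<lambda>i x. a * \<theta> i x) i \<phi>\<bar> \<le> 1 / real (Suc n) * nrm \<phi>" if p: "\<phi> \<in> D" for i \<phi>
    proof -
      have "\<bar>tf (\<lambda>i x. a * \<theta> i x) i \<phi>\<bar> = a * \<bar>tf \<theta> i \<phi>\<bar>"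
        unfolding tf_cmult[of \<theta>, OF t p] using a by (simp add: abs_mult)
      also have "\<dots> \<le> a * (\<delta> * nrm \<phi>)" using a by (intro mult_left_mono d p) auto
      also have "\<dots> = a * \<delta> * nrm \<phi>" by simp
      also have "\<dots> \<le> 1 / real (Suc n) * nrm \<phi>"
      proof (rule mult_right_mono[OF _ nrm_nonneg[OF D_H1[OF p]]])
        have "a * norm (P (shift \<theta>)) \<ge> 0" using a by simp
        then show "a * \<delta> \<le> 1 / real (Suc n)" using sm unfolding distrib_left by linarith
      qed
      finally show ?thesis .
    qed
    have 2: "norm (P (shift (\<lambda>i x. a * \<theta> i x))) \<le> 1 / real (Suc n)"
    proof -
      have "norm (P (shift (\<lambda>i x. a * \<theta> i x))) = a * norm (P (shift \<theta>))"
        unfolding shift_cmult linear_scale[OF P_linear] using a by simp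
      moreover have "a * \<delta> \<ge> 0" using a d0 by simp
      ultimately show ?thesis using sm unfolding distrib_left by linarith
    qed
    have 3: "vn (\<lambda>i x. a * \<theta> i x) = 1" unfolding vn_cmult[of \<theta>, OF t] using v by (simp add: a_def)
    show ?thesis using 1 2 3 H_cmult[OF t] by (intro exI[of _ "\<lambda>i x. a * \<theta> i x"]) blast
  qed
  then obtain \<Theta> where t: "\<And>n i. \<Theta> n i \<in> H" and v1: "\<And>n. vn (\<Theta> n) = 1"
    and d: "\<And>n i \<phi>. \<phi> \<in> D \<Longrightarrow> \<bar>tf (\<Theta> n) i \<phi>\<bar> \<le> 1 / real (Suc n) * nrm \<phi>"
    and Pd: "\<And>n. norm (P (shift (\<Theta> n))) \<le> 1 / real (Suc n)" by metis
  have d0: "(\<lambda>n. 1 / real (Suc n)) \<longlonglongrightarrow> 0" by (rule LIMSEQ_Suc[OF lim_const_over_n])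
  from linearized_compactness[of \<Theta> "\<lambda>n. 1 / real (Suc n)", OF t v1 d d0] obtain r \<theta> where
    r: "strict_mono r" and tH: "\<And>i. \<theta> i \<in> H" and lim: "(\<lambda>n. vn (\<lambda>i x. \<Theta> (r n) i x - \<theta> i x)) \<longlonglongrightarrow> 0"
    by blast
  let ?v = "\<lambda>n. vn (\<lambda>i x. \<Theta> (r n) i x - \<theta> i x)"
  have d0r: "(\<lambda>n. 1 / real (Suc (r n))) \<longlonglongrightarrow> 0" using LIMSEQ_subseq_LIMSEQ[OF d0 r] by (simp add: comp_def)
  have dH: "(\<lambda>x. \<Theta> (r n) i x - \<theta> i x) \<in> H" for n i by (intro H_diff t tH)
  have small: "x \<le> 0" if "C \<ge> 0" "\<And>n. x \<le> 1 / real (Suc (r n)) * b + C * ?v n" for x C b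
  proof -
    have "(\<lambda>n. 1 / real (Suc (r n)) * b + C * ?v n) \<longlonglongrightarrow> 0 * b + C * 0"
      by (intro tendsto_intros d0r lim)
    then have "x \<le> 0 * b + C * 0" by (rule LIMSEQ_le_const) (use that(2) in blast)
    then show ?thesis by simp
  qed
  have "tf \<theta> i \<phi> = 0" if p: "\<phi> \<in> D" for i \<phi>
  proof -
    obtain C where C: "C \<ge> 0" "\<And>\<theta> i \<phi>. \<phi> \<in> D \<Longrightarrow> (\<And>i. \<theta> i \<in> H) \<Longrightarrow> \<bar>tf \<theta> i \<phi>\<bar> \<le> C * vn \<theta> * nrm \<phi>"
      using tf_bound by blast
    have "\<bar>tf \<theta> i \<phi>\<bar> \<le> 0"
    proof (rule small[of "C * nrm \<phi>" _ "nrm \<phi>"])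
      show "C * nrm \<phi> \<ge> 0" using C(1) nrm_nonneg[OF D_H1[OF p]] by simp
      fix n
      have "\<bar>tf (\<lambda>i x. \<Theta> (r n) i x - \<theta> i x) i \<phi>\<bar> \<le> C * ?v n * nrm \<phi>" by (rule C(2)[OF p dH])
      then show "\<bar>tf \<theta> i \<phi>\<bar> \<le> 1 / real (Suc (r n)) * nrm \<phi> + C * nrm \<phi> * ?v n"
        using d[OF p, of "r n" i] unfolding tf_diff[of "\<Theta> (r n)" \<theta>, OF t tH p] mult.assoc mult.commute[of "nrm \<phi>"] by linarith
    qed
    then show ?thesis by simp
  qed
  moreover have "P (\<chi> i. 2 * c $ i * mean (\<theta> i)) = 0"
  proof -
    obtain C where C: "C \<ge> 0" "\<And>\<theta>. (\<And>i. \<theta> i \<in> H) \<Longrightarrow> norm (shift \<theta>) \<le> C * vn \<theta>"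
      using shift_bound by blast
    have "norm (P (shift \<theta>)) \<le> 0"
    proof (rule small[OF C(1), where b = 1])
      fix n
      have "norm (P (shift (\<lambda>i x. \<Theta> (r n) i x - \<theta> i x))) \<le> C * ?v n"
        using P_norm_le[of "shift (\<lambda>i x. \<Theta> (r n) i x - \<theta> i x)"] C(2)[of "\<lambda>i x. \<Theta> (r n) i x - \<theta> i x", OF dH] by linarith
      then have "norm (P (shift (\<Theta> (r n))) - P (shift \<theta>)) \<le> C * ?v n"
        unfolding shift_diff[of "\<Theta> (r n)" \<theta>, OF t tH] linear_diff[OF P_linear] .
      then show "norm (P (shift \<theta>)) \<le> 1 / real (Suc (r n)) * 1 + C * ?v n"
        using Pd[of "r n"] norm_triangle_sub[of "P (shift \<theta>)" "P (shift (\<Theta> (r n)))"]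
        unfolding norm_minus_commute[of "P (shift \<theta>)"] by linarith
    qed
    then show ?thesis by (simp add: shift_def)
  qed
  ultimately have "nrm (\<theta> i) = 0" for i by (rule linearized_kernel[of \<theta>, OF tH])
  then have "vn \<theta> = 0" by (simp add: vn_def)
  moreover have "1 - vn \<theta> \<le> 0"
    by (rule small[of 1 _ 0]) (use vn_diff_le[of "\<Theta> (r _)" \<theta>, OF t tH] v1 in \<open>auto simp: abs_le_iff\<close>)
  ultimately show False by simp
qed

end

subsection \<open>Uniqueness near the given solution\<close>

text \<open>A solution \<open>v\<close> near \<open>c U\<close> is compared with \<open>d U\<close>, where \<open>d\<^sup>2 = x + \<beta>\<close> with \<open>\<beta> \<in> K\<close> chosen such
  that \<open>K\<close> annihilates the means of the remainder \<open>\<theta> = v - d U\<close> up to higher order. All fixed constants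
  are absorbed in \<open>G\<close>, and \<open>s\<close> measures the distance to \<open>c U\<close>.\<close>

locale near_solution = linearized \<Omega> lam U A E c P
  for \<Omega> :: "'a::euclidean_space set" and lam :: real and U :: "'a \<Rightarrow> real"
    and A E :: "real^'n^'n" and c :: "real^'n" and P :: "real^'n \<Rightarrow> real^'n" +
  fixes \<epsilon> s G :: real and x \<beta> d :: "real^'n" and v :: "'n \<Rightarrow> 'a \<Rightarrow> real"
  assumes eps: "0 < \<epsilon>" "\<epsilon> \<le> s" "s \<le> 1"
    and G: "G \<ge> 1" "KK\<^sup>2 \<le> G" "nrm U \<le> G" "\<bar>A $ i $ j\<bar> + \<bar>E $ i $ j\<bar> \<le> G" "real CARD('n) \<le> G"
      "norm (E *v w) \<le> G * norm w" "u \<in> D \<Longrightarrow> \<bar>mean u\<bar> \<le> G * nrm u" "c $ i \<le> G"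
    and vH: "v i \<in> H" and vG: "nrm (v i) \<le> G" and vs: "nrm (\<lambda>y. v i y - c $ i * U y) \<le> s"
    and v_eq: "\<phi> \<in> D \<Longrightarrow> ip (v i) \<phi> = (\<Sum>j\<in>UNIV. (A + \<epsilon> *\<^sub>R E) $ i $ j * qf (v i) (v j) (v j) \<phi>)"
    and x_eq: "(A + \<epsilon> *\<^sub>R E) *v x = 1"
    and beta: "\<beta> = P (\<chi> i. (mean (v i))\<^sup>2 - x $ i)"
    and d_pos: "d $ i > 0" and d_sq: "(d $ i)\<^sup>2 = x $ i + \<beta> $ i"
    and dG: "d $ i \<le> G" "1 / d $ i \<le> G" and ds: "\<bar>d $ i - c $ i\<bar> \<le> s" and ms: "\<bar>mean (v i) - c $ i\<bar> \<le> s"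
begin

abbreviation "B i j \<equiv> (A + \<epsilon> *\<^sub>R E) $ i $ j"

definition \<theta> :: "'n \<Rightarrow> 'a \<Rightarrow> real" where "\<theta> i = (\<lambda>y. v i y - d $ i * U y)"

abbreviation "X \<equiv> vn \<theta>"

lemma G0: "G \<ge> 0" "s \<ge> 0" using G(1) eps by auto
lemma vD: "v i \<in> D" by (rule H_D[OF vH])
lemma \<theta>H: "\<theta> i \<in> H" unfolding \<theta>_def by (intro H_diff H_cmult vH U_H)
lemma \<theta>D: "\<theta> i \<in> D" by (rule H_D[OF \<theta>H])
lemma X0: "X \<ge> 0" by (rule vn_nonneg[of \<theta>, OF \<theta>H])
lemma nX: "nrm (\<theta> i) \<le> X" by (rule nrm_le_vn[of \<theta>, OF \<theta>H])
lemma \<beta>K: "\<beta> \<in> mat_kernel A" unfolding beta by (rule P_mem)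
lemma d_le: "\<bar>d $ i\<bar> \<le> G" "\<bar>1 / d $ i\<bar> \<le> G" using d_pos[of i] dG[of i] by simp_all
lemma c_le: "\<bar>c $ i\<bar> \<le> G" using c_pos[of i] G(8)[of i] by simp
lemma A_le: "\<bar>A $ i $ j\<bar> \<le> G" and E_le: "\<bar>E $ i $ j\<bar> \<le> G" using G(4)[of i j] by simp_all
lemma E\<beta>_le: "\<bar>(E *v w) $ i\<bar> \<le> G * norm w"
  using component_le_norm_cart[of "E *v w" i] G(6)[of w] by simp

lemma B_le: "\<bar>B i j\<bar> \<le> G"
proof -
  have "\<bar>\<epsilon> * E $ i $ j\<bar> \<le> 1 * \<bar>E $ i $ j\<bar>" unfolding abs_mult using eps by (intro mult_right_mono) auto
  then have "\<bar>A $ i $ j + \<epsilon> * E $ i $ j\<bar> \<le> G" using G(4)[of i j] by linarith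
  then show ?thesis by simp
qed

lemma sum_B_d: "(\<Sum>j\<in>UNIV. B i j * (d $ j)\<^sup>2) = 1 + \<epsilon> * (E *v \<beta>) $ i"
proof -
  have "(\<Sum>j\<in>UNIV. B i j * (d $ j)\<^sup>2) = ((A + \<epsilon> *\<^sub>R E) *v (x + \<beta>)) $ i"
    by (simp add: matrix_vector_mult_def d_sq)
  also have "(A + \<epsilon> *\<^sub>R E) *v (x + \<beta>) = 1 + (A *v \<beta> + \<epsilon> *\<^sub>R (E *v \<beta>))"
    by (simp only: matrix_vector_right_distrib x_eq) (simp only: matrix_vector_mult_add_rdistrib scaleR_matrix_vector_assoc[symmetric])
  finally show ?thesis using \<beta>K by (simp add: mat_kernel_def)
qed

lemma qf_le:
  assumes "a \<in> D" "b \<in> D" "t \<in> D" "\<phi> \<in> D" "nrm a \<le> a'" "nrm b \<le> b'" "nrm t \<le> t'" "\<bar>k\<bar> \<le> k'"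
  shows "\<bar>k * qf a b t \<phi>\<bar> \<le> k' * (G * (a' * b' * t')) * nrm \<phi>"
proof -
  note n = nrm_nonneg[OF D_H1[OF assms(1)]] nrm_nonneg[OF D_H1[OF assms(2)]] nrm_nonneg[OF D_H1[OF assms(3)]]
    nrm_nonneg[OF D_H1[OF assms(4)]]
  have p: "0 \<le> a'" "0 \<le> b'" "0 \<le> t'" "0 \<le> k'" using n assms(5-8) by linarith+
  have "\<bar>qf a b t \<phi>\<bar> \<le> KK\<^sup>2 * (nrm a * nrm b * nrm t * nrm \<phi>)" by (rule qf_bound[OF assms(1-4)])
  also have "\<dots> \<le> G * (a' * b' * t' * nrm \<phi>)"
    using n p G0 by (intro mult_mono mult_nonneg_nonneg assms G(2)) auto
  finally have "\<bar>k\<bar> * \<bar>qf a b t \<phi>\<bar> \<le> k' * (G * (a' * b' * t' * nrm \<phi>))"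
    by (intro mult_mono assms(8) p) auto
  then show ?thesis by (simp add: abs_mult mult.assoc)
qed

lemma add_abs_le: "\<bar>a\<bar> \<le> a' \<Longrightarrow> \<bar>b\<bar> \<le> b' \<Longrightarrow> \<bar>a + b\<bar> \<le> a' + (b' :: real)"
  by linarith

lemma mult_abs_le: "\<bar>a\<bar> \<le> a' \<Longrightarrow> \<bar>b\<bar> \<le> b' \<Longrightarrow> \<bar>a * b\<bar> \<le> a' * (b' :: real)"
  unfolding abs_mult by (intro mult_mono) auto

lemma \<theta>_equation:
  assumes p: "\<phi> \<in> D"
  shows "ip (\<theta> i) \<phi> = (\<Sum>j\<in>UNIV. B i j * (qf (v j) (v j) (\<theta> i) \<phi> + d $ i * qf U (v j) (\<theta> j) \<phi> + d $ i * d $ j * qf U U (\<theta> j) \<phi>))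
    + \<epsilon> * d $ i * (E *v \<beta>) $ i * qf U U U \<phi>"
proof -
  have e1: "qf (v j) (v j) (\<theta> i) \<phi> = qf (v j) (v j) (v i) \<phi> - d $ i * qf (v j) (v j) U \<phi>" for j
    unfolding \<theta>_def by (subst qf_diff3) (simp_all add: vD U_D D_intros p qf_cmult3)
  have e2: "qf U (v j) (\<theta> j) \<phi> = qf U (v j) (v j) \<phi> - d $ j * qf U (v j) U \<phi>" for j
    unfolding \<theta>_def by (subst qf_diff3) (simp_all add: vD U_D D_intros p qf_cmult3)
  have e3: "qf U U (\<theta> j) \<phi> = qf U U (v j) \<phi> - d $ j * qf U U U \<phi>" for j
    unfolding \<theta>_def by (subst qf_diff3) (simp_all add: vD U_D D_intros p qf_cmult3)
  have w: "qf (v i) (v j) (v j) \<phi> = qf (v j) (v j) (v i) \<phi>" "qf (v j) (v j) U \<phi> = qf U (v j) (v j) \<phi>"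
    "qf U (v j) U \<phi> = qf U U (v j) \<phi>" for j
    unfolding qf_def by (simp_all add: mult_ac)
  have alg: "b * a = b * (a - y * u + y * (u - z * t) + y * z * (t - z * w)) + b * (z * z) * (y * w)"
    for a b t u w y z :: real by (simp add: algebra_simps)
  have q: "B i j * qf (v i) (v j) (v j) \<phi> = B i j * (qf (v j) (v j) (\<theta> i) \<phi> + d $ i * qf U (v j) (\<theta> j) \<phi> + d $ i * d $ j * qf U U (\<theta> j) \<phi>)
      + B i j * (d $ j)\<^sup>2 * (d $ i * qf U U U \<phi>)" for j
    unfolding e1 e2 e3 w power2_eq_square by (rule alg)
  have "ip (\<theta> i) \<phi> = ip (v i) \<phi> - d $ i * qf U U U \<phi>"
    unfolding \<theta>_def
    by (simp add: ip_diff_left H_H1[OF vH] H1_cmult[OF U_H1] U_H1 D_H1[OF p] ip_cmult_left U_eq[OF p])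
  also have "ip (v i) \<phi> = (\<Sum>j\<in>UNIV. B i j * (qf (v j) (v j) (\<theta> i) \<phi> + d $ i * qf U (v j) (\<theta> j) \<phi> + d $ i * d $ j * qf U U (\<theta> j) \<phi>))
      + (\<Sum>j\<in>UNIV. B i j * (d $ j)\<^sup>2) * (d $ i * qf U U U \<phi>)"
    unfolding v_eq[OF p] q sum.distrib sum_distrib_right ..
  finally show ?thesis unfolding sum_B_d by (simp add: algebra_simps)
qed

definition CR :: real where "CR = G * (3 * G ^ 4 + G ^ 3 + 4 * G ^ 5 + G ^ 6)"

lemma tf_small:
  assumes p: "\<phi> \<in> D"
  shows "\<bar>tf \<theta> i \<phi>\<bar> \<le> (\<epsilon> * G ^ 6 * norm \<beta> + CR * s * X) * nrm \<phi>"
proof -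
  let ?w = "\<lambda>j y. v j y - c $ j * U y"
  have wD: "?w j \<in> D" for j by (intro D_intros vD U_D)
  have p0: "nrm \<phi> \<ge> 0" by (rule nrm_nonneg[OF D_H1[OF p]])
  define R where "R j = B i j * (qf (v j) (v j) (\<theta> i) \<phi> + d $ i * qf U (v j) (\<theta> j) \<phi> + d $ i * d $ j * qf U U (\<theta> j) \<phi>)
      - A $ i $ j * (c $ j)\<^sup>2 * qf U U (\<theta> i) \<phi> - 2 * (c $ i * A $ i $ j * c $ j * qf U U (\<theta> j) \<phi>)" for j
  have tf: "tf \<theta> i \<phi> = (\<Sum>j\<in>UNIV. R j) + \<epsilon> * d $ i * (E *v \<beta>) $ i * qf U U U \<phi>"
  proof -
    have "(\<Sum>j\<in>UNIV. A $ i $ j * (c $ j)\<^sup>2 * qf U U (\<theta> i) \<phi>) = qf U U (\<theta> i) \<phi>"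
      by (simp add: sum_distrib_right[symmetric] A_c)
    then show ?thesis
      unfolding tf_def \<theta>_equation[OF p] R_def sum_subtractf sum_distrib_left[symmetric] by simp
  qed
  have R: "\<bar>R j\<bar> \<le> (3 * G ^ 4 + G ^ 3 + 4 * G ^ 5 + G ^ 6) * s * X * nrm \<phi>" for j
  proof -
    have e1: "qf (?w j) (v j) (\<theta> i) \<phi> = qf (v j) (v j) (\<theta> i) \<phi> - c $ j * qf U (v j) (\<theta> i) \<phi>"
      by (subst qf_diff1) (simp_all add: vD U_D \<theta>D D_intros p qf_cmult1)
    have e2: "qf U (?w j) t \<phi> = qf U (v j) t \<phi> - c $ j * qf U U t \<phi>" if "t \<in> D" for t
      by (subst qf_diff2) (simp_all add: vD U_D that D_intros p qf_cmult2)
    have Req: "R j = (\<epsilon> * E $ i $ j) * qf (v j) (v j) (\<theta> i) \<phi> + A $ i $ j * qf (?w j) (v j) (\<theta> i) \<phi>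
        + (A $ i $ j * c $ j) * qf U (?w j) (\<theta> i) \<phi> + (\<epsilon> * E $ i $ j * d $ i) * qf U (v j) (\<theta> j) \<phi>
        + (\<epsilon> * E $ i $ j * d $ i * d $ j) * qf U U (\<theta> j) \<phi> + (A $ i $ j * d $ i) * qf U (?w j) (\<theta> j) \<phi>
        + (A $ i $ j * (2 * (d $ i - c $ i) * c $ j + d $ i * (d $ j - c $ j))) * qf U U (\<theta> j) \<phi>"
      unfolding e1 e2[OF \<theta>D] R_def by (simp add: algebra_simps power2_eq_square)
    have es: "\<bar>\<epsilon>\<bar> \<le> s" using eps by simp
    have coef: "\<bar>2 * (d $ i - c $ i) * c $ j + d $ i * (d $ j - c $ j)\<bar> \<le> 3 * s * G"
    proof -
      have "\<bar>(d $ i - c $ i) * c $ j\<bar> \<le> s * G" "\<bar>d $ i * (d $ j - c $ j)\<bar> \<le> G * s"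
        by (intro mult_abs_le ds c_le d_le)+
      then show ?thesis unfolding mult.assoc by (simp add: mult.commute[of G])
    qed
    have "\<bar>(\<epsilon> * E $ i $ j) * qf (v j) (v j) (\<theta> i) \<phi>\<bar> \<le> s * G * (G * (G * G * X)) * nrm \<phi>"
      by (intro qf_le mult_abs_le es E_le vG nX vD \<theta>D p)
    moreover have "\<bar>A $ i $ j * qf (?w j) (v j) (\<theta> i) \<phi>\<bar> \<le> G * (G * (s * G * X)) * nrm \<phi>"
      by (intro qf_le A_le vs wD vG nX vD \<theta>D p)
    moreover have "\<bar>(A $ i $ j * c $ j) * qf U (?w j) (\<theta> i) \<phi>\<bar> \<le> G * G * (G * (G * s * X)) * nrm \<phi>"
      by (intro qf_le A_le mult_abs_le c_le vs wD G(3) U_D nX vD \<theta>D p)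
    moreover have "\<bar>(\<epsilon> * E $ i $ j * d $ i) * qf U (v j) (\<theta> j) \<phi>\<bar> \<le> s * G * G * (G * (G * G * X)) * nrm \<phi>"
      by (intro qf_le mult_abs_le es E_le d_le vG G(3) U_D nX vD \<theta>D p)
    moreover have "\<bar>(\<epsilon> * E $ i $ j * d $ i * d $ j) * qf U U (\<theta> j) \<phi>\<bar> \<le> s * G * G * G * (G * (G * G * X)) * nrm \<phi>"
      by (intro qf_le mult_abs_le es E_le d_le G(3) U_D nX vD \<theta>D p)
    moreover have "\<bar>(A $ i $ j * d $ i) * qf U (?w j) (\<theta> j) \<phi>\<bar> \<le> G * G * (G * (G * s * X)) * nrm \<phi>"
      by (intro qf_le A_le mult_abs_le d_le vs wD G(3) U_D nX vD \<theta>D p)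
    moreover have "\<bar>(A $ i $ j * (2 * (d $ i - c $ i) * c $ j + d $ i * (d $ j - c $ j))) * qf U U (\<theta> j) \<phi>\<bar>
        \<le> G * (3 * s * G) * (G * (G * G * X)) * nrm \<phi>"
      by (intro qf_le A_le mult_abs_le coef G(3) U_D nX vD \<theta>D p)
    ultimately have "\<bar>R j\<bar> \<le> s * G * (G * (G * G * X)) * nrm \<phi> + G * (G * (s * G * X)) * nrm \<phi> + G * G * (G * (G * s * X)) * nrm \<phi>
        + s * G * G * (G * (G * G * X)) * nrm \<phi> + s * G * G * G * (G * (G * G * X)) * nrm \<phi> + G * G * (G * (G * s * X)) * nrm \<phi>
        + G * (3 * s * G) * (G * (G * G * X)) * nrm \<phi>" unfolding Req by (intro add_abs_le)
    also have "\<dots> = (3 * G ^ 4 + G ^ 3 + 4 * G ^ 5 + G ^ 6) * s * X * nrm \<phi>"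
      by (simp add: eval_nat_numeral algebra_simps)
    finally show ?thesis .
  qed
  have "\<bar>\<Sum>j\<in>UNIV. R j\<bar> \<le> (\<Sum>j\<in>(UNIV :: 'n set). (3 * G ^ 4 + G ^ 3 + 4 * G ^ 5 + G ^ 6) * s * X * nrm \<phi>)"
    by (rule order_trans[OF sum_abs]) (intro sum_mono R)
  also have "\<dots> = real CARD('n) * ((3 * G ^ 4 + G ^ 3 + 4 * G ^ 5 + G ^ 6) * s * X * nrm \<phi>)" by simp
  also have "\<dots> \<le> G * ((3 * G ^ 4 + G ^ 3 + 4 * G ^ 5 + G ^ 6) * s * X * nrm \<phi>)"
    using G0 X0 p0 by (intro mult_right_mono G(5)) auto
  also have "\<dots> = CR * s * X * nrm \<phi>" by (simp add: CR_def)
  finally have 1: "\<bar>\<Sum>j\<in>UNIV. R j\<bar> \<le> CR * s * X * nrm \<phi>" .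
  have "\<bar>(\<epsilon> * d $ i * (E *v \<beta>) $ i) * qf U U U \<phi>\<bar> \<le> \<epsilon> * G * (G * norm \<beta>) * (G * (G * G * G)) * nrm \<phi>"
    using eps by (intro qf_le mult_abs_le d_le E\<beta>_le G(3) U_D p) auto
  also have "\<dots> = \<epsilon> * G ^ 6 * norm \<beta> * nrm \<phi>" by (simp add: eval_nat_numeral)
  finally show ?thesis using 1 unfolding tf distrib_right by linarith
qed

lemma shift_small: "norm (P (shift \<theta>)) \<le> 2 * G * s * X"
proof -
  define g where "g i = mean (\<theta> i)" for i
  have g: "g i = mean (v i) - d $ i" for i
    unfolding g_def \<theta>_def by (simp add: mean_diff vD D_intros U_D mean_cmult mean_U)
  have md: "(mean (v i) + d $ i) * g i = (mean (v i))\<^sup>2 - x $ i - \<beta> $ i" for i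
    using d_sq[of i] unfolding g by (simp add: algebra_simps power2_eq_square)
  have "P (\<chi> i. (mean (v i) + d $ i) * g i) = P ((\<chi> i. (mean (v i))\<^sup>2 - x $ i) - \<beta>)"
    by (rule arg_cong[where f = P]) (simp add: vec_eq_iff md)
  also have "\<dots> = 0" unfolding linear_diff[OF P_linear] P_fix[OF \<beta>K] by (simp add: beta)
  finally have 0: "P (\<chi> i. (mean (v i) + d $ i) * g i) = 0" .
  have "shift \<theta> = (\<chi> i. (2 * c $ i - mean (v i) - d $ i) * g i) + (\<chi> i. (mean (v i) + d $ i) * g i)"
    by (simp add: vec_eq_iff shift_def g_def algebra_simps)
  then have "P (shift \<theta>) = P (\<chi> i. (2 * c $ i - mean (v i) - d $ i) * g i)"
    using linear_add[OF P_linear] 0 by simp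
  then have "norm (P (shift \<theta>)) \<le> norm (\<chi> i. (2 * c $ i - mean (v i) - d $ i) * g i)" using P_norm_le by simp
  also have "\<dots> \<le> (\<Sum>i\<in>UNIV. \<bar>(\<chi> i. (2 * c $ i - mean (v i) - d $ i) * g i) $ i\<bar>)" by (rule norm_le_l1_cart)
  also have "\<dots> \<le> (\<Sum>i\<in>UNIV. (2 * s) * (G * nrm (\<theta> i)))"
  proof (rule sum_mono)
    fix i
    have "\<bar>2 * c $ i - mean (v i) - d $ i\<bar> \<le> 2 * s" using ds[of i] ms[of i] by linarith
    then have "\<bar>(2 * c $ i - mean (v i) - d $ i) * g i\<bar> \<le> (2 * s) * (G * nrm (\<theta> i))"
      unfolding g_def by (rule mult_abs_le[OF _ G(7)[OF \<theta>D]])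
    then show "\<bar>(\<chi> i. (2 * c $ i - mean (v i) - d $ i) * g i) $ i\<bar> \<le> (2 * s) * (G * nrm (\<theta> i))" by simp
  qed
  also have "\<dots> = 2 * G * s * X" by (simp add: vn_def sum_distrib_left mult_ac)
  finally show ?thesis .
qed

lemma \<beta>_small:
  assumes \<gamma>: "\<gamma> \<in> mat_kernel A"
  shows "\<epsilon> * S * \<bar>\<gamma> \<bullet> (E *v \<beta>)\<bar> \<le> norm \<gamma> * (\<epsilon> * (G ^ 6 + G ^ 7) * X + (G ^ 7 + G ^ 8) * X\<^sup>2 + \<epsilon> * G ^ 7 * norm \<beta> * X)"
proof -
  define Y where "Y j = qf U (v j) (\<theta> j) U + d $ j * qf U U (\<theta> j) U" for j
  define Q where "Q i j = qf (\<theta> j) (v j) (\<theta> i) U + d $ j * qf U (\<theta> j) (\<theta> i) U" for i j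
  define Z where "Z i = (\<Sum>j\<in>UNIV. B i j * Q i j) + \<epsilon> * (E *v \<beta>) $ i * qf U U (\<theta> i) U" for i
  have UG: "nrm U \<le> G" by (rule G(3))
  have id: "\<epsilon> * S * (E *v \<beta>) $ i = - (\<Sum>j\<in>UNIV. B i j * Y j) - 1 / d $ i * Z i" for i
  proof -
    have ipU: "ip (\<theta> i) U = qf U U (\<theta> i) U"
      using U_eq[OF \<theta>D] ip_commute[of U "\<theta> i"] qf_swap34[of U U U "\<theta> i"] by simp
    have e1: "qf (\<theta> j) (v j) (\<theta> i) U = qf (v j) (v j) (\<theta> i) U - d $ j * qf U (v j) (\<theta> i) U" for j
      unfolding \<theta>_def[of j] by (subst qf_diff1) (simp_all add: vD U_D \<theta>D D_intros qf_cmult1)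
    have e2: "qf U (\<theta> j) (\<theta> i) U = qf U (v j) (\<theta> i) U - d $ j * qf U U (\<theta> i) U" for j
      unfolding \<theta>_def[of j] by (subst qf_diff2) (simp_all add: vD U_D \<theta>D D_intros qf_cmult2)
    have alg1: "b * (p + y * q + y * z * r) = b * (p - z * t + z * (t - z * u)) + y * (b * (q + z * r)) + b * (z * z) * u"
      for b p q r t u y z :: real by (simp add: algebra_simps)
    have alg2: "q = sq + y + (1 + t) * q + e \<Longrightarrow> sq + t * q + y + e = 0"
      for q sq y t e :: real by (simp add: algebra_simps)
    have alg3: "y \<noteq> 0 \<Longrightarrow> y * (1 / y * z + sy + e * S * w) = z + y * sy + e * y * w * S"
      for y z sy e w :: real by (simp add: algebra_simps)
    have tq: "B i j * (qf (v j) (v j) (\<theta> i) U + d $ i * qf U (v j) (\<theta> j) U + d $ i * d $ j * qf U U (\<theta> j) U)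
        = B i j * Q i j + d $ i * (B i j * Y j) + B i j * (d $ j)\<^sup>2 * qf U U (\<theta> i) U" for j
      unfolding Q_def Y_def e1 e2 power2_eq_square by (rule alg1)
    have "qf U U (\<theta> i) U = (\<Sum>j\<in>UNIV. B i j * Q i j + d $ i * (B i j * Y j) + B i j * (d $ j)\<^sup>2 * qf U U (\<theta> i) U)
        + \<epsilon> * d $ i * (E *v \<beta>) $ i * S"
      using \<theta>_equation[OF U_D, of i] unfolding ipU tq S_def[symmetric] .
    also have "\<dots> = (\<Sum>j\<in>UNIV. B i j * Q i j) + d $ i * (\<Sum>j\<in>UNIV. B i j * Y j) + (1 + \<epsilon> * (E *v \<beta>) $ i) * qf U U (\<theta> i) U
        + \<epsilon> * d $ i * (E *v \<beta>) $ i * S"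
      unfolding sum.distrib sum_distrib_left[symmetric] sum_distrib_right[symmetric] sum_B_d ..
    finally have "Z i + d $ i * (\<Sum>j\<in>UNIV. B i j * Y j) + \<epsilon> * d $ i * (E *v \<beta>) $ i * S = 0"
      unfolding Z_def by (rule alg2)
    then have "d $ i * (1 / d $ i * Z i + (\<Sum>j\<in>UNIV. B i j * Y j) + \<epsilon> * S * (E *v \<beta>) $ i) = 0"
      by (subst alg3) (use d_pos[of i] in simp_all)
    then have "1 / d $ i * Z i + (\<Sum>j\<in>UNIV. B i j * Y j) + \<epsilon> * S * (E *v \<beta>) $ i = 0" using d_pos[of i] by simp
    then show ?thesis by linarith
  qed
  have Bg: "(\<Sum>i\<in>UNIV. \<gamma> $ i * B i j) = \<epsilon> * (E *v \<gamma>) $ j" for j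
  proof -
    have "(\<Sum>i\<in>UNIV. \<gamma> $ i * B i j) = (\<Sum>i\<in>UNIV. A $ j $ i * \<gamma> $ i) + \<epsilon> * (\<Sum>i\<in>UNIV. E $ j $ i * \<gamma> $ i)"
      unfolding sum_distrib_left sum.distrib[symmetric] by (intro sum.cong refl) (simp add: A_sym[of _ j] E_sym[of _ j] algebra_simps)
    also have "(\<Sum>i\<in>UNIV. A $ j $ i * \<gamma> $ i) = (A *v \<gamma>) $ j" by (simp add: matrix_vector_mult_def)
    also have "\<dots> = 0" using \<gamma> by (simp add: mat_kernel_def)
    finally show ?thesis by (simp add: matrix_vector_mult_def)
  qed
  have "\<epsilon> * S * (\<gamma> \<bullet> (E *v \<beta>)) = (\<Sum>i\<in>UNIV. \<gamma> $ i * (\<epsilon> * S * (E *v \<beta>) $ i))"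
    by (simp add: inner_vec_def sum_distrib_left mult_ac)
  also have "\<dots> = (\<Sum>i\<in>UNIV. - (\<Sum>j\<in>UNIV. \<gamma> $ i * B i j * Y j) - \<gamma> $ i * (1 / d $ i) * Z i)"
    unfolding id by (simp only: right_diff_distrib mult_minus_right sum_distrib_left mult.assoc)
  also have "\<dots> = - (\<Sum>i\<in>UNIV. \<Sum>j\<in>UNIV. \<gamma> $ i * B i j * Y j) - (\<Sum>i\<in>UNIV. \<gamma> $ i * (1 / d $ i) * Z i)"
    by (simp only: sum_subtractf sum_negf)
  also have "(\<Sum>i\<in>UNIV. \<Sum>j\<in>UNIV. \<gamma> $ i * B i j * Y j) = (\<Sum>j\<in>UNIV. \<epsilon> * (E *v \<gamma>) $ j * Y j)"
    unfolding Bg[symmetric] sum_distrib_right by (rule sum.swap)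
  finally have main: "\<epsilon> * S * (\<gamma> \<bullet> (E *v \<beta>)) = - (\<Sum>j\<in>UNIV. \<epsilon> * (E *v \<gamma>) $ j * Y j) - (\<Sum>i\<in>UNIV. \<gamma> $ i * (1 / d $ i) * Z i)" .
  have mG: "a * nrm U \<le> a * G" if "a \<ge> 0" for a using that UG by (rule mult_left_mono[rotated])
  have qfU: "\<bar>k * qf a b t U\<bar> \<le> k' * (G * (a' * b' * t')) * G"
    if "a \<in> D" "b \<in> D" "t \<in> D" "nrm a \<le> a'" "nrm b \<le> b'" "nrm t \<le> t'" "\<bar>k\<bar> \<le> k'" for k k' a b t a' b' t'
  proof (rule order_trans[OF qf_le[OF that(1-3) U_D that(4-7)]], rule mG)
    have "0 \<le> a'" "0 \<le> b'" "0 \<le> t'" "0 \<le> k'"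
      using nrm_nonneg[OF D_H1[OF that(1)]] nrm_nonneg[OF D_H1[OF that(2)]] nrm_nonneg[OF D_H1[OF that(3)]] that(4-7) by linarith+
    then show "0 \<le> k' * (G * (a' * b' * t'))" using G0 by simp
  qed
  have Y: "\<bar>Y j\<bar> \<le> (G ^ 4 + G ^ 5) * X" for j
  proof -
    have "\<bar>1 * qf U (v j) (\<theta> j) U\<bar> \<le> 1 * (G * (G * G * X)) * G"
      by (intro qfU UG vG nX U_D vD \<theta>D) simp
    moreover have "\<bar>d $ j * qf U U (\<theta> j) U\<bar> \<le> G * (G * (G * G * X)) * G"
      by (intro qfU UG nX U_D \<theta>D d_le)
    ultimately have "\<bar>Y j\<bar> \<le> 1 * (G * (G * G * X)) * G + G * (G * (G * G * X)) * G" unfolding Y_def by linarith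
    also have "\<dots> = (G ^ 4 + G ^ 5) * X" by (simp add: eval_nat_numeral algebra_simps)
    finally show ?thesis .
  qed
  have Q: "\<bar>Q i j\<bar> \<le> (G ^ 3 + G ^ 4) * X\<^sup>2" for i j
  proof -
    have "\<bar>1 * qf (\<theta> j) (v j) (\<theta> i) U\<bar> \<le> 1 * (G * (X * G * X)) * G"
      by (intro qfU vG nX vD \<theta>D) simp
    moreover have "\<bar>d $ j * qf U (\<theta> j) (\<theta> i) U\<bar> \<le> G * (G * (G * X * X)) * G"
      by (intro qfU UG nX U_D \<theta>D d_le)
    ultimately have "\<bar>Q i j\<bar> \<le> 1 * (G * (X * G * X)) * G + G * (G * (G * X * X)) * G" unfolding Q_def by linarith
    also have "\<dots> = (G ^ 3 + G ^ 4) * X\<^sup>2" by (simp add: eval_nat_numeral algebra_simps)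
    finally show ?thesis .
  qed
  have Z: "\<bar>Z i\<bar> \<le> (G ^ 5 + G ^ 6) * X\<^sup>2 + \<epsilon> * G ^ 5 * norm \<beta> * X" for i
  proof -
    have "\<bar>\<Sum>j\<in>UNIV. B i j * Q i j\<bar> \<le> (\<Sum>j\<in>(UNIV :: 'n set). G * ((G ^ 3 + G ^ 4) * X\<^sup>2))"
      by (rule order_trans[OF sum_abs]) (intro sum_mono mult_abs_le B_le Q)
    also have "\<dots> = real CARD('n) * (G * ((G ^ 3 + G ^ 4) * X\<^sup>2))" by simp
    also have "\<dots> \<le> G * (G * ((G ^ 3 + G ^ 4) * X\<^sup>2))" using G0 by (intro mult_right_mono G(5)) auto
    also have "\<dots> = (G ^ 5 + G ^ 6) * X\<^sup>2" by (simp add: eval_nat_numeral algebra_simps)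
    finally have 1: "\<bar>\<Sum>j\<in>UNIV. B i j * Q i j\<bar> \<le> (G ^ 5 + G ^ 6) * X\<^sup>2" .
    have "\<bar>\<epsilon> * (E *v \<beta>) $ i * qf U U (\<theta> i) U\<bar> \<le> \<epsilon> * (G * norm \<beta>) * (G * (G * G * X)) * G"
      using eps by (intro qfU UG nX U_D \<theta>D mult_abs_le E\<beta>_le) auto
    also have "\<dots> = \<epsilon> * G ^ 5 * norm \<beta> * X" by (simp add: eval_nat_numeral)
    finally show ?thesis using 1 unfolding Z_def by linarith
  qed
  let ?zb = "(G ^ 5 + G ^ 6) * X\<^sup>2 + \<epsilon> * G ^ 5 * norm \<beta> * X"
  have zb0: "?zb \<ge> 0" using G0 X0 eps by simp
  have "\<bar>\<Sum>j\<in>UNIV. \<epsilon> * (E *v \<gamma>) $ j * Y j\<bar> \<le> (\<Sum>j\<in>(UNIV :: 'n set). \<epsilon> * (G * norm \<gamma>) * ((G ^ 4 + G ^ 5) * X))"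
    using eps by (intro order_trans[OF sum_abs] sum_mono mult_abs_le E\<beta>_le Y) auto
  also have "\<dots> = real CARD('n) * (\<epsilon> * (G * norm \<gamma>) * ((G ^ 4 + G ^ 5) * X))" by simp
  also have "\<dots> \<le> G * (\<epsilon> * (G * norm \<gamma>) * ((G ^ 4 + G ^ 5) * X))"
    using G0 eps X0 by (intro mult_right_mono G(5)) auto
  finally have b1: "\<bar>\<Sum>j\<in>UNIV. \<epsilon> * (E *v \<gamma>) $ j * Y j\<bar> \<le> G * (\<epsilon> * (G * norm \<gamma>) * ((G ^ 4 + G ^ 5) * X))" .
  have "\<bar>\<Sum>i\<in>UNIV. \<gamma> $ i * (1 / d $ i) * Z i\<bar> \<le> (\<Sum>j\<in>(UNIV :: 'n set). norm \<gamma> * G * ?zb)"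
    by (intro order_trans[OF sum_abs] sum_mono mult_abs_le d_le Z component_le_norm_cart)
  also have "\<dots> = real CARD('n) * (norm \<gamma> * G * ?zb)" by simp
  also have "\<dots> \<le> G * (norm \<gamma> * G * ?zb)" using G0 zb0 by (intro mult_right_mono G(5)) auto
  finally have b2: "\<bar>\<Sum>i\<in>UNIV. \<gamma> $ i * (1 / d $ i) * Z i\<bar> \<le> G * (norm \<gamma> * G * ?zb)" .
  have "\<epsilon> * S * \<bar>\<gamma> \<bullet> (E *v \<beta>)\<bar> = \<bar>\<epsilon> * S * (\<gamma> \<bullet> (E *v \<beta>))\<bar>" using eps S_pos by (simp add: abs_mult)
  also have "\<dots> \<le> G * (\<epsilon> * (G * norm \<gamma>) * ((G ^ 4 + G ^ 5) * X)) + G * (norm \<gamma> * G * ?zb)"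
    unfolding main using b1 b2 by linarith
  also have "\<dots> = norm \<gamma> * (\<epsilon> * (G ^ 6 + G ^ 7) * X + (G ^ 7 + G ^ 8) * X\<^sup>2 + \<epsilon> * G ^ 7 * norm \<beta> * X)"
    by (simp add: eval_nat_numeral algebra_simps)
  finally show ?thesis .
qed

lemma near_solution_unique:
  assumes T: "T > 0" "\<And>\<theta> \<delta>. (\<And>i. \<theta> i \<in> H) \<Longrightarrow> (\<And>i \<phi>. \<phi> \<in> D \<Longrightarrow> \<bar>tf \<theta> i \<phi>\<bar> \<le> \<delta> * nrm \<phi>) \<Longrightarrow> vn \<theta> \<le> T * (\<delta> + norm (P (shift \<theta>)))"
    and s: "T * (CR + 2 * G) * s \<le> 1 / 2"
    and k: "\<kappa> > 0" "\<And>w. \<kappa> * norm w \<le> norm (A *v w + P (E *v w))"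
    and Z: "Z = 2 * T * G ^ 6"
    and e: "\<epsilon> * ((G ^ 6 + G ^ 7) * Z + (G ^ 7 + G ^ 8) * Z\<^sup>2 * norm \<beta> + G ^ 7 * Z * norm \<beta>) < S * \<kappa>"
  shows "nrm (\<lambda>y. v i y - sqrt (x $ i) * U y) = 0"
proof -
  have "X \<le> T * (\<epsilon> * G ^ 6 * norm \<beta> + CR * s * X + norm (P (shift \<theta>)))"
    by (rule T(2)[of \<theta>, OF \<theta>H tf_small])
  also have "\<dots> \<le> T * (\<epsilon> * G ^ 6 * norm \<beta> + CR * s * X + 2 * G * s * X)"
    using T(1) by (intro mult_left_mono add_left_mono shift_small) auto
  also have "\<dots> = T * \<epsilon> * G ^ 6 * norm \<beta> + T * (CR + 2 * G) * s * X" by (simp add: algebra_simps)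
  also have "\<dots> \<le> T * \<epsilon> * G ^ 6 * norm \<beta> + 1 / 2 * X" by (intro add_left_mono mult_right_mono s X0)
  finally have XZ: "X \<le> \<epsilon> * Z * norm \<beta>" by (simp add: Z mult_ac)
  have Z0: "Z \<ge> 0" unfolding Z using T(1) G0 by simp
  define \<gamma> where "\<gamma> = P (E *v \<beta>)"
  have gK: "\<gamma> \<in> mat_kernel A" unfolding \<gamma>_def by (rule P_mem)
  have "\<gamma> \<bullet> (E *v \<beta>) = \<gamma> \<bullet> \<gamma>" using P_inner[OF gK, of "E *v \<beta>"] by (simp add: \<gamma>_def inner_commute)
  then have gg: "\<bar>\<gamma> \<bullet> (E *v \<beta>)\<bar> = norm \<gamma> * norm \<gamma>" by (simp add: dot_square_norm power2_eq_square)
  have kb: "\<kappa> * norm \<beta> \<le> norm \<gamma>" using k(2)[of \<beta>] \<beta>K by (simp add: \<gamma>_def mat_kernel_def)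
  define M where "M = (G ^ 6 + G ^ 7) * Z + (G ^ 7 + G ^ 8) * Z\<^sup>2 * norm \<beta> + G ^ 7 * Z * norm \<beta>"
  have "\<epsilon> * S * (norm \<gamma> * norm \<gamma>) \<le> norm \<gamma> * (\<epsilon> * (G ^ 6 + G ^ 7) * X + (G ^ 7 + G ^ 8) * X\<^sup>2 + \<epsilon> * G ^ 7 * norm \<beta> * X)"
    using \<beta>_small[OF gK] unfolding gg .
  also have "\<dots> \<le> norm \<gamma> * (\<epsilon> * (G ^ 6 + G ^ 7) * (\<epsilon> * Z * norm \<beta>) + (G ^ 7 + G ^ 8) * (\<epsilon> * Z * norm \<beta>)\<^sup>2 + \<epsilon> * G ^ 7 * norm \<beta> * (\<epsilon> * Z * norm \<beta>))"
    using G0 eps XZ X0 by (intro mult_left_mono add_mono power_mono) auto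
  also have "\<dots> = \<epsilon> * norm \<gamma> * (\<epsilon> * M * norm \<beta>)"
    unfolding M_def by (simp add: algebra_simps power2_eq_square)
  finally have le: "\<epsilon> * norm \<gamma> * (S * norm \<gamma>) \<le> \<epsilon> * norm \<gamma> * (\<epsilon> * M * norm \<beta>)" by (simp add: mult_ac)
  have b0: "\<beta> = 0"
  proof (rule ccontr)
    assume "\<beta> \<noteq> 0"
    then have nb: "norm \<beta> > 0" by simp
    then have "0 < norm \<gamma>" using kb k(1) mult_pos_pos[of \<kappa> "norm \<beta>"] by linarith
    then have "S * norm \<gamma> \<le> \<epsilon> * M * norm \<beta>" using le eps(1) by (simp only: mult_le_cancel_left_pos mult_pos_pos)
    moreover have "S * (\<kappa> * norm \<beta>) \<le> S * norm \<gamma>" using S_pos by (intro mult_left_mono kb) auto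
    ultimately have "S * \<kappa> * norm \<beta> \<le> \<epsilon> * M * norm \<beta>" by simp
    then have "S * \<kappa> \<le> \<epsilon> * M" using nb by simp
    then show False using e unfolding M_def by simp
  qed
  then have "X \<le> 0" using XZ by simp
  then have "nrm (\<theta> i) = 0" using nX[of i] nrm_nonneg[OF H_H1[OF \<theta>H], of i] by linarith
  moreover have "d $ i = sqrt (x $ i)" using d_sq[of i] d_pos[of i] b0 by (simp add: real_sqrt_unique)
  ultimately show ?thesis unfolding \<theta>_def by simp
qed

end

context linearized
begin

lemma solution_unique:
  assumes C: "C \<ge> 0"
  shows "\<exists>\<epsilon>1>0. \<exists>\<rho>>0. \<forall>\<epsilon> x v. 0 < \<epsilon> \<and> \<epsilon> < \<epsilon>1 \<and> (A + \<epsilon> *\<^sub>R E) *v x = 1 \<and> norm (x - c2) \<le> C * \<epsilon> \<and>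
    (\<forall>i. v i \<in> H) \<and> (\<forall>i. nrm (\<lambda>y. v i y - c $ i * U y) < \<rho>) \<and>
    (\<forall>i. \<forall>\<phi>\<in>D. ip (v i) \<phi> = (\<Sum>j\<in>UNIV. (A + \<epsilon> *\<^sub>R E) $ i $ j * qf (v i) (v j) (v j) \<phi>)) \<longrightarrow>
    (\<forall>i. nrm (\<lambda>y. v i y - sqrt (x $ i) * U y) = 0)"
proof -
  obtain \<kappa> where k: "\<kappa> > 0" "\<And>w. \<kappa> * norm w \<le> norm (A *v w + P (E *v w))"
    by (rule coupling_bounded_below) blast
  obtain b where b: "b > 0" "\<And>w. norm (E *v w) \<le> b * norm w"
    by (rule linear_bounded_pos[OF matrix_vector_mul_linear[of E]]) blast
  obtain T where T: "T > 0" "\<And>\<theta> \<delta>. (\<And>i. \<theta> i \<in> H) \<Longrightarrow> (\<And>i \<phi>. \<phi> \<in> D \<Longrightarrow> \<bar>tf \<theta> i \<phi>\<bar> \<le> \<delta> * nrm \<phi>) \<Longrightarrow> vn \<theta> \<le> T * (\<delta> + norm (P (shift \<theta>)))"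
    using T_estimate by blast
  have U0: "nrm U \<ge> 0" by (rule nrm_nonneg[OF U_H1])
  define g1 where "g1 = (\<Sum>i\<in>UNIV. \<Sum>j\<in>UNIV. \<bar>A $ i $ j\<bar> + \<bar>E $ i $ j\<bar>)"
  define g2 where "g2 = KK\<^sup>2 * nrm U ^ 3 / S"
  define g3 where "g3 = (\<Sum>i\<in>UNIV. c $ i)"
  define g4 where "g4 = (\<Sum>i\<in>UNIV. c $ i * nrm U)"
  define g5 where "g5 = (\<Sum>i\<in>UNIV. 2 / c $ i)"
  define G where "G = 2 + KK\<^sup>2 + nrm U + real CARD('n) + b + g1 + g2 + g3 + g4 + g5"
  have c0: "0 \<le> c $ i" "0 \<le> c $ i * nrm U" "0 \<le> 2 / c $ i" for i using c_pos[of i] U0 by auto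
  have g: "g1 \<ge> 0" "g2 \<ge> 0" "g3 \<ge> 0" "g4 \<ge> 0" "g5 \<ge> 0"
    unfolding g1_def g2_def g3_def g4_def g5_def using U0 S_pos by (intro sum_nonneg c0 add_nonneg_nonneg divide_nonneg_pos; simp)+
  have gi: "c $ i \<le> g3" "c $ i * nrm U \<le> g4" "2 / c $ i \<le> g5" for i
    unfolding g3_def g4_def g5_def by (intro member_le_sum c0 finite UNIV_I)+
  have gA: "\<bar>A $ i $ j\<bar> + \<bar>E $ i $ j\<bar> \<le> g1" for i j
  proof -
    have "\<bar>A $ i $ j\<bar> + \<bar>E $ i $ j\<bar> \<le> (\<Sum>j\<in>UNIV. \<bar>A $ i $ j\<bar> + \<bar>E $ i $ j\<bar>)"
      by (rule member_le_sum) auto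
    also have "\<dots> \<le> g1" unfolding g1_def
      by (rule member_le_sum[where f = "\<lambda>i. \<Sum>j\<in>UNIV. \<bar>A $ i $ j\<bar> + \<bar>E $ i $ j\<bar>"]) (auto intro: sum_nonneg)
    finally show ?thesis .
  qed
  have KK0: "KK\<^sup>2 \<ge> 0" by simp
  have n0: "real CARD('n) \<ge> 0" by simp
  have G1: "G \<ge> 1" using g U0 KK0 n0 b(1) unfolding G_def by linarith
  have G2: "KK\<^sup>2 \<le> G" "nrm U \<le> G" "real CARD('n) \<le> G" "b \<le> G" "g1 \<le> G" "g2 \<le> G" "1 + g3 \<le> G" "1 + g4 \<le> G" "g5 \<le> G"
    using g U0 KK0 n0 b(1) unfolding G_def by linarith+
  have mG: "\<bar>mean u\<bar> \<le> G * nrm u" if "u \<in> D" for u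
    using order_trans[OF mean_bound[OF that] mult_right_mono[OF G2(6)[unfolded g2_def] nrm_nonneg[OF D_H1[OF that]]]] .
  define CRG where "CRG = G * (3 * G ^ 4 + G ^ 3 + 4 * G ^ 5 + G ^ 6)"
  have CRG0: "CRG \<ge> 0" unfolding CRG_def using G1 by simp
  define Z where "Z = 2 * T * G ^ 6"
  have Z0: "Z \<ge> 0" unfolding Z_def using T(1) G1 by simp
  define M1 where "M1 = (G ^ 6 + G ^ 7) * Z + (G ^ 7 + G ^ 8) * Z\<^sup>2 + G ^ 7 * Z"
  have M10: "M1 \<ge> 0" unfolding M1_def using G1 Z0 by simp
  define K where "K = 1 + G + G * (3 * G ^ 3 + (G + 1) * C)"
  have K1: "K \<ge> 1" unfolding K_def using G1 C by simp
  define q where "q = T * (CRG + 2 * G)"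
  have q0: "q > 0" unfolding q_def using T(1) CRG0 G1 by (intro mult_pos_pos add_nonneg_pos) auto
  define t where "t = min 1 (min (1 / (G * K)) (min (1 / (2 * q * K)) (S * \<kappa> / (M1 + 1))))"
  have t0: "t > 0" unfolding t_def using G1 K1 q0 S_pos k(1) M10 by (simp add: zero_less_mult_iff)
  have t1: "t \<le> 1" "t \<le> 1 / (G * K)" "t \<le> 1 / (2 * q * K)" "t \<le> S * \<kappa> / (M1 + 1)" unfolding t_def by auto
  have tG: "K * t \<le> 1 / G" using t1(2) G1 K1 by (simp add: field_simps)
  have tq: "q * (K * t) \<le> 1 / 2" using t1(3) q0 K1 by (simp add: field_simps)
  have tM: "t * (M1 + 1) \<le> S * \<kappa>" using t1(4) M10 by (simp add: field_simps)
  define s where "s = K * t"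
  have "nrm (\<lambda>y. v i y - sqrt (x $ i) * U y) = 0"
    if e: "0 < \<epsilon>" "\<epsilon> < t" and x: "(A + \<epsilon> *\<^sub>R E) *v x = 1" "norm (x - c2) \<le> C * \<epsilon>" and vH: "\<And>i. v i \<in> H"
      and vt: "\<And>i. nrm (\<lambda>y. v i y - c $ i * U y) < t"
      and v_eq: "\<And>i \<phi>. \<phi> \<in> D \<Longrightarrow> ip (v i) \<phi> = (\<Sum>j\<in>UNIV. (A + \<epsilon> *\<^sub>R E) $ i $ j * qf (v i) (v j) (v j) \<phi>)"
    for \<epsilon> x v i
  proof -
    have s1: "t \<le> s" "s \<le> 1 / G" "s \<le> 1"
    proof -
      show "t \<le> s" unfolding s_def using mult_right_mono[OF K1, of t] t0 by simp
      show "s \<le> 1 / G" unfolding s_def by (rule tG)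
      then show "s \<le> 1" using G1 by (smt (verit) divide_le_eq_1)
    qed
    have Gt: "G * t \<le> s" unfolding s_def K_def using G1 C t0 by (simp add: mult_right_mono)
    define \<tau> where "\<tau> = (3 * G ^ 3 + (G + 1) * C) * t"
    have \<tau>0: "\<tau> \<ge> 0" unfolding \<tau>_def using G1 C t0 by simp
    have G\<tau>: "G * \<tau> \<le> s"
    proof -
      have "s = G * \<tau> + (1 + G) * t" unfolding s_def K_def \<tau>_def by (simp add: algebra_simps)
      moreover have "(1 + G) * t \<ge> 0" using G1 t0 by simp
      ultimately show ?thesis by linarith
    qed
    have \<tau>s: "\<tau> \<le> s" using G\<tau> mult_right_mono[OF G1 \<tau>0] by linarith
    have Ce: "C * \<epsilon> \<le> C * t" using C e by (intro mult_left_mono) auto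
    have cG: "c $ i \<le> G" "2 / c $ i \<le> G" for i using gi[of i] G2 by linarith+
    have cs: "s \<le> c $ i / 2" for i
    proof -
      have "1 / G \<le> c $ i / 2" using cG(2)[of i] c_pos[of i] G1 by (simp add: field_simps)
      then show ?thesis using s1(2) by linarith
    qed
    define \<beta> where "\<beta> = P (\<chi> i. (mean (v i))\<^sup>2 - x $ i)"
    define d where "d = (\<chi> i. sqrt (x $ i + \<beta> $ i))"
    have m: "\<bar>mean (v i) - c $ i\<bar> \<le> G * t" for i
    proof -
      have D: "(\<lambda>y. v i y - c $ i * U y) \<in> D" by (intro D_intros H_D vH U_D)
      have "mean (v i) - c $ i = mean (\<lambda>y. v i y - c $ i * U y)"
        using mean_diff[OF H_D[OF vH] D_cmult[OF U_D], of i "c $ i"] by (simp add: mean_cmult mean_U)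
      also have "\<bar>\<dots>\<bar> \<le> G * nrm (\<lambda>y. v i y - c $ i * U y)" by (rule mG[OF D])
      also have "\<dots> \<le> G * t" using vt[of i] G1 by (intro mult_left_mono) auto
      finally show ?thesis .
    qed
    have xc: "\<bar>x $ i - (c $ i)\<^sup>2\<bar> \<le> C * t" for i
      using component_le_norm_cart[of "x - c2" i] x(2) Ce by (simp add: c2_nth)
    have m2: "\<bar>(mean (v i))\<^sup>2 - x $ i\<bar> \<le> 3 * G ^ 2 * t + C * t" for i
    proof -
      have "\<bar>mean (v i) + c $ i\<bar> \<le> 3 * G" using m[of i] Gt s1(3) cG(1)[of i] c_pos[of i] G1 by linarith
      then have "\<bar>(mean (v i) - c $ i) * (mean (v i) + c $ i)\<bar> \<le> G * t * (3 * G)"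
        unfolding abs_mult using m[of i] by (intro mult_mono) auto
      then have "\<bar>(mean (v i))\<^sup>2 - (c $ i)\<^sup>2\<bar> \<le> 3 * G ^ 2 * t" by (simp add: power2_eq_square algebra_simps)
      then show ?thesis using xc[of i] by linarith
    qed
    have \<beta>n: "norm \<beta> \<le> G * (3 * G ^ 2 * t + C * t)"
    proof -
      have "norm \<beta> \<le> norm (\<chi> i. (mean (v i))\<^sup>2 - x $ i)" unfolding \<beta>_def by (rule P_norm_le)
      also have "\<dots> \<le> (\<Sum>i\<in>UNIV. \<bar>(\<chi> i. (mean (v i))\<^sup>2 - x $ i) $ i\<bar>)" by (rule norm_le_l1_cart)
      also have "\<dots> \<le> (\<Sum>i\<in>(UNIV :: 'n set). 3 * G ^ 2 * t + C * t)" using m2 by (intro sum_mono) simp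
      also have "\<dots> = real CARD('n) * (3 * G ^ 2 * t + C * t)" by simp
      also have "\<dots> \<le> G * (3 * G ^ 2 * t + C * t)" using G1 C t0 by (intro mult_right_mono G2(3)) auto
      finally show ?thesis .
    qed
    have \<tau>e: "G * (3 * G ^ 2 * t + C * t) + C * t = \<tau>"
      unfolding \<tau>_def by (simp add: algebra_simps power2_eq_square power3_eq_cube)
    have Ct: "C * t \<ge> 0" using C t0 by simp
    have \<beta>1: "norm \<beta> \<le> 1" using \<beta>n \<tau>e Ct \<tau>s s1(3) by linarith
    have xb: "\<bar>x $ i + \<beta> $ i - (c $ i)\<^sup>2\<bar> \<le> \<tau>" for i
      using xc[of i] component_le_norm_cart[of \<beta> i] \<beta>n \<tau>e by linarith
    have pos: "x $ i + \<beta> $ i > 0" for i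
    proof -
      have "c $ i * (2 * s) \<le> c $ i * c $ i" using cs[of i] c_pos[of i] by (intro mult_left_mono) auto
      moreover have "\<tau> \<le> c $ i * s"
      proof -
        have "1 \<le> G * c $ i" using cG(2)[of i] c_pos[of i] by (simp add: field_simps)
        then have "\<tau> \<le> G * c $ i * \<tau>" using mult_right_mono[OF _ \<tau>0, of 1 "G * c $ i"] by simp
        also have "\<dots> = c $ i * (G * \<tau>)" by simp
        also have "\<dots> \<le> c $ i * s" using c_pos[of i] by (intro mult_left_mono G\<tau>) auto
        finally show ?thesis .
      qed
      moreover have "c $ i * s > 0" using c_pos[of i] t0 s1(1) by (intro mult_pos_pos) auto
      ultimately show ?thesis using xb[of i] by (simp add: power2_eq_square)
    qed
    have d_pos: "d $ i > 0" for i using pos[of i] by (simp add: d_def)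
    have d_sq: "(d $ i)\<^sup>2 = x $ i + \<beta> $ i" for i using pos[of i] by (simp add: d_def)
    have dc: "\<bar>d $ i - c $ i\<bar> \<le> s" for i
    proof -
      have "\<bar>d $ i - c $ i\<bar> * (d $ i + c $ i) = \<bar>(d $ i)\<^sup>2 - (c $ i)\<^sup>2\<bar>"
        using d_pos[of i] c_pos[of i] by (simp add: square_diff_square_factored abs_mult power2_eq_square)
      also have "\<dots> \<le> \<tau>" using xb[of i] by (simp add: d_sq)
      finally have 1: "\<bar>d $ i - c $ i\<bar> * (d $ i + c $ i) \<le> \<tau>" .
      have "\<bar>d $ i - c $ i\<bar> * c $ i \<le> \<bar>d $ i - c $ i\<bar> * (d $ i + c $ i)" using d_pos[of i] by (intro mult_left_mono) auto
      then have 2: "\<bar>d $ i - c $ i\<bar> * c $ i \<le> \<tau>" using 1 by linarith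
      have Gc: "1 \<le> G * c $ i" using cG(2)[of i] c_pos[of i] by (simp add: field_simps)
      have "\<bar>d $ i - c $ i\<bar> \<le> \<bar>d $ i - c $ i\<bar> * (G * c $ i)" using mult_left_mono[OF Gc, of "\<bar>d $ i - c $ i\<bar>"] by simp
      also have "\<dots> = G * (\<bar>d $ i - c $ i\<bar> * c $ i)" by simp
      also have "\<dots> \<le> G * \<tau>" using G1 by (intro mult_left_mono 2) auto
      finally show ?thesis using G\<tau> by linarith
    qed
    have dG: "d $ i \<le> G" "1 / d $ i \<le> G" for i
    proof -
      show "d $ i \<le> G" using dc[of i] s1(3) gi(1)[of i] G2(7) by linarith
      have "c $ i / 2 \<le> d $ i" using dc[of i] cs[of i] by linarith
      then have "1 / d $ i \<le> 2 / c $ i" using c_pos[of i] d_pos[of i] by (simp add: field_simps)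
      then show "1 / d $ i \<le> G" using cG(2)[of i] by linarith
    qed
    have vG: "nrm (v i) \<le> G" for i
    proof -
      have "nrm (v i) - nrm (\<lambda>y. c $ i * U y) \<le> nrm (\<lambda>y. v i y - c $ i * U y)"
        using nrm_diff_le[OF H_H1[OF vH] H1_cmult[OF U_H1], of i "c $ i"] by linarith
      moreover have "nrm (\<lambda>y. c $ i * U y) = c $ i * nrm U" using c_pos[of i] by (simp add: nrm_cmult U_H1)
      ultimately show ?thesis using vt[of i] t1(1) gi(2)[of i] G2(8) by linarith
    qed
    interpret N: near_solution \<Omega> lam U A E c P \<epsilon> s G x \<beta> d v
    proof (rule near_solution.intro[OF linearized_axioms], unfold_locales)
      show "0 < \<epsilon>" "\<epsilon> \<le> s" "s \<le> 1" "G \<ge> 1" "KK\<^sup>2 \<le> G" "nrm U \<le> G" "real CARD('n) \<le> G"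
        using e s1 G1 G2 by linarith+
      show "\<bar>A $ i $ j\<bar> + \<bar>E $ i $ j\<bar> \<le> G" for i j using gA[of i j] G2(5) by linarith
      show "norm (E *v w) \<le> G * norm w" for w
        using b(2)[of w] mult_right_mono[OF G2(4), of "norm w"] by simp
      show "\<bar>mean u\<bar> \<le> G * nrm u" if "u \<in> D" for u by (rule mG[OF that])
      show "c $ i \<le> G" for i by (rule cG(1))
      show "v i \<in> H" for i by (rule vH)
      show "nrm (v i) \<le> G" for i by (rule vG)
      show "nrm (\<lambda>y. v i y - c $ i * U y) \<le> s" for i using vt[of i] s1(1) by linarith
      show "ip (v i) \<phi> = (\<Sum>j\<in>UNIV. (A + \<epsilon> *\<^sub>R E) $ i $ j * qf (v i) (v j) (v j) \<phi>)" if "\<phi> \<in> D" for i \<phi>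
        by (rule v_eq[OF that])
      show "(A + \<epsilon> *\<^sub>R E) *v x = 1" by (rule x(1))
      show "\<beta> = P (\<chi> i. (mean (v i))\<^sup>2 - x $ i)" by (rule \<beta>_def)
      show "d $ i > 0" for i by (rule d_pos)
      show "(d $ i)\<^sup>2 = x $ i + \<beta> $ i" for i by (rule d_sq)
      show "d $ i \<le> G" "1 / d $ i \<le> G" for i by (rule dG)+
      show "\<bar>d $ i - c $ i\<bar> \<le> s" for i by (rule dc)
      show "\<bar>mean (v i) - c $ i\<bar> \<le> s" for i using m[of i] Gt by linarith
    qed
    show ?thesis
    proof (rule N.near_solution_unique[OF T _ k Z_def])
      show "T * (N.CR + 2 * G) * s \<le> 1 / 2" using tq unfolding q_def CRG_def N.CR_def s_def by (simp only: mult.assoc)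
      have "\<epsilon> * ((G ^ 6 + G ^ 7) * Z + (G ^ 7 + G ^ 8) * Z\<^sup>2 * norm \<beta> + G ^ 7 * Z * norm \<beta>) \<le> \<epsilon> * M1"
        unfolding M1_def using e G1 Z0 by (intro mult_left_mono add_mono mult_left_le \<beta>1) auto
      also have "\<dots> \<le> t * M1" using e M10 by (intro mult_right_mono) auto
      also have "\<dots> < t * (M1 + 1)" using t0 by simp
      also have "\<dots> \<le> S * \<kappa>" by (rule tM)
      finally show "\<epsilon> * ((G ^ 6 + G ^ 7) * Z + (G ^ 7 + G ^ 8) * Z\<^sup>2 * norm \<beta> + G ^ 7 * Z * norm \<beta>) < S * \<kappa>" .
    qed
  qed
  then show ?thesis using t0 by (intro exI[of _ t] conjI) blast+
qed

end

subsection \<open>The manifold of solutions of the unperturbed system\<close>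

lemma Ck_on_vec:
  fixes f :: "'a::euclidean_space \<Rightarrow> real^'n"
  assumes "open S" "\<And>i. Ck_on k S (\<lambda>x. f x $ i)"
  shows "Ck_on k S f"
proof -
  have "Ck_on k S (\<lambda>x. \<Sum>i\<in>UNIV. (f x $ i) *\<^sub>R (axis i 1 :: real^'n))"
    by (intro Ck_on_sum Ck_on_bounded_linear[OF assms(1) bounded_linear_scaleR_left] assms)
  moreover have "(\<Sum>i\<in>UNIV. (f x $ i) *\<^sub>R (axis i 1 :: real^'n)) = f x" for x
    using basis_expansion[of "f x"] by (simp add: scalar_mult_eq_scaleR)
  ultimately show ?thesis by simp
qed

lemma Ck_on_sqrt:
  assumes "open S" "\<And>x. x \<in> S \<Longrightarrow> f x > 0" "Ck_on k S f"
  shows "Ck_on k S (\<lambda>x. sqrt (f x))"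
proof -
  define h where "h j t = (\<Prod>i<j. 1/2 - real i) * t powr (1/2 - real j)" for j t
  have "(h j has_real_derivative h (Suc j) t) (at t)" if "t \<in> {0<..}" for j t
    unfolding h_def[abs_def] using that
    by (auto intro!: derivative_eq_intros simp: powr_diff field_simps)
  from Ck_on_compose_real[where H = h and I = "{0<..}" and j = 0, OF assms(1) _ this assms(3)]
  have "Ck_on k S (\<lambda>x. h 0 (f x))" using assms(2) by simp
  then show ?thesis
  proof (rule Ck_on_cong[OF assms(1), rotated])
    fix x assume "x \<in> S"
    then show "h 0 (f x) = sqrt (f x)" using assms(2)[of x] by (simp add: h_def powr_half_sqrt)
  qed
qed

lemma Ck_on_vec_nth: "open S \<Longrightarrow> Ck_on k S (\<lambda>x. (x :: real^'n) $ i)"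
  by (rule Ck_on_bounded_linear[OF _ bounded_linear_vec_nth Ck_on_id])

lemma open_vec_greaterThan: "open {x :: real^'n. \<forall>i. a i < x $ i}"
proof -
  have "{x :: real^'n. \<forall>i. a i < x $ i} = (\<Inter>i\<in>UNIV. {x. a i < x $ i})" by auto
  then show ?thesis by (simp add: open_INT open_halfspace_component_gt_cart)
qed

context
  fixes A :: "real^'n^'n" and c :: "real^'n"
begin

private definition "W = {d :: real^'n. \<forall>i. 0 < d $ i}"
private definition "W' = {y :: real^'n. \<forall>i. - (c $ i)\<^sup>2 < y $ i}"
private definition "\<Phi> d = (\<chi> i. (d $ i)\<^sup>2 - (c $ i)\<^sup>2)" for d :: "real^'n"
private definition "\<Psi> y = (\<chi> i. sqrt ((c $ i)\<^sup>2 + y $ i))" for y :: "real^'n"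

private lemma open_W: "open W" and open_W': "open W'"
  unfolding W_def W'_def by (rule open_vec_greaterThan)+

private lemma smooth_\<Phi>: "smooth_map_on W \<Phi>"
  unfolding smooth_map_on_def
proof
  fix k
  have "Ck_on k W (\<lambda>d. d $ i * d $ i + - (c $ i)\<^sup>2)" for i
    by (intro Ck_on_add Ck_on_bilinear[OF _ bounded_bilinear_mult] Ck_on_const Ck_on_vec_nth open_W)
  then show "Ck_on k W \<Phi>" by (intro Ck_on_vec open_W) (simp add: \<Phi>_def power2_eq_square)
qed

private lemma smooth_\<Psi>: "smooth_map_on W' \<Psi>"
  unfolding smooth_map_on_def
proof
  fix k
  have "Ck_on k W' (\<lambda>y. sqrt ((c $ i)\<^sup>2 + y $ i))" for i
  proof (rule Ck_on_sqrt[OF open_W'])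
    show "(c $ i)\<^sup>2 + y $ i > 0" if "y \<in> W'" for y
      using spec[OF that[unfolded W'_def mem_Collect_eq], of i] by linarith
    show "Ck_on k W' (\<lambda>y. (c $ i)\<^sup>2 + y $ i)" by (intro Ck_on_add Ck_on_const Ck_on_vec_nth open_W')
  qed
  then show "Ck_on k W' \<Psi>" by (intro Ck_on_vec open_W') (simp add: \<Psi>_def)
qed

private lemma \<Phi>_\<Psi>: "y \<in> W' \<Longrightarrow> \<Phi> (\<Psi> y) = y" and \<Psi>_W: "y \<in> W' \<Longrightarrow> \<Psi> y \<in> W"
proof -
  assume "y \<in> W'"
  then have "- (c $ i)\<^sup>2 < y $ i" for i by (simp add: W'_def)
  then have p: "(c $ i)\<^sup>2 + y $ i > 0" for i by (smt (verit))
  show "\<Phi> (\<Psi> y) = y" using p by (simp add: \<Phi>_def \<Psi>_def vec_eq_iff less_imp_le)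
  show "\<Psi> y \<in> W" using p by (simp add: \<Psi>_def W_def)
qed

private lemma \<Psi>_\<Phi>: "d \<in> W \<Longrightarrow> \<Psi> (\<Phi> d) = d" and \<Phi>_W': "d \<in> W \<Longrightarrow> \<Phi> d \<in> W'"
proof -
  assume "d \<in> W"
  then have p: "0 < d $ i" for i by (simp add: W_def)
  then show "\<Psi> (\<Phi> d) = d" by (simp add: \<Phi>_def \<Psi>_def vec_eq_iff less_imp_le)
  have "0 < (d $ i)\<^sup>2" for i using p[of i] by simp
  then show "\<Phi> d \<in> W'" by (simp add: \<Phi>_def W'_def)
qed

private lemma L_set_eq: "L_set A c = \<Psi> ` (mat_kernel A \<inter> W')"
proof -
  have "(c $ i)\<^sup>2 + y $ i > 0 \<longleftrightarrow> - (c $ i)\<^sup>2 < y $ i" for y :: "real^'n" and i by linarith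
  then show ?thesis unfolding L_set_def \<Psi>_def W'_def by auto
qed

private lemma mat_kernel_subspace: "subspace (mat_kernel A)"
  unfolding mat_kernel_def subspace_def
  by (simp add: matrix_vector_right_distrib matrix_vector_mult_scaleR)

lemma connected_L_set: "connected (L_set A c)"
proof -
  have "convex W'"
    unfolding W'_def convex_def
  proof (clarsimp)
    fix x y :: "real^'n" and u v :: real and i
    assume h: "\<forall>i. - (c $ i)\<^sup>2 < x $ i" "\<forall>i. - (c $ i)\<^sup>2 < y $ i" and uv: "0 \<le> u" "0 \<le> v" "u + v = 1"
    have "- (u * x $ i + v * y $ i) < (c $ i)\<^sup>2"
      using convex_bound_lt[of "- (x $ i)" "(c $ i)\<^sup>2" "- (y $ i)" u v] spec[OF h(1), of i] spec[OF h(2), of i] uv by simp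
    then show "- (c $ i)\<^sup>2 < u * x $ i + v * y $ i" by simp
  qed
  then have "convex (mat_kernel A \<inter> W')" by (rule convex_Int[OF subspace_imp_convex[OF mat_kernel_subspace]])
  then show ?thesis
    unfolding L_set_eq
    by (intro connected_continuous_image convex_connected continuous_on_subset[OF smooth_map_on_continuous[OF smooth_\<Psi>]]) auto
qed

lemma smooth_submanifold_L_set: "smooth_submanifold (dim (mat_kernel A)) (L_set A c)"
  unfolding smooth_submanifold_def
proof
  fix p assume p: "p \<in> L_set A c"
  have sub: "L_set A c \<subseteq> W" unfolding L_set_eq using \<Psi>_W by auto
  have hom: "homeomorphism W W' \<Phi> \<Psi>"
    by (intro homeomorphismI smooth_map_on_continuous smooth_\<Phi> smooth_\<Psi>) (auto simp: \<Phi>_\<Psi> \<Psi>_\<Phi> \<Psi>_W \<Phi>_W')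
  have "\<Phi> ` (L_set A c \<inter> W) = \<Phi> ` \<Psi> ` (mat_kernel A \<inter> W')" using sub by (simp add: Int_absorb2 L_set_eq)
  also have "\<dots> = mat_kernel A \<inter> W'"
    unfolding image_image using \<Phi>_\<Psi> by (auto simp: image_iff)
  finally have "\<Phi> ` (L_set A c \<inter> W) = mat_kernel A \<inter> W'" .
  then show "\<exists>W W' (\<Phi> :: real^'n \<Rightarrow> real^'n) \<Psi> S. open W \<and> p \<in> W \<and> open W' \<and> homeomorphism W W' \<Phi> \<Psi> \<and> smooth_map_on W \<Phi> \<and> smooth_map_on W' \<Psi> \<and>
      subspace S \<and> dim S = dim (mat_kernel A) \<and> \<Phi> ` (L_set A c \<inter> W) = S \<inter> W'"
    using open_W open_W' hom smooth_\<Phi> smooth_\<Psi> mat_kernel_subspace subsetD[OF sub p]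
    by - (rule exI[of _ W], rule exI[of _ W'], rule exI[of _ \<Phi>], rule exI[of _ \<Psi>], rule exI[of _ "mat_kernel A"], (intro conjI refl; assumption))
qed

end

lemma (in coupling) L_set_subset: "L_set A c \<subseteq> S_plus (\<Sum>i\<in>UNIV. (c $ i)\<^sup>2)"
proof
  fix d assume "d \<in> L_set A c"
  then obtain \<gamma> where \<gamma>: "\<gamma> \<in> mat_kernel A" "\<And>i. (c $ i)\<^sup>2 + \<gamma> $ i > 0" and d: "d = (\<chi> i. sqrt ((c $ i)\<^sup>2 + \<gamma> $ i))"
    unfolding L_set_def by blast
  have "(\<Sum>i\<in>UNIV. \<gamma> $ i) = \<gamma> \<bullet> 1" by (simp add: inner_vec_def)
  also have "\<dots> = 0" using A_inner[of \<gamma> c2] \<gamma>(1) by (simp add: A_c2 mat_kernel_def)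
  finally have "(\<Sum>i\<in>UNIV. (c $ i)\<^sup>2 + \<gamma> $ i) = (\<Sum>i\<in>UNIV. (c $ i)\<^sup>2)" by (simp add: sum.distrib)
  then show "d \<in> S_plus (\<Sum>i\<in>UNIV. (c $ i)\<^sup>2)" using \<gamma>(2) by (simp add: S_plus_def d less_imp_le)
qed

subsection \<open>Vector solutions\<close>

context ground_state
begin

lemma vector_weak_solution_iff:
  fixes B :: "real^'n^'n" and u :: "'n \<Rightarrow> 'a \<Rightarrow> real"
  assumes "\<And>i. u i \<in> H"
  shows "weak_solution \<Omega> lam (u i) (\<lambda>x. \<Sum>j\<in>UNIV. B $ i $ j * u i x * (u j x)\<^sup>2)
    \<longleftrightarrow> (\<forall>\<phi>\<in>D. ip (u i) \<phi> = (\<Sum>j\<in>UNIV. B $ i $ j * qf (u i) (u j) (u j) \<phi>))"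
  by (rule qf_weak_extend) (use assms in \<open>auto intro: H_H1 H_D simp: power2_eq_square mult.assoc\<close>)

lemma multiple_solution_iff:
  fixes B :: "real^'n^'n" and d :: "real^'n"
  assumes d: "\<And>i. d $ i > 0"
  shows "positive_vector_solution \<Omega> lam B (vec_mult d U) \<longleftrightarrow> B *v (\<chi> i. (d $ i)\<^sup>2) = 1"
proof -
  have dH: "vec_mult d U i \<in> H" for i unfolding vec_mult_def by (intro H_cmult U_H)
  have pos: "AE x in M. vec_mult d U i x > 0" for i
    using U_pos by eventually_elim (simp add: vec_mult_def d)
  have q: "(\<Sum>j\<in>UNIV. B $ i $ j * qf (vec_mult d U i) (vec_mult d U j) (vec_mult d U j) \<phi>)
      = d $ i * (B *v (\<chi> i. (d $ i)\<^sup>2)) $ i * qf U U U \<phi>" for i \<phi>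
    unfolding vec_mult_def qf_cmult1 qf_cmult2 qf_cmult3
    by (simp add: matrix_vector_mult_def sum_distrib_left sum_distrib_right power2_eq_square mult_ac)
  have l: "ip (vec_mult d U i) \<phi> = d $ i * qf U U U \<phi>" if "\<phi> \<in> D" for i \<phi>
    unfolding vec_mult_def using that by (simp add: ip_cmult_left U_H1 D_H1 U_eq)
  have "(\<forall>\<phi>\<in>D. ip (vec_mult d U i) \<phi> = (\<Sum>j\<in>UNIV. B $ i $ j * qf (vec_mult d U i) (vec_mult d U j) (vec_mult d U j) \<phi>))
      \<longleftrightarrow> (B *v (\<chi> i. (d $ i)\<^sup>2)) $ i = 1" for i
  proof
    assume "\<forall>\<phi>\<in>D. ip (vec_mult d U i) \<phi> = (\<Sum>j\<in>UNIV. B $ i $ j * qf (vec_mult d U i) (vec_mult d U j) (vec_mult d U j) \<phi>)"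
    then have "d $ i * S = d $ i * (B *v (\<chi> i. (d $ i)\<^sup>2)) $ i * S"
      unfolding q using l[OF U_D, of i] U_D by (simp add: S_def)
    then show "(B *v (\<chi> i. (d $ i)\<^sup>2)) $ i = 1" using d[of i] S_pos by simp
  next
    assume "(B *v (\<chi> i. (d $ i)\<^sup>2)) $ i = 1"
    then show "\<forall>\<phi>\<in>D. ip (vec_mult d U i) \<phi> = (\<Sum>j\<in>UNIV. B $ i $ j * qf (vec_mult d U i) (vec_mult d U j) (vec_mult d U j) \<phi>)"
      unfolding q by (simp add: l)
  qed
  then show ?thesis
    unfolding positive_vector_solution_def Hvec_def vector_weak_solution_iff[of "vec_mult d U", OF dH]
    using dH pos by (simp add: vec_eq_iff)
qed

end

lemma Hvec_dist_ge:
  fixes u v :: "'n::finite \<Rightarrow> 'a::euclidean_space \<Rightarrow> real"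
  shows "H1_norm \<Omega> (\<lambda>x. u i x - v i x) \<le> Hvec_dist \<Omega> u v"
proof -
  have "(H1_norm \<Omega> (\<lambda>x. u i x - v i x))\<^sup>2 \<le> (\<Sum>i\<in>UNIV. (H1_norm \<Omega> (\<lambda>x. u i x - v i x))\<^sup>2)"
    by (rule member_le_sum) auto
  then show ?thesis unfolding Hvec_dist_def by (rule real_le_rsqrt)
qed

lemma Hvec_dist_le_sum:
  fixes u v :: "'n::finite \<Rightarrow> 'a::euclidean_space \<Rightarrow> real"
  shows "Hvec_dist \<Omega> u v \<le> (\<Sum>i\<in>UNIV. \<bar>H1_norm \<Omega> (\<lambda>x. u i x - v i x)\<bar>)"
  using L2_set_le_sum_abs[of "\<lambda>i. H1_norm \<Omega> (\<lambda>x. u i x - v i x)" UNIV] by (simp add: Hvec_dist_def L2_set_def)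

lemma (in ground_state) Hvec_dist_multiples:
  fixes d c :: "real^'n"
  shows "Hvec_dist \<Omega> (vec_mult d U) (vec_mult c U) \<le> (\<Sum>i\<in>UNIV. eqc * nrm U * \<bar>d $ i - c $ i\<bar>)"
proof (rule order_trans[OF Hvec_dist_le_sum sum_mono])
  fix i
  have e: "(\<lambda>x. vec_mult d U i x - vec_mult c U i x) = (\<lambda>x. (d $ i - c $ i) * U x)"
    by (simp add: vec_mult_def left_diff_distrib)
  have "H1_norm \<Omega> (\<lambda>x. (d $ i - c $ i) * U x) \<le> eqc * (\<bar>d $ i - c $ i\<bar> * nrm U)"
    using H1_norm_le_nrm[OF H1_cmult[OF U_H1], of "d $ i - c $ i"] by (simp add: nrm_cmult U_H1)
  moreover have "H1_norm \<Omega> (\<lambda>x. (d $ i - c $ i) * U x) \<ge> 0"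
    unfolding H1_norm_def by (intro real_sqrt_ge_zero integral_nonneg_AE AE_I2) simp
  ultimately show "\<bar>H1_norm \<Omega> (\<lambda>x. vec_mult d U i x - vec_mult c U i x)\<bar> \<le> eqc * nrm U * \<bar>d $ i - c $ i\<bar>"
    unfolding e by (simp add: mult_ac)
qed

theorem theorem2p9:
  fixes \<Omega> :: "'a::euclidean_space set" and lam :: real and U :: "'a \<Rightarrow> real"
    and A E :: "real^'n^'n" and c :: "real^'n" and k :: nat
  assumes "DIM('a) \<le> 3"
    and "open \<Omega>" and "connected \<Omega>" and "\<Omega> \<noteq> {}"
    and "lam > 0"
    and "least_energy_positive_solution \<Omega> lam U"
    and "nondegenerate \<Omega> lam U"
    and "\<forall>i j. A $ i $ j = A $ j $ i \<and> A $ i $ j \<ge> 0"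
    and "dim (mat_kernel A) = k" and "k \<in> {1..CARD('n) - 1}"
    and "positive_vector_solution \<Omega> lam A (vec_mult c U)"
    and "c \<in> L_set A c" and "complementary E A c"
  shows "L_set A c \<subseteq> S_plus (\<Sum>i\<in>UNIV. (c $ i)\<^sup>2)
    \<and> connected (L_set A c) \<and> smooth_submanifold k (L_set A c)
    \<and> (\<exists>\<epsilon>0>0. \<exists>V. Hvec_neighborhood \<Omega> (vec_mult c U) V \<and>
        (\<exists>u :: real \<Rightarrow> 'n \<Rightarrow> 'a \<Rightarrow> real.
           (\<forall>\<epsilon>. 0 < \<epsilon> \<and> \<epsilon> < \<epsilon>0 \<longrightarrow>
              u \<epsilon> \<in> V \<and> positive_vector_solution \<Omega> lam (A + \<epsilon> *\<^sub>R E) (u \<epsilon>) \<and>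
              (\<forall>v\<in>V. positive_vector_solution \<Omega> lam (A + \<epsilon> *\<^sub>R E) v \<longrightarrow> Hvec_eq \<Omega> v (u \<epsilon>)) \<and>
              (\<exists>d. Hvec_eq \<Omega> (u \<epsilon>) (vec_mult d U))) \<and>
           ((\<lambda>\<epsilon>. Hvec_dist \<Omega> (u \<epsilon>) (vec_mult c U)) \<longlongrightarrow> 0) (at_right 0)))"
proof -
  interpret ground_state \<Omega> lam U by unfold_locales (use assms in auto)
  have c_pos: "c $ i > 0" for i
  proof -
    obtain \<gamma> where c: "c = (\<chi> i. sqrt ((c $ i)\<^sup>2 + \<gamma> $ i))" and g: "\<forall>i. (c $ i)\<^sup>2 + \<gamma> $ i > 0"
      using assms(12) unfolding L_set_def mem_Collect_eq by (elim exE conjE)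
    have "c $ i = sqrt ((c $ i)\<^sup>2 + \<gamma> $ i)" using arg_cong[OF c, of "\<lambda>d. d $ i"] by (simp only: vec_lambda_beta)
    also have "\<dots> > 0" using g by (simp only: real_sqrt_gt_0_iff)
    finally show ?thesis .
  qed
  have "A *v (\<chi> i. (c $ i)\<^sup>2) = 1" using assms(11) multiple_solution_iff[of c, OF c_pos] by blast
  then have A_c: "(\<Sum>j\<in>UNIV. A $ i $ j * (c $ j)\<^sup>2) = 1" for i
    by (simp add: vec_eq_iff matrix_vector_mult_def)
  have "subspace (mat_kernel A)"
    unfolding mat_kernel_def subspace_def by (simp add: matrix_vector_right_distrib matrix_vector_mult_scaleR)
  from orthogonal_projection_exists[OF this] obtain P where
    P: "linear P" "\<And>x. P x \<in> mat_kernel A" "\<And>x k. k \<in> mat_kernel A \<Longrightarrow> P x \<bullet> k = x \<bullet> k" by blast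
  have "coupling A E c P"
    using assms(8) by (intro coupling.intro c_pos A_c assms(13) P) (simp_all only:)
  then interpret linearized \<Omega> lam U A E c P by (rule linearized.intro[OF ground_state_axioms])
  let ?x = "\<lambda>\<epsilon> C x. (A + \<epsilon> *\<^sub>R E) *v x = 1 \<and> norm (x - c2) \<le> C * \<epsilon>"
  obtain \<epsilon>1 C where C: "\<epsilon>1 > 0" "C \<ge> 0" and ex: "\<forall>\<epsilon>. 0 < \<epsilon> \<and> \<epsilon> < \<epsilon>1 \<longrightarrow> (\<exists>x. ?x \<epsilon> C x)"
    using perturbed_solution by (elim exE conjE)
  define x where "x \<epsilon> = (SOME x. ?x \<epsilon> C x)" for \<epsilon>
  have x: "(A + \<epsilon> *\<^sub>R E) *v x \<epsilon> = 1" "norm (x \<epsilon> - c2) \<le> C * \<epsilon>" if "0 < \<epsilon>" "\<epsilon> < \<epsilon>1" for \<epsilon>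
    using someI_ex[OF mp[OF spec[OF ex, of \<epsilon>] conjI[OF that]]] unfolding x_def by blast+
  obtain \<epsilon>2 \<rho> where r: "\<epsilon>2 > 0" "\<rho> > 0" and uniq: "\<forall>\<epsilon> x v. 0 < \<epsilon> \<and> \<epsilon> < \<epsilon>2 \<and> (A + \<epsilon> *\<^sub>R E) *v x = 1 \<and> norm (x - c2) \<le> C * \<epsilon> \<and>
      (\<forall>i. v i \<in> H) \<and> (\<forall>i. nrm (\<lambda>y. v i y - c $ i * U y) < \<rho>) \<and>
      (\<forall>i. \<forall>\<phi>\<in>D. ip (v i) \<phi> = (\<Sum>j\<in>UNIV. (A + \<epsilon> *\<^sub>R E) $ i $ j * qf (v i) (v j) (v j) \<phi>)) \<longrightarrow>
      (\<forall>i. nrm (\<lambda>y. v i y - sqrt (x $ i) * U y) = 0)"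
    using solution_unique[OF C(2)] by (elim exE conjE)
  define m where "m = Min (range (\<lambda>i. (c $ i)\<^sup>2))"
  have m0: "m > 0" unfolding m_def using c_pos by (simp add: Min_gr_iff less_imp_neq[THEN not_sym])
  have mc: "m \<le> (c $ i)\<^sup>2" for i unfolding m_def by (rule Min_le) auto
  define Q where "Q = (\<Sum>i\<in>UNIV. eqc * nrm U * (C / c $ i))"
  have Q0: "Q \<ge> 0" unfolding Q_def
    using eqc_pos nrm_nonneg[OF U_H1] C(2) c_pos by (intro sum_nonneg mult_nonneg_nonneg divide_nonneg_pos) auto
  define u where "u \<epsilon> = vec_mult (\<chi> i. sqrt (x \<epsilon> $ i)) U" for \<epsilon>
  define \<epsilon>0 where "\<epsilon>0 = min (min \<epsilon>1 \<epsilon>2) (min (m / (C + 1)) (\<rho> / eqc / (Q + 1)))"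
  have e0: "\<epsilon>0 > 0" unfolding \<epsilon>0_def using C(1,2) r m0 eqc_pos Q0 by (auto intro!: divide_pos_pos)
  have e1: "\<epsilon>0 \<le> \<epsilon>1" "\<epsilon>0 \<le> \<epsilon>2" "\<epsilon>0 \<le> m / (C + 1)" "\<epsilon>0 \<le> \<rho> / eqc / (Q + 1)" unfolding \<epsilon>0_def by auto
  define V where "V = {v \<in> Hvec \<Omega>. Hvec_dist \<Omega> v (vec_mult c U) < \<rho> / eqc}"
  have V: "Hvec_neighborhood \<Omega> (vec_mult c U) V"
    unfolding Hvec_neighborhood_def V_def using r eqc_pos by (intro conjI exI[of _ "\<rho> / eqc"]) auto
  have xd: "\<bar>x \<epsilon> $ i - (c $ i)\<^sup>2\<bar> \<le> C * \<epsilon>" if "0 < \<epsilon>" "\<epsilon> < \<epsilon>0" for \<epsilon> i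
    using order_trans[OF component_le_norm_cart x(2)[OF that(1)], of i] that(2) e1(1) by (simp add: c2_nth)
  have xpos: "x \<epsilon> $ i > 0" if e: "0 < \<epsilon>" "\<epsilon> < \<epsilon>0" for \<epsilon> i
  proof -
    have "\<epsilon> < m / (C + 1)" using e(2) e1(3) by linarith
    then have "C * \<epsilon> + \<epsilon> < m" using C(2) by (simp add: field_simps)
    then show ?thesis using xd[OF e, of i] mc[of i] e(1) by linarith
  qed
  have dist: "Hvec_dist \<Omega> (u \<epsilon>) (vec_mult c U) \<le> Q * \<epsilon>" if e: "0 < \<epsilon>" "\<epsilon> < \<epsilon>0" for \<epsilon>
  proof -
    have "eqc * nrm U * \<bar>(\<chi> i. sqrt (x \<epsilon> $ i)) $ i - c $ i\<bar> \<le> eqc * nrm U * (C / c $ i) * \<epsilon>" for i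
    proof -
      let ?s = "sqrt (x \<epsilon> $ i)"
      have s: "?s > 0" using xpos[OF e, of i] by simp
      have "\<bar>?s - c $ i\<bar> * (?s + c $ i) = \<bar>?s\<^sup>2 - (c $ i)\<^sup>2\<bar>"
        using s c_pos[of i] by (simp only: power2_eq_square square_diff_square_factored abs_mult mult.commute abs_of_pos add_pos_pos)
      also have "\<dots> \<le> C * \<epsilon>" using xd[OF e, of i] xpos[OF e, of i] by simp
      finally have "\<bar>?s - c $ i\<bar> * (?s + c $ i) \<le> C * \<epsilon>" .
      moreover have "\<bar>?s - c $ i\<bar> * c $ i \<le> \<bar>?s - c $ i\<bar> * (?s + c $ i)" using s by (intro mult_left_mono) auto
      ultimately have "\<bar>?s - c $ i\<bar> \<le> C / c $ i * \<epsilon>" using c_pos[of i] by (simp add: field_simps)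
      then have "eqc * nrm U * \<bar>?s - c $ i\<bar> \<le> eqc * nrm U * (C / c $ i * \<epsilon>)"
        using eqc_pos nrm_nonneg[OF U_H1] by (intro mult_left_mono) auto
      then show ?thesis by simp
    qed
    then have "(\<Sum>i\<in>UNIV. eqc * nrm U * \<bar>(\<chi> i. sqrt (x \<epsilon> $ i)) $ i - c $ i\<bar>) \<le> Q * \<epsilon>"
      unfolding Q_def sum_distrib_right by (rule sum_mono)
    then show ?thesis unfolding u_def using Hvec_dist_multiples[of "\<chi> i. sqrt (x \<epsilon> $ i)" c] by linarith
  qed
  have sol: "positive_vector_solution \<Omega> lam (A + \<epsilon> *\<^sub>R E) (u \<epsilon>)" if e: "0 < \<epsilon>" "\<epsilon> < \<epsilon>0" for \<epsilon>
  proof -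
    have "(\<chi> i. ((\<chi> i. sqrt (x \<epsilon> $ i)) $ i)\<^sup>2) = x \<epsilon>"
      using xpos[OF e] by (simp add: vec_eq_iff less_imp_le)
    then show ?thesis
      unfolding u_def using x(1)[OF e(1)] e(2) e1(1) xpos[OF e] by (subst multiple_solution_iff) auto
  qed
  have uV: "u \<epsilon> \<in> V" if e: "0 < \<epsilon>" "\<epsilon> < \<epsilon>0" for \<epsilon>
  proof -
    have "u \<epsilon> \<in> Hvec \<Omega>" using sol[OF e] by (simp add: positive_vector_solution_def)
    moreover have "Q * \<epsilon> < \<rho> / eqc"
    proof -
      have "\<epsilon> < \<rho> / eqc / (Q + 1)" using e(2) e1(4) by linarith
      then have "\<epsilon> * (Q + 1) < \<rho> / eqc" by (rule iffD1[OF pos_less_divide_eq, rotated]) (use Q0 in linarith)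
      then show ?thesis using e(1) by (simp add: algebra_simps)
    qed
    ultimately show ?thesis unfolding V_def using dist[OF e] by simp
  qed
  have eq: "Hvec_eq \<Omega> v (u \<epsilon>)" if e: "0 < \<epsilon>" "\<epsilon> < \<epsilon>0" and v: "v \<in> V" "positive_vector_solution \<Omega> lam (A + \<epsilon> *\<^sub>R E) v" for \<epsilon> v
  proof -
    have vH: "v i \<in> H" for i using v(1) by (simp add: V_def Hvec_def)
    have w: "ip (v i) \<phi> = (\<Sum>j\<in>UNIV. (A + \<epsilon> *\<^sub>R E) $ i $ j * qf (v i) (v j) (v j) \<phi>)" if "\<phi> \<in> D" for i \<phi>
      using v(2) that unfolding positive_vector_solution_def vector_weak_solution_iff[of v, OF vH] by blast
    have near: "nrm (\<lambda>y. v i y - c $ i * U y) < \<rho>" for i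
    proof -
      have "nrm (\<lambda>y. v i y - c $ i * U y) \<le> eqc * H1_norm \<Omega> (\<lambda>y. v i y - vec_mult c U i y)"
        unfolding vec_mult_def by (intro nrm_le_H1_norm H1_diff H1_cmult U_H1 H_H1 vH)
      also have "\<dots> \<le> eqc * Hvec_dist \<Omega> v (vec_mult c U)"
        using eqc_pos by (intro mult_left_mono Hvec_dist_ge) auto
      also have "\<dots> < eqc * (\<rho> / eqc)" using v(1) eqc_pos by (intro mult_strict_left_mono) (auto simp: V_def)
      finally show ?thesis using eqc_pos by simp
    qed
    have "\<forall>i. nrm (\<lambda>y. v i y - sqrt (x \<epsilon> $ i) * U y) = 0"
    proof (rule mp[OF spec[OF spec[OF spec[OF uniq, of \<epsilon>], of "x \<epsilon>"], of v]], intro conjI allI ballI e(1) vH near w)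
      show "\<epsilon> < \<epsilon>2" using e(2) e1(2) by linarith
      show "(A + \<epsilon> *\<^sub>R E) *v x \<epsilon> = 1" using x(1)[OF e(1)] e(2) e1(1) by simp
      show "norm (x \<epsilon> - c2) \<le> C * \<epsilon>" using x(2)[OF e(1)] e(2) e1(1) by simp
    qed
    then have z: "nrm (\<lambda>y. v i y - sqrt (x \<epsilon> $ i) * U y) = 0" for i by blast
    have "AE y in M. v i y - sqrt (x \<epsilon> $ i) * U y = 0" for i
      by (rule nrm_eq_0_imp[OF _ z]) (intro H1_diff H1_cmult U_H1 H_H1 vH)
    then show ?thesis unfolding Hvec_eq_def u_def vec_mult_def by simp
  qed
  have lim: "((\<lambda>\<epsilon>. Hvec_dist \<Omega> (u \<epsilon>) (vec_mult c U)) \<longlongrightarrow> 0) (at_right 0)"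
  proof (rule tendsto_sandwich)
    have ev: "\<forall>\<^sub>F \<epsilon> in at_right 0. 0 < \<epsilon> \<and> \<epsilon> < \<epsilon>0" using e0 by (auto simp: eventually_at_right_field)
    show "\<forall>\<^sub>F \<epsilon> in at_right 0. Hvec_dist \<Omega> (u \<epsilon>) (vec_mult c U) \<le> Q * \<epsilon>"
      using ev by eventually_elim (simp add: dist)
    show "\<forall>\<^sub>F \<epsilon> in at_right 0. 0 \<le> Hvec_dist \<Omega> (u \<epsilon>) (vec_mult c U)"
      by (simp add: Hvec_dist_def sum_nonneg)
    have "((\<lambda>\<epsilon>. Q * \<epsilon>) \<longlongrightarrow> Q * 0) (at_right 0)" by (intro tendsto_intros)
    then show "((\<lambda>\<epsilon>. Q * \<epsilon>) \<longlongrightarrow> 0) (at_right 0)" by simp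
  qed simp
  have mult: "\<exists>d. Hvec_eq \<Omega> (u \<epsilon>) (vec_mult d U)" for \<epsilon>
    unfolding u_def Hvec_eq_def by (intro exI[of _ "\<chi> i. sqrt (x \<epsilon> $ i)"]) simp
  show ?thesis
    using L_set_subset connected_L_set[of A c] smooth_submanifold_L_set[of A c] assms(9) e0 V uV sol eq lim mult
    by (intro conjI exI[of _ \<epsilon>0] exI[of _ V] exI[of _ u]) auto
qed

end
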